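(* Fix an integer $m\ge 1$. For each $n\ge 1$ let $p_0=n\le p_1\le\cdots\le p_m$ be integers with $p_\nu=p_\nu(n)\ge n$, and let $X^{(\nu)}_{jk}$, $\nu=1,\ldots,m$, $1\le j\le p_{\nu-1}$, $1\le k\le p_\nu$, be independent complex random variables (possibly depending on $n$) defined on a common probability space, with $\mathbb{E}X^{(\nu)}_{jk}=0$ and $\mathbb{E}|X^{(\nu)}_{jk}|^2=1$. Let $\mathbf X^{(\nu)}$ be the $p_{\nu-1}\times p_\nu$ matrix with entries $[\mathbf X^{(\nu)}]_{jk}=\frac{1}{\sqrt{p_\nu}}X^{(\nu)}_{jk}$, let $\mathbf W=\prod_{\nu=1}^m\mathbf X^{(\nu)}$ (an $n\times p_m$ matrix), let $s_1\ge\cdots\ge s_n$ be the singular values of $\mathbf W$, and let $F_n(x)=\mathbb{E}\,\frac1n\sum_{k=1}^n I_{\{s_k^2\le x\}}$ be the expected empirical distribution function of the squared singular values. Assume the Lindeberg condition: for every $\tau>0$, $$L_n(\tau):=\max_{\nu=1,\ldots,m}\frac{1}{n^2}\sum_{j=1}^{p_{\nu-1}}\sum_{k=1}^{p_\nu}\mathbb{E}|X^{(\nu)}_{jk}|^2 I_{\{|X^{(\nu)}_{jk}|\ge\tau\sqrt n\}}\to 0\quad (n\to\infty),$$ and assume $\lim_{n\to\infty} n/p_l=y_l\in(0,1]$ for $l=1,\ldots,m$. Then $$\lim_{n\to\infty}\sup_x|F_n(x)-G_{\mathbf y}(x)|=0,$$ where $G_{\mathbf y}$ is the distribution function on $[0,\infty)$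 whose Stieltjes transform $s_{\mathbf y}(z)=\int\frac{1}{x-z}\,dG_{\mathbf y}(x)$ satisfies, for $z$ in the upper half-plane, $$1+zs_{\mathbf y}(z)-s_{\mathbf y}(z)\prod_{l=1}^m\bigl(1-y_l-zy_ls_{\mathbf y}(z)\bigr)=0.$$
   Context: $I_{\{B\}}$ denotes the indicator of the event $B$; $\mathbf y=(y_1,\ldots,y_m)$. For $m=1$ the limit is the Marchenko–Pastur law, and for $y_1=\cdots=y_m=1$ the distribution $G_{\mathbf y}$ has moments given by the Fuss–Catalan numbers $\frac{1}{mk+1}\binom{mk+k}{k}$. *)

theory Defs
  imports "Jordan_Normal_Form.Schur_Decomposition" "HOL-Probability.Probability"
begin

text \<open>The matrix X^(nu) (rows/columns indexed from 0), for a fixed n and a fixed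
  outcome: p gives the dimensions p_0,...,p_m and x nu j k is the sample of X^(nu)_{jk}.\<close>
definition Xmat :: "(nat \<Rightarrow> nat) \<Rightarrow> (nat \<Rightarrow> nat \<Rightarrow> nat \<Rightarrow> complex) \<Rightarrow> nat \<Rightarrow> complex mat" where
  "Xmat p x \<nu> = Matrix.mat (p (\<nu> - 1)) (p \<nu>)
      (\<lambda>(j, k). x \<nu> j k / complex_of_real (sqrt (real (p \<nu>))))"

fun Wprod :: "(nat \<Rightarrow> nat) \<Rightarrow> (nat \<Rightarrow> nat \<Rightarrow> nat \<Rightarrow> complex) \<Rightarrow> nat \<Rightarrow> complex mat" where
  "Wprod p x 0 = 1\<^sub>m (p 0)"
| "Wprod p x (Suc \<nu>) = Wprod p x \<nu> * Xmat p x (Suc \<nu>)"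

text \<open>Number of squared singular values of W (counted with multiplicity) that are \<le> t:
  the squared singular values of W are the eigenvalues of W W^*, with algebraic multiplicity
  given by the order of the root of the characteristic polynomial.\<close>
definition sq_sv_count :: "complex mat \<Rightarrow> real \<Rightarrow> nat" where
  "sq_sv_count W t =
     (\<Sum>e \<in> {e. poly (char_poly (W * mat_adjoint W)) e = 0 \<and> e \<in> \<real> \<and> Re e \<le> t}.
         order e (char_poly (W * mat_adjoint W)))"

definition Fn :: "'a measure \<Rightarrow> nat \<Rightarrow> (nat \<Rightarrow> nat \<Rightarrow> nat) \<Rightarrow>
    (nat \<Rightarrow> nat \<Rightarrow> nat \<Rightarrow> nat \<Rightarrow> 'a \<Rightarrow> complex) \<Rightarrow> nat \<Rightarrow> real \<Rightarrow> real" where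
  "Fn M m p X n t =
     (\<integral>\<omega>. real (sq_sv_count (Wprod (p n) (\<lambda>\<nu> j k. X n \<nu> j k \<omega>) m) t) / real n \<partial>M)"

definition Lind :: "'a measure \<Rightarrow> nat \<Rightarrow> (nat \<Rightarrow> nat \<Rightarrow> nat) \<Rightarrow>
    (nat \<Rightarrow> nat \<Rightarrow> nat \<Rightarrow> nat \<Rightarrow> 'a \<Rightarrow> complex) \<Rightarrow> nat \<Rightarrow> real \<Rightarrow> real" where
  "Lind M m p X n \<tau> =
     Max ((\<lambda>\<nu>. 1 / (real n)\<^sup>2 * (\<Sum>j < p n (\<nu> - 1). \<Sum>k < p n \<nu>.
        (\<integral>\<omega>. (cmod (X n \<nu> j k \<omega>))\<^sup>2 *
               indicator {\<omega>. cmod (X n \<nu> j k \<omega>) \<ge> \<tau> * sqrt (real n)} \<omega> \<partial>M))) ` {1..m})"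

definition stieltjes :: "real measure \<Rightarrow> complex \<Rightarrow> complex" where
  "stieltjes \<mu> z = (\<integral>x. 1 / (complex_of_real x - z) \<partial>\<mu>)"

text \<open>mu is a probability distribution on [0,oo) whose Stieltjes transform satisfies the
  equation of the theorem on the upper half-plane; G_y is then cdf mu.\<close>
definition is_Gy :: "nat \<Rightarrow> (nat \<Rightarrow> real) \<Rightarrow> real measure \<Rightarrow> bool" where
  "is_Gy m y \<mu> \<longleftrightarrow> real_distribution \<mu> \<and> measure \<mu> {..<0} = 0 \<and>
     (\<forall>z. Im z > 0 \<longrightarrow>
        1 + z * stieltjes \<mu> z - stieltjes \<mu> z *
          (\<Prod>l = 1..m. 1 - complex_of_real (y l) - z * complex_of_real (y l) * stieltjes \<mu> z) = 0)"

end

theory Submission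
  imports Defs "HOL-Real_Asymp.Real_Asymp" "HOL-Complex_Analysis.Complex_Analysis"
begin

text \<open>
  Until the very end only the points \<open>z = -v\<close> with \<open>v > 0\<close> are considered, where all resolvents
  \<open>(W W^* + v)^-1\<close> are positive and bounded by \<open>1/v\<close>. There the number
  \<open>t = 1 - v s(-v)\<close> lies in \<open>[0, 1]\<close>, the equation for \<open>s\<close> becomes
  \<open>v t - (1 - t) \<Prod>l. (1 - y_l t) = 0\<close>, and the derivative in \<open>t\<close> of the left-hand side is at
  least \<open>v\<close>, so that the root is unique and an approximate root is close to it.

  The residual is shown to vanish in mean by induction on the number of factors. Let \<open>D\<close> be the Gram
  matrix of the product of the first factors. Removing one column of the next factor from the resolvent
  (a rank one update) and replacing the resulting quadratic forms by traces shows that the resolvent at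
  \<open>v\<close> after multiplying by the next factor is close to the resolvent of \<open>\<alpha> D\<close> at \<open>v\<close>, with
  \<open>\<alpha>\<close> close to \<open>1 - y t\<close>; this turns the residual at \<open>v\<close> into the residual of
  \<open>D\<close> at \<open>v / \<alpha>\<close>. The errors are controlled by truncation with the Lindeberg condition, by
  the Frobenius norm of \<open>D / n\<close>, and by the mean deviation of the squared column norms, which are
  propagated by the same induction.

  The bound on \<open>t\<close> for large \<open>v\<close> gives tightness. Any weak limit has the right Stieltjes
  transform on the negative half-line, hence satisfies the equation on the upper half-plane by analytic
  continuation; conversely the equation determines the transform on the negative half-line and
  therefore the measure, since the kernels \<open>1 / (x + v)\<close> generate all indicators of half-lines under
  bounded limits. The equation excludes atoms, so convergence of the distribution functions is uniform.
\<close>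

subsection \<open>Matrices as functions on indices\<close>

text \<open>Only second moments and the Lindeberg condition are available, so the operator norms of
  the factors are not controlled. On the negative half-line this does no harm: \<open>h\<close> and
  \<open>g\<close> are nonnegative, every denominator \<open>1 + h\<close> is at least 1, and
  \<open>\<alpha> = 1 / (1 + g)\<close> lies in (0, 1]. The size of \<open>D\<close> enters only
  through its trace, of order \<open>n\<close>, and its Frobenius norm, which is of smaller order
  than \<open>n\<close> in mean and takes the place of boundedness. The obstacle is that
  \<open>\<alpha>\<close> is random and depends on the very columns that are averaged, so the
  resolvent of \<open>\<alpha> D\<close> cannot serve as the independent matrix in a quadratic form.
  It is replaced by the resolvent for the nearest of the finitely many numbers \<open>j / N\<close>,
  with the errors summed over this grid; \<open>N\<close> is fixed before \<open>n\<close> tends to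
  infinity. All estimates are first absolute moments written as nonnegative integrals, so that
  conditioning is an application of Tonelli. The existence of \<open>G_y\<close> needs no separate
  construction: a weak limit of the mean empirical measures provides it.\<close>

text \<open>Matrices and vectors are functions on \<open>nat\<close>; only indices below the explicit dimension
  \<open>n\<close> matter.\<close>

definition mmul :: "nat \<Rightarrow> (nat \<Rightarrow> nat \<Rightarrow> complex) \<Rightarrow> (nat \<Rightarrow> nat \<Rightarrow> complex) \<Rightarrow> nat \<Rightarrow> nat \<Rightarrow> complex" where
  "mmul n A B = (\<lambda>i j. \<Sum>l<n. A i l * B l j)"

definition mvec :: "nat \<Rightarrow> (nat \<Rightarrow> nat \<Rightarrow> complex) \<Rightarrow> (nat \<Rightarrow> complex) \<Rightarrow> nat \<Rightarrow> complex" where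
  "mvec n A u = (\<lambda>i. \<Sum>l<n. A i l * u l)"

definition cinner :: "nat \<Rightarrow> (nat \<Rightarrow> complex) \<Rightarrow> (nat \<Rightarrow> complex) \<Rightarrow> complex" where
  "cinner n u w = (\<Sum>i<n. cnj (u i) * w i)"

definition cnorm :: "nat \<Rightarrow> (nat \<Rightarrow> complex) \<Rightarrow> real" where
  "cnorm n u = L2_set (\<lambda>i. cmod (u i)) {..<n}"

definition adj :: "(nat \<Rightarrow> nat \<Rightarrow> complex) \<Rightarrow> nat \<Rightarrow> nat \<Rightarrow> complex" where
  "adj A = (\<lambda>i j. cnj (A j i))"

definition ctrace :: "nat \<Rightarrow> (nat \<Rightarrow> nat \<Rightarrow> complex) \<Rightarrow> complex" where
  "ctrace n A = (\<Sum>i<n. A i i)"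

definition frob :: "nat \<Rightarrow> (nat \<Rightarrow> nat \<Rightarrow> complex) \<Rightarrow> real" where
  "frob n A = sqrt (\<Sum>i<n. \<Sum>j<n. (cmod (A i j))\<^sup>2)"

definition gram :: "nat set \<Rightarrow> (nat \<Rightarrow> nat \<Rightarrow> complex) \<Rightarrow> nat \<Rightarrow> nat \<Rightarrow> complex" where
  "gram K r = (\<lambda>i j. \<Sum>k\<in>K. r i k * cnj (r j k))"

definition idm :: "nat \<Rightarrow> nat \<Rightarrow> complex" where
  "idm = (\<lambda>i j. if i = j then 1 else 0)"

definition opbound :: "nat \<Rightarrow> real \<Rightarrow> (nat \<Rightarrow> nat \<Rightarrow> complex) \<Rightarrow> bool" where
  "opbound n c C \<longleftrightarrow> (\<forall>u. cnorm n (mvec n C u) \<le> c * cnorm n u)"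

definition hermitian_on :: "nat \<Rightarrow> (nat \<Rightarrow> nat \<Rightarrow> complex) \<Rightarrow> bool" where
  "hermitian_on n A \<longleftrightarrow> (\<forall>i<n. \<forall>j<n. A i j = cnj (A j i))"

definition hpsd :: "nat \<Rightarrow> (nat \<Rightarrow> nat \<Rightarrow> complex) \<Rightarrow> bool" where
  "hpsd n A \<longleftrightarrow> hermitian_on n A \<and> (\<forall>u. 0 \<le> Re (cinner n u (mvec n A u)))"

text \<open>The inverse of \<open>A + v\<close> as adjugate over determinant: its entries are
  rational functions of the entries of \<open>A\<close>, which reduces measurability for random
  \<open>A\<close> to that of determinants, and the expression is total.\<close>

definition resolvent :: "nat \<Rightarrow> real \<Rightarrow> (nat \<Rightarrow> nat \<Rightarrow> complex) \<Rightarrow> nat \<Rightarrow> nat \<Rightarrow> complex" where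
  "resolvent n v A = (let M = Matrix.mat n n (\<lambda>(i, j). A i j + of_real v * idm i j)
     in (\<lambda>i j. adj_mat M $$ (i, j) / Determinant.det M))"

lemma mmul_assoc: "mmul m (mmul n A B) C = mmul n A (mmul m B C)"
  unfolding mmul_def sum_distrib_left sum_distrib_right
  by (intro ext, subst sum.swap) (simp only: mult.assoc)

lemma ctrace_mmul_comm: "ctrace n (mmul m A B) = ctrace m (mmul n B A)"
  unfolding ctrace_def mmul_def
  by (subst sum.swap) (simp add: mult.commute)

lemma mvec_mmul: "mvec m (mmul n A B) u = mvec n A (mvec m B u)"
  unfolding mmul_def mvec_def sum_distrib_left sum_distrib_right
  by (intro ext, subst sum.swap) (simp only: mult.assoc)

lemma mmul_idm: "i < n \<Longrightarrow> mmul n idm A i j = A i j" "j < n \<Longrightarrow> mmul n A idm i j = A i j"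
  unfolding mmul_def idm_def by (simp_all add: if_distrib if_distribR sum.delta cong: if_cong)

lemma mvec_idm: "i < n \<Longrightarrow> mvec n idm u i = u i"
  unfolding mvec_def idm_def by (simp add: if_distrib if_distribR sum.delta cong: if_cong)

lemma mmul_cong:
  "(\<And>l. l < n \<Longrightarrow> A i l = A' i l) \<Longrightarrow> (\<And>l. l < n \<Longrightarrow> B l j = B' l j) \<Longrightarrow> mmul n A B i j = mmul n A' B' i j"
  unfolding mmul_def by simp

lemma mvec_cong:
  "(\<And>l. l < n \<Longrightarrow> A i l = A' i l) \<Longrightarrow> (\<And>l. l < n \<Longrightarrow> u l = u' l) \<Longrightarrow> mvec n A u i = mvec n A' u' i"
  unfolding mvec_def by simp

lemma cinner_cong:
  "(\<And>l. l < n \<Longrightarrow> u l = u' l) \<Longrightarrow> (\<And>l. l < n \<Longrightarrow> w l = w' l) \<Longrightarrow> cinner n u w = cinner n u' w'"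
  unfolding cinner_def by simp

lemma cnorm_cong: "(\<And>l. l < n \<Longrightarrow> u l = u' l) \<Longrightarrow> cnorm n u = cnorm n u'"
  unfolding cnorm_def by (rule L2_set_cong) auto

lemma ctrace_cong: "(\<And>l. l < n \<Longrightarrow> A l l = B l l) \<Longrightarrow> ctrace n A = ctrace n B"
  unfolding ctrace_def by simp

lemma cnorm_nonneg [simp]: "0 \<le> cnorm n u"
  unfolding cnorm_def by simp

lemma cnorm_sq: "(cnorm n u)\<^sup>2 = (\<Sum>i<n. (cmod (u i))\<^sup>2)"
  unfolding cnorm_def L2_set_def by (simp add: sum_nonneg)

lemma frob_nonneg [simp]: "0 \<le> frob n A"
  unfolding frob_def by (simp add: sum_nonneg)

lemma frob_sq: "(frob n A)\<^sup>2 = (\<Sum>i<n. \<Sum>j<n. (cmod (A i j))\<^sup>2)"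
  unfolding frob_def by (simp add: sum_nonneg)

lemma cinner_self: "cinner n u u = of_real ((cnorm n u)\<^sup>2)"
  unfolding cnorm_sq cinner_def of_real_sum
  by (intro sum.cong refl) (metis complex_norm_square mult.commute)

lemma cnj_cinner: "cnj (cinner n u w) = cinner n w u"
  unfolding cinner_def by (simp add: mult.commute)

lemma cinner_mvec_adj: "cinner n u (mvec m A w) = cinner m (mvec n (adj A) u) w"
  unfolding cinner_def mvec_def adj_def cnj_sum sum_distrib_left sum_distrib_right
  by (subst sum.swap) (simp add: mult.assoc mult.left_commute mult.commute)

lemma cinner_Cauchy_Schwarz: "cmod (cinner n u w) \<le> cnorm n u * cnorm n w"
proof -
  have "cmod (cinner n u w) \<le> (\<Sum>i<n. cmod (cnj (u i) * w i))"
    unfolding cinner_def by (rule norm_sum)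
  also have "\<dots> = (\<Sum>i<n. \<bar>cmod (u i)\<bar> * \<bar>cmod (w i)\<bar>)"
    by (simp add: norm_mult)
  also have "\<dots> \<le> cnorm n u * cnorm n w"
    unfolding cnorm_def by (rule L2_set_mult_ineq)
  finally show ?thesis .
qed

lemma hermitian_onD: "hermitian_on n A \<Longrightarrow> i < n \<Longrightarrow> j < n \<Longrightarrow> cnj (A j i) = A i j"
  unfolding hermitian_on_def by (rule sym) blast

lemma cinner_mvec_hermitian:
  assumes "hermitian_on n A"
  shows "cinner n u (mvec n A w) = cinner n (mvec n A u) w"
proof -
  have "mvec n (adj A) u i = mvec n A u i" if "i < n" for i
    by (rule mvec_cong) (use assms that in \<open>auto simp: adj_def hermitian_onD\<close>)
  then show ?thesis
    unfolding cinner_mvec_adj by (intro cinner_cong) auto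
qed

lemma frob_col_sum: "(frob n A)\<^sup>2 = (\<Sum>j<n. (cnorm n (\<lambda>i. A i j))\<^sup>2)"
  unfolding frob_sq cnorm_sq by (rule sum.swap)

lemma frob_adj: "frob n (adj A) = frob n A"
  unfolding frob_def adj_def by (subst sum.swap) simp

lemma frob_mmul_left:
  assumes "opbound n c C" "0 \<le> c"
  shows "frob n (mmul n C A) \<le> c * frob n A"
proof -
  have "(frob n (mmul n C A))\<^sup>2 = (\<Sum>j<n. (cnorm n (mvec n C (\<lambda>i. A i j)))\<^sup>2)"
    unfolding frob_col_sum by (simp add: mmul_def mvec_def)
  also have "\<dots> \<le> (\<Sum>j<n. (c * cnorm n (\<lambda>i. A i j))\<^sup>2)"
    using assms unfolding opbound_def by (intro sum_mono power_mono) auto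
  also have "\<dots> = (c * frob n A)\<^sup>2"
    unfolding power_mult_distrib frob_col_sum sum_distrib_left ..
  finally show ?thesis
    using assms by (intro power2_le_imp_le[of "frob n (mmul n C A)"]) auto
qed


lemma adj_adj [simp]: "adj (adj A) = A" by (simp add: adj_def)

lemma adj_mmul: "adj (mmul n A B) = mmul n (adj B) (adj A)"
  unfolding adj_def mmul_def by (simp add: mult.commute)

text \<open>For \<open>y = adj C u\<close> the squared norm of \<open>y\<close> is the inner product
  of \<open>u\<close> with \<open>C y\<close>; Cauchy-Schwarz and division by the norm of
  \<open>y\<close> give the same constant.\<close>

lemma opbound_adj:
  assumes "opbound n c C" "0 \<le> c"
  shows "opbound n c (adj C)"
  unfolding opbound_def
proof
  fix u
  let ?y = "mvec n (adj C) u"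
  have "(cnorm n ?y)\<^sup>2 = cmod (cinner n ?y ?y)"
    unfolding cinner_self norm_of_real by simp
  also have "\<dots> = cmod (cinner n u (mvec n C ?y))"
    by (simp add: cinner_mvec_adj)
  also have "\<dots> \<le> cnorm n u * cnorm n (mvec n C ?y)"
    by (rule cinner_Cauchy_Schwarz)
  also have "\<dots> \<le> cnorm n u * (c * cnorm n ?y)"
    using assms unfolding opbound_def by (intro mult_left_mono) auto
  finally have *: "cnorm n ?y * cnorm n ?y \<le> (c * cnorm n u) * cnorm n ?y"
    by (simp add: power2_eq_square ac_simps)
  show "cnorm n ?y \<le> c * cnorm n u"
  proof (cases "cnorm n ?y = 0")
    case True
    then show ?thesis using assms by simp
  next
    case False
    then have "0 < cnorm n ?y" using cnorm_nonneg[of n ?y] by linarith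
    with * show ?thesis by (simp add: mult_le_cancel_right_pos)
  qed
qed

lemma frob_mmul_right:
  assumes "opbound n c C" "0 \<le> c"
  shows "frob n (mmul n A C) \<le> c * frob n A"
  using frob_mmul_left[OF opbound_adj[OF assms] assms(2), of "adj A"]
  by (simp add: adj_mmul[symmetric] frob_adj)

lemma opbound_mmul:
  assumes "opbound n c C" "opbound n d B" "0 \<le> c"
  shows "opbound n (c * d) (mmul n C B)"
  unfolding opbound_def mvec_mmul
proof
  fix u
  have "cnorm n (mvec n C (mvec n B u)) \<le> c * cnorm n (mvec n B u)"
    using assms by (auto simp: opbound_def)
  also have "\<dots> \<le> c * (d * cnorm n u)"
    using assms by (intro mult_left_mono) (auto simp: opbound_def)
  finally show "cnorm n (mvec n C (mvec n B u)) \<le> c * d * cnorm n u" by simp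
qed

lemma opbound_idm: "opbound n 1 idm"
  unfolding opbound_def by (auto simp: mvec_idm intro!: eq_refl cnorm_cong)

lemma frob_Cauchy_Schwarz:
  "cmod (\<Sum>i<n. \<Sum>j<n. A i j * B i j) \<le> frob n A * frob n B"
proof -
  have "cmod (\<Sum>(i,j)\<in>{..<n}\<times>{..<n}. A i j * B i j) \<le> (\<Sum>(i,j)\<in>{..<n}\<times>{..<n}. \<bar>cmod (A i j)\<bar> * \<bar>cmod (B i j)\<bar>)"
    by (rule order_trans[OF norm_sum]) (simp add: norm_mult split_def)
  also have "\<dots> \<le> L2_set (\<lambda>(i,j). cmod (A i j)) ({..<n}\<times>{..<n}) * L2_set (\<lambda>(i,j). cmod (B i j)) ({..<n}\<times>{..<n})"
    using L2_set_mult_ineq[of "\<lambda>(i,j). cmod (A i j)" "\<lambda>(i,j). cmod (B i j)" "{..<n}\<times>{..<n}"]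
    by (simp add: split_def)
  finally show ?thesis
    by (simp add: frob_def L2_set_def sum.cartesian_product split_def)
qed

lemma cnorm_mvec_frob: "cnorm n (mvec n A u) \<le> frob n A * cnorm n u"
proof -
  have "(cmod (mvec n A u i))\<^sup>2 \<le> (\<Sum>j<n. (cmod (A i j))\<^sup>2) * (cnorm n u)\<^sup>2" for i
  proof -
    have "cmod (mvec n A u i) \<le> cnorm n (\<lambda>j. cnj (A i j)) * cnorm n u"
      using cinner_Cauchy_Schwarz[of n "\<lambda>j. cnj (A i j)" u] by (simp add: cinner_def mvec_def)
    then have "(cmod (mvec n A u i))\<^sup>2 \<le> (cnorm n (\<lambda>j. cnj (A i j)) * cnorm n u)\<^sup>2"
      by (intro power_mono) auto
    then show ?thesis by (simp add: power_mult_distrib cnorm_sq)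
  qed
  then have "(cnorm n (mvec n A u))\<^sup>2 \<le> (\<Sum>i<n. (\<Sum>j<n. (cmod (A i j))\<^sup>2) * (cnorm n u)\<^sup>2)"
    unfolding cnorm_sq[of n "mvec n A u"] by (intro sum_mono)
  also have "\<dots> = (frob n A * cnorm n u)\<^sup>2"
    by (simp add: power_mult_distrib frob_sq sum_distrib_right)
  finally show ?thesis
    by (intro power2_le_imp_le[of "cnorm n (mvec n A u)"]) auto
qed

lemma gram_hermitian: "hermitian_on n (gram K r)"
  unfolding hermitian_on_def gram_def by (auto simp: mult.commute)

lemma cinner_gram:
  "cinner n u (mvec n (gram K r) w) = (\<Sum>k\<in>K. cnj (cinner n (\<lambda>i. r i k) u) * cinner n (\<lambda>i. r i k) w)"
proof -
  have "cinner n u (mvec n (gram K r) w) = (\<Sum>i<n. \<Sum>l<n. \<Sum>k\<in>K. (cnj (u i) * r i k) * (cnj (r l k) * w l))"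
    unfolding cinner_def mvec_def gram_def by (simp add: sum_distrib_left sum_distrib_right ac_simps)
  also have "\<dots> = (\<Sum>k\<in>K. \<Sum>i<n. \<Sum>l<n. (cnj (u i) * r i k) * (cnj (r l k) * w l))"
    unfolding sum.swap[of _ K "{..<n}", symmetric] ..
  also have "\<dots> = (\<Sum>k\<in>K. cnj (cinner n (\<lambda>i. r i k) u) * cinner n (\<lambda>i. r i k) w)"
    unfolding cinner_def by (simp add: sum_product mult.commute[of "r _ _" "cnj _"])
  finally show ?thesis .
qed

lemma hpsd_gram: "hpsd n (gram K r)"
  unfolding hpsd_def cinner_gram mult.commute[of "cnj _"] complex_norm_square[symmetric] of_real_sum[symmetric]
  by (auto simp: gram_hermitian intro!: sum_nonneg)

lemma hpsd_scale: "hpsd n A \<Longrightarrow> 0 \<le> a \<Longrightarrow> hpsd n (\<lambda>i j. of_real a * A i j)"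
  unfolding hpsd_def
proof (intro conjI allI)
  assume "hermitian_on n A \<and> (\<forall>u. 0 \<le> Re (cinner n u (mvec n A u)))"
  then have "cnj (A j i) = A i j" if "i < n" "j < n" for i j
    using that hermitian_onD[of n A i j] by simp
  then show "hermitian_on n (\<lambda>i j. of_real a * A i j)"
    unfolding hermitian_on_def by simp
next
  fix u assume *: "hermitian_on n A \<and> (\<forall>u. 0 \<le> Re (cinner n u (mvec n A u)))" "0 \<le> a"
  have "cinner n u (mvec n (\<lambda>i j. of_real a * A i j) u) = of_real a * cinner n u (mvec n A u)"
    unfolding cinner_def mvec_def by (simp add: sum_distrib_left ac_simps)
  then show "0 \<le> Re (cinner n u (mvec n (\<lambda>i j. of_real a * A i j) u))"
    using * by simp
qed

lemma cmod_diag_le: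
  assumes "opbound n c C" "i < n"
  shows "cmod (C i i) \<le> c"
proof -
  let ?e = "\<lambda>l. if l = i then 1 else 0 :: complex"
  have e: "cnorm n ?e = 1"
    using assms(2) unfolding cnorm_def L2_set_def by (simp add: if_distrib if_distribR cong: if_cong)
  have "C i i = cinner n ?e (mvec n C ?e)"
    using assms(2) unfolding cinner_def mvec_def by (simp add: if_distrib if_distribR cong: if_cong)
  also have "cmod \<dots> \<le> cnorm n ?e * cnorm n (mvec n C ?e)" by (rule cinner_Cauchy_Schwarz)
  also have "\<dots> \<le> c" using assms(1) e unfolding opbound_def by (metis mult.right_neutral mult_1)
  finally show ?thesis .
qed

lemma cmod_ctrace_le:
  assumes "opbound n c C" shows "cmod (ctrace n C) \<le> n * c"
  unfolding ctrace_def using sum_norm_le[of "{..<n}" "\<lambda>i. C i i" "\<lambda>_. c"] cmod_diag_le[OF assms] by simp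

subsection \<open>Resolvents\<close>

text \<open>The form of \<open>A + v\<close> at \<open>u\<close> is at least \<open>v\<close> times
  the squared norm of \<open>u\<close>. This argument gives both the existence of the resolvent
  (nonzero determinant) and its uniqueness.\<close>

lemma hpsd_shift_inj:
  assumes A: "hpsd n A" and v: "0 < v" and z: "\<And>i. i < n \<Longrightarrow> mvec n A u i + of_real v * u i = 0" and i: "i < n"
  shows "u i = 0"
proof -
  have "0 = cinner n u (\<lambda>i. mvec n A u i + of_real v * u i)"
    unfolding cinner_def using z by simp
  also have "\<dots> = cinner n u (mvec n A u) + of_real v * cinner n u u"
    unfolding cinner_def by (simp add: algebra_simps sum.distrib sum_distrib_left)
  finally have "0 = Re (cinner n u (mvec n A u)) + v * (cnorm n u)\<^sup>2"
    unfolding cinner_self by (metis Re_complex_of_real of_real_mult plus_complex.simps(1) zero_complex.simps(1))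
  moreover have "0 \<le> Re (cinner n u (mvec n A u))" using A by (auto simp: hpsd_def)
  ultimately have "v * (cnorm n u)\<^sup>2 \<le> 0" by linarith
  with v have "(cnorm n u)\<^sup>2 \<le> 0" by (simp add: mult_le_0_iff)
  then have "(\<Sum>i<n. (cmod (u i))\<^sup>2) = 0" by (simp add: cnorm_sq order_antisym sum_nonneg)
  then show ?thesis using i by (simp add: sum_nonneg_eq_0_iff)
qed

lemma
  assumes A: "hpsd n A" and v: "0 < v" and ij: "i < n" "j < n"
  shows resolvent_right: "mmul n A (resolvent n v A) i j = idm i j - of_real v * resolvent n v A i j"
    and resolvent_left: "mmul n (resolvent n v A) A i j = idm i j - of_real v * resolvent n v A i j"
proof -
  define M where "M = Matrix.mat n n (\<lambda>(i, j). A i j + of_real v * idm i j)"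
  have M: "M \<in> carrier_mat n n" unfolding M_def by simp
  have det: "Determinant.det M \<noteq> 0"
  proof
    assume "Determinant.det M = 0"
    then obtain x where x: "x \<in> carrier_vec n" "x \<noteq> 0\<^sub>v n" "M *\<^sub>v x = 0\<^sub>v n"
      using det_0_iff_vec_prod_zero_field[OF M] by auto
    have "mvec n A (\<lambda>i. x $ i) i + of_real v * (x $ i) = 0" if "i < n" for i
    proof -
      have "0 = (M *\<^sub>v x) $ i" using x that by simp
      also have "\<dots> = (\<Sum>l<n. (A i l + of_real v * idm i l) * x $ l)"
        using that x(1) by (simp add: M_def scalar_prod_def atLeast0LessThan)
      also have "\<dots> = mvec n A (\<lambda>i. x $ i) i + of_real v * mvec n idm (\<lambda>i. x $ i) i"
        unfolding mvec_def by (simp add: algebra_simps sum.distrib sum_distrib_left)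
      finally show ?thesis using that by (simp add: mvec_idm)
    qed
    from hpsd_shift_inj[OF A v this] have "x = 0\<^sub>v n"
      using x by (intro eq_vecI) auto
    with x show False by simp
  qed
  have R: "resolvent n v A = (\<lambda>i j. adj_mat M $$ (i, j) / Determinant.det M)"
    unfolding resolvent_def Let_def M_def ..
  have 1: "(\<Sum>l<n. (A i l + of_real v * idm i l) * resolvent n v A l j) = idm i j"
  proof -
    have "(M * adj_mat M) $$ (i, j) = (\<Sum>l<n. (A i l + of_real v * idm i l) * adj_mat M $$ (l, j))"
      using adj_mat(1)[OF M] ij by (simp add: M_def scalar_prod_def atLeast0LessThan)
    then have "(\<Sum>l<n. (A i l + of_real v * idm i l) * adj_mat M $$ (l, j)) = Determinant.det M * idm i j"
      unfolding adj_mat(2)[OF M] using ij by (simp add: idm_def)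
    then show ?thesis unfolding R using det by (simp add: sum_divide_distrib[symmetric])
  qed
  have 2: "(\<Sum>l<n. resolvent n v A i l * (A l j + of_real v * idm l j)) = idm i j"
  proof -
    have "(adj_mat M * M) $$ (i, j) = (\<Sum>l<n. adj_mat M $$ (i, l) * (A l j + of_real v * idm l j))"
      using adj_mat(1)[OF M] ij by (simp add: M_def scalar_prod_def atLeast0LessThan)
    then have "(\<Sum>l<n. adj_mat M $$ (i, l) * (A l j + of_real v * idm l j)) = Determinant.det M * idm i j"
      unfolding adj_mat(3)[OF M] using ij by (simp add: idm_def)
    then show ?thesis unfolding R using det by (simp add: sum_divide_distrib[symmetric])
  qed
  have "mmul n A (resolvent n v A) i j + of_real v * mmul n idm (resolvent n v A) i j = idm i j"
    using 1 unfolding mmul_def by (simp add: algebra_simps sum.distrib sum_distrib_left)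
  then show "mmul n A (resolvent n v A) i j = idm i j - of_real v * resolvent n v A i j"
    using ij by (simp add: mmul_idm algebra_simps)
  have "mmul n (resolvent n v A) A i j + of_real v * mmul n (resolvent n v A) idm i j = idm i j"
    using 2 unfolding mmul_def by (simp add: algebra_simps sum.distrib sum_distrib_left)
  then show "mmul n (resolvent n v A) A i j = idm i j - of_real v * resolvent n v A i j"
    using ij by (simp add: mmul_idm algebra_simps)
qed

lemma mvec_resolvent:
  assumes "hpsd n A" "0 < v" "i < n"
  shows "mvec n A (mvec n (resolvent n v A) u) i = u i - of_real v * mvec n (resolvent n v A) u i"
proof -
  have "mvec n A (mvec n (resolvent n v A) u) i = (\<Sum>l<n. (idm i l - of_real v * resolvent n v A i l) * u l)"
    unfolding mvec_mmul[symmetric] unfolding mvec_def[of n "mmul _ _ _"]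
    by (intro sum.cong refl) (use assms in \<open>simp add: resolvent_right\<close>)
  also have "\<dots> = mvec n idm u i - of_real v * mvec n (resolvent n v A) u i"
    unfolding mvec_def by (simp add: algebra_simps sum_subtractf sum_distrib_left)
  finally show ?thesis using assms by (simp add: mvec_idm)
qed

text \<open>The way in which later resolvent identities are checked: a candidate is put into the
  linear equation, instead of manipulating inverses.\<close>

lemma resolvent_unique:
  assumes A: "hpsd n A" and v: "0 < v"
    and S: "\<And>i. i < n \<Longrightarrow> mvec n A y i + of_real v * y i = u i" and i: "i < n"
  shows "y i = mvec n (resolvent n v A) u i"
proof -
  have "y i - mvec n (resolvent n v A) u i = 0"
  proof (rule hpsd_shift_inj[OF A v _ i, where u = "\<lambda>i. y i - mvec n (resolvent n v A) u i"])
    fix j assume j: "j < n"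
    have "mvec n A (\<lambda>i. y i - mvec n (resolvent n v A) u i) j
        = mvec n A y j - mvec n A (mvec n (resolvent n v A) u) j"
      unfolding mvec_def[of n A] by (simp add: right_diff_distrib sum_subtractf)
    moreover have "(a - b) + of_real v * (y' - b') = 0"
      if "a + of_real v * y' = c" "b = c - of_real v * b'" for a b c y' b' :: complex
    proof -
      have "a = c - of_real v * y'" using that(1) by (simp add: eq_diff_eq)
      then show ?thesis using that(2) by (simp add: algebra_simps)
    qed
    ultimately show "mvec n A (\<lambda>i. y i - mvec n (resolvent n v A) u i) j
        + of_real v * (y j - mvec n (resolvent n v A) u j) = 0"
      using S[OF j] mvec_resolvent[OF A v j, of u] by auto
  qed
  then show ?thesis by simp
qed

lemma mvec_single:
  "j < n \<Longrightarrow> mvec n A (\<lambda>l. idm l j) i = A i j"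
  using mmul_idm(2)[of j n A i] unfolding mmul_def mvec_def by simp

lemma resolvent_eqI:
  assumes A: "hpsd n A" and v: "0 < v"
    and S: "\<And>i j. i < n \<Longrightarrow> j < n \<Longrightarrow> mmul n A S i j + of_real v * S i j = idm i j"
    and ij: "i < n" "j < n"
  shows "S i j = resolvent n v A i j"
proof -
  have "mvec n A (\<lambda>l. S l j) i + of_real v * S i j = idm i j" if "i < n" for i
    using S[OF that ij(2)] by (simp add: mmul_def mvec_def)
  from resolvent_unique[OF A v this ij(1)] show ?thesis
    using ij by (simp add: mvec_single)
qed

context
  fixes n v A R
  assumes A: "hpsd n A" and v: "0 < v"
  defines "R \<equiv> resolvent n v A"
begin

text \<open>Writing \<open>u = (A + v) y\<close> with \<open>y = R u\<close> turns the form of the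
  inverse into the form of \<open>A\<close> at \<open>y\<close> plus \<open>v\<close> times the
  squared norm of \<open>y\<close>. Hence the form of \<open>R\<close> is nonnegative and controls
  the norm of \<open>R u\<close>, which also yields the operator bound \<open>1 / v\<close>.\<close>

lemma cinner_resolvent:
  "cinner n u (mvec n R u) = cnj (cinner n (mvec n R u) (mvec n A (mvec n R u))) + of_real (v * (cnorm n (mvec n R u))\<^sup>2)"
proof -
  let ?y = "mvec n R u"
  have "cinner n u ?y = cinner n (\<lambda>i. mvec n A ?y i + of_real v * ?y i) ?y"
    by (rule cinner_cong) (simp_all add: R_def mvec_resolvent[OF A v])
  also have "\<dots> = cinner n (mvec n A ?y) ?y + of_real v * cinner n ?y ?y"
    unfolding cinner_def by (simp add: algebra_simps sum.distrib sum_distrib_left)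
  finally show ?thesis by (simp add: cinner_self cnj_cinner)
qed

lemma Re_cinner_resolvent: "v * (cnorm n (mvec n R u))\<^sup>2 \<le> Re (cinner n u (mvec n R u))"
  unfolding cinner_resolvent using A by (simp add: hpsd_def)

lemma opbound_resolvent: "opbound n (1 / v) R"
  unfolding opbound_def
proof
  fix u
  let ?y = "cnorm n (mvec n R u)"
  have "v * ?y\<^sup>2 \<le> Re (cinner n u (mvec n R u))" by (rule Re_cinner_resolvent)
  also have "\<dots> \<le> cmod (cinner n u (mvec n R u))" by (rule complex_Re_le_cmod)
  also have "\<dots> \<le> cnorm n u * ?y" by (rule cinner_Cauchy_Schwarz)
  finally have *: "(v * ?y) * ?y \<le> cnorm n u * ?y" by (simp add: power2_eq_square ac_simps)
  have "v * ?y \<le> cnorm n u"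
  proof (cases "?y = 0")
    case False
    then have "0 < ?y" using cnorm_nonneg[of n "mvec n R u"] by linarith
    with * show ?thesis by (simp add: mult_le_cancel_right_pos)
  qed simp
  then show "?y \<le> 1 / v * cnorm n u" using v by (simp add: field_simps)
qed

lemma resolvent_hermitian: "hermitian_on n R"
  unfolding hermitian_on_def
proof (intro allI impI)
  fix i j assume ij: "i < n" "j < n"
  have "adj R i j = R i j"
    unfolding R_def
  proof (rule resolvent_eqI[OF A v _ ij, where S = "adj (resolvent n v A)"])
    fix i j assume ij: "i < n" "j < n"
    have "mmul n A (adj R) i j = cnj (mmul n R A j i)"
      unfolding mmul_def adj_def cnj_sum
      by (intro sum.cong refl) (use A ij in \<open>simp add: hpsd_def hermitian_onD[of n A i] mult.commute\<close>)
    also have "\<dots> = idm i j - of_real v * adj R i j"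
      unfolding R_def using ij by (simp add: resolvent_left[OF A v] adj_def idm_def)
    finally show "mmul n A (adj (resolvent n v A)) i j + of_real v * adj (resolvent n v A) i j = idm i j"
      by (simp add: R_def)
  qed
  then show "R i j = cnj (R j i)" by (simp add: adj_def)
qed

lemma cinner_resolvent_real: "cinner n u (mvec n R u) = of_real (Re (cinner n u (mvec n R u)))"
proof -
  have "cnj (cinner n u (mvec n R u)) = cinner n u (mvec n R u)"
    by (simp add: cnj_cinner cinner_mvec_hermitian[OF resolvent_hermitian])
  then show ?thesis by (metis Reals_cnj_iff of_real_Re)
qed

end

text \<open>A factor on the matrix amounts to a change of the spectral parameter; this is how the
  factor contributed by a layer moves the recursion from \<open>v\<close> to
  \<open>v / a\<close>.\<close>

lemma resolvent_scale:
  assumes A: "hpsd n A" and v: "0 < v" and a: "0 < a" and ij: "i < n" "j < n"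
  shows "resolvent n v (\<lambda>i j. of_real a * A i j) i j = resolvent n (v / a) A i j / of_real a"
proof (rule resolvent_eqI[symmetric, OF hpsd_scale[OF A] v _ ij, where S = "\<lambda>i j. resolvent n (v / a) A i j / of_real a"])
  fix i j assume ij: "i < n" "j < n"
  have "mmul n (\<lambda>i j. of_real a * A i j) (\<lambda>i j. resolvent n (v / a) A i j / of_real a) i j
      = mmul n A (resolvent n (v / a) A) i j"
    unfolding mmul_def using a by simp
  also have "\<dots> = idm i j - of_real (v / a) * resolvent n (v / a) A i j"
    using A v a ij by (intro resolvent_right) auto
  finally show "mmul n (\<lambda>i j. of_real a * A i j) (\<lambda>i j. resolvent n (v / a) A i j / of_real a) i j
     + of_real v * (resolvent n (v / a) A i j / of_real a) = idm i j" by simp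
qed (use a in auto)

lemma mvec_gram_remove:
  assumes "finite K" "k \<in> K"
  shows "mvec n (gram K r) w i = mvec n (gram (K - {k}) r) w i + r i k * cinner n (\<lambda>i. r i k) w"
proof -
  have "gram K r i l = gram (K - {k}) r i l + r i k * cnj (r l k)" for l
    unfolding gram_def using assms by (subst sum.remove[of K k]) auto
  then show ?thesis
    unfolding mvec_def cinner_def by (simp add: algebra_simps sum.distrib sum_distrib_left)
qed

text \<open>Cyclicity of the trace, column by column: here traces become quadratic forms in single
  columns.\<close>

lemma ctrace_mmul_gram:
  "ctrace n (mmul n (gram K r) B) = (\<Sum>k\<in>K. cinner n (\<lambda>i. r i k) (mvec n B (\<lambda>i. r i k)))"
proof -
  have "ctrace n (mmul n (gram K r) B) = (\<Sum>i<n. \<Sum>l<n. \<Sum>k\<in>K. r i k * cnj (r l k) * B l i)"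
    unfolding ctrace_def mmul_def gram_def sum_distrib_right ..
  also have "\<dots> = (\<Sum>k\<in>K. \<Sum>i<n. \<Sum>l<n. r i k * cnj (r l k) * B l i)"
    unfolding sum.swap[of _ K "{..<n}", symmetric] ..
  also have "\<dots> = (\<Sum>k\<in>K. \<Sum>l<n. \<Sum>i<n. r i k * cnj (r l k) * B l i)"
    by (intro sum.cong refl sum.swap)
  also have "\<dots> = (\<Sum>k\<in>K. cinner n (\<lambda>i. r i k) (mvec n B (\<lambda>i. r i k)))"
    unfolding cinner_def mvec_def sum_distrib_left by (intro sum.cong refl) (simp add: ac_simps)
  finally show ?thesis .
qed

lemma cmod_cinner_mvec_le:
  "opbound n c C \<Longrightarrow> cmod (cinner n w (mvec n C w)) \<le> c * (cnorm n w)\<^sup>2"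
proof -
  assume C: "opbound n c C"
  have "cmod (cinner n w (mvec n C w)) \<le> cnorm n w * cnorm n (mvec n C w)" by (rule cinner_Cauchy_Schwarz)
  also have "\<dots> \<le> cnorm n w * (c * cnorm n w)" using C by (intro mult_left_mono) (auto simp: opbound_def)
  finally show ?thesis by (simp add: power2_eq_square ac_simps)
qed

text \<open>The normalised trace of \<open>A (A + v)^-1\<close>, that is the mean of
  \<open>e / (e + v)\<close> over the eigenvalues \<open>e\<close>. It is the number
  \<open>t = 1 - v s(-v)\<close> of a single matrix and lies in [0, 1] for every
  \<open>v\<close>.\<close>

definition Tres :: "nat \<Rightarrow> real \<Rightarrow> (nat \<Rightarrow> nat \<Rightarrow> complex) \<Rightarrow> real" where
  "Tres n v A = 1 - v / n * Re (ctrace n (resolvent n v A))"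

lemma resolvent_diag_bounds:
  assumes A: "hpsd n A" and v: "0 < v" and i: "i < n"
  shows "0 \<le> Re (resolvent n v A i i)" "Re (resolvent n v A i i) \<le> 1 / v"
proof -
  have "Re (resolvent n v A i i) \<le> cmod (resolvent n v A i i)" by (rule complex_Re_le_cmod)
  also have "\<dots> \<le> 1 / v" using opbound_resolvent[OF A v] i by (rule cmod_diag_le)
  finally show "Re (resolvent n v A i i) \<le> 1 / v" .
  have "cinner n (\<lambda>l. idm l i) (mvec n (resolvent n v A) (\<lambda>l. idm l i)) = resolvent n v A i i"
    using i by (simp add: mvec_single cinner_def) (simp add: idm_def if_distrib if_distribR cong: if_cong)
  moreover have "0 \<le> v * (cnorm n (mvec n (resolvent n v A) (\<lambda>l. idm l i)))\<^sup>2" using v by simp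
  ultimately show "0 \<le> Re (resolvent n v A i i)"
    using Re_cinner_resolvent[OF A v, of "\<lambda>l. idm l i"] by simp
qed

lemma Tres_bounds:
  assumes A: "hpsd n A" and v: "0 < v"
  shows "0 \<le> Tres n v A" "Tres n v A \<le> 1"
proof -
  have "0 \<le> Re (ctrace n (resolvent n v A))"
    unfolding ctrace_def Re_sum by (intro sum_nonneg) (auto intro: resolvent_diag_bounds[OF A v])
  then show "Tres n v A \<le> 1" unfolding Tres_def using v by simp
  have "Re (ctrace n (resolvent n v A)) \<le> (\<Sum>i<n. 1 / v)"
    unfolding ctrace_def Re_sum by (intro sum_mono) (auto intro: resolvent_diag_bounds[OF A v])
  then have "v * Re (ctrace n (resolvent n v A)) \<le> n" using v by (simp add: field_simps)
  then show "0 \<le> Tres n v A" unfolding Tres_def by (cases "n = 0") (auto simp: field_simps)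
qed

lemma Tres_scale:
  assumes A: "hpsd n A" and v: "0 < v" and a: "0 < a"
  shows "Tres n v (\<lambda>i j. of_real a * A i j) = Tres n (v / a) A"
proof -
  have "ctrace n (resolvent n v (\<lambda>i j. of_real a * A i j)) = ctrace n (\<lambda>i j. resolvent n (v / a) A i j / of_real a)"
    by (rule ctrace_cong) (simp add: resolvent_scale[OF assms])
  also have "\<dots> = ctrace n (resolvent n (v / a) A) / of_real a"
    unfolding ctrace_def by (simp add: sum_divide_distrib)
  finally show ?thesis unfolding Tres_def by simp
qed

subsection \<open>Leaving out one column\<close>

text \<open>Sherman-Morrison for one column \<open>c\<close>: with \<open>u = R' c\<close> and
  \<open>h\<close> the form of \<open>R'\<close> at \<open>c\<close>, the full resolvent maps
  \<open>c\<close> to \<open>u / (1 + h)\<close>.\<close>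

locale rank_one_update =
  fixes n :: nat and v :: real and K :: "nat set" and k :: nat and r :: "nat \<Rightarrow> nat \<Rightarrow> complex"
  assumes v: "0 < v" and K: "finite K" "k \<in> K"
begin

abbreviation "c \<equiv> (\<lambda>i. r i k)"
abbreviation "R \<equiv> resolvent n v (gram K r)"
abbreviation "R' \<equiv> resolvent n v (gram (K - {k}) r)"
definition "u = mvec n R' c"
definition "h = Re (cinner n c u)"

lemma h: "cinner n c u = of_real h" "0 \<le> h" "v * (cnorm n u)\<^sup>2 \<le> h"
proof -
  show "cinner n c u = of_real h" unfolding h_def u_def by (rule cinner_resolvent_real[OF hpsd_gram v])
  show *: "v * (cnorm n u)\<^sup>2 \<le> h" unfolding h_def u_def by (rule Re_cinner_resolvent[OF hpsd_gram v])
  have "0 \<le> v * (cnorm n u)\<^sup>2" using v by simp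
  with * show "0 \<le> h" by linarith
qed

lemma one_plus_h: "1 + complex_of_real h \<noteq> 0"
proof
  assume "1 + complex_of_real h = 0"
  then have "Re (1 + complex_of_real h) = 0" by (simp only: zero_complex.sel)
  then show False using h(2) by simp
qed

lemma mvec_u: "i < n \<Longrightarrow> mvec n (gram K r) u i + of_real v * u i = c i * (1 + of_real h)"
  using mvec_resolvent[OF hpsd_gram v, of i n "K - {k}" r c]
  by (simp add: mvec_gram_remove[OF K] h(1) u_def[symmetric] algebra_simps)

lemma mvec_resolvent_update:
  assumes "i < n"
  shows "mvec n R c i = u i / (1 + of_real h)"
proof (rule resolvent_unique[OF hpsd_gram v _ assms, symmetric])
  fix i assume i: "i < n"
  have "mvec n (gram K r) (\<lambda>i. u i / (1 + of_real h)) i = mvec n (gram K r) u i / (1 + of_real h)"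
    unfolding mvec_def by (simp add: sum_divide_distrib)
  then show "mvec n (gram K r) (\<lambda>i. u i / (1 + of_real h)) i + of_real v * (u i / (1 + of_real h)) = c i"
    using mvec_u[OF i] one_plus_h by (simp add: add_divide_distrib[symmetric])
qed

text \<open>The rank one formula, verified by applying \<open>gram K r + v\<close> to
  \<open>S\<close>: the matrix \<open>R'\<close> leaves the surplus \<open>c i * cnj (u j)\<close>,
  which by \<open>mvec_u\<close> is exactly the contribution of the subtracted term.\<close>

lemma resolvent_update:
  assumes "i < n" "j < n"
  shows "R' i j - R i j = u i * cnj (u j) / (1 + of_real h)"
proof -
  define S where "S = (\<lambda>i j. R' i j - u i * cnj (u j) / (1 + of_real h))"
  have "S i j = R i j"
  proof (rule resolvent_eqI[OF hpsd_gram v _ assms])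
    fix i j assume ij: "i < n" "j < n"
    define w where "w = (\<lambda>l. R' l j)"
    define s where "s = cnj (u j) / (1 + of_real h)"
    have "cinner n c w = cnj (u j)"
      unfolding cinner_def w_def u_def mvec_def cnj_sum complex_cnj_mult
      by (intro sum.cong refl)
        (use ij hermitian_onD[OF resolvent_hermitian[OF hpsd_gram v], of _ n j] in \<open>simp add: mult.commute\<close>)
    then have 1: "mvec n (gram K r) w i + of_real v * w i = idm i j + c i * cnj (u j)"
      using resolvent_right[OF hpsd_gram v ij, of "K - {k}" r]
      by (simp add: mvec_gram_remove[OF K] mvec_def[of n "gram (K - {k}) r"] mmul_def w_def)
    have "mmul n (gram K r) S i j = mvec n (gram K r) w i - s * mvec n (gram K r) u i"
      unfolding mmul_def mvec_def S_def w_def s_def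
      by (simp add: algebra_simps sum_subtractf sum_distrib_left sum_divide_distrib)
    then have "mmul n (gram K r) S i j + of_real v * S i j
        = (mvec n (gram K r) w i + of_real v * w i) - s * (mvec n (gram K r) u i + of_real v * u i)"
      unfolding S_def w_def s_def by (simp add: algebra_simps)
    also have "\<dots> = idm i j"
      unfolding 1 mvec_u[OF ij(1)] s_def using one_plus_h by simp
    finally show "mmul n (gram K r) S i j + of_real v * S i j = idm i j" .
  qed
  then show ?thesis unfolding S_def by (simp add: algebra_simps)
qed

text \<open>The trace changes by the form of \<open>E\<close> at \<open>u\<close> divided by
  \<open>1 + h\<close>. Since \<open>v\<close> times the squared norm of \<open>u\<close> is at most
  \<open>h\<close>, the length of the removed column cancels and the bound depends on
  \<open>E\<close> and \<open>v\<close> alone.\<close>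

lemma ctrace_update_le:
  "cmod (ctrace n (mmul n E R') - ctrace n (mmul n E R)) \<le> frob n E / v"
proof -
  have "ctrace n (mmul n E R') - ctrace n (mmul n E R) = (\<Sum>i<n. \<Sum>l<n. E i l * (R' l i - R l i))"
    unfolding ctrace_def mmul_def by (simp add: algebra_simps sum_subtractf)
  also have "\<dots> = (\<Sum>i<n. \<Sum>l<n. cnj (u i) * (E i l * u l) / (1 + of_real h))"
    by (intro sum.cong refl) (simp add: resolvent_update)
  also have "\<dots> = cinner n u (mvec n E u) / (1 + of_real h)"
    unfolding cinner_def mvec_def by (simp add: sum_divide_distrib sum_distrib_left)
  finally have eq: "ctrace n (mmul n E R') - ctrace n (mmul n E R) = cinner n u (mvec n E u) / (1 + of_real h)" .
  have "cmod (cinner n u (mvec n E u) / (1 + of_real h)) = cmod (cinner n u (mvec n E u)) / (1 + h)"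
  proof -
    have "cmod (1 + complex_of_real h) = cmod (of_real (1 + h))" by (simp only: of_real_add of_real_1)
    also have "\<dots> = 1 + h" unfolding norm_of_real using h(2) by (rule abs_of_nonneg[OF add_nonneg_nonneg[OF zero_le_one]])
    finally have 1: "cmod (1 + complex_of_real h) = 1 + h" .
    show ?thesis unfolding norm_divide 1 ..
  qed
  also have "\<dots> \<le> (cnorm n u * (frob n E * cnorm n u)) / (1 + h)"
  proof (rule divide_right_mono)
    show "cmod (cinner n u (mvec n E u)) \<le> cnorm n u * (frob n E * cnorm n u)"
      by (rule order_trans[OF cinner_Cauchy_Schwarz mult_left_mono[OF cnorm_mvec_frob cnorm_nonneg]])
  qed (use h(2) in simp)
  also have "\<dots> = frob n E * ((cnorm n u)\<^sup>2 / (1 + h))" by (simp add: power2_eq_square)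
  also have "\<dots> \<le> frob n E * (1 / v)"
  proof (rule mult_left_mono)
    have "(cnorm n u)\<^sup>2 * v \<le> 1 + h" using h(2,3) by (simp add: mult.commute)
    then show "(cnorm n u)\<^sup>2 / (1 + h) \<le> 1 / v" using v h(2) by (simp add: field_simps)
  qed simp
  finally show ?thesis unfolding eq by simp
qed

end

lemma abs_diff_inverse_one_plus_le:
  fixes g h :: real assumes "0 \<le> g" "0 \<le> h"
  shows "\<bar>1 / (1 + g) - 1 / (1 + h)\<bar> \<le> \<bar>h - g\<bar>"
proof -
  have "1 / (1 + g) - 1 / (1 + h) = (h - g) / ((1 + g) * (1 + h))"
    using assms by (simp add: field_simps)
  also have "\<bar>\<dots>\<bar> = \<bar>h - g\<bar> / ((1 + g) * (1 + h))" using assms by (simp add: abs_mult)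
  also have "\<dots> \<le> \<bar>h - g\<bar>"
  proof -
    have "1 * 1 \<le> (1 + g) * (1 + h)" using assms by (intro mult_mono) auto
    then have "1 \<le> (1 + g) * (1 + h)" by simp
    then show ?thesis using divide_left_mono[of 1 "(1 + g) * (1 + h)" "\<bar>h - g\<bar>"] by simp
  qed
  finally show ?thesis .
qed

text \<open>One factor, treated deterministically: \<open>D\<close> comes from the columns of the
  product so far, and \<open>r\<close> holds the columns of the next product. Nothing relates
  \<open>W\<close> and \<open>r\<close> here; their relation enters only through the smallness of
  the deviations \<open>\<eta>\<close>.\<close>

locale layer =
  fixes n p q :: nat and v :: real and W r :: "nat \<Rightarrow> nat \<Rightarrow> complex"
  assumes v: "0 < v" and n: "0 < n" "n \<le> q"
begin

abbreviation "D \<equiv> gram {..<p} W"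
abbreviation "R \<equiv> resolvent n v (gram {..<q} r)"
abbreviation "R' k \<equiv> resolvent n v (gram ({..<q} - {k}) r)"
definition "g = Re (ctrace n (mmul n D R)) / q"
definition "\<alpha> = 1 / (1 + g)"
definition "sqn = (\<Sum>i<p. (cnorm n (\<lambda>l. W l i))\<^sup>2)"
text \<open>The centre uses the full resolvent \<open>R\<close> and is therefore built in the same
  way for every \<open>k\<close>, whereas the form uses \<open>R' k\<close>, which does not involve
  column \<open>k\<close>. The cases of interest are \<open>B\<close> the identity and
  \<open>B\<close> the resolvent \<open>Q\<close> of \<open>a D\<close>.\<close>

definition "\<eta> k B = cmod (cinner n (\<lambda>i. r i k) (mvec n (mmul n B (R' k)) (\<lambda>i. r i k))
    - ctrace n (mmul n D (mmul n B R)) / q)"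

lemma q: "0 < q" using n by simp

lemma \<eta>_nonneg: "0 \<le> \<eta> k B" unfolding \<eta>_def by simp

text \<open>Exchanges the common centre for the one built from \<open>R' k\<close>, as the estimate
  of quadratic forms requires; by the rank one bound the exchange costs the Frobenius norm of
  \<open>D B\<close>.\<close>

lemma \<eta>_le:
  assumes "k < q" "opbound n \<beta> B" "0 \<le> \<beta>"
  shows "\<eta> k B \<le> cmod (cinner n (\<lambda>i. r i k) (mvec n (mmul n B (R' k)) (\<lambda>i. r i k))
      - ctrace n (mmul n D (mmul n B (R' k))) / q) + \<beta> * frob n D / (q * v)"
proof -
  interpret ro: rank_one_update n v "{..<q}" k r by standard (use v assms in auto)
  let ?X = "cinner n (\<lambda>i. r i k) (mvec n (mmul n B (R' k)) (\<lambda>i. r i k))"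
  let ?t = "ctrace n (mmul n D (mmul n B (R' k)))" and ?t' = "ctrace n (mmul n D (mmul n B R))"
  have "cmod (?t - ?t') \<le> frob n (mmul n D B) / v"
    unfolding mmul_assoc[symmetric] by (rule ro.ctrace_update_le)
  also have "\<dots> \<le> \<beta> * frob n D / v"
    using v assms by (intro divide_right_mono frob_mmul_right) auto
  finally have "cmod ((?t - ?t') / q) \<le> \<beta> * frob n D / (q * v)"
    using q v by (simp add: norm_divide field_simps)
  moreover have "?X - ?t' / q = (?X - ?t / q) + (?t - ?t') / q" by (simp add: diff_divide_distrib)
  then have "\<eta> k B \<le> cmod (?X - ?t / q) + cmod ((?t - ?t') / q)"
    unfolding \<eta>_def by (simp only: norm_triangle_ineq)
  ultimately show ?thesis by linarith
qed

lemma ctrace_D: "opbound n c C \<Longrightarrow> cmod (ctrace n (mmul n D C)) \<le> c * sqn"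
  unfolding ctrace_mmul_gram sqn_def sum_distrib_left
  by (intro sum_norm_le cmod_cinner_mvec_le)

lemma g: "ctrace n (mmul n D R) = of_real (q * g)" "0 \<le> g"
proof -
  have "ctrace n (mmul n D R) = of_real (\<Sum>k<p. Re (cinner n (\<lambda>i. W i k) (mvec n R (\<lambda>i. W i k))))"
    unfolding ctrace_mmul_gram of_real_sum
    by (intro sum.cong refl cinner_resolvent_real[OF hpsd_gram v])
  moreover have "0 \<le> (\<Sum>k<p. Re (cinner n (\<lambda>i. W i k) (mvec n R (\<lambda>i. W i k))))"
  proof (rule sum_nonneg)
    fix k
    have "0 \<le> v * (cnorm n (mvec n R (\<lambda>i. W i k)))\<^sup>2" using v by simp
    then show "0 \<le> Re (cinner n (\<lambda>i. W i k) (mvec n R (\<lambda>i. W i k)))"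
      using Re_cinner_resolvent[OF hpsd_gram[of n "{..<q}" r] v, of "\<lambda>i. W i k"] by linarith
  qed
  ultimately show "ctrace n (mmul n D R) = of_real (q * g)" "0 \<le> g"
    unfolding g_def using q by simp_all
qed

lemma \<alpha>: "0 < \<alpha>" "\<alpha> \<le> 1"
  unfolding \<alpha>_def using g(2) by simp_all

definition "h k = Re (cinner n (\<lambda>i. r i k) (mvec n (R' k) (\<lambda>i. r i k)))"

lemma h:
  assumes "k < q"
  shows "0 \<le> h k" "cinner n (\<lambda>i. r i k) (mvec n (R' k) (\<lambda>i. r i k)) = of_real (h k)"
    "\<And>i. i < n \<Longrightarrow> mvec n R (\<lambda>i. r i k) i = mvec n (R' k) (\<lambda>i. r i k) i / of_real (1 + h k)"
    "\<bar>h k - g\<bar> = \<eta> k idm"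
proof -
  interpret ro: rank_one_update n v "{..<q}" k r by standard (use v assms in auto)
  have ro: "ro.h = h k" unfolding ro.h_def ro.u_def h_def ..
  show "0 \<le> h k" using ro.h(2) unfolding ro .
  show *: "cinner n (\<lambda>i. r i k) (mvec n (R' k) (\<lambda>i. r i k)) = of_real (h k)"
    using ro.h(1) unfolding ro ro.u_def .
  show "mvec n R (\<lambda>i. r i k) i = mvec n (R' k) (\<lambda>i. r i k) i / of_real (1 + h k)" if "i < n" for i
    using ro.mvec_resolvent_update[OF that] unfolding ro ro.u_def by simp
  have "mvec n (mmul n idm (R' k)) (\<lambda>i. r i k) i = mvec n (R' k) (\<lambda>i. r i k) i" if "i < n" for i
    using that by (simp add: mvec_mmul mvec_idm)
  then have 1: "cinner n (\<lambda>i. r i k) (mvec n (mmul n idm (R' k)) (\<lambda>i. r i k)) = of_real (h k)"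
    unfolding *[symmetric] by (intro cinner_cong) auto
  have "mmul n D (mmul n idm R) = mmul n D R"
    by (intro ext mmul_cong) (auto simp: mmul_idm)
  then have 2: "ctrace n (mmul n D (mmul n idm R)) / q = of_real g"
    using g(1) q by simp
  show "\<bar>h k - g\<bar> = \<eta> k idm"
    unfolding \<eta>_def 1 2 of_real_diff[symmetric] norm_of_real ..
qed

text \<open>\<open>n - v tr R\<close> is the trace of the Gram matrix times \<open>R\<close>, that
  is the sum of the \<open>h k / (1 + h k)\<close>, and each term is \<open>1 - \<alpha>\<close> up
  to \<open>\<eta> k idm\<close>. Division by \<open>q\<close> identifies
  \<open>1 - \<alpha>\<close> with \<open>n / q\<close> times \<open>Tres\<close>, whence the factor
  \<open>1 - y t\<close> in the limit.\<close>

lemma \<alpha>_approx: "\<bar>\<alpha> - (1 - n / q * Tres n v (gram {..<q} r))\<bar> \<le> (\<Sum>k<q. \<eta> k idm) / q"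
proof -
  have "of_real n - of_real v * ctrace n R = ctrace n (mmul n (gram {..<q} r) R)"
    unfolding ctrace_def sum_distrib_left
    using resolvent_right[OF hpsd_gram v, of _ n _ "{..<q}" r] by (simp add: sum_subtractf idm_def)
  also have "\<dots> = (\<Sum>k<q. of_real (h k / (1 + h k)))"
    unfolding ctrace_mmul_gram
  proof (intro sum.cong refl)
    fix k assume k: "k \<in> {..<q}"
    have "cinner n (\<lambda>i. r i k) (mvec n R (\<lambda>i. r i k))
        = cinner n (\<lambda>i. r i k) (\<lambda>i. mvec n (R' k) (\<lambda>i. r i k) i / of_real (1 + h k))"
      using h(3)[of k] k by (intro cinner_cong) auto
    also have "\<dots> = of_real (h k) / of_real (1 + h k)"
      using h(2)[of k] k by (simp add: cinner_def sum_divide_distrib[symmetric])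
    finally show "cinner n (\<lambda>i. r i k) (mvec n R (\<lambda>i. r i k)) = of_real (h k / (1 + h k))" by simp
  qed
  finally have "Re (of_real n - of_real v * ctrace n R) = (\<Sum>k<q. h k / (1 + h k))"
    by (simp del: of_real_divide)
  then have "n * Tres n v (gram {..<q} r) = (\<Sum>k<q. h k / (1 + h k))"
    unfolding Tres_def using n by (simp add: field_simps)
  then have "\<alpha> - (1 - n / q * Tres n v (gram {..<q} r)) = (\<Sum>k<q. \<alpha> - 1 + h k / (1 + h k)) / q"
    using q by (simp add: sum.distrib sum_subtractf add_divide_distrib diff_divide_distrib)
  then have eq: "\<alpha> - (1 - n / q * Tres n v (gram {..<q} r)) = (\<Sum>k<q. \<alpha> - 1 + h k / (1 + h k)) / q" .
  show "\<bar>\<alpha> - (1 - n / q * Tres n v (gram {..<q} r))\<bar> \<le> (\<Sum>k<q. \<eta> k idm) / q"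
    unfolding eq abs_divide abs_of_nat
  proof (intro divide_right_mono order_trans[OF sum_abs] sum_mono)
    fix k assume "k \<in> {..<q}" then have k: "k < q" by simp
    have "\<alpha> - 1 + h k / (1 + h k) = 1 / (1 + g) - 1 / (1 + h k)"
      unfolding \<alpha>_def using h(1)[OF k] by (simp add: field_simps)
    then show "\<bar>\<alpha> - 1 + h k / (1 + h k)\<bar> \<le> \<eta> k idm"
      using abs_diff_inverse_one_plus_le[OF g(2) h(1)[OF k]] h(4)[OF k] by simp
  qed simp
qed

context
  fixes a :: real
  assumes a: "0 < a" "a \<le> 1"
begin

text \<open>The parameter \<open>a\<close> is free; it will be a grid point near
  \<open>\<alpha>\<close>. The number \<open>\<alpha>\<close> itself depends on all columns of
  \<open>r\<close>, and using it would destroy the independence of \<open>Q\<close> from column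
  \<open>k\<close>.\<close>

abbreviation "Q \<equiv> resolvent n v (\<lambda>i j. of_real a * D i j)"

lemma hpsd_aD: "hpsd n (\<lambda>i j. of_real a * D i j)"
  using a by (intro hpsd_scale hpsd_gram) auto

lemma opbound_Q: "opbound n (1 / v) Q"
  by (rule opbound_resolvent[OF hpsd_aD v])

definition "\<kappa> = ctrace n (mmul n D (mmul n Q R)) / q"

text \<open>The first bound, by the trace of \<open>D\<close>, goes with the small factor
  \<open>a - \<alpha>\<close>. The second rests on \<open>a D Q = 1 - v Q\<close>, so no information
  on \<open>D\<close> enters; it goes with the sum of the \<open>\<eta> k idm\<close>.\<close>

lemma \<kappa>_le: "cmod (of_nat q * \<kappa>) \<le> sqn / v\<^sup>2" "cmod \<kappa> \<le> 2 / (a * v)"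
proof -
  have qk: "of_nat q * \<kappa> = ctrace n (mmul n D (mmul n Q R))" unfolding \<kappa>_def using q by simp
  have QR: "opbound n (1 / v * (1 / v)) (mmul n Q R)"
    using v by (intro opbound_mmul opbound_Q opbound_resolvent[OF hpsd_gram]) auto
  then show "cmod (of_nat q * \<kappa>) \<le> sqn / v\<^sup>2"
    unfolding qk using ctrace_D[OF QR] by (simp add: power2_eq_square)
  have "of_real a * (of_nat q * \<kappa>) = ctrace n (mmul n (mmul n (\<lambda>i j. of_real a * D i j) Q) R)"
    unfolding qk mmul_assoc by (simp add: ctrace_def mmul_def sum_distrib_left mult.assoc)
  also have "\<dots> = (\<Sum>i<n. \<Sum>l<n. (idm i l - of_real v * Q i l) * R l i)"
    unfolding ctrace_def mmul_def[of n "mmul _ _ _" R]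
    by (intro sum.cong refl) (simp add: resolvent_right[OF hpsd_aD v])
  also have "\<dots> = ctrace n (mmul n idm R) - of_real v * ctrace n (mmul n Q R)"
    unfolding ctrace_def mmul_def by (simp add: algebra_simps sum_subtractf sum_distrib_left)
  also have "ctrace n (mmul n idm R) = ctrace n R" by (intro ctrace_cong) (simp add: mmul_idm)
  finally have eq: "of_real a * (of_nat q * \<kappa>) = ctrace n R - of_real v * ctrace n (mmul n Q R)" .
  have "a * (q * cmod \<kappa>) = cmod (ctrace n R - of_real v * ctrace n (mmul n Q R))"
    unfolding eq[symmetric] using a by (simp add: norm_mult)
  also have "\<dots> \<le> cmod (ctrace n R) + cmod (of_real v * ctrace n (mmul n Q R))"
    by (rule norm_triangle_ineq4)
  also have "\<dots> = cmod (ctrace n R) + v * cmod (ctrace n (mmul n Q R))"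
    using v by (simp add: norm_mult)
  also have "\<dots> \<le> n * (1 / v) + v * (n * (1 / v * (1 / v)))"
    using v by (intro add_mono mult_left_mono cmod_ctrace_le QR opbound_resolvent[OF hpsd_gram]) auto
  also have "\<dots> \<le> q * (2 / v)" using v n by (simp add: field_simps)
  finally have "q * (a * cmod \<kappa>) \<le> q * (2 / v)" by (simp add: ac_simps)
  then have "a * cmod \<kappa> \<le> 2 / v" using q by (simp only: mult_le_cancel_left_pos of_nat_0_less_iff)
  then show "cmod \<kappa> \<le> 2 / (a * v)" using a v by (simp add: field_simps)
qed

text \<open>Resolvent identity \<open>R - Q = R (a D - gram {..<q} r) Q\<close>. In the trace the
  second part is the sum of the \<open>x k / (1 + h k)\<close>; replacing \<open>x k\<close> by
  \<open>\<kappa>\<close> and \<open>1 / (1 + h k)\<close> by \<open>\<alpha>\<close> gives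
  \<open>\<alpha> q \<kappa>\<close>, which cancels the first part \<open>a q \<kappa>\<close> up to
  the factor \<open>a - \<alpha>\<close>.\<close>

lemma Tres_approx:
  "\<bar>Tres n v (gram {..<q} r) - Tres n (v / a) D\<bar>
    \<le> \<bar>a - \<alpha>\<bar> * (sqn / n) / v + v / n * (\<Sum>k<q. \<eta> k Q) + 2 / a * (\<Sum>k<q. \<eta> k idm) / n"
proof -
  define x where "x k = cinner n (\<lambda>i. r i k) (mvec n (mmul n Q (R' k)) (\<lambda>i. r i k))" for k
  have "mmul n R (mmul n (\<lambda>i j. of_real a * D i j) Q) i i = R i i - of_real v * mmul n R Q i i" if "i < n" for i
  proof -
    have "mmul n R (mmul n (\<lambda>i j. of_real a * D i j) Q) i i = (\<Sum>l<n. R i l * (idm l i - of_real v * Q l i))"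
      unfolding mmul_def[of n R] using that by (intro sum.cong refl) (simp add: resolvent_right[OF hpsd_aD v])
    also have "\<dots> = mmul n R idm i i - of_real v * mmul n R Q i i"
      unfolding mmul_def by (simp add: algebra_simps sum_subtractf sum_distrib_left)
    finally show ?thesis using that by (simp add: mmul_idm)
  qed
  moreover have "mmul n (mmul n R (gram {..<q} r)) Q i i = Q i i - of_real v * mmul n R Q i i" if "i < n" for i
  proof -
    have "mmul n (mmul n R (gram {..<q} r)) Q i i = (\<Sum>l<n. (idm i l - of_real v * R i l) * Q l i)"
      unfolding mmul_def[of n _ Q] using that by (intro sum.cong refl) (simp add: resolvent_left[OF hpsd_gram v])
    also have "\<dots> = mmul n idm Q i i - of_real v * mmul n R Q i i"
      unfolding mmul_def by (simp add: algebra_simps sum_subtractf sum_distrib_left)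
    finally show ?thesis using that by (simp add: mmul_idm)
  qed
  ultimately have "ctrace n R - ctrace n Q = ctrace n (mmul n R (mmul n (\<lambda>i j. of_real a * D i j) Q))
      - ctrace n (mmul n (mmul n R (gram {..<q} r)) Q)"
    unfolding ctrace_def sum_subtractf[symmetric] by (intro sum.cong refl) simp
  also have "ctrace n (mmul n R (mmul n (\<lambda>i j. of_real a * D i j) Q)) = of_real a * (of_nat q * \<kappa>)"
  proof -
    have "ctrace n (mmul n R (mmul n (\<lambda>i j. of_real a * D i j) Q)) = ctrace n (mmul n (\<lambda>i j. of_real a * D i j) (mmul n Q R))"
      by (subst ctrace_mmul_comm) (simp add: mmul_assoc)
    also have "\<dots> = of_real a * ctrace n (mmul n D (mmul n Q R))"
      by (simp add: ctrace_def mmul_def sum_distrib_left mult.assoc)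
    finally show ?thesis unfolding \<kappa>_def using q by simp
  qed
  also have "ctrace n (mmul n (mmul n R (gram {..<q} r)) Q) = ctrace n (mmul n (gram {..<q} r) (mmul n Q R))"
    unfolding mmul_assoc by (subst ctrace_mmul_comm) (simp add: mmul_assoc)
  also have "\<dots> = (\<Sum>k<q. x k / of_real (1 + h k))"
    unfolding ctrace_mmul_gram
  proof (intro sum.cong refl)
    fix k assume "k \<in> {..<q}" then have k: "k < q" by simp
    have "mvec n (mmul n Q R) (\<lambda>i. r i k) i = mvec n (mmul n Q (R' k)) (\<lambda>i. r i k) i / of_real (1 + h k)" for i
    proof -
      have "mvec n Q (mvec n R (\<lambda>i. r i k)) i = mvec n Q (\<lambda>i. mvec n (R' k) (\<lambda>i. r i k) i / of_real (1 + h k)) i"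
        by (intro mvec_cong refl h(3)[OF k])
      then show ?thesis unfolding mvec_mmul by (simp add: mvec_def[of n Q] sum_divide_distrib)
    qed
    then show "cinner n (\<lambda>i. r i k) (mvec n (mmul n Q R) (\<lambda>i. r i k)) = x k / of_real (1 + h k)"
      unfolding x_def cinner_def by (simp add: sum_divide_distrib)
  qed
  also have "of_real a * (of_nat q * \<kappa>) - (\<Sum>k<q. x k / of_real (1 + h k))
      = of_real (a - \<alpha>) * (of_nat q * \<kappa>) + (\<Sum>k<q. (\<kappa> - x k) / of_real (1 + h k) + \<kappa> * of_real (\<alpha> - 1 / (1 + h k)))"
    by (simp add: algebra_simps sum.distrib sum_subtractf diff_divide_distrib)
  finally have "cmod (ctrace n R - ctrace n Q) \<le> cmod (of_real (a - \<alpha>) * (of_nat q * \<kappa>))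
      + cmod (\<Sum>k<q. (\<kappa> - x k) / of_real (1 + h k) + \<kappa> * of_real (\<alpha> - 1 / (1 + h k)))"
    by (simp only: norm_triangle_ineq)
  also have "\<dots> \<le> \<bar>a - \<alpha>\<bar> * (sqn / v\<^sup>2) + (\<Sum>k<q. \<eta> k Q + 2 / (a * v) * \<eta> k idm)"
  proof (intro add_mono sum_norm_le)
    show "cmod (of_real (a - \<alpha>) * (of_nat q * \<kappa>)) \<le> \<bar>a - \<alpha>\<bar> * (sqn / v\<^sup>2)"
      unfolding norm_mult norm_of_real using \<kappa>_le(1) by (intro mult_left_mono) (auto simp: norm_mult)
    fix k assume "k \<in> {..<q}" then have k: "k < q" by simp
    have "cmod ((\<kappa> - x k) / of_real (1 + h k)) = \<eta> k Q / (1 + h k)"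
      unfolding norm_divide norm_of_real using h(1)[OF k]
      by (simp add: \<eta>_def x_def \<kappa>_def norm_minus_commute)
    also have "\<dots> \<le> \<eta> k Q"
      using h(1)[OF k] \<eta>_nonneg[of k Q] by (simp add: divide_le_eq mult_le_cancel_left1)
    finally have 1: "cmod ((\<kappa> - x k) / of_real (1 + h k)) \<le> \<eta> k Q" .
    have "\<bar>\<alpha> - 1 / (1 + h k)\<bar> \<le> \<eta> k idm"
      unfolding \<alpha>_def using abs_diff_inverse_one_plus_le[OF g(2) h(1)[OF k]] h(4)[OF k] by simp
    then have 2: "cmod (\<kappa> * of_real (\<alpha> - 1 / (1 + h k))) \<le> 2 / (a * v) * \<eta> k idm"
      unfolding norm_mult norm_of_real using \<kappa>_le(2) a v by (intro mult_mono) auto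
    show "cmod ((\<kappa> - x k) / of_real (1 + h k) + \<kappa> * of_real (\<alpha> - 1 / (1 + h k))) \<le> \<eta> k Q + 2 / (a * v) * \<eta> k idm"
      using norm_triangle_le[OF add_mono[OF 1 2]] .
  qed
  finally have *: "cmod (ctrace n R - ctrace n Q)
      \<le> \<bar>a - \<alpha>\<bar> * (sqn / v\<^sup>2) + ((\<Sum>k<q. \<eta> k Q) + 2 / (a * v) * (\<Sum>k<q. \<eta> k idm))"
    by (simp add: sum.distrib sum_distrib_left)
  have "Tres n v (gram {..<q} r) - Tres n (v / a) D = v / n * Re (ctrace n Q - ctrace n R)"
    unfolding Tres_scale[OF hpsd_gram v a(1), symmetric] by (simp add: Tres_def right_diff_distrib)
  then have "\<bar>Tres n v (gram {..<q} r) - Tres n (v / a) D\<bar> \<le> v / n * cmod (ctrace n R - ctrace n Q)"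
    using v abs_Re_le_cmod[of "ctrace n Q - ctrace n R"]
    by (simp add: abs_mult norm_minus_commute mult_left_mono divide_right_mono)
  also have "\<dots> \<le> v / n * (\<bar>a - \<alpha>\<bar> * (sqn / v\<^sup>2) + ((\<Sum>k<q. \<eta> k Q) + 2 / (a * v) * (\<Sum>k<q. \<eta> k idm)))"
    using v * by (intro mult_left_mono) auto
  also have "\<dots> = \<bar>a - \<alpha>\<bar> * (sqn / n) / v + v / n * (\<Sum>k<q. \<eta> k Q) + 2 / a * (\<Sum>k<q. \<eta> k idm) / n"
    using v a n by (simp add: field_simps power2_eq_square)
  finally show ?thesis .
qed

end

end

subsection \<open>Truncation and quadratic forms in independent variables\<close>

lemma cnj_borel_measurable [measurable]: "cnj \<in> borel_measurable borel"
  by (intro borel_measurable_continuous_onI continuous_intros)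

lemma measurable_component_compose:
  assumes "i \<in> I" "f \<in> borel_measurable N"
  shows "(\<lambda>y. f (y i)) \<in> borel_measurable (PiM I (\<lambda>_. N))"
  by (rule measurable_compose[OF measurable_component_singleton[OF assms(1)] assms(2)])

context prob_space
begin

text \<open>The entries are indexed by triples; this brings one column, or two columns laid end to
  end, into the form of a family on an initial segment.\<close>

lemma indep_vars_reindex:
  assumes inj: "inj_on h J" and ind: "indep_vars (\<lambda>_. N) X (h ` J)"
  shows "indep_vars (\<lambda>_. N) (\<lambda>i. X (h i)) J"
  unfolding indep_vars_def2
proof
  show "\<forall>i\<in>J. random_variable N (X (h i))"
    using ind unfolding indep_vars_def2 by auto
  define F where "F = (\<lambda>i. {X i -` A \<inter> space M |A. A \<in> sets N})"
  have F: "indep_sets F (h ` J)"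
    using ind unfolding indep_vars_def2 F_def by simp
  show "indep_sets (\<lambda>i. {X (h i) -` A \<inter> space M |A. A \<in> sets N}) J"
  proof (rule indep_setsI)
    fix i assume "i \<in> J"
    then show "{X (h i) -` A \<inter> space M |A. A \<in> sets N} \<subseteq> events"
      using F unfolding indep_sets_def F_def by blast
  next
    fix A K assume K: "K \<noteq> {}" "K \<subseteq> J" "finite K"
      and A: "\<forall>j\<in>K. A j \<in> {X (h j) -` A \<inter> space M |A. A \<in> sets N}"
    define A' where "A' = (\<lambda>x. A (the_inv_into K h x))"
    have injK: "inj_on h K" using inj K(2) by (rule inj_on_subset)
    have A': "A' (h j) = A j" if "j \<in> K" for j
      unfolding A'_def using the_inv_into_f_f[OF injK that] by simp
    have "prob (\<Inter>x\<in>h ` K. A' x) = (\<Prod>x\<in>h ` K. prob (A' x))"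
    proof (rule indep_setsD[OF F])
      show "\<forall>j\<in>h ` K. A' j \<in> F j"
        using A A' unfolding F_def by auto
    qed (use K in auto)
    then show "prob (\<Inter>j\<in>K. A j) = (\<Prod>j\<in>K. prob (A j))"
      using A' by (simp add: prod.reindex[OF injK] image_image)
  qed
qed

text \<open>Conditioning in elementary form: the joint law of independent \<open>A\<close> and
  \<open>B\<close> is a product, so \<open>B\<close> may be given its own integration variable. As
  \<open>F\<close> is nonnegative, no integrability has to be supplied.\<close>

lemma nn_integral_decouple:
  assumes ind: "indep_var S A T B" and F: "F \<in> borel_measurable (S \<Otimes>\<^sub>M T)"
  shows "(\<integral>\<^sup>+\<omega>. F (A \<omega>, B \<omega>) \<partial>M) = (\<integral>\<^sup>+\<omega>. \<integral>\<^sup>+\<omega>'. F (A \<omega>, B \<omega>') \<partial>M \<partial>M)"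
proof -
  have A[measurable]: "A \<in> measurable M S" and B[measurable]: "B \<in> measurable M T"
    and eq: "distr M S A \<Otimes>\<^sub>M distr M T B = distr M (S \<Otimes>\<^sub>M T) (\<lambda>x. (A x, B x))"
    using ind unfolding indep_var_distribution_eq by auto
  interpret T: prob_space "distr M T B" by (rule prob_space_distr[OF B])
  note F[measurable]
  have "(\<integral>\<^sup>+\<omega>. F (A \<omega>, B \<omega>) \<partial>M) = (\<integral>\<^sup>+z. F z \<partial>distr M (S \<Otimes>\<^sub>M T) (\<lambda>x. (A x, B x)))"
    by (subst nn_integral_distr) auto
  also have "\<dots> = (\<integral>\<^sup>+x. \<integral>\<^sup>+y. F (x, y) \<partial>distr M T B \<partial>distr M S A)"
    unfolding eq[symmetric] by (subst T.nn_integral_fst[symmetric]) (auto cong: measurable_cong_sets)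
  also have "\<dots> = (\<integral>\<^sup>+x. \<integral>\<^sup>+\<omega>'. F (x, B \<omega>') \<partial>M \<partial>distr M S A)"
  proof (rule nn_integral_cong)
    fix x assume "x \<in> space (distr M S A)"
    then have [measurable]: "(\<lambda>y. F (x, y)) \<in> borel_measurable T"
      by (intro measurable_compose[OF measurable_Pair1' F]) simp
    show "(\<integral>\<^sup>+y. F (x, y) \<partial>distr M T B) = (\<integral>\<^sup>+\<omega>'. F (x, B \<omega>') \<partial>M)"
      by (subst nn_integral_distr) auto
  qed
  also have "\<dots> = (\<integral>\<^sup>+\<omega>. \<integral>\<^sup>+\<omega>'. F (A \<omega>, B \<omega>') \<partial>M \<partial>M)"
    by (subst nn_integral_distr) auto
  finally show ?thesis .
qed

lemma nn_integral_norm_le_sqrt: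
  fixes f :: "'a \<Rightarrow> complex"
  assumes [measurable]: "f \<in> borel_measurable M" and "(\<integral>\<^sup>+\<omega>. ennreal ((cmod (f \<omega>))\<^sup>2) \<partial>M) \<le> ennreal (B\<^sup>2)" and B: "0 \<le> B"
  shows "(\<integral>\<^sup>+\<omega>. ennreal (cmod (f \<omega>)) \<partial>M) \<le> ennreal B"
proof -
  have "(\<integral>\<^sup>+\<omega>. ennreal (cmod (f \<omega>)) * 1 \<partial>M)\<^sup>2 \<le> (\<integral>\<^sup>+\<omega>. (ennreal (cmod (f \<omega>)))\<^sup>2 \<partial>M) * (\<integral>\<^sup>+\<omega>. 1\<^sup>2 \<partial>M)"
    by (rule Cauchy_Schwarz_nn_integral) auto
  also have "\<dots> = (\<integral>\<^sup>+\<omega>. ennreal ((cmod (f \<omega>))\<^sup>2) \<partial>M)"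
    by (simp add: emeasure_space_1 ennreal_power)
  also have "\<dots> \<le> (ennreal B)\<^sup>2" using assms by (simp add: ennreal_power)
  finally have *: "(\<integral>\<^sup>+\<omega>. ennreal (cmod (f \<omega>)) \<partial>M)\<^sup>2 \<le> (ennreal B)\<^sup>2" by simp
  show ?thesis
  proof (cases "\<integral>\<^sup>+\<omega>. ennreal (cmod (f \<omega>)) \<partial>M")
    case (real r)
    then have "r\<^sup>2 \<le> B\<^sup>2" using * B by (simp add: ennreal_power)
    then show ?thesis unfolding real using B by (intro ennreal_leI power2_le_imp_le[of r])
  next
    case top
    then show ?thesis using * B by (simp add: power2_eq_square top_unique ennreal_mult[symmetric])
  qed
qed

text \<open>The mixed term is linear in \<open>x\<close> and has mean zero. Only an upper bound
  \<open>\<sigma>\<close> on the second moment is asked for, so that centred truncated variables fit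
  as well.\<close>

lemma nn_integral_affine_square:
  fixes x :: "'a \<Rightarrow> complex"
  assumes x: "integrable M x" "expectation x = 0" "integrable M (\<lambda>\<omega>. (cmod (x \<omega>))\<^sup>2)"
    and \<sigma>: "expectation (\<lambda>\<omega>. (cmod (x \<omega>))\<^sup>2) \<le> \<sigma>"
  shows "(\<integral>\<^sup>+\<omega>. ennreal ((cmod (z + s * x \<omega>))\<^sup>2) \<partial>M) \<le> ennreal ((cmod z)\<^sup>2) + ennreal \<sigma> * ennreal ((cmod s)\<^sup>2)"
proof -
  have eq: "(cmod (z + s * x \<omega>))\<^sup>2 = (cmod z)\<^sup>2 + 2 * Re (cnj z * s * x \<omega>) + (cmod s)\<^sup>2 * (cmod (x \<omega>))\<^sup>2" for \<omega>
    unfolding cmod_power2 by (simp add: power2_eq_square algebra_simps)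
  have i1: "integrable M (\<lambda>\<omega>. Re (cnj z * s * x \<omega>))"
    using x(1) by (intro integrable_Re integrable_mult_right)
  have "expectation (\<lambda>\<omega>. cnj z * s * x \<omega>) = 0"
    using x(1,2) by (subst integral_mult_right_zero) simp
  then have e1: "expectation (\<lambda>\<omega>. Re (cnj z * s * x \<omega>)) = 0"
    using x(1) by (subst integral_Re) auto
  have int: "integrable M (\<lambda>\<omega>. (cmod (z + s * x \<omega>))\<^sup>2)"
    unfolding eq using i1 x(3) by (intro Bochner_Integration.integrable_add integrable_mult_right integrable_const) auto
  have "expectation (\<lambda>\<omega>. (cmod (z + s * x \<omega>))\<^sup>2) = (cmod z)\<^sup>2 + (cmod s)\<^sup>2 * expectation (\<lambda>\<omega>. (cmod (x \<omega>))\<^sup>2)"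
  proof -
    define f where "f \<omega> = Re (cnj z * s * x \<omega>)" for \<omega>
    have "integrable M f" "expectation f = 0" using i1 e1 unfolding f_def by auto
    then show ?thesis
      unfolding eq f_def[symmetric] using x(3) by (simp add: prob_space)
  qed
  also have "\<dots> \<le> (cmod z)\<^sup>2 + (cmod s)\<^sup>2 * \<sigma>"
    using \<sigma> by (intro add_left_mono mult_left_mono) auto
  finally have le: "expectation (\<lambda>\<omega>. (cmod (z + s * x \<omega>))\<^sup>2) \<le> (cmod z)\<^sup>2 + \<sigma> * (cmod s)\<^sup>2" by (simp add: mult.commute)
  have "0 \<le> expectation (\<lambda>\<omega>. (cmod (x \<omega>))\<^sup>2)" by simp
  with \<sigma> have "0 \<le> \<sigma>" by linarith
  have "(\<integral>\<^sup>+\<omega>. ennreal ((cmod (z + s * x \<omega>))\<^sup>2) \<partial>M) = ennreal (expectation (\<lambda>\<omega>. (cmod (z + s * x \<omega>))\<^sup>2))"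
    using int by (intro nn_integral_eq_integral) auto
  also have "\<dots> \<le> ennreal ((cmod z)\<^sup>2 + \<sigma> * (cmod s)\<^sup>2)" using le by (rule ennreal_leI)
  finally show ?thesis using \<open>0 \<le> \<sigma>\<close> by (simp add: ennreal_mult ennreal_plus)
qed

lemma orthogonal_step:
  fixes x :: "'b \<Rightarrow> complex"
  assumes ind: "indep_var N A T B"
    and [measurable]: "Z \<in> borel_measurable N" "S \<in> borel_measurable N" "x \<in> borel_measurable T"
    and x: "integrable M (\<lambda>\<omega>. x (B \<omega>))" "expectation (\<lambda>\<omega>. x (B \<omega>)) = 0"
      "integrable M (\<lambda>\<omega>. (cmod (x (B \<omega>)))\<^sup>2)"
    and \<sigma>: "expectation (\<lambda>\<omega>. (cmod (x (B \<omega>)))\<^sup>2) \<le> \<sigma>"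
  shows "(\<integral>\<^sup>+\<omega>. ennreal ((cmod (Z (A \<omega>) + S (A \<omega>) * x (B \<omega>)))\<^sup>2) \<partial>M)
    \<le> (\<integral>\<^sup>+\<omega>. ennreal ((cmod (Z (A \<omega>)))\<^sup>2) \<partial>M) + ennreal \<sigma> * (\<integral>\<^sup>+\<omega>. ennreal ((cmod (S (A \<omega>)))\<^sup>2) \<partial>M)"
proof -
  have [measurable]: "A \<in> measurable M N"
    using ind by (rule indep_var_rv1)
  let ?F = "\<lambda>(a, y). ennreal ((cmod (Z a + S a * x y))\<^sup>2)"
  have F: "?F \<in> borel_measurable (N \<Otimes>\<^sub>M T)" by measurable
  have "(\<integral>\<^sup>+\<omega>. ennreal ((cmod (Z (A \<omega>) + S (A \<omega>) * x (B \<omega>)))\<^sup>2) \<partial>M)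
      = (\<integral>\<^sup>+\<omega>. \<integral>\<^sup>+\<omega>'. ennreal ((cmod (Z (A \<omega>) + S (A \<omega>) * x (B \<omega>')))\<^sup>2) \<partial>M \<partial>M)"
    using nn_integral_decouple[OF ind F] by simp
  also have "\<dots> \<le> (\<integral>\<^sup>+\<omega>. ennreal ((cmod (Z (A \<omega>)))\<^sup>2) + ennreal \<sigma> * ennreal ((cmod (S (A \<omega>)))\<^sup>2) \<partial>M)"
    by (intro nn_integral_mono nn_integral_affine_square x \<sigma>)
  also have "\<dots> = (\<integral>\<^sup>+\<omega>. ennreal ((cmod (Z (A \<omega>)))\<^sup>2) \<partial>M) + ennreal \<sigma> * (\<integral>\<^sup>+\<omega>. ennreal ((cmod (S (A \<omega>)))\<^sup>2) \<partial>M)"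
    by (subst nn_integral_add) (auto simp: nn_integral_cmult)
  finally show ?thesis .
qed

text \<open>Martingale differences are orthogonal: \<open>s j\<close> looks only at the variables
  before \<open>j\<close>, so each new term adds at most its own second moment. Invariance under
  \<open>restrict\<close> expresses this dependence for a function of a whole sequence;
  \<open>t\<close> covers the identity, conjugation and the centred truncated squares.\<close>

lemma orthogonal_sum:
  fixes Y :: "nat \<Rightarrow> 'a \<Rightarrow> complex" and t :: "nat \<Rightarrow> complex \<Rightarrow> complex"
    and s :: "nat \<Rightarrow> (nat \<Rightarrow> complex) \<Rightarrow> complex"
  assumes ind: "indep_vars (\<lambda>_. borel) Y {..<p}"
    and t: "\<And>j. j < p \<Longrightarrow> t j \<in> borel_measurable borel"
      "\<And>j. j < p \<Longrightarrow> integrable M (\<lambda>\<omega>. t j (Y j \<omega>))"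
      "\<And>j. j < p \<Longrightarrow> expectation (\<lambda>\<omega>. t j (Y j \<omega>)) = 0"
      "\<And>j. j < p \<Longrightarrow> integrable M (\<lambda>\<omega>. (cmod (t j (Y j \<omega>)))\<^sup>2)"
      "\<And>j. j < p \<Longrightarrow> expectation (\<lambda>\<omega>. (cmod (t j (Y j \<omega>)))\<^sup>2) \<le> \<sigma>"
    and s: "\<And>j. j < p \<Longrightarrow> s j \<in> borel_measurable (PiM {..<j} (\<lambda>_. borel))"
      "\<And>j y. j < p \<Longrightarrow> s j (restrict y {..<j}) = s j y"
  shows "(\<integral>\<^sup>+\<omega>. ennreal ((cmod (\<Sum>j<p. s j (\<lambda>i. Y i \<omega>) * t j (Y j \<omega>)))\<^sup>2) \<partial>M)
    \<le> ennreal \<sigma> * (\<Sum>j<p. \<integral>\<^sup>+\<omega>. ennreal ((cmod (s j (\<lambda>i. Y i \<omega>)))\<^sup>2) \<partial>M)"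
  using assms
proof (induction p)
  case 0
  then show ?case by simp
next
  case (Suc p)
  let ?N = "PiM {..<p} (\<lambda>_. borel :: complex measure)"
  define A where "A \<omega> = (\<lambda>i\<in>{..<p}. Y i \<omega>)" for \<omega>
  define Z where "Z y = (\<Sum>j<p. s j y * t j (y j))" for y
  define B where "B \<omega> = (\<lambda>i\<in>{p}. Y i \<omega>)" for \<omega>
  have ind: "indep_var ?N A (PiM {p} (\<lambda>_. borel)) B"
    unfolding A_def B_def by (rule indep_var_restrict[OF Suc.prems(1)]) auto
  have mt: "(\<lambda>y. t p (y p)) \<in> borel_measurable (PiM {p} (\<lambda>_. borel))"
    by (rule measurable_component_compose[OF _ Suc.prems(2)]) auto
  have tB: "t p (B \<omega> p) = t p (Y p \<omega>)" for \<omega> by (simp add: B_def)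
  have sA: "s j (A \<omega>) = s j (\<lambda>i. Y i \<omega>)" if "j \<le> p" for j \<omega>
  proof -
    have "restrict (A \<omega>) {..<j} = restrict (\<lambda>i. Y i \<omega>) {..<j}"
      using that by (auto simp: A_def restrict_def)
    then show ?thesis
      using Suc.prems(8)[of j "A \<omega>"] Suc.prems(8)[of j "\<lambda>i. Y i \<omega>"] that by simp
  qed
  have ms: "s j \<in> borel_measurable ?N" if "j \<le> p" for j
  proof -
    have "(\<lambda>y. s j (restrict y {..<j})) \<in> borel_measurable ?N"
      using that by (intro measurable_compose[OF measurable_restrict_subset Suc.prems(7)]) auto
    then show ?thesis using Suc.prems(8)[of j] that by simp
  qed
  have Z: "Z \<in> borel_measurable ?N"
    unfolding Z_def
  proof (rule borel_measurable_sum)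
    fix j assume j: "j \<in> {..<p}"
    have "(\<lambda>y. t j (y j)) \<in> borel_measurable ?N"
      by (rule measurable_component_compose[OF j Suc.prems(2)]) (use j in simp)
    moreover have "s j \<in> borel_measurable ?N" using ms[of j] j by simp
    ultimately show "(\<lambda>y. s j y * t j (y j)) \<in> borel_measurable ?N"
      by (intro borel_measurable_times)
  qed
  have ZA: "Z (A \<omega>) = (\<Sum>j<p. s j (\<lambda>i. Y i \<omega>) * t j (Y j \<omega>))" for \<omega>
    unfolding Z_def by (intro sum.cong refl) (auto simp: sA, simp add: A_def)
  have "(\<integral>\<^sup>+\<omega>. ennreal ((cmod (\<Sum>j<Suc p. s j (\<lambda>i. Y i \<omega>) * t j (Y j \<omega>)))\<^sup>2) \<partial>M)
     = (\<integral>\<^sup>+\<omega>. ennreal ((cmod (Z (A \<omega>) + s p (A \<omega>) * t p (B \<omega> p)))\<^sup>2) \<partial>M)"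
    by (simp add: ZA sA tB)
  also have "\<dots> \<le> (\<integral>\<^sup>+\<omega>. ennreal ((cmod (Z (A \<omega>)))\<^sup>2) \<partial>M) + ennreal \<sigma> * (\<integral>\<^sup>+\<omega>. ennreal ((cmod (s p (A \<omega>)))\<^sup>2) \<partial>M)"
    by (rule orthogonal_step[OF ind Z ms mt]) (use Suc.prems in \<open>auto simp: tB\<close>)
  also have "\<dots> \<le> ennreal \<sigma> * (\<Sum>j<p. \<integral>\<^sup>+\<omega>. ennreal ((cmod (s j (\<lambda>i. Y i \<omega>)))\<^sup>2) \<partial>M)
      + ennreal \<sigma> * (\<integral>\<^sup>+\<omega>. ennreal ((cmod (s p (\<lambda>i. Y i \<omega>)))\<^sup>2) \<partial>M)"
    unfolding ZA sA[OF order_refl]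
    by (intro add_right_mono Suc.IH indep_vars_subset[OF Suc.prems(1)]) (use Suc.prems in auto)
  finally show ?case by (simp add: distrib_left)
qed

lemma linear_form_square:
  fixes Y :: "nat \<Rightarrow> 'a \<Rightarrow> complex"
  assumes ind: "indep_vars (\<lambda>_. borel) Y {..<p}"
    and Y: "\<And>j. j < p \<Longrightarrow> integrable M (Y j)" "\<And>j. j < p \<Longrightarrow> expectation (Y j) = 0"
      "\<And>j. j < p \<Longrightarrow> integrable M (\<lambda>\<omega>. (cmod (Y j \<omega>))\<^sup>2)"
      "\<And>j. j < p \<Longrightarrow> expectation (\<lambda>\<omega>. (cmod (Y j \<omega>))\<^sup>2) = 1"
    and J: "J \<subseteq> {..<p}"
  shows "(\<integral>\<^sup>+\<omega>. ennreal ((cmod (\<Sum>j\<in>J. c j * cnj (Y j \<omega>)))\<^sup>2) \<partial>M) \<le> ennreal (\<Sum>j\<in>J. (cmod (c j))\<^sup>2)"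
    and "(\<integral>\<^sup>+\<omega>. ennreal ((cmod (\<Sum>j\<in>J. c j * Y j \<omega>))\<^sup>2) \<partial>M) \<le> ennreal (\<Sum>j\<in>J. (cmod (c j))\<^sup>2)"
proof -
  define c' where "c' j = (if j \<in> J then c j else 0)" for j
  have sumJ: "(\<Sum>j\<in>J. c j * x j) = (\<Sum>j<p. c' j * x j)" for x :: "nat \<Rightarrow> complex"
    unfolding c'_def using J by (auto intro!: sum.mono_neutral_cong_left)
  have *: "ennreal 1 * (\<Sum>j<p. \<integral>\<^sup>+\<omega>. ennreal ((cmod (c' j))\<^sup>2) \<partial>M) = ennreal (\<Sum>j\<in>J. (cmod (c j))\<^sup>2)"
  proof -
    have "(\<Sum>j\<in>J. (cmod (c j))\<^sup>2) = (\<Sum>j<p. (cmod (c' j))\<^sup>2)"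
      unfolding c'_def using J by (auto intro!: sum.mono_neutral_cong_left)
    then show ?thesis by (simp add: emeasure_space_1)
  qed
  show "(\<integral>\<^sup>+\<omega>. ennreal ((cmod (\<Sum>j\<in>J. c j * cnj (Y j \<omega>)))\<^sup>2) \<partial>M) \<le> ennreal (\<Sum>j\<in>J. (cmod (c j))\<^sup>2)"
    unfolding sumJ *[symmetric]
    by (rule orthogonal_sum[OF ind, where t = "\<lambda>_. cnj" and s = "\<lambda>j _. c' j"]) (use Y in \<open>auto intro: cnj_borel_measurable\<close>)
  show "(\<integral>\<^sup>+\<omega>. ennreal ((cmod (\<Sum>j\<in>J. c j * Y j \<omega>))\<^sup>2) \<partial>M) \<le> ennreal (\<Sum>j\<in>J. (cmod (c j))\<^sup>2)"
    unfolding sumJ *[symmetric]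
    by (rule orthogonal_sum[OF ind, where t = "\<lambda>_ y. y" and s = "\<lambda>j _. c' j"]) (use Y in \<open>auto intro: cnj_borel_measurable\<close>)
qed

text \<open>Orthogonality is used twice: in \<open>j\<close>, with the inner sums as coefficients
  that depend on the past, and inside these sums by \<open>linear_form_square\<close>. The
  \<open>J j\<close> are arbitrary subsets of the earlier indices because products of two different
  columns call for a bipartite pattern.\<close>

lemma bilinear_form_square:
  fixes Y :: "nat \<Rightarrow> 'a \<Rightarrow> complex"
  assumes ind: "indep_vars (\<lambda>_. borel) Y {..<p}"
    and Y: "\<And>j. j < p \<Longrightarrow> integrable M (Y j)" "\<And>j. j < p \<Longrightarrow> expectation (Y j) = 0"
      "\<And>j. j < p \<Longrightarrow> integrable M (\<lambda>\<omega>. (cmod (Y j \<omega>))\<^sup>2)"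
      "\<And>j. j < p \<Longrightarrow> expectation (\<lambda>\<omega>. (cmod (Y j \<omega>))\<^sup>2) = 1"
    and J: "\<And>j. j < p \<Longrightarrow> J j \<subseteq> {..<j}"
  shows "(\<integral>\<^sup>+\<omega>. ennreal ((cmod (\<Sum>j<p. \<Sum>i\<in>J j. cnj (Y i \<omega>) * G i j * Y j \<omega>))\<^sup>2) \<partial>M)
    \<le> ennreal (\<Sum>j<p. \<Sum>i\<in>J j. (cmod (G i j))\<^sup>2)" (is "?l \<le> _")
    and "(\<integral>\<^sup>+\<omega>. ennreal ((cmod (\<Sum>j<p. \<Sum>i\<in>J j. cnj (Y j \<omega>) * G j i * Y i \<omega>))\<^sup>2) \<partial>M)
    \<le> ennreal (\<Sum>j<p. \<Sum>i\<in>J j. (cmod (G j i))\<^sup>2)" (is "?l' \<le> _")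
proof -
  define s where "s j y = (\<Sum>i\<in>J j. G i j * cnj (y i))" for j and y :: "nat \<Rightarrow> complex"
  define s' where "s' j y = (\<Sum>i\<in>J j. G j i * y i)" for j and y :: "nat \<Rightarrow> complex"
  have fin: "finite (J j)" if "j < p" for j using finite_subset[OF J[OF that]] by simp
  have [simp]: "s j (restrict y {..<j}) = s j y" "s' j (restrict y {..<j}) = s' j y" if "j < p" for j y
    unfolding s_def s'_def using J[OF that] by (auto intro!: sum.cong)
  have m: "s j \<in> borel_measurable (PiM {..<j} (\<lambda>_. borel))" "s' j \<in> borel_measurable (PiM {..<j} (\<lambda>_. borel))" if "j < p" for j
    unfolding s_def s'_def using J[OF that]
    by (intro borel_measurable_sum borel_measurable_times borel_measurable_const
        measurable_component_compose[OF _ cnj_borel_measurable] measurable_component_singleton; auto)+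
  have mY: "Y j \<in> borel_measurable M" if "j < p" for j using Y(1)[OF that] by auto
  have "?l = (\<integral>\<^sup>+\<omega>. ennreal ((cmod (\<Sum>j<p. s j (\<lambda>i. Y i \<omega>) * Y j \<omega>))\<^sup>2) \<partial>M)"
    unfolding s_def by (simp add: sum_distrib_left sum_distrib_right mult_ac)
  also have "\<dots> \<le> ennreal 1 * (\<Sum>j<p. \<integral>\<^sup>+\<omega>. ennreal ((cmod (s j (\<lambda>i. Y i \<omega>)))\<^sup>2) \<partial>M)"
    by (rule orthogonal_sum[OF ind, where t = "\<lambda>_ y. y" and s = s]) (use Y m in auto)
  also have "\<dots> \<le> (\<Sum>j<p. ennreal (\<Sum>i\<in>J j. (cmod (G i j))\<^sup>2))"
  proof (simp, intro sum_mono)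
    fix j assume "j \<in> {..<p}"
    then have j: "j < p" by simp
    have Jj: "J j \<subseteq> {..<p}" using J[OF j] j by auto
    show "(\<integral>\<^sup>+\<omega>. ennreal ((cmod (s j (\<lambda>i. Y i \<omega>)))\<^sup>2) \<partial>M) \<le> ennreal (\<Sum>i\<in>J j. (cmod (G i j))\<^sup>2)"
      unfolding s_def by (rule linear_form_square(1)[OF ind]) (use Y Jj in auto)
  qed
  finally show "?l \<le> ennreal (\<Sum>j<p. \<Sum>i\<in>J j. (cmod (G i j))\<^sup>2)" by (simp add: sum_nonneg)
  have "?l' = (\<integral>\<^sup>+\<omega>. ennreal ((cmod (\<Sum>j<p. s' j (\<lambda>i. Y i \<omega>) * cnj (Y j \<omega>)))\<^sup>2) \<partial>M)"
    unfolding s'_def by (simp add: sum_distrib_left sum_distrib_right mult_ac)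
  also have "\<dots> \<le> ennreal 1 * (\<Sum>j<p. \<integral>\<^sup>+\<omega>. ennreal ((cmod (s' j (\<lambda>i. Y i \<omega>)))\<^sup>2) \<partial>M)"
    by (rule orthogonal_sum[OF ind, where t = "\<lambda>_. cnj" and s = s']) (use Y m in auto)
  also have "\<dots> \<le> (\<Sum>j<p. ennreal (\<Sum>i\<in>J j. (cmod (G j i))\<^sup>2))"
  proof (simp, intro sum_mono)
    fix j assume "j \<in> {..<p}"
    then have j: "j < p" by simp
    have Jj: "J j \<subseteq> {..<p}" using J[OF j] j by auto
    show "(\<integral>\<^sup>+\<omega>. ennreal ((cmod (s' j (\<lambda>i. Y i \<omega>)))\<^sup>2) \<partial>M) \<le> ennreal (\<Sum>i\<in>J j. (cmod (G j i))\<^sup>2)"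
      unfolding s'_def by (rule linear_form_square(2)[OF ind]) (use Y Jj in auto)
  qed
  finally show "?l' \<le> ennreal (\<Sum>j<p. \<Sum>i\<in>J j. (cmod (G j i))\<^sup>2)" by (simp add: sum_nonneg)
qed

text \<open>No fourth moment is available, but after truncation the square of \<open>\<xi> j\<close>
  is at most \<open>\<theta>\<^sup>2\<close> times the squared modulus of \<open>Y j\<close>, so
  each variance is at most \<open>\<theta>\<^sup>2\<close>.\<close>

lemma truncated_diagonal:
  fixes Y :: "nat \<Rightarrow> 'a \<Rightarrow> complex" and c :: "nat \<Rightarrow> complex"
  assumes ind: "indep_vars (\<lambda>_. borel) Y {..<p}"
    and Y: "\<And>j. j < p \<Longrightarrow> integrable M (\<lambda>\<omega>. (cmod (Y j \<omega>))\<^sup>2)"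
      "\<And>j. j < p \<Longrightarrow> expectation (\<lambda>\<omega>. (cmod (Y j \<omega>))\<^sup>2) = 1"
    and \<theta>: "0 \<le> \<theta>" and b: "0 \<le> b" "\<And>j. j < p \<Longrightarrow> cmod (c j) \<le> b"
  defines "\<xi> \<equiv> (\<lambda>j \<omega>. (cmod (Y j \<omega>))\<^sup>2 * indicator {\<omega>. cmod (Y j \<omega>) < \<theta>} \<omega>)"
  shows "(\<integral>\<^sup>+\<omega>. ennreal (cmod (\<Sum>j<p. c j * of_real (\<xi> j \<omega> - expectation (\<xi> j)))) \<partial>M) \<le> ennreal (b * \<theta> * sqrt p)"
proof (rule nn_integral_norm_le_sqrt)
  have mY[measurable]: "Y j \<in> borel_measurable M" if "j < p" for j
    using ind that unfolding indep_vars_def2 by auto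
  have m\<xi>: "\<xi> j \<in> borel_measurable M" if "j < p" for j
    unfolding \<xi>_def using mY[OF that] by measurable
  then show "(\<lambda>\<omega>. \<Sum>j<p. c j * of_real (\<xi> j \<omega> - expectation (\<xi> j))) \<in> borel_measurable M" by simp
  show "0 \<le> b * \<theta> * sqrt p" using b \<theta> by simp
  have \<xi>: "0 \<le> \<xi> j \<omega>" "\<xi> j \<omega> \<le> (cmod (Y j \<omega>))\<^sup>2" "\<xi> j \<omega> \<le> \<theta>\<^sup>2" for j \<omega>
    unfolding \<xi>_def by (auto simp: indicator_def intro: power_mono)
  have int\<xi>: "integrable M (\<xi> j)" if "j < p" for j
    by (rule integrable_const_bound[where B = "\<theta>\<^sup>2"]) (use \<xi> m\<xi>[OF that] in auto)
  have int\<xi>2: "integrable M (\<lambda>\<omega>. (\<xi> j \<omega>)\<^sup>2)" if "j < p" for j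
  proof (rule integrable_const_bound[where B = "(\<theta>\<^sup>2)\<^sup>2"])
    have "(\<xi> j \<omega>)\<^sup>2 \<le> (\<theta>\<^sup>2)\<^sup>2" for \<omega> by (intro power_mono \<xi>)
    then show "AE \<omega> in M. norm ((\<xi> j \<omega>)\<^sup>2) \<le> (\<theta>\<^sup>2)\<^sup>2" by (simp only: real_norm_def abs_power2) simp
    show "(\<lambda>\<omega>. (\<xi> j \<omega>)\<^sup>2) \<in> borel_measurable M" using m\<xi>[OF that] by simp
  qed
  define e where "e j = expectation (\<xi> j)" for j
  have int: "integrable M (\<lambda>\<omega>. (\<xi> j \<omega> - e j)\<^sup>2)" if "j < p" for j
    unfolding power2_diff using int\<xi>[OF that] int\<xi>2[OF that]
    by (intro Bochner_Integration.integrable_diff Bochner_Integration.integrable_add integrable_const integrable_mult_left integrable_mult_right) auto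
  have var: "expectation (\<lambda>\<omega>. (\<xi> j \<omega> - e j)\<^sup>2) \<le> \<theta>\<^sup>2" if "j < p" for j
  proof -
    have "expectation (\<lambda>\<omega>. (\<xi> j \<omega> - e j)\<^sup>2) = expectation (\<lambda>\<omega>. (\<xi> j \<omega>)\<^sup>2) - (e j)\<^sup>2"
      unfolding e_def using int\<xi>[OF that] int\<xi>2[OF that] by (rule variance_eq)
    also have "\<dots> \<le> expectation (\<lambda>\<omega>. (\<xi> j \<omega>)\<^sup>2)" by simp
    also have "\<dots> \<le> expectation (\<lambda>\<omega>. \<theta>\<^sup>2 * (cmod (Y j \<omega>))\<^sup>2)"
      using int\<xi>2[OF that] Y(1)[OF that] \<xi>[of j]
      by (intro integral_mono integrable_mult_right) (auto simp: power2_eq_square[of "\<xi> j _"] intro!: mult_mono)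
    also have "\<dots> = \<theta>\<^sup>2" using Y(2)[OF that] by simp
    finally show ?thesis .
  qed
  define t where "t j y = complex_of_real ((cmod y)\<^sup>2 * indicator {y. cmod y < \<theta>} y - e j)" for j y
  have tY: "t j (Y j \<omega>) = of_real (\<xi> j \<omega> - e j)" for j \<omega>
    unfolding t_def \<xi>_def by (simp add: indicator_def)
  have t: "t j \<in> borel_measurable borel" for j unfolding t_def by measurable
  have "(\<integral>\<^sup>+\<omega>. ennreal ((cmod (\<Sum>j<p. c j * of_real (\<xi> j \<omega> - expectation (\<xi> j))))\<^sup>2) \<partial>M)
      = (\<integral>\<^sup>+\<omega>. ennreal ((cmod (\<Sum>j<p. c j * t j (Y j \<omega>)))\<^sup>2) \<partial>M)"
    unfolding tY e_def ..
  also have "\<dots> \<le> ennreal (\<theta>\<^sup>2) * (\<Sum>j<p. \<integral>\<^sup>+\<omega>. ennreal ((cmod (c j))\<^sup>2) \<partial>M)"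
  proof (rule orthogonal_sum[OF ind, where s = "\<lambda>j _. c j"])
    fix j assume j: "j < p"
    show "integrable M (\<lambda>\<omega>. t j (Y j \<omega>))" unfolding tY using int\<xi>[OF j] by simp
    show "expectation (\<lambda>\<omega>. t j (Y j \<omega>)) = 0"
      unfolding tY integral_complex_of_real using int\<xi>[OF j] by (simp add: e_def prob_space)
    show "integrable M (\<lambda>\<omega>. (cmod (t j (Y j \<omega>)))\<^sup>2)" unfolding tY norm_of_real power2_abs by (rule int[OF j])
    show "expectation (\<lambda>\<omega>. (cmod (t j (Y j \<omega>)))\<^sup>2) \<le> \<theta>\<^sup>2" unfolding tY norm_of_real power2_abs by (rule var[OF j])
  qed (use t in auto)
  also have "\<dots> \<le> ennreal (\<theta>\<^sup>2) * (\<Sum>j<p. ennreal (b\<^sup>2))"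
    using b by (intro mult_left_mono sum_mono) (auto simp: emeasure_space_1 intro!: ennreal_leI power_mono)
  also have "\<dots> = ennreal ((b * \<theta> * sqrt p)\<^sup>2)"
  proof -
    have "(\<Sum>j<p. ennreal (b\<^sup>2)) = ennreal (\<Sum>j<p. b\<^sup>2)" by (rule sum_ennreal) simp
    then show ?thesis by (simp add: ennreal_mult'[symmetric] power_mult_distrib mult_ac del: sum_constant) (simp add: mult_ac)
  qed
  finally show "(\<integral>\<^sup>+\<omega>. ennreal ((cmod (\<Sum>j<p. c j * of_real (\<xi> j \<omega> - expectation (\<xi> j))))\<^sup>2) \<partial>M)
      \<le> ennreal ((b * \<theta> * sqrt p)\<^sup>2)" .
qed

definition lind :: "real \<Rightarrow> ('a \<Rightarrow> complex) \<Rightarrow> real" where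
  "lind \<theta> Y = expectation (\<lambda>\<omega>. (cmod (Y \<omega>))\<^sup>2 * indicator {\<omega>. \<theta> \<le> cmod (Y \<omega>)} \<omega>)"

lemma lind_nonneg: "0 \<le> lind \<theta> Y"
  unfolding lind_def by (intro Bochner_Integration.integral_nonneg) auto

text \<open>Radial projection to the disc of radius \<open>b\<close>. In this way the diagonal of a
  quadratic form is split into a uniformly bounded part, to which the variance bound applies, and an
  excess that is merely summed.\<close>

lemma ex_norm_split:
  fixes z :: complex assumes "cmod z \<le> b + d" "0 \<le> b" "0 \<le> d"
  shows "\<exists>x. cmod x \<le> b \<and> cmod (z - x) \<le> d"
proof (cases "cmod z \<le> b")
  case True
  then show ?thesis using assms by (intro exI[of _ z]) auto
next
  case False
  then have z: "0 < cmod z" using assms by linarith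
  have "cmod (of_real (b / cmod z) * z) = b" using z assms by (simp only: norm_mult norm_of_real) simp
  moreover have "z - of_real (b / cmod z) * z = of_real (1 - b / cmod z) * z" by (simp add: algebra_simps)
  moreover have "cmod (of_real (1 - b / cmod z) * z) = cmod z - b"
    using z False by (simp only: norm_mult norm_of_real) (simp add: field_simps)
  ultimately show ?thesis using assms by (intro exI[of _ "of_real (b / cmod z) * z"]) auto
qed

text \<open>The four terms are the two triangles, each with second moment at most the squared
  Frobenius norm; the truncated diagonal with coefficients of size \<open>b\<close>; the tails of
  the squares beyond \<open>\<theta>\<close>; and the excess \<open>d\<close> of the diagonal, where
  the factor 2 bounds the mean of \<open>|Y|^2 + 1\<close>.\<close>

lemma quadratic_form_deviation:
  fixes Y :: "nat \<Rightarrow> 'a \<Rightarrow> complex" and G :: "nat \<Rightarrow> nat \<Rightarrow> complex" and d :: "nat \<Rightarrow> real"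
  assumes ind: "indep_vars (\<lambda>_. borel) Y {..<p}"
    and Y: "\<And>j. j < p \<Longrightarrow> integrable M (Y j)" "\<And>j. j < p \<Longrightarrow> expectation (Y j) = 0"
      "\<And>j. j < p \<Longrightarrow> integrable M (\<lambda>\<omega>. (cmod (Y j \<omega>))\<^sup>2)"
      "\<And>j. j < p \<Longrightarrow> expectation (\<lambda>\<omega>. (cmod (Y j \<omega>))\<^sup>2) = 1"
    and \<theta>: "0 \<le> \<theta>" and b: "0 \<le> b" and d: "\<And>j. j < p \<Longrightarrow> 0 \<le> d j" "\<And>j. j < p \<Longrightarrow> cmod (G j j) \<le> b + d j"
  shows "(\<integral>\<^sup>+\<omega>. ennreal (cmod ((\<Sum>i<p. \<Sum>j<p. cnj (Y i \<omega>) * G i j * Y j \<omega>) - (\<Sum>i<p. G i i))) \<partial>M)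
    \<le> ennreal (2 * frob p G + b * \<theta> * sqrt p + 2 * b * (\<Sum>i<p. lind \<theta> (Y i)) + 2 * (\<Sum>i<p. d i))"
proof -
  have mY[measurable]: "Y j \<in> borel_measurable M" if "j < p" for j using Y(1)[OF that] by auto
  have "\<forall>j. \<exists>x. j < p \<longrightarrow> cmod x \<le> b \<and> cmod (G j j - x) \<le> d j"
    using ex_norm_split[OF d(2) b d(1)] by blast
  then obtain c where c: "\<And>j. j < p \<Longrightarrow> cmod (c j) \<le> b" "\<And>j. j < p \<Longrightarrow> cmod (G j j - c j) \<le> d j"
    by metis
  define \<xi> where "\<xi> = (\<lambda>j \<omega>. (cmod (Y j \<omega>))\<^sup>2 * indicator {\<omega>. cmod (Y j \<omega>) < \<theta>} \<omega>)"
  define \<zeta> where "\<zeta> = (\<lambda>j \<omega>. (cmod (Y j \<omega>))\<^sup>2 * indicator {\<omega>. \<theta> \<le> cmod (Y j \<omega>)} \<omega>)"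
  define U where "U \<omega> = (\<Sum>j<p. \<Sum>i<j. cnj (Y i \<omega>) * G i j * Y j \<omega>)" for \<omega>
  define V where "V \<omega> = (\<Sum>j<p. \<Sum>i<j. cnj (Y j \<omega>) * G j i * Y i \<omega>)" for \<omega>
  define T where "T \<omega> = (\<Sum>j<p. c j * of_real (\<xi> j \<omega> - expectation (\<xi> j)))" for \<omega>
  define l where "l j = lind \<theta> (Y j)" for j
  have \<xi>\<zeta>: "\<xi> j \<omega> + \<zeta> j \<omega> = (cmod (Y j \<omega>))\<^sup>2" for j \<omega>
    unfolding \<xi>_def \<zeta>_def by (auto simp: indicator_def)
  have m\<xi>[measurable]: "\<xi> j \<in> borel_measurable M" and m\<zeta>[measurable]: "\<zeta> j \<in> borel_measurable M" if "j < p" for j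
    unfolding \<xi>_def \<zeta>_def using mY[OF that] by measurable
  have \<zeta>0: "0 \<le> \<zeta> j \<omega>" "\<zeta> j \<omega> \<le> (cmod (Y j \<omega>))\<^sup>2" "\<xi> j \<omega> \<le> (cmod (Y j \<omega>))\<^sup>2" "0 \<le> \<xi> j \<omega>" for j \<omega>
    unfolding \<xi>_def \<zeta>_def by (auto simp: indicator_def)
  have int: "integrable M (\<xi> j)" "integrable M (\<zeta> j)" if "j < p" for j
    by (rule Bochner_Integration.integrable_bound[OF Y(3)[OF that]]; use \<zeta>0 that in auto)+
  have e\<zeta>: "expectation (\<zeta> j) = l j" for j unfolding \<zeta>_def l_def lind_def ..
  have e\<xi>: "expectation (\<xi> j) = 1 - l j" if "j < p" for j
  proof -
    have "expectation (\<lambda>\<omega>. \<xi> j \<omega> + \<zeta> j \<omega>) = 1" unfolding \<xi>\<zeta> using Y(4)[OF that] .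
    then show ?thesis using int[OF that] e\<zeta> by simp
  qed
  have decomp: "(\<Sum>i<p. \<Sum>j<p. f i j) = (\<Sum>j<p. \<Sum>i<j. f i j) + (\<Sum>j<p. \<Sum>i<j. f j i) + (\<Sum>i<p. f i i)"
    for f :: "nat \<Rightarrow> nat \<Rightarrow> complex"
    by (induction p) (simp_all add: sum.distrib algebra_simps)
  have pw: "cmod ((\<Sum>i<p. \<Sum>j<p. cnj (Y i \<omega>) * G i j * Y j \<omega>) - (\<Sum>i<p. G i i))
      \<le> cmod (U \<omega>) + cmod (V \<omega>) + cmod (T \<omega>) + (\<Sum>i<p. b * (\<zeta> i \<omega> + l i) + d i * ((cmod (Y i \<omega>))\<^sup>2 + 1))" for \<omega>
  proof -
    \<comment> \<open>\<open>\<xi>\<close> and \<open>\<zeta>\<close> are the parts of the square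
      below and above \<open>\<theta>\<close>, with means \<open>1 - l i\<close> and
      \<open>l i\<close>. Only the bounded part \<open>c i\<close> of the coefficient meets the
      truncated fluctuation; the excess \<open>G i i - c i\<close> keeps the square
      untruncated.\<close>
    have diag: "cnj (Y i \<omega>) * G i i * Y i \<omega> - G i i = c i * of_real (\<xi> i \<omega> - expectation (\<xi> i))
      + (c i * of_real (\<zeta> i \<omega> - l i) + (G i i - c i) * of_real ((cmod (Y i \<omega>))\<^sup>2 - 1))" if "i < p" for i
    proof -
      have 1: "of_real ((cmod (Y i \<omega>))\<^sup>2) = cnj (Y i \<omega>) * Y i \<omega>"
        using complex_norm_square[of "Y i \<omega>"] by (simp add: mult.commute)
      have 2: "\<xi> i \<omega> - expectation (\<xi> i) + (\<zeta> i \<omega> - l i) = (cmod (Y i \<omega>))\<^sup>2 - 1"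
        unfolding e\<xi>[OF that] \<xi>\<zeta>[symmetric] by simp
      have "c i * of_real (\<xi> i \<omega> - expectation (\<xi> i)) + c i * of_real (\<zeta> i \<omega> - l i) = c i * of_real ((cmod (Y i \<omega>))\<^sup>2 - 1)"
        unfolding 2[symmetric] of_real_add by (simp add: distrib_left)
      moreover have "cnj (Y i \<omega>) * G i i * Y i \<omega> - G i i = G i i * of_real ((cmod (Y i \<omega>))\<^sup>2 - 1)"
        unfolding of_real_diff of_real_1 1 by (simp add: algebra_simps)
      ultimately show ?thesis by (simp only: add.assoc[symmetric]) (simp add: algebra_simps)
    qed
    have "(\<Sum>i<p. \<Sum>j<p. cnj (Y i \<omega>) * G i j * Y j \<omega>) - (\<Sum>i<p. G i i)
        = U \<omega> + V \<omega> + (\<Sum>i<p. cnj (Y i \<omega>) * G i i * Y i \<omega> - G i i)"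
      unfolding decomp U_def V_def by (simp add: sum_subtractf)
    also have "\<dots> = U \<omega> + V \<omega> + T \<omega> + (\<Sum>i<p. c i * of_real (\<zeta> i \<omega> - l i) + (G i i - c i) * of_real ((cmod (Y i \<omega>))\<^sup>2 - 1))"
      unfolding T_def by (simp add: diag sum.distrib)
    finally have eq: "(\<Sum>i<p. \<Sum>j<p. cnj (Y i \<omega>) * G i j * Y j \<omega>) - (\<Sum>i<p. G i i)
        = U \<omega> + V \<omega> + T \<omega> + (\<Sum>i<p. c i * of_real (\<zeta> i \<omega> - l i) + (G i i - c i) * of_real ((cmod (Y i \<omega>))\<^sup>2 - 1))" .
    have "cmod (\<Sum>i<p. c i * of_real (\<zeta> i \<omega> - l i) + (G i i - c i) * of_real ((cmod (Y i \<omega>))\<^sup>2 - 1))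
        \<le> (\<Sum>i<p. b * (\<zeta> i \<omega> + l i) + d i * ((cmod (Y i \<omega>))\<^sup>2 + 1))"
    proof (rule sum_norm_le)
      fix i assume "i \<in> {..<p}" then have i: "i < p" by simp
      have l0: "0 \<le> l i" unfolding l_def by (rule lind_nonneg)
      have 1: "cmod (c i * of_real (\<zeta> i \<omega> - l i)) \<le> b * (\<zeta> i \<omega> + l i)"
        unfolding norm_mult norm_of_real using c(1)[OF i] \<zeta>0(1)[of i \<omega>] l0 b by (intro mult_mono) auto
      have "\<bar>(cmod (Y i \<omega>))\<^sup>2 - 1\<bar> \<le> (cmod (Y i \<omega>))\<^sup>2 + 1"
        using zero_le_power2[of "cmod (Y i \<omega>)"] by linarith
      then have 2: "cmod ((G i i - c i) * of_real ((cmod (Y i \<omega>))\<^sup>2 - 1)) \<le> d i * ((cmod (Y i \<omega>))\<^sup>2 + 1)"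
        unfolding norm_mult norm_of_real using c(2)[OF i] d(1)[OF i] by (intro mult_mono) auto
      show "cmod (c i * of_real (\<zeta> i \<omega> - l i) + (G i i - c i) * of_real ((cmod (Y i \<omega>))\<^sup>2 - 1))
          \<le> b * (\<zeta> i \<omega> + l i) + d i * ((cmod (Y i \<omega>))\<^sup>2 + 1)"
        by (rule norm_triangle_le[OF add_mono[OF 1 2]])
    qed
    then show ?thesis unfolding eq
      by (intro order_trans[OF norm_triangle_ineq] add_mono order_refl)
  qed
  have m[measurable]: "U \<in> borel_measurable M" "V \<in> borel_measurable M" "T \<in> borel_measurable M"
  proof -
    have cm: "(\<lambda>\<omega>. cnj (Y j \<omega>)) \<in> borel_measurable M" if "j < p" for j
      by (rule measurable_compose[OF mY[OF that] cnj_borel_measurable])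
    show "U \<in> borel_measurable M" "V \<in> borel_measurable M"
      unfolding U_def V_def
      by (intro borel_measurable_sum borel_measurable_times borel_measurable_const mY cm; simp)+
    show "T \<in> borel_measurable M"
      unfolding T_def
      by (intro borel_measurable_sum borel_measurable_times borel_measurable_const borel_measurable_of_real borel_measurable_diff m\<xi>; simp)
  qed
  have tri: "(\<Sum>j<p. \<Sum>i<j. (cmod (G i j))\<^sup>2) \<le> (frob p G)\<^sup>2" "(\<Sum>j<p. \<Sum>i<j. (cmod (G j i))\<^sup>2) \<le> (frob p G)\<^sup>2"
  proof -
    have "(\<Sum>j<p. \<Sum>i<j. (cmod (G i j))\<^sup>2) \<le> (\<Sum>j<p. \<Sum>i<p. (cmod (G i j))\<^sup>2)"
      by (intro sum_mono sum_mono2) auto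
    also have "\<dots> = (frob p G)\<^sup>2" unfolding frob_sq by (rule sum.swap)
    finally show "(\<Sum>j<p. \<Sum>i<j. (cmod (G i j))\<^sup>2) \<le> (frob p G)\<^sup>2" .
    show "(\<Sum>j<p. \<Sum>i<j. (cmod (G j i))\<^sup>2) \<le> (frob p G)\<^sup>2"
      unfolding frob_sq by (intro sum_mono sum_mono2) auto
  qed
  have U: "(\<integral>\<^sup>+\<omega>. ennreal (cmod (U \<omega>)) \<partial>M) \<le> ennreal (frob p G)"
  proof (rule nn_integral_norm_le_sqrt[OF m(1)])
    have "(\<integral>\<^sup>+\<omega>. ennreal ((cmod (U \<omega>))\<^sup>2) \<partial>M) \<le> ennreal (\<Sum>j<p. \<Sum>i<j. (cmod (G i j))\<^sup>2)"
      unfolding U_def using bilinear_form_square(1)[OF ind, of "\<lambda>j. {..<j}" G] Y by blast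
    then show "(\<integral>\<^sup>+\<omega>. ennreal ((cmod (U \<omega>))\<^sup>2) \<partial>M) \<le> ennreal ((frob p G)\<^sup>2)"
      using ennreal_leI[OF tri(1)] by (rule order_trans)
  qed simp
  have V: "(\<integral>\<^sup>+\<omega>. ennreal (cmod (V \<omega>)) \<partial>M) \<le> ennreal (frob p G)"
  proof (rule nn_integral_norm_le_sqrt[OF m(2)])
    have "(\<integral>\<^sup>+\<omega>. ennreal ((cmod (V \<omega>))\<^sup>2) \<partial>M) \<le> ennreal (\<Sum>j<p. \<Sum>i<j. (cmod (G j i))\<^sup>2)"
      unfolding V_def using bilinear_form_square(2)[OF ind, of "\<lambda>j. {..<j}" G] Y by blast
    then show "(\<integral>\<^sup>+\<omega>. ennreal ((cmod (V \<omega>))\<^sup>2) \<partial>M) \<le> ennreal ((frob p G)\<^sup>2)"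
      using ennreal_leI[OF tri(2)] by (rule order_trans)
  qed simp
  have T: "(\<integral>\<^sup>+\<omega>. ennreal (cmod (T \<omega>)) \<partial>M) \<le> ennreal (b * \<theta> * sqrt p)"
    unfolding T_def \<xi>_def using truncated_diagonal[OF ind Y(3,4) \<theta> b c(1)] by simp
  define E where "E \<omega> = (\<Sum>i<p. b * (\<zeta> i \<omega> + l i) + d i * ((cmod (Y i \<omega>))\<^sup>2 + 1))" for \<omega>
  have E0: "0 \<le> E \<omega>" for \<omega>
    unfolding E_def using \<zeta>0 d(1) b lind_nonneg by (intro sum_nonneg) (auto simp: l_def)
  have intE: "integrable M E"
    unfolding E_def using int Y(3)
    by (intro Bochner_Integration.integrable_sum Bochner_Integration.integrable_add integrable_mult_right integrable_const) auto
  have "expectation E = (\<Sum>i<p. 2 * b * l i + 2 * d i)"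
    unfolding E_def using int Y(3,4) by (subst Bochner_Integration.integral_sum) (auto simp: e\<zeta> prob_space algebra_simps)
  then have E: "(\<integral>\<^sup>+\<omega>. ennreal (E \<omega>) \<partial>M) = ennreal (2 * b * (\<Sum>i<p. l i) + 2 * (\<Sum>i<p. d i))"
    using intE E0 by (subst nn_integral_eq_integral) (auto simp: sum.distrib sum_distrib_left)
  have mE[measurable]: "E \<in> borel_measurable M" using intE by auto
  have "(\<integral>\<^sup>+\<omega>. ennreal (cmod ((\<Sum>i<p. \<Sum>j<p. cnj (Y i \<omega>) * G i j * Y j \<omega>) - (\<Sum>i<p. G i i))) \<partial>M)
      \<le> (\<integral>\<^sup>+\<omega>. ennreal (cmod (U \<omega>)) + ennreal (cmod (V \<omega>)) + ennreal (cmod (T \<omega>)) + ennreal (E \<omega>) \<partial>M)"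
    using pw E0 unfolding E_def[symmetric]
    by (intro nn_integral_mono) (simp add: ennreal_plus[symmetric] ennreal_leI del: ennreal_plus)
  also have "\<dots> = (\<integral>\<^sup>+\<omega>. ennreal (cmod (U \<omega>)) \<partial>M) + (\<integral>\<^sup>+\<omega>. ennreal (cmod (V \<omega>)) \<partial>M)
      + (\<integral>\<^sup>+\<omega>. ennreal (cmod (T \<omega>)) \<partial>M) + (\<integral>\<^sup>+\<omega>. ennreal (E \<omega>) \<partial>M)"
    by (simp add: nn_integral_add)
  also have "\<dots> \<le> ennreal (frob p G) + ennreal (frob p G) + ennreal (b * \<theta> * sqrt p)
      + ennreal (2 * b * (\<Sum>i<p. l i) + 2 * (\<Sum>i<p. d i))"
    unfolding E by (intro add_mono U V T order_refl)
  also have "\<dots> = ennreal (2 * frob p G + b * \<theta> * sqrt p + 2 * b * (\<Sum>i<p. lind \<theta> (Y i)) + 2 * (\<Sum>i<p. d i))"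
  proof -
    have "0 \<le> b * \<theta> * sqrt p" "0 \<le> 2 * b * (\<Sum>i<p. l i) + 2 * (\<Sum>i<p. d i)"
      using b \<theta> d(1) lind_nonneg by (auto simp: l_def intro!: add_nonneg_nonneg mult_nonneg_nonneg sum_nonneg)
    then show ?thesis unfolding l_def by (simp add: ennreal_plus[symmetric] add_ac del: ennreal_plus)
  qed
  finally show ?thesis .
qed

text \<open>The matrix may be random as long as it is a function of variables outside the form:
  after decoupling it is frozen in the inner integral.\<close>

lemma quadratic_form_deviation_indep:
  fixes X :: "'i \<Rightarrow> 'a \<Rightarrow> complex" and \<gamma> :: "nat \<Rightarrow> nat \<Rightarrow> ('i \<Rightarrow> complex) \<Rightarrow> complex" and d :: "nat \<Rightarrow> ('i \<Rightarrow> complex) \<Rightarrow> real"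
  assumes ind: "indep_vars (\<lambda>_. borel) X I" and h: "inj_on h {..<p}" "h ` {..<p} \<subseteq> I"
    and X: "\<And>j. j < p \<Longrightarrow> integrable M (X (h j))" "\<And>j. j < p \<Longrightarrow> expectation (X (h j)) = 0"
      "\<And>j. j < p \<Longrightarrow> integrable M (\<lambda>\<omega>. (cmod (X (h j) \<omega>))\<^sup>2)"
      "\<And>j. j < p \<Longrightarrow> expectation (\<lambda>\<omega>. (cmod (X (h j) \<omega>))\<^sup>2) = 1"
    and J: "J \<subseteq> I" "J \<inter> h ` {..<p} = {}"
    and \<gamma>: "\<And>i j. i < p \<Longrightarrow> j < p \<Longrightarrow> \<gamma> i j \<in> borel_measurable (PiM J (\<lambda>_. borel))"
      "\<And>i j x. i < p \<Longrightarrow> j < p \<Longrightarrow> \<gamma> i j (restrict x J) = \<gamma> i j x"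
    and \<theta>: "0 \<le> \<theta>" and b: "0 \<le> b"
    and d: "\<And>j x. j < p \<Longrightarrow> 0 \<le> d j x" "\<And>j x. j < p \<Longrightarrow> cmod (\<gamma> j j x) \<le> b + d j x"
  shows "(\<integral>\<^sup>+\<omega>. ennreal (cmod ((\<Sum>i<p. \<Sum>j<p. cnj (X (h i) \<omega>) * \<gamma> i j (\<lambda>k. X k \<omega>) * X (h j) \<omega>)
        - (\<Sum>i<p. \<gamma> i i (\<lambda>k. X k \<omega>)))) \<partial>M)
    \<le> (\<integral>\<^sup>+\<omega>. ennreal (2 * frob p (\<lambda>i j. \<gamma> i j (\<lambda>k. X k \<omega>)) + b * \<theta> * sqrt p
        + 2 * b * (\<Sum>i<p. lind \<theta> (X (h i))) + 2 * (\<Sum>i<p. d i (\<lambda>k. X k \<omega>))) \<partial>M)"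
proof -
  define A where "A \<omega> = (\<lambda>i\<in>J. X i \<omega>)" for \<omega>
  define B where "B \<omega> = (\<lambda>i\<in>h ` {..<p}. X i \<omega>)" for \<omega>
  define F where "F = (\<lambda>(x, y). ennreal (cmod ((\<Sum>i<p. \<Sum>j<p. cnj (y (h i)) * \<gamma> i j x * y (h j)) - (\<Sum>i<p. \<gamma> i i x))))"
  have indAB: "indep_var (PiM J (\<lambda>_. borel)) A (PiM (h ` {..<p}) (\<lambda>_. borel)) B"
    unfolding A_def B_def by (rule indep_var_restrict[OF ind J(2,1) h(2)])
  have F: "F \<in> borel_measurable (PiM J (\<lambda>_. borel) \<Otimes>\<^sub>M PiM (h ` {..<p}) (\<lambda>_. borel))"
  proof -
    let ?P = "PiM J (\<lambda>_. borel :: complex measure) \<Otimes>\<^sub>M PiM (h ` {..<p}) (\<lambda>_. borel :: complex measure)"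
    have 1: "(\<lambda>z. snd z (h i)) \<in> borel_measurable ?P" if "i < p" for i
      by (rule measurable_compose[OF measurable_snd measurable_component_singleton]) (use that in auto)
    have 2: "(\<lambda>z. \<gamma> i j (fst z)) \<in> borel_measurable ?P" if "i < p" "j < p" for i j
      by (rule measurable_compose[OF measurable_fst \<gamma>(1)[OF that]])
    have 3: "(\<lambda>z. cnj (snd z (h i))) \<in> borel_measurable ?P" if "i < p" for i
      by (rule measurable_compose[OF 1[OF that] cnj_borel_measurable])
    have "(\<lambda>z. (\<Sum>i<p. \<Sum>j<p. cnj (snd z (h i)) * \<gamma> i j (fst z) * snd z (h j)) - (\<Sum>i<p. \<gamma> i i (fst z))) \<in> borel_measurable ?P"
      by (intro borel_measurable_diff borel_measurable_sum borel_measurable_times 1 2 3; simp)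
    then show ?thesis
      unfolding F_def split_beta by measurable
  qed
  have \<gamma>A: "\<gamma> i j (A \<omega>) = \<gamma> i j (\<lambda>k. X k \<omega>)" if "i < p" "j < p" for i j \<omega>
    unfolding A_def by (rule \<gamma>(2)[OF that])
  have FA: "F (A \<omega>, B \<omega>') = ennreal (cmod ((\<Sum>i<p. \<Sum>j<p. cnj (X (h i) \<omega>') * \<gamma> i j (\<lambda>k. X k \<omega>) * X (h j) \<omega>')
        - (\<Sum>i<p. \<gamma> i i (\<lambda>k. X k \<omega>))))" for \<omega> \<omega>'
    unfolding F_def by (simp add: \<gamma>A) (simp add: B_def)
  have indh: "indep_vars (\<lambda>_. borel) (\<lambda>i. X (h i)) {..<p}"
    by (rule indep_vars_reindex[OF h(1) indep_vars_subset[OF ind h(2)]])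
  have "(\<integral>\<^sup>+\<omega>. F (A \<omega>, B \<omega>) \<partial>M) = (\<integral>\<^sup>+\<omega>. \<integral>\<^sup>+\<omega>'. F (A \<omega>, B \<omega>') \<partial>M \<partial>M)"
    by (rule nn_integral_decouple[OF indAB F])
  also have "\<dots> \<le> (\<integral>\<^sup>+\<omega>. ennreal (2 * frob p (\<lambda>i j. \<gamma> i j (\<lambda>k. X k \<omega>)) + b * \<theta> * sqrt p
        + 2 * b * (\<Sum>i<p. lind \<theta> (X (h i))) + 2 * (\<Sum>i<p. d i (\<lambda>k. X k \<omega>))) \<partial>M)"
    unfolding FA by (intro nn_integral_mono quadratic_form_deviation[OF indh X \<theta> b d]) auto
  finally show ?thesis unfolding FA .
qed

end

section \<open>Frobenius norms of Gram matrices and of sandwiched matrices\<close>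

lemma gram_eq_mmul: "gram {..<p} W = mmul p W (adj W)"
  unfolding gram_def mmul_def adj_def ..

lemma frob_sq_eq_ctrace: "of_real ((frob n A)\<^sup>2) = ctrace n (mmul n A (adj A))"
  unfolding frob_sq ctrace_def mmul_def adj_def of_real_sum
  by (simp only: complex_norm_square)

text \<open>By cyclicity the squared norm is the trace of \<open>C D (adj C) D\<close> with
  \<open>D\<close> the Gram matrix: the copies of \<open>W\<close> combine, and only the Frobenius
  norm of \<open>D\<close> is needed, the quantity that the recursion controls.\<close>

lemma frob_sandwich_le:
  assumes C: "opbound n c C" and c: "0 \<le> c"
  shows "frob p (mmul n (adj W) (mmul n C W)) \<le> c * frob n (gram {..<p} W)"
proof -
  let ?D = "gram {..<p} W" and ?G = "mmul n (adj W) (mmul n C W)"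
  have adjG: "adj ?G = mmul n (adj W) (mmul n (adj C) W)"
    by (simp add: adj_mmul mmul_assoc)
  have "of_real ((frob p ?G)\<^sup>2) = ctrace p (mmul n (adj W) (mmul p (mmul n C W) (adj ?G)))"
    unfolding frob_sq_eq_ctrace by (simp add: mmul_assoc)
  also have "\<dots> = ctrace n (mmul p (mmul p (mmul n C W) (adj ?G)) (adj W))"
    by (rule ctrace_mmul_comm)
  also have "\<dots> = ctrace n (mmul n (mmul n C ?D) (mmul n (adj C) ?D))"
    unfolding adjG gram_eq_mmul by (simp add: mmul_assoc)
  finally have eq: "of_real ((frob p ?G)\<^sup>2) = ctrace n (mmul n (mmul n C ?D) (mmul n (adj C) ?D))" .
  have "(frob p ?G)\<^sup>2 = cmod (ctrace n (mmul n (mmul n C ?D) (mmul n (adj C) ?D)))"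
    unfolding eq[symmetric] by (simp only: norm_of_real abs_power2)
  also have "\<dots> \<le> frob n (mmul n C ?D) * frob n (adj (mmul n (adj C) ?D))"
  proof -
    have "frob n (\<lambda>i j. mmul n (adj C) ?D j i) = frob n (mmul n (adj C) ?D)"
      unfolding frob_def by (subst sum.swap) simp
    then show ?thesis
      using frob_Cauchy_Schwarz[of "mmul n C ?D" "\<lambda>i j. mmul n (adj C) ?D j i" n]
      unfolding frob_adj ctrace_def mmul_def[of n "mmul n C ?D"] by simp
  qed
  also have "\<dots> \<le> (c * frob n ?D) * (c * frob n ?D)"
    unfolding frob_adj
    by (intro mult_mono frob_mmul_left C c opbound_adj[OF C c] mult_nonneg_nonneg frob_nonneg)
  finally have "(frob p ?G)\<^sup>2 \<le> (c * frob n ?D)\<^sup>2" by (simp add: power2_eq_square)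
  then show ?thesis using c by (intro power2_le_imp_le[of "frob p ?G"]) auto
qed

lemma frob_gram_flip: "frob p (mmul n (adj W) W) = frob n (gram {..<p} W)"
proof -
  have "complex_of_real ((frob p (mmul n (adj W) W))\<^sup>2) = ctrace p (mmul n (adj W) (mmul p W (mmul n (adj W) W)))"
    unfolding frob_sq_eq_ctrace by (simp add: adj_mmul mmul_assoc)
  also have "\<dots> = ctrace n (mmul p (mmul p W (mmul n (adj W) W)) (adj W))"
    by (rule ctrace_mmul_comm)
  also have "\<dots> = of_real ((frob n (gram {..<p} W))\<^sup>2)"
    unfolding frob_sq_eq_ctrace gram_eq_mmul by (simp add: adj_mmul mmul_assoc)
  finally have "(frob p (mmul n (adj W) W))\<^sup>2 = (frob n (gram {..<p} W))\<^sup>2"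
    unfolding of_real_eq_iff .
  then show ?thesis by simp
qed

text \<open>Meant for a matrix whose diagonal entries are close to \<open>c\<close>: the constant
  part costs only \<open>c sqrt q\<close>, and the rest is measured by a summed deviation of the
  diagonal and a square sum off the diagonal, both of which can be estimated in mean.\<close>

lemma frob_le_diag_offdiag:
  fixes c :: real
  assumes that: "0 \<le> c"
  shows "frob q A \<le> c * sqrt q + (\<Sum>k<q. cmod (A k k - of_real c)) + sqrt (\<Sum>k<q. \<Sum>l\<in>{..<q} - {k}. (cmod (A k l))\<^sup>2)"
proof -
  have "frob q A = sqrt ((\<Sum>k<q. (cmod (A k k))\<^sup>2) + (\<Sum>k<q. \<Sum>l\<in>{..<q} - {k}. (cmod (A k l))\<^sup>2))"
    unfolding frob_def sum.distrib[symmetric]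
    by (intro arg_cong[where f = sqrt] sum.cong refl) (subst sum.remove[of "{..<q}"], auto)
  also have "\<dots> \<le> sqrt (\<Sum>k<q. (cmod (A k k))\<^sup>2) + sqrt (\<Sum>k<q. \<Sum>l\<in>{..<q} - {k}. (cmod (A k l))\<^sup>2)"
    by (intro sqrt_add_le_add_sqrt sum_nonneg) auto
  finally have 1: "frob q A \<le> L2_set (\<lambda>k. cmod (A k k)) {..<q} + sqrt (\<Sum>k<q. \<Sum>l\<in>{..<q} - {k}. (cmod (A k l))\<^sup>2)"
    unfolding L2_set_def .
  have "L2_set (\<lambda>k. cmod (A k k)) {..<q} \<le> L2_set (\<lambda>k. c + cmod (A k k - of_real c)) {..<q}"
  proof (rule L2_set_mono)
    fix k
    have "cmod (A k k) \<le> cmod (of_real c) + cmod (A k k - of_real c)"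
      using norm_triangle_ineq[of "of_real c" "A k k - of_real c"] by simp
    then show "cmod (A k k) \<le> c + cmod (A k k - of_real c)" using that by simp
  qed simp
  also have "\<dots> \<le> L2_set (\<lambda>k. c) {..<q} + L2_set (\<lambda>k. cmod (A k k - of_real c)) {..<q}"
    by (rule L2_set_triangle_ineq)
  finally have 2: "L2_set (\<lambda>k. cmod (A k k)) {..<q} \<le> L2_set (\<lambda>k. c) {..<q} + L2_set (\<lambda>k. cmod (A k k - of_real c)) {..<q}" .
  have 3: "L2_set (\<lambda>k. c) {..<q} = c * sqrt q"
    unfolding L2_set_def using that by (simp add: real_sqrt_mult)
  have "L2_set (\<lambda>k. cmod (A k k - of_real c)) {..<q} \<le> (\<Sum>k<q. cmod (A k k - of_real c))"
    by (rule L2_set_le_sum) simp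
  with 1 2 3 show ?thesis by linarith
qed

section \<open>Measurability of matrix-valued expressions\<close>

definition mat_measurable :: "'a measure \<Rightarrow> nat \<Rightarrow> ('a \<Rightarrow> nat \<Rightarrow> nat \<Rightarrow> complex) \<Rightarrow> bool" where
  "mat_measurable N n A \<longleftrightarrow> (\<forall>i<n. \<forall>j<n. (\<lambda>\<omega>. A \<omega> i j) \<in> borel_measurable N)"

lemma mat_measurableD: "mat_measurable N n A \<Longrightarrow> i < n \<Longrightarrow> j < n \<Longrightarrow> (\<lambda>\<omega>. A \<omega> i j) \<in> borel_measurable N"
  unfolding mat_measurable_def by blast

lemma mat_measurable_mmul:
  "mat_measurable N n A \<Longrightarrow> mat_measurable N n B \<Longrightarrow> mat_measurable N n (\<lambda>\<omega>. mmul n (A \<omega>) (B \<omega>))"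
  unfolding mat_measurable_def mmul_def by (auto intro!: borel_measurable_sum borel_measurable_times)

lemma mat_measurable_const: "mat_measurable N n (\<lambda>\<omega>. A)"
  unfolding mat_measurable_def by simp

lemma mat_measurable_scale: "mat_measurable N n A \<Longrightarrow> mat_measurable N n (\<lambda>\<omega> i j. c * A \<omega> i j)"
  unfolding mat_measurable_def by (auto intro!: borel_measurable_times)

lemma mat_measurable_gram:
  assumes "\<And>i k. i < n \<Longrightarrow> k \<in> K \<Longrightarrow> (\<lambda>\<omega>. r \<omega> i k) \<in> borel_measurable N"
  shows "mat_measurable N n (\<lambda>\<omega>. gram K (r \<omega>))"
  unfolding mat_measurable_def gram_def
  by (intro allI impI borel_measurable_sum borel_measurable_times assms
      measurable_compose[OF assms cnj_borel_measurable])

lemma borel_measurable_ctrace: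
  "mat_measurable N n A \<Longrightarrow> (\<lambda>\<omega>. ctrace n (A \<omega>)) \<in> borel_measurable N"
  unfolding mat_measurable_def ctrace_def by (auto intro!: borel_measurable_sum)

lemma borel_measurable_frob:
  "mat_measurable N n A \<Longrightarrow> (\<lambda>\<omega>. frob n (A \<omega>)) \<in> borel_measurable N"
  unfolding frob_def
  by (intro measurable_compose[OF _ borel_measurable_sqrt] borel_measurable_sum borel_measurable_power borel_measurable_norm)
    (auto dest: mat_measurableD)

lemma borel_measurable_det:
  assumes "\<And>\<omega>. A \<omega> \<in> carrier_mat n n"
    "\<And>i j. i < n \<Longrightarrow> j < n \<Longrightarrow> (\<lambda>\<omega>. A \<omega> $$ (i, j)) \<in> borel_measurable N"
  shows "(\<lambda>\<omega>. Determinant.det (A \<omega>) :: complex) \<in> borel_measurable N"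
  unfolding det_def'[OF assms(1)]
proof (intro borel_measurable_sum borel_measurable_times borel_measurable_const borel_measurable_prod assms(2))
  fix f i assume "f \<in> {f. f permutes {0..<n}}" "i \<in> {0..<n}"
  then show "i < n" "f i < n" using permutes_in_image[of f "{0..<n}" i] by auto
qed

lemma mat_measurable_resolvent:
  assumes A: "mat_measurable N n A"
  shows "mat_measurable N n (\<lambda>\<omega>. resolvent n v (A \<omega>))"
  unfolding mat_measurable_def
proof (intro allI impI)
  fix i j assume ij: "i < n" "j < n"
  let ?M = "\<lambda>\<omega>. Matrix.mat n n (\<lambda>(i, j). A \<omega> i j + of_real v * idm i j)"
  have M: "(\<lambda>\<omega>. ?M \<omega> $$ (i, j)) \<in> borel_measurable N" if "i < n" "j < n" for i j
    using that mat_measurableD[OF A that] by simp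
  have 1: "(\<lambda>\<omega>. Determinant.det (?M \<omega>)) \<in> borel_measurable N"
    by (rule borel_measurable_det[where n = n]) (use M in auto)
  have 2: "(\<lambda>\<omega>. Determinant.det (mat_delete (?M \<omega>) j i)) \<in> borel_measurable N"
  proof (rule borel_measurable_det[where n = "n - 1"])
    fix a b assume ab: "a < n - 1" "b < n - 1"
    have "(\<lambda>\<omega>. mat_delete (?M \<omega>) j i $$ (a, b)) = (\<lambda>\<omega>. ?M \<omega> $$ (if a < j then a else Suc a, if b < i then b else Suc b))"
      unfolding mat_delete_def using ab by simp
    also have "\<dots> \<in> borel_measurable N" by (rule M) (use ab in auto)
    finally show "(\<lambda>\<omega>. mat_delete (?M \<omega>) j i $$ (a, b)) \<in> borel_measurable N" .
  qed (simp add: mat_delete_def)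
  have "(\<lambda>\<omega>. adj_mat (?M \<omega>) $$ (i, j)) = (\<lambda>\<omega>. (- 1) ^ (j + i) * Determinant.det (mat_delete (?M \<omega>) j i))"
    using ij by (simp add: adj_mat_def cofactor_def)
  then have 3: "(\<lambda>\<omega>. adj_mat (?M \<omega>) $$ (i, j)) \<in> borel_measurable N"
    using 2 by simp
  show "(\<lambda>\<omega>. resolvent n v (A \<omega>) i j) \<in> borel_measurable N"
    unfolding resolvent_def Let_def using borel_measurable_divide[OF 3 1] .
qed

lemma resolvent_cong:
  assumes "\<And>i j. i < n \<Longrightarrow> j < n \<Longrightarrow> A i j = B i j"
  shows "resolvent n v A = resolvent n v B"
proof -
  have "Matrix.mat n n (\<lambda>(i, j). A i j + of_real v * idm i j) = Matrix.mat n n (\<lambda>(i, j). B i j + of_real v * idm i j)"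
    by (rule eq_matI) (use assms in auto)
  then show ?thesis unfolding resolvent_def by simp
qed

subsection \<open>Products of random matrices\<close>

text \<open>The product as a function of one family indexed by triples, the index set of the
  independence assumption. Since any family may be inserted, the product can be evaluated at a
  family cut down to a subset of the indices.\<close>

fun wprod :: "(nat \<Rightarrow> nat) \<Rightarrow> (nat \<times> nat \<times> nat \<Rightarrow> complex) \<Rightarrow> nat \<Rightarrow> nat \<Rightarrow> nat \<Rightarrow> complex" where
  "wprod p x 0 i j = idm i j"
| "wprod p x (Suc \<nu>) i j = (\<Sum>l<p \<nu>. wprod p x \<nu> i l * (x (Suc \<nu>, l, j) / of_real (sqrt (p (Suc \<nu>)))))"

definition layers :: "(nat \<Rightarrow> nat) \<Rightarrow> nat \<Rightarrow> (nat \<times> nat \<times> nat) set" where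
  "layers p \<nu> = {(\<mu>, l, k). \<mu> \<in> {1..\<nu>} \<and> l < p (\<mu> - 1) \<and> k < p \<mu>}"

definition layer_column :: "(nat \<Rightarrow> nat) \<Rightarrow> nat \<Rightarrow> nat \<Rightarrow> (nat \<times> nat \<times> nat) set" where
  "layer_column p \<nu> k = (\<lambda>l. (\<nu>, l, k)) ` {..<p (\<nu> - 1)}"

lemma layers_mono: "\<nu> \<le> \<nu>' \<Longrightarrow> layers p \<nu> \<subseteq> layers p \<nu>'"
  unfolding layers_def by auto

lemma layers_Suc: "layers p (Suc \<nu>) = layers p \<nu> \<union> (\<Union>k<p (Suc \<nu>). layer_column p (Suc \<nu>) k)"
  unfolding layers_def layer_column_def by (auto simp: le_Suc_eq)

text \<open>The form in which it is used that a product involves only the entries of its layers: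
  independence is available for families restricted to disjoint index sets.\<close>

lemma wprod_restrict:
  "layers p \<nu> \<subseteq> J \<Longrightarrow> j < p \<nu> \<Longrightarrow> wprod p (restrict x J) \<nu> i j = wprod p x \<nu> i j"
proof (induction \<nu> arbitrary: j)
  case (Suc \<nu>)
  have "layers p \<nu> \<subseteq> J" using Suc.prems layers_Suc by blast
  moreover have "(Suc \<nu>, l, j) \<in> J" if "l < p \<nu>" for l
    using Suc.prems that unfolding layers_def by auto
  ultimately show ?case using Suc.IH by simp
qed simp

lemma wprod_restrict_column:
  assumes "layers p \<nu> \<subseteq> J" "layer_column p (Suc \<nu>) j \<subseteq> J"
  shows "wprod p (restrict x J) (Suc \<nu>) i j = wprod p x (Suc \<nu>) i j"
proof -
  have "(Suc \<nu>, l, j) \<in> J" if "l < p \<nu>" for l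
    using assms(2) that unfolding layer_column_def by auto
  then show ?thesis using wprod_restrict[OF assms(1)] by simp
qed

lemma borel_measurable_wprod:
  assumes "\<And>a. a \<in> J \<Longrightarrow> (\<lambda>\<omega>. x \<omega> a) \<in> borel_measurable N" "layers p \<nu> \<subseteq> J" "j < p \<nu>"
  shows "(\<lambda>\<omega>. wprod p (x \<omega>) \<nu> i j) \<in> borel_measurable N"
  using assms(2,3)
proof (induction \<nu> arbitrary: j)
  case (Suc \<nu>)
  have "layers p \<nu> \<subseteq> J" using Suc.prems layers_Suc by blast
  moreover have "(Suc \<nu>, l, j) \<in> J" if "l < p \<nu>" for l
    using Suc.prems that unfolding layers_def by auto
  ultimately show ?case using Suc.IH assms(1)
    by (auto intro!: borel_measurable_sum borel_measurable_times borel_measurable_divide)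
qed simp

lemma borel_measurable_wprod_column:
  assumes "\<And>a. a \<in> J \<Longrightarrow> (\<lambda>\<omega>. x \<omega> a) \<in> borel_measurable N" "layers p \<nu> \<subseteq> J" "layer_column p (Suc \<nu>) j \<subseteq> J"
  shows "(\<lambda>\<omega>. wprod p (x \<omega>) (Suc \<nu>) i j) \<in> borel_measurable N"
proof -
  have "(Suc \<nu>, l, j) \<in> J" if "l < p \<nu>" for l
    using assms(3) that unfolding layer_column_def by auto
  then show ?thesis using borel_measurable_wprod[OF assms(1,2)] assms(1)
    by (auto intro!: borel_measurable_sum borel_measurable_times borel_measurable_divide)
qed

lemma borel_measurable_wprod_PiM:
  assumes "layers p \<nu> \<subseteq> J" "j < p \<nu>"
  shows "(\<lambda>x. wprod p x \<nu> i j) \<in> borel_measurable (PiM J (\<lambda>_. borel))"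
  using borel_measurable_wprod[where x = "\<lambda>x. x" and N = "PiM J (\<lambda>_. borel)", OF _ assms]
  by (simp add: measurable_component_singleton)

lemma borel_measurable_wprod_column_PiM:
  assumes "layers p \<nu> \<subseteq> J" "layer_column p (Suc \<nu>) j \<subseteq> J"
  shows "(\<lambda>x. wprod p x (Suc \<nu>) i j) \<in> borel_measurable (PiM J (\<lambda>_. borel))"
  using borel_measurable_wprod_column[where x = "\<lambda>x. x" and N = "PiM J (\<lambda>_. borel)", OF _ assms]
  by (simp add: measurable_component_singleton del: wprod.simps)

abbreviation dmat :: "(nat \<Rightarrow> nat) \<Rightarrow> (nat \<times> nat \<times> nat \<Rightarrow> complex) \<Rightarrow> nat \<Rightarrow> nat \<Rightarrow> nat \<Rightarrow> complex" where
  "dmat p x \<nu> \<equiv> gram {..<p \<nu>} (wprod p x \<nu>)"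

definition colsq :: "nat \<Rightarrow> (nat \<Rightarrow> nat) \<Rightarrow> (nat \<times> nat \<times> nat \<Rightarrow> complex) \<Rightarrow> nat \<Rightarrow> nat \<Rightarrow> real" where
  "colsq n p x \<nu> k = (cnorm n (\<lambda>i. wprod p x \<nu> i k))\<^sup>2"

text \<open>A column is expected to have squared norm \<open>n / p \<nu>\<close>, which adds up to
  \<open>n\<close> over all columns; hence the summed deviations are divided by
  \<open>n\<close>.\<close>

definition dev :: "nat \<Rightarrow> (nat \<Rightarrow> nat) \<Rightarrow> (nat \<times> nat \<times> nat \<Rightarrow> complex) \<Rightarrow> nat \<Rightarrow> real" where
  "dev n p x \<nu> = (\<Sum>k<p \<nu>. \<bar>colsq n p x \<nu> k - n / p \<nu>\<bar>) / n"

lemma ctrace_dmat: "ctrace n (dmat p x \<nu>) = of_real (\<Sum>k<p \<nu>. colsq n p x \<nu> k)"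
proof -
  have "ctrace n (dmat p x \<nu>) = (\<Sum>k<p \<nu>. \<Sum>i<n. wprod p x \<nu> i k * cnj (wprod p x \<nu> i k))"
    unfolding ctrace_def gram_def by (rule sum.swap)
  then show ?thesis
    unfolding colsq_def cnorm_sq of_real_sum complex_norm_square .
qed

text \<open>Column \<open>k\<close> of the next product is the previous product applied to fresh
  entries, so a form with matrix \<open>C\<close> becomes a form in independent entries with
  \<open>C\<close> sandwiched between the previous product and its adjoint.\<close>

lemma cinner_column_form:
  assumes q: "0 < p (Suc \<nu>)"
  shows "cinner n (\<lambda>i. wprod p x (Suc \<nu>) i k) (mvec n C (\<lambda>i. wprod p x (Suc \<nu>) i k))
    = (\<Sum>i<p \<nu>. \<Sum>j<p \<nu>. cnj (x (Suc \<nu>, i, k)) * mmul n (adj (wprod p x \<nu>)) (mmul n C (wprod p x \<nu>)) i j * x (Suc \<nu>, j, k)) / p (Suc \<nu>)"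
proof -
  let ?W = "wprod p x \<nu>" and ?c = "\<lambda>l. x (Suc \<nu>, l, k) / of_real (sqrt (p (Suc \<nu>)))"
  have r: "(\<lambda>i. wprod p x (Suc \<nu>) i k) = mvec (p \<nu>) ?W ?c"
    by (rule ext) (simp add: mvec_def)
  have sq: "complex_of_real (sqrt (p (Suc \<nu>))) * of_real (sqrt (p (Suc \<nu>))) = of_nat (p (Suc \<nu>))"
    unfolding of_real_mult[symmetric] by simp
  have "cinner n (mvec (p \<nu>) ?W ?c) (mvec n C (mvec (p \<nu>) ?W ?c))
      = cnj (cinner n (mvec n C (mvec (p \<nu>) ?W ?c)) (mvec (p \<nu>) ?W ?c))" by (simp add: cnj_cinner)
  also have "\<dots> = cinner (p \<nu>) ?c (mvec n (adj ?W) (mvec n C (mvec (p \<nu>) ?W ?c)))"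
    unfolding cinner_mvec_adj cnj_cinner ..
  also have "\<dots> = cinner (p \<nu>) ?c (mvec (p \<nu>) (mmul n (adj ?W) (mmul n C ?W)) ?c)"
    by (simp add: mvec_mmul)
  also have "\<dots> = (\<Sum>i<p \<nu>. \<Sum>j<p \<nu>. cnj (x (Suc \<nu>, i, k)) * mmul n (adj ?W) (mmul n C ?W) i j * x (Suc \<nu>, j, k)) / p (Suc \<nu>)"
    unfolding cinner_def mvec_def[of "p \<nu>"] sum_distrib_left sum_divide_distrib
    by (intro sum.cong refl) (simp add: sq[symmetric] del: of_nat_Suc)
  finally show ?thesis unfolding r .
qed

lemma ctrace_sandwich: "ctrace n (mmul n (gram {..<p} W) C) = (\<Sum>i<p. mmul n (adj W) (mmul n C W) i i)"
  unfolding ctrace_mmul_gram by (intro sum.cong refl) (simp add: cinner_def mvec_def mmul_def adj_def)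

lemma cmod_sandwich_diag_le:
  assumes "opbound n c C"
  shows "cmod (mmul n (adj W) (mmul n C W) i i) \<le> c * (cnorm n (\<lambda>l. W l i))\<^sup>2"
  using cmod_cinner_mvec_le[OF assms, of "\<lambda>l. W l i"] by (simp add: cinner_def mvec_def mmul_def adj_def)

section \<open>Recursion for the Frobenius norm and the column norms\<close>

locale random_layers = prob_space M for M :: "'a measure" +
  fixes n m :: nat and p :: "nat \<Rightarrow> nat" and X :: "nat \<times> nat \<times> nat \<Rightarrow> 'a \<Rightarrow> complex" and \<tau> L :: real
  assumes n: "0 < n" and p0: "p 0 = n" and pmono: "\<And>\<nu>. \<nu> < m \<Longrightarrow> p \<nu> \<le> p (Suc \<nu>)"
    and ind: "indep_vars (\<lambda>_. borel) X (layers p m)"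
    and X: "\<And>a. a \<in> layers p m \<Longrightarrow> integrable M (X a)"
      "\<And>a. a \<in> layers p m \<Longrightarrow> expectation (X a) = 0"
      "\<And>a. a \<in> layers p m \<Longrightarrow> integrable M (\<lambda>\<omega>. (cmod (X a \<omega>))\<^sup>2)"
      "\<And>a. a \<in> layers p m \<Longrightarrow> expectation (\<lambda>\<omega>. (cmod (X a \<omega>))\<^sup>2) = 1"
    and \<tau>: "0 < \<tau>"
    and L: "\<And>\<nu>. \<nu> \<in> {1..m} \<Longrightarrow> (\<Sum>j<p (\<nu> - 1). \<Sum>k<p \<nu>. lind (\<tau> * sqrt n) (X (\<nu>, j, k))) / (real n)\<^sup>2 \<le> L"
begin

abbreviation sample :: "'a \<Rightarrow> nat \<times> nat \<times> nat \<Rightarrow> complex" where "sample \<omega> \<equiv> (\<lambda>a. X a \<omega>)"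

definition "Efrob \<nu> = (\<integral>\<^sup>+\<omega>. ennreal (frob n (dmat p (sample \<omega>) \<nu>) / n) \<partial>M)"
definition "Edev \<nu> = (\<integral>\<^sup>+\<omega>. ennreal (dev n p (sample \<omega>) \<nu>) \<partial>M)"

lemma p_ge: "\<nu> \<le> m \<Longrightarrow> n \<le> p \<nu>"
proof (induction \<nu>)
  case (Suc \<nu>)
  then show ?case using pmono[of \<nu>] by simp
qed (simp add: p0)

lemma p_pos: "\<nu> \<le> m \<Longrightarrow> 0 < p \<nu>"
  using p_ge[of \<nu>] n by simp

lemma borel_measurable_X: "a \<in> layers p m \<Longrightarrow> X a \<in> borel_measurable M"
  by (rule borel_measurable_integrable[OF X(1)])

lemma borel_measurable_wprod_sample:
  "\<nu> \<le> m \<Longrightarrow> k < p \<nu> \<Longrightarrow> (\<lambda>\<omega>. wprod p (sample \<omega>) \<nu> i k) \<in> borel_measurable M"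
  by (rule borel_measurable_wprod[OF borel_measurable_X layers_mono])

lemma mat_measurable_dmat: "\<nu> \<le> m \<Longrightarrow> mat_measurable M n (\<lambda>\<omega>. dmat p (sample \<omega>) \<nu>)"
  by (intro mat_measurable_gram borel_measurable_wprod_sample) auto

lemma borel_measurable_frob_dmat: "\<nu> \<le> m \<Longrightarrow> (\<lambda>\<omega>. frob n (dmat p (sample \<omega>) \<nu>)) \<in> borel_measurable M"
  by (rule borel_measurable_frob[OF mat_measurable_dmat])

lemma borel_measurable_colsq:
  assumes "\<nu> \<le> m" "k < p \<nu>"
  shows "(\<lambda>\<omega>. colsq n p (sample \<omega>) \<nu> k) \<in> borel_measurable M"
proof -
  have "(\<lambda>\<omega>. cmod (wprod p (sample \<omega>) \<nu> i k)) \<in> borel_measurable M" for i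
    by (rule measurable_compose[OF borel_measurable_wprod_sample[OF assms] borel_measurable_norm])
  then show ?thesis
    unfolding colsq_def cnorm_sq by (intro borel_measurable_sum borel_measurable_power)
qed

lemma borel_measurable_dev:
  assumes "\<nu> \<le> m" shows "(\<lambda>\<omega>. dev n p (sample \<omega>) \<nu>) \<in> borel_measurable M"
  unfolding dev_def
  by (intro borel_measurable_divide borel_measurable_sum borel_measurable_abs borel_measurable_diff
    borel_measurable_const borel_measurable_colsq assms) auto

lemma dev_nonneg: "0 \<le> dev n p x \<nu>"
  unfolding dev_def by (intro divide_nonneg_nonneg sum_nonneg) auto

text \<open>\<open>C k\<close> may involve all entries except those of column \<open>k\<close> of
  the new layer, and these are exactly the variables of the \<open>k\<close>-th form. The
  normalisation by \<open>q\<close> makes the sum over the columns an average, so that a single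
  constant \<open>c\<close> remains.\<close>

lemma quadratic_forms_sum:
  fixes C :: "nat \<Rightarrow> (nat \<times> nat \<times> nat \<Rightarrow> complex) \<Rightarrow> nat \<Rightarrow> nat \<Rightarrow> complex" and c :: real
  assumes \<nu>: "\<nu> < m" and c: "0 \<le> c"
    and opb: "\<And>k x. k < p (Suc \<nu>) \<Longrightarrow> opbound n c (C k x)"
    and meas: "\<And>k. k < p (Suc \<nu>) \<Longrightarrow> mat_measurable (PiM (layers p m - layer_column p (Suc \<nu>) k) (\<lambda>_. borel)) n (C k)"
    and inv: "\<And>k x i j. k < p (Suc \<nu>) \<Longrightarrow> i < n \<Longrightarrow> j < n \<Longrightarrow> C k (restrict x (layers p m - layer_column p (Suc \<nu>) k)) i j = C k x i j"
  shows "(\<Sum>k<p (Suc \<nu>). \<integral>\<^sup>+\<omega>. ennreal (cmod (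
      cinner n (\<lambda>i. wprod p (sample \<omega>) (Suc \<nu>) i k) (mvec n (C k (sample \<omega>)) (\<lambda>i. wprod p (sample \<omega>) (Suc \<nu>) i k))
      - ctrace n (mmul n (dmat p (sample \<omega>) \<nu>) (C k (sample \<omega>))) / p (Suc \<nu>)) / n) \<partial>M)
    \<le> ennreal c * (2 * Efrob \<nu> + 2 * Edev \<nu> + ennreal (\<tau> + 2 * L))"
proof -
  define q where "q = p (Suc \<nu>)"
  define P where "P = p \<nu>"
  have q: "0 < q" "n \<le> q" and P: "0 < P" "n \<le> P"
    unfolding q_def P_def using p_pos p_ge \<nu> by auto
  define J where "J k = layers p m - layer_column p (Suc \<nu>) k" for k
  \<comment> \<open>A diagonal entry of the sandwiched matrix is at most \<open>c\<close> times a
    squared column norm, hence at most this \<open>b\<close> plus an excess that \<open>dev\<close>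
    sums up. The truncation level \<open>\<theta>\<close> is that of the Lindeberg
    condition.\<close>
  define b where "b = c * (n / P)"
  define \<theta> where "\<theta> = \<tau> * sqrt n"
  define l where "l k = (\<Sum>i<P. lind \<theta> (X (Suc \<nu>, i, k)))" for k
  define f where "f \<omega> = 2 * (frob n (dmat p (sample \<omega>) \<nu>) / n) + 2 * dev n p (sample \<omega>) \<nu>" for \<omega>
  have b: "0 \<le> b" unfolding b_def using c by simp
  have \<theta>: "0 \<le> \<theta>" unfolding \<theta>_def using \<tau> by simp
  have f0: "0 \<le> f \<omega>" for \<omega>
    unfolding f_def using dev_nonneg by (intro add_nonneg_nonneg mult_nonneg_nonneg divide_nonneg_nonneg) auto
  have mf[measurable]: "f \<in> borel_measurable M"
    unfolding f_def
    by (intro borel_measurable_add borel_measurable_times borel_measurable_divide borel_measurable_const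
      borel_measurable_dev borel_measurable_frob_dmat) (use \<nu> in auto)
  have If: "(\<integral>\<^sup>+\<omega>. ennreal (f \<omega>) \<partial>M) = 2 * Efrob \<nu> + 2 * Edev \<nu>"
  proof -
    have "(\<integral>\<^sup>+\<omega>. ennreal (f \<omega>) \<partial>M) = (\<integral>\<^sup>+\<omega>. 2 * ennreal (frob n (dmat p (sample \<omega>) \<nu>) / n) + 2 * ennreal (dev n p (sample \<omega>) \<nu>) \<partial>M)"
    proof (rule nn_integral_cong)
      fix \<omega>
      have *: "ennreal (2 * a + 2 * b) = 2 * ennreal a + 2 * ennreal b" if "0 \<le> a" "0 \<le> b" for a b :: real
        using that by (simp add: ennreal_plus ennreal_mult')
      show "ennreal (f \<omega>) = 2 * ennreal (frob n (dmat p (sample \<omega>) \<nu>) / n) + 2 * ennreal (dev n p (sample \<omega>) \<nu>)"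
        unfolding f_def by (intro * dev_nonneg divide_nonneg_nonneg frob_nonneg) simp
    qed
    then show ?thesis
      unfolding Efrob_def Edev_def using borel_measurable_dev[of \<nu>] borel_measurable_frob_dmat[of \<nu>] \<nu>
      by (simp add: nn_integral_add nn_integral_cmult)
  qed
  have l0: "0 \<le> l k" for k unfolding l_def by (intro sum_nonneg lind_nonneg)
  have each: "(\<integral>\<^sup>+\<omega>. ennreal (cmod (
      cinner n (\<lambda>i. wprod p (sample \<omega>) (Suc \<nu>) i k) (mvec n (C k (sample \<omega>)) (\<lambda>i. wprod p (sample \<omega>) (Suc \<nu>) i k))
      - ctrace n (mmul n (dmat p (sample \<omega>) \<nu>) (C k (sample \<omega>))) / q) / n) \<partial>M)
      \<le> ennreal (c / q) * (2 * Efrob \<nu> + 2 * Edev \<nu>) + ennreal (c * \<tau> / q + 2 * c * l k / (q * n))"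
    if k: "k < q" for k
  proof -
    define \<gamma> where "\<gamma> i j x = mmul n (adj (wprod p x \<nu>)) (mmul n (C k x) (wprod p x \<nu>)) i j" for i j x
    define S where "S \<omega> = (\<Sum>i<P. \<Sum>j<P. cnj (X (Suc \<nu>, i, k) \<omega>) * \<gamma> i j (sample \<omega>) * X (Suc \<nu>, j, k) \<omega>) - (\<Sum>i<P. \<gamma> i i (sample \<omega>))" for \<omega>
    have kq: "k < p (Suc \<nu>)" using k by (simp add: q_def)
    have eq: "cinner n (\<lambda>i. wprod p (sample \<omega>) (Suc \<nu>) i k) (mvec n (C k (sample \<omega>)) (\<lambda>i. wprod p (sample \<omega>) (Suc \<nu>) i k))
      - ctrace n (mmul n (dmat p (sample \<omega>) \<nu>) (C k (sample \<omega>))) / q = S \<omega> / q" for \<omega>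
      using q(1) unfolding S_def \<gamma>_def q_def P_def
      by (simp only: cinner_column_form ctrace_sandwich diff_divide_distrib)
    have layJ: "layers p \<nu> \<subseteq> J k"
      unfolding J_def using layers_mono[of \<nu> m p] \<nu> by (auto simp: layer_column_def layers_def)
    have colI: "(\<lambda>l. (Suc \<nu>, l, k)) ` {..<P} \<subseteq> layers p m"
      unfolding layers_def P_def using kq \<nu> by auto
    have bound: "(\<integral>\<^sup>+\<omega>. ennreal (cmod (S \<omega>)) \<partial>M)
      \<le> (\<integral>\<^sup>+\<omega>. ennreal (2 * frob P (\<lambda>i j. \<gamma> i j (sample \<omega>)) + b * \<theta> * sqrt P + 2 * b * l k
         + 2 * (\<Sum>i<P. c * \<bar>colsq n p (sample \<omega>) \<nu> i - n / P\<bar>)) \<partial>M)"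
      unfolding S_def l_def
    proof (rule quadratic_form_deviation_indep[OF ind _ colI, where J = "J k" and d = "\<lambda>i x. c * \<bar>colsq n p x \<nu> i - n / P\<bar>"])
      show "inj_on (\<lambda>l. (Suc \<nu>, l, k)) {..<P}" by (auto simp: inj_on_def)
      show "J k \<subseteq> layers p m" "J k \<inter> (\<lambda>l. (Suc \<nu>, l, k)) ` {..<P} = {}"
        unfolding J_def layer_column_def P_def by auto
      show "0 \<le> \<theta>" "0 \<le> b" by fact+
      fix i j x assume i: "i < P" and j: "j < P"
      have [measurable]: "(\<lambda>x. wprod p x \<nu> a j) \<in> borel_measurable (PiM (J k) (\<lambda>_. borel))" if "j < P" for a j
        by (rule borel_measurable_wprod_PiM[OF layJ]) (use that in \<open>auto simp: P_def\<close>)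
      have mC: "(\<lambda>x. C k x a b) \<in> borel_measurable (PiM (J k) (\<lambda>_. borel))" if "a < n" "b < n" for a b
        using mat_measurableD[OF meas[OF kq] that] unfolding J_def .
      show "\<gamma> i j \<in> borel_measurable (PiM (J k) (\<lambda>_. borel))"
        unfolding \<gamma>_def mmul_def adj_def
        by (intro borel_measurable_sum borel_measurable_times mC measurable_compose[OF _ cnj_borel_measurable] borel_measurable_wprod_PiM[OF layJ])
          (use i j in \<open>auto simp: P_def\<close>)
      have W: "wprod p (restrict x (J k)) \<nu> a j = wprod p x \<nu> a j" if "j < P" for a j
        by (rule wprod_restrict[OF layJ]) (use that in \<open>simp add: P_def\<close>)
      show "\<gamma> i j (restrict x (J k)) = \<gamma> i j x"
        unfolding \<gamma>_def mmul_def adj_def using i j inv[OF kq, folded J_def] by (simp add: W)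
    next
      fix i x assume i: "i < P"
      show "0 \<le> c * \<bar>colsq n p x \<nu> i - n / P\<bar>" using c by simp
      have "cmod (\<gamma> i i x) \<le> c * colsq n p x \<nu> i"
        unfolding \<gamma>_def colsq_def by (rule cmod_sandwich_diag_le[OF opb[OF kq]])
      also have "\<dots> \<le> c * (n / P + \<bar>colsq n p x \<nu> i - n / P\<bar>)"
        using c by (intro mult_left_mono) auto
      finally show "cmod (\<gamma> i i x) \<le> b + c * \<bar>colsq n p x \<nu> i - n / P\<bar>"
        unfolding b_def by (simp add: distrib_left)
    qed (use X colI in auto)
    have le: "2 * frob P (\<lambda>i j. \<gamma> i j (sample \<omega>)) + b * \<theta> * sqrt P + 2 * b * l k
         + 2 * (\<Sum>i<P. c * \<bar>colsq n p (sample \<omega>) \<nu> i - n / P\<bar>) \<le> c * n * f \<omega> + (c * n * \<tau> + 2 * c * l k)" for \<omega>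
    proof -
      have 1: "frob P (\<lambda>i j. \<gamma> i j (sample \<omega>)) \<le> c * frob n (dmat p (sample \<omega>) \<nu>)"
        unfolding \<gamma>_def P_def by (rule frob_sandwich_le[OF opb[OF kq] c])
      have nP: "n / P \<le> 1" using P by simp
      \<comment> \<open>This is \<open>c \<tau> n\<close> times \<open>sqrt n / sqrt P\<close>, and
        \<open>n \<le> P\<close>; after the division by \<open>n\<close> only
        \<open>c \<tau>\<close> is left.\<close>
      have "b * \<theta> * sqrt P = c * \<tau> * (n * (sqrt n / sqrt P))"
      proof -
        define s where "s = sqrt P"
        have s: "real P = s * s" "0 < s" unfolding s_def using P by auto
        show ?thesis
          unfolding b_def \<theta>_def s_def[symmetric] unfolding s(1) using s(2) by (simp add: field_simps)
      qed
      also have "\<dots> \<le> c * \<tau> * (real n * 1)"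
      proof (rule mult_left_mono[OF mult_left_mono])
        show "sqrt n / sqrt P \<le> 1" using P by (simp add: divide_le_eq)
      qed (use c \<tau> in auto)
      finally have 2: "b * \<theta> * sqrt P \<le> c * n * \<tau>" by (simp add: mult_ac)
      have "b * l k \<le> c * l k"
        unfolding b_def using mult_left_mono[OF nP c] l0[of k] by (intro mult_right_mono) simp_all
      moreover have "(\<Sum>i<P. c * \<bar>colsq n p (sample \<omega>) \<nu> i - n / P\<bar>) = c * n * dev n p (sample \<omega>) \<nu>"
        unfolding dev_def P_def sum_distrib_left[symmetric] using n by simp
      moreover have "c * n * f \<omega> = 2 * (c * frob n (dmat p (sample \<omega>) \<nu>)) + 2 * (c * n * dev n p (sample \<omega>) \<nu>)"
        unfolding f_def using n by (simp add: field_simps)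
      ultimately show ?thesis using 1 2 by linarith
    qed
    have "(\<integral>\<^sup>+\<omega>. ennreal (cmod (S \<omega> / q) / n) \<partial>M) = (\<integral>\<^sup>+\<omega>. ennreal (1 / (q * n)) * ennreal (cmod (S \<omega>)) \<partial>M)"
      by (intro nn_integral_cong) (simp add: ennreal_mult'[symmetric] norm_divide)
    also have "\<dots> = ennreal (1 / (q * n)) * (\<integral>\<^sup>+\<omega>. ennreal (cmod (S \<omega>)) \<partial>M)"
    proof (rule nn_integral_cmult)
      have "(\<lambda>\<omega>. \<gamma> i j (sample \<omega>)) \<in> borel_measurable M" if "i < P" "j < P" for i j
      proof -
        have "(\<lambda>\<omega>. restrict (sample \<omega>) (J k)) \<in> measurable M (PiM (J k) (\<lambda>_. borel))"
          by (intro measurable_restrict borel_measurable_X) (auto simp: J_def)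
        note mR = this
        have mC: "(\<lambda>\<omega>. C k (sample \<omega>) a b) \<in> borel_measurable M" if "a < n" "b < n" for a b
          using measurable_compose[OF mR mat_measurableD[OF meas[OF kq] that, folded J_def]] inv[OF kq that]
          unfolding J_def by simp
        show ?thesis
          unfolding \<gamma>_def mmul_def adj_def
          by (intro borel_measurable_sum borel_measurable_times mC measurable_compose[OF _ cnj_borel_measurable] borel_measurable_wprod_sample)
            (use that \<nu> in \<open>auto simp: P_def\<close>)
      qed
      moreover have "X (Suc \<nu>, i, k) \<in> borel_measurable M" if "i < P" for i
        using borel_measurable_X colI that by auto
      ultimately have "S \<in> borel_measurable M"
        unfolding S_def
        by (intro borel_measurable_diff borel_measurable_sum borel_measurable_times measurable_compose[OF _ cnj_borel_measurable]) auto
      then show "(\<lambda>\<omega>. ennreal (cmod (S \<omega>))) \<in> borel_measurable M" by measurable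
    qed
    also have "\<dots> \<le> ennreal (1 / (q * n)) * (\<integral>\<^sup>+\<omega>. ennreal (c * n * f \<omega> + (c * n * \<tau> + 2 * c * l k)) \<partial>M)"
      by (intro mult_left_mono order_trans[OF bound] nn_integral_mono ennreal_leI le) auto
    also have "\<dots> = (\<integral>\<^sup>+\<omega>. ennreal (1 / (q * n)) * ennreal (c * n * f \<omega> + (c * n * \<tau> + 2 * c * l k)) \<partial>M)"
      by (subst nn_integral_cmult) auto
    also have "\<dots> = (\<integral>\<^sup>+\<omega>. ennreal (c / q) * ennreal (f \<omega>) + ennreal (c * \<tau> / q + 2 * c * l k / (q * n)) \<partial>M)"
    proof (rule nn_integral_cong)
      fix \<omega>
      have "1 / (q * n) * (c * n * f \<omega> + (c * n * \<tau> + 2 * c * l k)) = c / q * f \<omega> + (c * \<tau> / q + 2 * c * l k / (q * n))"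
        using n q by (simp add: field_simps)
      moreover have "0 \<le> c / q * f \<omega>" "0 \<le> c * \<tau> / q + 2 * c * l k / (q * n)"
        using c f0 l0 \<tau> by (auto intro!: add_nonneg_nonneg divide_nonneg_nonneg mult_nonneg_nonneg)
      ultimately show "ennreal (1 / (q * n)) * ennreal (c * n * f \<omega> + (c * n * \<tau> + 2 * c * l k))
          = ennreal (c / q) * ennreal (f \<omega>) + ennreal (c * \<tau> / q + 2 * c * l k / (q * n))"
        using c by (simp add: ennreal_mult'[symmetric] ennreal_plus[symmetric] del: ennreal_plus)
    qed
    also have "\<dots> = ennreal (c / q) * (2 * Efrob \<nu> + 2 * Edev \<nu>) + ennreal (c * \<tau> / q + 2 * c * l k / (q * n))"
      by (simp add: nn_integral_add nn_integral_cmult If emeasure_space_1)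
    finally show ?thesis unfolding eq .
  qed
  have s1: "(\<Sum>k<q. ennreal (c / q)) = ennreal c"
  proof -
    have "(\<Sum>k<q. ennreal (c / q)) = ennreal (\<Sum>k<q. c / q)"
      using c by (intro sum_ennreal) simp
    then show ?thesis using q by simp
  qed
  \<comment> \<open>The average over the columns carries \<open>1 / (q n)\<close>, which by
    \<open>n \<le> q\<close> is at most the \<open>1 / n^2\<close> of the Lindeberg sum.\<close>
  have "(\<Sum>k<q. l k) / (q * n) \<le> (\<Sum>k<q. l k) / (real n)\<^sup>2"
    using l0 q n by (intro divide_left_mono sum_nonneg) (auto simp: power2_eq_square)
  also have "\<dots> = (\<Sum>j<p (Suc \<nu> - 1). \<Sum>k<p (Suc \<nu>). lind (\<tau> * sqrt n) (X (Suc \<nu>, j, k))) / (real n)\<^sup>2"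
    unfolding l_def q_def P_def \<theta>_def by (subst sum.swap) simp
  also have "\<dots> \<le> L" by (rule L) (use \<nu> in auto)
  finally have lL: "(\<Sum>k<q. l k) / (q * n) \<le> L" .
  have "(\<Sum>k<q. c * \<tau> / q + 2 * c * l k / (q * n)) = c * \<tau> + 2 * c * ((\<Sum>k<q. l k) / (q * n))"
    using q by (simp add: sum.distrib sum_divide_distrib sum_distrib_left)
  also have "\<dots> \<le> c * \<tau> + 2 * c * L"
    using lL c by (intro add_left_mono mult_left_mono) auto
  finally have s2: "(\<Sum>k<q. c * \<tau> / q + 2 * c * l k / (q * n)) \<le> c * (\<tau> + 2 * L)" by (simp add: algebra_simps)
  have s3: "(\<Sum>k<q. ennreal (c * \<tau> / q + 2 * c * l k / (q * n))) = ennreal (\<Sum>k<q. c * \<tau> / q + 2 * c * l k / (q * n))"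
    using c l0 \<tau> by (intro sum_ennreal) (auto intro!: add_nonneg_nonneg divide_nonneg_nonneg mult_nonneg_nonneg)
  have "(\<Sum>k<q. ennreal (c / q) * (2 * Efrob \<nu> + 2 * Edev \<nu>) + ennreal (c * \<tau> / q + 2 * c * l k / (q * n)))
      = ennreal c * (2 * Efrob \<nu> + 2 * Edev \<nu>) + ennreal (\<Sum>k<q. c * \<tau> / q + 2 * c * l k / (q * n))"
    unfolding sum.distrib sum_distrib_right[symmetric] s1 s3 ..
  also have "\<dots> \<le> ennreal c * (2 * Efrob \<nu> + 2 * Edev \<nu>) + ennreal c * ennreal (\<tau> + 2 * L)"
    using s2 c by (intro add_left_mono) (simp add: ennreal_mult'[symmetric] ennreal_leI)
  finally have "(\<Sum>k<q. ennreal (c / q) * (2 * Efrob \<nu> + 2 * Edev \<nu>) + ennreal (c * \<tau> / q + 2 * c * l k / (q * n)))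
      \<le> ennreal c * (2 * Efrob \<nu> + 2 * Edev \<nu> + ennreal (\<tau> + 2 * L))"
    by (simp only: distrib_left)
  then show ?thesis
    unfolding q_def[symmetric] by (rule order_trans[rotated]) (rule sum_mono, rule each, simp)
qed

lemma colsq_eq: "complex_of_real (colsq n p x \<nu> k) = cinner n (\<lambda>i. wprod p x \<nu> i k) (mvec n idm (\<lambda>i. wprod p x \<nu> i k))"
proof -
  have "cinner n (\<lambda>i. wprod p x \<nu> i k) (mvec n idm (\<lambda>i. wprod p x \<nu> i k)) = cinner n (\<lambda>i. wprod p x \<nu> i k) (\<lambda>i. wprod p x \<nu> i k)"
    by (rule cinner_cong) (simp_all add: mvec_idm)
  then show ?thesis unfolding colsq_def cinner_self by simp
qed

lemma sum_colsq_dev: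
  assumes "\<nu> \<le> m" shows "\<bar>(\<Sum>k<p \<nu>. colsq n p x \<nu> k) - n\<bar> \<le> n * dev n p x \<nu>"
proof -
  have "(\<Sum>k<p \<nu>. colsq n p x \<nu> k) - n = (\<Sum>k<p \<nu>. colsq n p x \<nu> k - n / p \<nu>)"
    using p_pos[OF assms] by (simp add: sum_subtractf)
  then show ?thesis
    unfolding dev_def using n sum_abs[of "\<lambda>k. colsq n p x \<nu> k - n / p \<nu>" "{..<p \<nu>}"] by simp
qed

text \<open>A squared column norm is the quadratic form with \<open>C\<close> the identity, centred
  at \<open>tr D / q\<close>. Since \<open>tr D\<close> differs from \<open>n\<close> by at most
  \<open>n\<close> times \<open>dev\<close> of the previous layer, a third copy of
  \<open>Edev\<close> appears.\<close>

lemma Edev_Suc: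
  assumes \<nu>: "\<nu> < m"
  shows "Edev (Suc \<nu>) \<le> 2 * Efrob \<nu> + 3 * Edev \<nu> + ennreal (\<tau> + 2 * L)"
proof -
  define q where "q = p (Suc \<nu>)"
  have q: "0 < q" unfolding q_def using p_pos \<nu> by auto
  define e where "e k \<omega> = cmod (
      cinner n (\<lambda>i. wprod p (sample \<omega>) (Suc \<nu>) i k) (mvec n idm (\<lambda>i. wprod p (sample \<omega>) (Suc \<nu>) i k))
      - ctrace n (mmul n (dmat p (sample \<omega>) \<nu>) idm) / q) / n" for k \<omega>
  have e: "e k \<omega> = \<bar>colsq n p (sample \<omega>) (Suc \<nu>) k - (\<Sum>i<p \<nu>. colsq n p (sample \<omega>) \<nu> i) / q\<bar> / n" for k \<omega>
  proof -
    have 1: "ctrace n (mmul n (dmat p (sample \<omega>) \<nu>) idm) = of_real (\<Sum>i<p \<nu>. colsq n p (sample \<omega>) \<nu> i)"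
      unfolding ctrace_dmat[symmetric] by (rule ctrace_cong) (simp add: mmul_idm)
    have 2: "complex_of_real a - of_real b / of_nat q = of_real (a - b / q)" for a b by simp
    show ?thesis unfolding e_def colsq_eq[symmetric] 1 2 norm_of_real ..
  qed
  have me: "(\<lambda>\<omega>. e k \<omega>) \<in> borel_measurable M" if "k < q" for k
    unfolding e
    by (intro borel_measurable_divide borel_measurable_abs borel_measurable_diff borel_measurable_sum
      borel_measurable_const borel_measurable_colsq) (use that \<nu> in \<open>auto simp: q_def\<close>)
  have le: "dev n p (sample \<omega>) (Suc \<nu>) \<le> (\<Sum>k<q. e k \<omega>) + dev n p (sample \<omega>) \<nu>" for \<omega>
  proof -
    let ?t = "\<Sum>i<p \<nu>. colsq n p (sample \<omega>) \<nu> i"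
    have "\<bar>colsq n p (sample \<omega>) (Suc \<nu>) k - n / q\<bar> \<le> n * e k \<omega> + n * dev n p (sample \<omega>) \<nu> / q" for k
    proof -
      have "\<bar>?t / q - n / q\<bar> \<le> n * dev n p (sample \<omega>) \<nu> / q"
        using sum_colsq_dev[of \<nu> "sample \<omega>"] \<nu> q
        by (simp add: diff_divide_distrib[symmetric] abs_divide divide_right_mono)
      moreover have "\<bar>colsq n p (sample \<omega>) (Suc \<nu>) k - ?t / q\<bar> = n * e k \<omega>"
        unfolding e using n by simp
      ultimately show ?thesis by linarith
    qed
    then have "(\<Sum>k<q. \<bar>colsq n p (sample \<omega>) (Suc \<nu>) k - n / q\<bar>) \<le> (\<Sum>k<q. n * e k \<omega> + n * dev n p (sample \<omega>) \<nu> / q)"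
      by (intro sum_mono)
    also have "\<dots> = n * ((\<Sum>k<q. e k \<omega>) + dev n p (sample \<omega>) \<nu>)"
      using q by (simp add: sum.distrib sum_distrib_left distrib_left)
    finally show ?thesis
      unfolding dev_def[of n p _ "Suc \<nu>"] q_def[symmetric] using n by (simp add: divide_le_eq mult.commute)
  qed
  have "Edev (Suc \<nu>) \<le> (\<integral>\<^sup>+\<omega>. (\<Sum>k<q. ennreal (e k \<omega>)) + ennreal (dev n p (sample \<omega>) \<nu>) \<partial>M)"
    unfolding Edev_def
  proof (rule nn_integral_mono)
    fix \<omega>
    have "0 \<le> e k \<omega>" for k unfolding e_def by simp
    then have "(\<Sum>k<q. ennreal (e k \<omega>)) + ennreal (dev n p (sample \<omega>) \<nu>) = ennreal ((\<Sum>k<q. e k \<omega>) + dev n p (sample \<omega>) \<nu>)"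
      using dev_nonneg by (simp add: sum_nonneg)
    then show "ennreal (dev n p (sample \<omega>) (Suc \<nu>)) \<le> (\<Sum>k<q. ennreal (e k \<omega>)) + ennreal (dev n p (sample \<omega>) \<nu>)"
      using ennreal_leI[OF le] by simp
  qed
  also have "\<dots> = (\<Sum>k<q. \<integral>\<^sup>+\<omega>. ennreal (e k \<omega>) \<partial>M) + Edev \<nu>"
  proof -
    have m: "(\<lambda>\<omega>. ennreal (e k \<omega>)) \<in> borel_measurable M" if "k \<in> {..<q}" for k
      by (rule measurable_compose[OF me measurable_ennreal]) (use that in simp)
    have "(\<lambda>\<omega>. \<Sum>k<q. ennreal (e k \<omega>)) \<in> borel_measurable M"
      by (intro borel_measurable_sum m)
    moreover have "(\<lambda>\<omega>. ennreal (dev n p (sample \<omega>) \<nu>)) \<in> borel_measurable M"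
      by (rule measurable_compose[OF borel_measurable_dev measurable_ennreal]) (use \<nu> in simp)
    ultimately show ?thesis
      unfolding Edev_def by (simp only: nn_integral_add nn_integral_sum[OF m])
  qed
  also have "\<dots> \<le> ennreal 1 * (2 * Efrob \<nu> + 2 * Edev \<nu> + ennreal (\<tau> + 2 * L)) + Edev \<nu>"
    unfolding e_def q_def
    by (intro add_right_mono quadratic_forms_sum \<nu> opbound_idm mat_measurable_const) auto
  also have "\<dots> = 2 * Efrob \<nu> + (2 * Edev \<nu> + Edev \<nu>) + ennreal (\<tau> + 2 * L)"
    by (simp add: ac_simps)
  also have "2 * Edev \<nu> + Edev \<nu> = (2 + 1) * Edev \<nu>" unfolding distrib_right by simp
  finally show ?thesis by simp
qed

text \<open>Between two different columns there is no diagonal to subtract, so the second moment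
  itself is bounded by the squared Frobenius norm.\<close>

lemma cross_form:
  assumes \<nu>: "\<nu> < m" and kl: "k < p (Suc \<nu>)" "l < p (Suc \<nu>)" "k \<noteq> l"
  shows "(\<integral>\<^sup>+\<omega>. ennreal ((cmod (\<Sum>i<p \<nu>. \<Sum>j<p \<nu>. cnj (X (Suc \<nu>, i, k) \<omega>) * G i j * X (Suc \<nu>, j, l) \<omega>))\<^sup>2) \<partial>M)
    \<le> ennreal ((frob (p \<nu>) G)\<^sup>2)"
proof -
  define P where "P = p \<nu>"
  \<comment> \<open>The two columns are laid end to end in one family of length
    \<open>P + P\<close>; the sets \<open>J\<close> let only indices of the first block meet indices
    of the second.\<close>
  define h where "h i = (if i < P then (Suc \<nu>, i, k) else (Suc \<nu>, i - P, l))" for i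
  define J where "J j = (if j < P then {} else {..<P})" for j
  have inj: "inj_on h {..<P + P}" using kl(3) unfolding h_def inj_on_def by (auto split: if_splits)
  have sub: "h ` {..<P + P} \<subseteq> layers p m" using kl \<nu> unfolding h_def layers_def P_def by auto
  have hin: "h j \<in> layers p m" if "j < P + P" for j using sub that by auto
  have ind': "indep_vars (\<lambda>_. borel) (\<lambda>i. X (h i)) {..<P + P}"
    by (rule indep_vars_reindex[OF inj indep_vars_subset[OF ind sub]])
  have split: "(\<Sum>j<P + P. \<Sum>i\<in>J j. g i j) = (\<Sum>j<P. \<Sum>i<P. g i (P + j))" for g :: "nat \<Rightarrow> nat \<Rightarrow> 'z::comm_monoid_add"
  proof -
    have sum_add: "(\<Sum>j<a + b. f j) = (\<Sum>j<a. f j) + (\<Sum>j<b. f (a + j))" for a b and f :: "nat \<Rightarrow> 'z"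
      by (induction b) (simp_all add: add.assoc)
    have "(\<Sum>j<P + P. \<Sum>i\<in>J j. g i j) = (\<Sum>j<P. \<Sum>i\<in>J j. g i j) + (\<Sum>j<P. \<Sum>i\<in>J (P + j). g i (P + j))"
      by (rule sum_add)
    then show ?thesis by (simp add: J_def)
  qed
  have "(\<integral>\<^sup>+\<omega>. ennreal ((cmod (\<Sum>j<P + P. \<Sum>i\<in>J j. cnj (X (h i) \<omega>) * G i (j - P) * X (h j) \<omega>))\<^sup>2) \<partial>M)
      \<le> ennreal (\<Sum>j<P + P. \<Sum>i\<in>J j. (cmod (G i (j - P)))\<^sup>2)"
    by (rule bilinear_form_square(1)[OF ind' X(1)[OF hin] X(2)[OF hin] X(3)[OF hin] X(4)[OF hin], where G = "\<lambda>i j. G i (j - P)"])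
      (auto simp: J_def)
  moreover have "(\<Sum>j<P + P. \<Sum>i\<in>J j. (cmod (G i (j - P)))\<^sup>2) = (frob P G)\<^sup>2"
    unfolding split frob_sq by (subst sum.swap) simp
  moreover have "(\<Sum>j<P + P. \<Sum>i\<in>J j. cnj (X (h i) \<omega>) * G i (j - P) * X (h j) \<omega>)
      = (\<Sum>i<P. \<Sum>j<P. cnj (X (Suc \<nu>, i, k) \<omega>) * G i j * X (Suc \<nu>, j, l) \<omega>)" for \<omega>
    unfolding split by (subst sum.swap) (simp add: h_def)
  ultimately show ?thesis unfolding P_def[symmetric] by simp
qed

text \<open>With the earlier layers frozen, each off-diagonal entry has second moment at most the
  squared Frobenius norm of the previous layer over \<open>q^2\<close>, and there are fewer than
  \<open>q^2\<close> of them. So the off-diagonal part is in mean no larger than the whole norm one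
  layer earlier.\<close>

lemma offdiag_le:
  assumes \<nu>: "\<nu> < m"
  defines "T \<equiv> \<lambda>x. mmul n (adj (wprod p x (Suc \<nu>))) (wprod p x (Suc \<nu>))"
  shows "(\<integral>\<^sup>+\<omega>. ennreal (sqrt (\<Sum>k<p (Suc \<nu>). \<Sum>l\<in>{..<p (Suc \<nu>)} - {k}. (cmod (T (sample \<omega>) k l))\<^sup>2) / n) \<partial>M) \<le> Efrob \<nu>"
proof -
  define q where "q = p (Suc \<nu>)"
  define P where "P = p \<nu>"
  have q: "0 < q" unfolding q_def using p_pos \<nu> by auto
  define K where "K = layers p m - layers p \<nu>"
  define U where "U x = mmul n (adj (wprod p x \<nu>)) (wprod p x \<nu>)" for x
  define g where "g k l x y = (\<Sum>i<P. \<Sum>j<P. cnj (y (Suc \<nu>, i, k)) * U x i j * y (Suc \<nu>, j, l))" for k l and x y :: "nat \<times> nat \<times> nat \<Rightarrow> complex"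
  have T: "T x k l = g k l x x / q" for x k l
  proof -
    let ?W = "wprod p x \<nu>" and ?c = "\<lambda>k l. x (Suc \<nu>, l, k) / of_real (sqrt (p (Suc \<nu>)))"
    have sq: "complex_of_real (sqrt (p (Suc \<nu>))) * of_real (sqrt (p (Suc \<nu>))) = of_nat (p (Suc \<nu>))"
      unfolding of_real_mult[symmetric] by simp
    have r: "wprod p x (Suc \<nu>) i k = mvec (p \<nu>) ?W (?c k) i" for i k
      by (simp add: mvec_def)
    have "T x k l = cinner n (mvec (p \<nu>) ?W (?c k)) (mvec (p \<nu>) ?W (?c l))"
      unfolding T_def mmul_def adj_def cinner_def r ..
    also have "\<dots> = cnj (cinner n (mvec (p \<nu>) ?W (?c l)) (mvec (p \<nu>) ?W (?c k)))" by (simp add: cnj_cinner)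
    also have "\<dots> = cinner (p \<nu>) (?c k) (mvec n (adj ?W) (mvec (p \<nu>) ?W (?c l)))"
      unfolding cinner_mvec_adj cnj_cinner ..
    also have "\<dots> = cinner (p \<nu>) (?c k) (mvec (p \<nu>) (U x) (?c l))"
      by (simp add: mvec_mmul U_def)
    also have "\<dots> = g k l x x / q"
      unfolding cinner_def mvec_def g_def q_def P_def sum_distrib_left sum_divide_distrib
      by (intro sum.cong refl) (simp add: sq[symmetric] del: of_nat_Suc)
    finally show ?thesis .
  qed
  define A where "A \<omega> = (\<lambda>a\<in>layers p \<nu>. X a \<omega>)" for \<omega>
  define B where "B \<omega> = (\<lambda>a\<in>K. X a \<omega>)" for \<omega>
  have indAB: "indep_var (PiM (layers p \<nu>) (\<lambda>_. borel)) A (PiM K (\<lambda>_. borel)) B"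
    unfolding A_def B_def by (rule indep_var_restrict[OF ind]) (use layers_mono[of \<nu> m p] \<nu> in \<open>auto simp: K_def\<close>)
  define F where "F = (\<lambda>(x, y). ennreal (sqrt (\<Sum>k<q. \<Sum>l\<in>{..<q} - {k}. (cmod (g k l x y / q))\<^sup>2) / n))"
  have inK: "(Suc \<nu>, i, k) \<in> K" if "i < P" "k < q" for i k
    using that \<nu> unfolding K_def layers_def P_def q_def by auto
  have UA: "U (A \<omega>) i j = U (sample \<omega>) i j" if "i < P" "j < P" for i j \<omega>
    unfolding U_def A_def mmul_def adj_def using that by (simp add: wprod_restrict P_def)
  have gAB: "g k l (A \<omega>) (B \<omega>') = g k l (sample \<omega>) (sample \<omega>')" if "k < q" "l < q" for k l \<omega> \<omega>'
    unfolding g_def using that inK by (intro sum.cong refl) (simp add: UA B_def)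
  have FAB: "F (A \<omega>, B \<omega>') = ennreal (sqrt (\<Sum>k<q. \<Sum>l\<in>{..<q} - {k}. (cmod (g k l (sample \<omega>) (sample \<omega>') / q))\<^sup>2) / n)" for \<omega> \<omega>'
    unfolding F_def by (simp add: gAB)
  have F: "F \<in> borel_measurable (PiM (layers p \<nu>) (\<lambda>_. borel) \<Otimes>\<^sub>M PiM K (\<lambda>_. borel))"
  proof -
    let ?P = "PiM (layers p \<nu>) (\<lambda>_. borel :: complex measure) \<Otimes>\<^sub>M PiM K (\<lambda>_. borel :: complex measure)"
    have 1: "(\<lambda>z. snd z a) \<in> borel_measurable ?P" if "a \<in> K" for a
      by (rule measurable_compose[OF measurable_snd measurable_component_singleton]) (use that in auto)
    have 2: "(\<lambda>z. wprod p (fst z) \<nu> i j) \<in> borel_measurable ?P" if "j < P" for i j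
      by (rule measurable_compose[OF measurable_fst borel_measurable_wprod_PiM]) (use that in \<open>auto simp: P_def\<close>)
    have 3: "(\<lambda>z. U (fst z) i j) \<in> borel_measurable ?P" if "i < P" "j < P" for i j
      unfolding U_def mmul_def adj_def
      by (intro borel_measurable_sum borel_measurable_times measurable_compose[OF _ cnj_borel_measurable] 2 that)
    have 4: "(\<lambda>z. g k l (fst z) (snd z)) \<in> borel_measurable ?P" if "k < q" "l < q" for k l
      unfolding g_def
      by (intro borel_measurable_sum borel_measurable_times measurable_compose[OF _ cnj_borel_measurable] 1 3 inK) (use that in auto)
    have "(\<lambda>z. (cmod (g k l (fst z) (snd z) / q))\<^sup>2) \<in> borel_measurable ?P" if "k < q" "l < q" for k l
      using 4[OF that] by measurable
    then have "(\<lambda>z. \<Sum>k<q. \<Sum>l\<in>{..<q} - {k}. (cmod (g k l (fst z) (snd z) / q))\<^sup>2) \<in> borel_measurable ?P"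
      by (intro borel_measurable_sum) auto
    then show ?thesis
      unfolding F_def split_beta by measurable
  qed
  have inner: "(\<integral>\<^sup>+\<omega>'. F (A \<omega>, B \<omega>') \<partial>M) \<le> ennreal (frob n (dmat p (sample \<omega>) \<nu>) / n)" for \<omega>
  proof -
    let ?x = "sample \<omega>"
    define S where "S \<omega>' = (\<Sum>k<q. \<Sum>l\<in>{..<q} - {k}. (cmod (g k l ?x (sample \<omega>') / q))\<^sup>2)" for \<omega>'
    have S0: "0 \<le> S \<omega>'" for \<omega>' unfolding S_def by (intro sum_nonneg) auto
    have mg: "(\<lambda>\<omega>'. g k l ?x (sample \<omega>')) \<in> borel_measurable M" if "k < q" "l < q" for k l
      unfolding g_def
      by (intro borel_measurable_sum borel_measurable_times measurable_compose[OF _ cnj_borel_measurable] borel_measurable_const borel_measurable_X)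
        (use that inK in \<open>auto simp: K_def\<close>)
    then have mg2: "(\<lambda>\<omega>'. (cmod (g k l ?x (sample \<omega>') / q))\<^sup>2) \<in> borel_measurable M" if "k < q" "l < q" for k l
      using that by measurable
    have mS[measurable]: "S \<in> borel_measurable M"
      unfolding S_def using mg2 by (intro borel_measurable_sum) auto
    have fr: "frob P (U ?x) = frob n (dmat p ?x \<nu>)"
      unfolding U_def P_def by (rule frob_gram_flip)
    have "(\<integral>\<^sup>+\<omega>'. ennreal (cmod (of_real (sqrt (S \<omega>')))) \<partial>M) \<le> ennreal (frob n (dmat p ?x \<nu>))"
    proof (rule nn_integral_norm_le_sqrt)
      have "(\<integral>\<^sup>+\<omega>'. ennreal ((cmod (of_real (sqrt (S \<omega>'))))\<^sup>2) \<partial>M) = (\<integral>\<^sup>+\<omega>'. (\<Sum>k<q. \<Sum>l\<in>{..<q} - {k}. ennreal ((cmod (g k l ?x (sample \<omega>') / q))\<^sup>2)) \<partial>M)"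
        using S0 by (intro nn_integral_cong) (simp add: S_def sum_nonneg)
      also have "\<dots> = (\<Sum>k<q. \<Sum>l\<in>{..<q} - {k}. \<integral>\<^sup>+\<omega>'. ennreal ((cmod (g k l ?x (sample \<omega>') / q))\<^sup>2) \<partial>M)"
      proof (subst nn_integral_sum)
        show "(\<lambda>\<omega>'. \<Sum>l\<in>{..<q} - {k}. ennreal ((cmod (g k l ?x (sample \<omega>') / q))\<^sup>2)) \<in> borel_measurable M" if "k \<in> {..<q}" for k
          using mg2 that by (intro borel_measurable_sum measurable_compose[OF _ measurable_ennreal]) auto
        show "(\<Sum>k<q. \<integral>\<^sup>+\<omega>'. (\<Sum>l\<in>{..<q} - {k}. ennreal ((cmod (g k l ?x (sample \<omega>') / q))\<^sup>2)) \<partial>M)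
            = (\<Sum>k<q. \<Sum>l\<in>{..<q} - {k}. \<integral>\<^sup>+\<omega>'. ennreal ((cmod (g k l ?x (sample \<omega>') / q))\<^sup>2) \<partial>M)"
          using mg2 by (intro sum.cong refl nn_integral_sum measurable_compose[OF _ measurable_ennreal]) auto
      qed
      also have "\<dots> \<le> (\<Sum>k<q. \<Sum>l\<in>{..<q} - {k}. ennreal ((frob P (U ?x))\<^sup>2 / (real q)\<^sup>2))"
      proof (intro sum_mono)
        fix k l assume "k \<in> {..<q}" "l \<in> {..<q} - {k}"
        then have kl: "k < q" "l < q" "k \<noteq> l" by auto
        have "(\<integral>\<^sup>+\<omega>'. ennreal ((cmod (g k l ?x (sample \<omega>') / q))\<^sup>2) \<partial>M)
            = (\<integral>\<^sup>+\<omega>'. ennreal (1 / (real q)\<^sup>2) * ennreal ((cmod (g k l ?x (sample \<omega>')))\<^sup>2) \<partial>M)"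
          by (intro nn_integral_cong) (simp add: ennreal_mult'[symmetric] norm_divide power_divide)
        also have "\<dots> = ennreal (1 / (real q)\<^sup>2) * (\<integral>\<^sup>+\<omega>'. ennreal ((cmod (g k l ?x (sample \<omega>')))\<^sup>2) \<partial>M)"
          using mg[OF kl(1,2)] by (intro nn_integral_cmult) measurable
        also have "\<dots> \<le> ennreal (1 / (real q)\<^sup>2) * ennreal ((frob P (U ?x))\<^sup>2)"
          unfolding g_def P_def using kl unfolding q_def by (intro mult_left_mono cross_form \<nu>) auto
        finally show "(\<integral>\<^sup>+\<omega>'. ennreal ((cmod (g k l ?x (sample \<omega>') / q))\<^sup>2) \<partial>M) \<le> ennreal ((frob P (U ?x))\<^sup>2 / (real q)\<^sup>2)"
          by (simp add: ennreal_mult'[symmetric])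
      qed
      also have "\<dots> \<le> (\<Sum>k<q. \<Sum>l<q. ennreal ((frob P (U ?x))\<^sup>2 / (real q)\<^sup>2))"
        by (intro sum_mono sum_mono2) auto
      also have "\<dots> = ennreal ((frob n (dmat p ?x \<nu>))\<^sup>2)"
      proof -
        let ?c = "(frob P (U ?x))\<^sup>2 / (real q)\<^sup>2"
        have "(\<Sum>l<q. ennreal ?c) = ennreal (\<Sum>l<q. ?c)" by (rule sum_ennreal) simp
        moreover have "(\<Sum>k<q. ennreal (\<Sum>l<q. ?c)) = ennreal (\<Sum>k<q. \<Sum>l<q. ?c)" by (rule sum_ennreal) (simp add: sum_nonneg)
        moreover have "(\<Sum>k<q. \<Sum>l<q. ?c) = (frob n (dmat p ?x \<nu>))\<^sup>2"
          unfolding fr using q by (simp add: power2_eq_square)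
        ultimately show ?thesis by (simp only:)
      qed
      finally show "(\<integral>\<^sup>+\<omega>'. ennreal ((cmod (of_real (sqrt (S \<omega>'))))\<^sup>2) \<partial>M) \<le> ennreal ((frob n (dmat p ?x \<nu>))\<^sup>2)" .
    qed simp_all
    then have *: "(\<integral>\<^sup>+\<omega>'. ennreal (sqrt (S \<omega>')) \<partial>M) \<le> ennreal (frob n (dmat p ?x \<nu>))"
      using S0 by simp
    have "(\<integral>\<^sup>+\<omega>'. F (A \<omega>, B \<omega>') \<partial>M) = (\<integral>\<^sup>+\<omega>'. ennreal (1 / n) * ennreal (sqrt (S \<omega>')) \<partial>M)"
      unfolding FAB S_def by (intro nn_integral_cong) (simp add: ennreal_mult'[symmetric])
    also have "\<dots> = ennreal (1 / n) * (\<integral>\<^sup>+\<omega>'. ennreal (sqrt (S \<omega>')) \<partial>M)"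
      by (intro nn_integral_cmult) measurable
    also have "\<dots> \<le> ennreal (1 / n) * ennreal (frob n (dmat p ?x \<nu>))"
      using * by (intro mult_left_mono) auto
    finally show ?thesis by (simp add: ennreal_mult'[symmetric])
  qed
  have "(\<integral>\<^sup>+\<omega>. F (A \<omega>, B \<omega>) \<partial>M) = (\<integral>\<^sup>+\<omega>. \<integral>\<^sup>+\<omega>'. F (A \<omega>, B \<omega>') \<partial>M \<partial>M)"
    by (rule nn_integral_decouple[OF indAB F])
  also have "\<dots> \<le> Efrob \<nu>"
    unfolding Efrob_def by (intro nn_integral_mono inner)
  finally show ?thesis unfolding FAB T q_def .
qed

text \<open>Both Gram matrices of a product have the same Frobenius norm, and the one indexed by
  columns has diagonal entries near \<open>n / q\<close>. Their constant part has norm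
  \<open>n / sqrt q\<close>, which after division by \<open>n\<close> is at most
  \<open>1 / sqrt n\<close>.\<close>

lemma Efrob_Suc:
  assumes \<nu>: "\<nu> < m"
  shows "Efrob (Suc \<nu>) \<le> Efrob \<nu> + ennreal (1 / sqrt n) + Edev (Suc \<nu>)"
proof -
  define q where "q = p (Suc \<nu>)"
  have q: "0 < q" "n \<le> q" unfolding q_def using p_pos p_ge \<nu> by auto
  define T where "T x = mmul n (adj (wprod p x (Suc \<nu>))) (wprod p x (Suc \<nu>))" for x
  define Od where "Od x = sqrt (\<Sum>k<q. \<Sum>l\<in>{..<q} - {k}. (cmod (T x k l))\<^sup>2) / n" for x
  have mOd: "(\<lambda>\<omega>. Od (sample \<omega>)) \<in> borel_measurable M"
  proof -
    have "(\<lambda>\<omega>. T (sample \<omega>) k l) \<in> borel_measurable M" if "k < q" "l < q" for k l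
      unfolding T_def mmul_def adj_def
      by (intro borel_measurable_sum borel_measurable_times measurable_compose[OF _ cnj_borel_measurable] borel_measurable_wprod_sample)
        (use that \<nu> in \<open>auto simp: q_def\<close>)
    then have "(\<lambda>\<omega>. (cmod (T (sample \<omega>) k l))\<^sup>2) \<in> borel_measurable M" if "k < q" "l < q" for k l
      using that by measurable
    then have "(\<lambda>\<omega>. \<Sum>k<q. \<Sum>l\<in>{..<q} - {k}. (cmod (T (sample \<omega>) k l))\<^sup>2) \<in> borel_measurable M"
      by (intro borel_measurable_sum) auto
    then show ?thesis unfolding Od_def by measurable
  qed
  have Od0: "0 \<le> Od x" for x unfolding Od_def by (intro divide_nonneg_nonneg) (auto intro!: sum_nonneg)
  have le: "frob n (dmat p x (Suc \<nu>)) / n \<le> Od x + 1 / sqrt n + dev n p x (Suc \<nu>)" for x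
  proof -
    have diag: "T x k k = of_real (colsq n p x (Suc \<nu>) k)" for k
      unfolding T_def colsq_def cinner_self[symmetric] by (simp add: mmul_def adj_def cinner_def)
    have "frob n (dmat p x (Suc \<nu>)) = frob q (T x)"
      unfolding T_def q_def by (rule frob_gram_flip[symmetric])
    also have "\<dots> \<le> n / q * sqrt q + (\<Sum>k<q. cmod (T x k k - of_real (n / q))) + n * Od x"
      using frob_le_diag_offdiag[of "n / q" q "T x"] n by (simp add: Od_def)
    finally have *: "frob n (dmat p x (Suc \<nu>)) \<le> n / q * sqrt q + (\<Sum>k<q. cmod (T x k k - of_real (n / q))) + n * Od x" .
    have 1: "(\<Sum>k<q. cmod (T x k k - of_real (n / q))) = n * dev n p x (Suc \<nu>)"
      unfolding diag of_real_diff[symmetric] norm_of_real dev_def q_def[symmetric] using n by simp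
    define s where "s = sqrt q"
    have s: "real q = s * s" "0 < s" unfolding s_def using q by auto
    have "n / q * sqrt q = n * (1 / sqrt q)"
      unfolding s_def[symmetric] unfolding s(1) using s(2) by (simp add: field_simps)
    with * 1 have "frob n (dmat p x (Suc \<nu>)) \<le> n * (Od x + 1 / sqrt q + dev n p x (Suc \<nu>))"
      by (simp only: distrib_left)
    then have "frob n (dmat p x (Suc \<nu>)) / n \<le> Od x + 1 / sqrt q + dev n p x (Suc \<nu>)"
      using n by (simp add: divide_le_eq mult.commute)
    moreover have "1 / sqrt q \<le> 1 / sqrt n" using q n by (simp add: frac_le)
    ultimately show ?thesis by linarith
  qed
  have "Efrob (Suc \<nu>) \<le> (\<integral>\<^sup>+\<omega>. ennreal (Od (sample \<omega>)) + ennreal (1 / sqrt n) + ennreal (dev n p (sample \<omega>) (Suc \<nu>)) \<partial>M)"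
    unfolding Efrob_def
  proof (rule nn_integral_mono)
    fix \<omega>
    show "ennreal (frob n (dmat p (sample \<omega>) (Suc \<nu>)) / n) \<le> ennreal (Od (sample \<omega>)) + ennreal (1 / sqrt n) + ennreal (dev n p (sample \<omega>) (Suc \<nu>))"
      using ennreal_leI[OF le[of "sample \<omega>"]] Od0 dev_nonneg by simp
  qed
  also have "\<dots> = (\<integral>\<^sup>+\<omega>. ennreal (Od (sample \<omega>)) \<partial>M) + ennreal (1 / sqrt n) + Edev (Suc \<nu>)"
    unfolding Edev_def using mOd borel_measurable_dev[of "Suc \<nu>"] \<nu>
    by (simp add: nn_integral_add emeasure_space_1)
  also have "\<dots> \<le> Efrob \<nu> + ennreal (1 / sqrt n) + Edev (Suc \<nu>)"
    using offdiag_le[OF \<nu>] unfolding Od_def T_def q_def by (intro add_right_mono)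
  finally show ?thesis .
qed

end

section \<open>The residual and its recursion over the layers\<close>

lemma abs_mult_diff_le:
  fixes a b c d :: real
  assumes "0 \<le> a" "a \<le> 1" "0 \<le> d" "d \<le> 1"
  shows "\<bar>a * b - c * d\<bar> \<le> \<bar>a - c\<bar> + \<bar>b - d\<bar>"
proof -
  have "a * b - c * d = a * (b - d) + (a - c) * d" by (simp add: algebra_simps)
  then have "\<bar>a * b - c * d\<bar> \<le> \<bar>a * (b - d)\<bar> + \<bar>(a - c) * d\<bar>" by (simp only: abs_triangle_ineq)
  moreover have "\<bar>a * (b - d)\<bar> \<le> 1 * \<bar>b - d\<bar>"
    unfolding abs_mult using assms by (intro mult_right_mono) auto
  moreover have "\<bar>(a - c) * d\<bar> \<le> \<bar>a - c\<bar> * 1"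
    unfolding abs_mult using assms by (intro mult_left_mono) auto
  ultimately show ?thesis by linarith
qed

text \<open>With \<open>t = 1 - v s(-v)\<close>, the equation for the Stieltjes transform at \<open>z = -v\<close> reads
  \<open>residual y m v t = 0\<close>.\<close>

definition residual :: "(nat \<Rightarrow> real) \<Rightarrow> nat \<Rightarrow> real \<Rightarrow> real \<Rightarrow> real" where
  "residual y \<nu> v t = v * t - (1 - t) * (\<Prod>l = 1..\<nu>. 1 - y l * t)"

lemma residual_product_bounds:
  fixes y :: "nat \<Rightarrow> real" and \<nu> :: nat and t s a v :: real
  assumes "\<And>l. l \<in> {1..\<nu>} \<Longrightarrow> 0 \<le> y l \<and> y l \<le> 1" "0 \<le> t" "t \<le> 1"
  shows "0 \<le> (1 - t) * (\<Prod>l = 1..\<nu>. 1 - y l * t)" "(1 - t) * (\<Prod>l = 1..\<nu>. 1 - y l * t) \<le> 1"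
proof -
  have f: "0 \<le> 1 - y l * t" "1 - y l * t \<le> 1" if "l \<in> {1..\<nu>}" for l
    using assms(1)[OF that] assms(2,3) by (auto intro: mult_le_one)
  then have "0 \<le> (\<Prod>l = 1..\<nu>. 1 - y l * t)" "(\<Prod>l = 1..\<nu>. 1 - y l * t) \<le> 1"
    by (auto intro!: prod_nonneg prod_le_1)
  then show "0 \<le> (1 - t) * (\<Prod>l = 1..\<nu>. 1 - y l * t)" "(1 - t) * (\<Prod>l = 1..\<nu>. 1 - y l * t) \<le> 1"
    using assms(2,3) by (auto intro!: mult_le_one)
qed

text \<open>There are \<open>\<nu> + 1\<close> factors, each in [0, 1] and Lipschitz in
  \<open>t\<close> with constant 1.\<close>

lemma residual_product_Lipschitz:
  fixes y :: "nat \<Rightarrow> real" and \<nu> :: nat and t s a v :: real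
  assumes "\<And>l. l \<in> {1..\<nu>} \<Longrightarrow> 0 \<le> y l \<and> y l \<le> 1" "0 \<le> t" "t \<le> 1" "0 \<le> s" "s \<le> 1"
  shows "\<bar>(1 - t) * (\<Prod>l = 1..\<nu>. 1 - y l * t) - (1 - s) * (\<Prod>l = 1..\<nu>. 1 - y l * s)\<bar> \<le> (\<nu> + 1) * \<bar>t - s\<bar>"
  using assms(1)
proof (induction \<nu>)
  case 0
  then show ?case by simp
next
  case (Suc \<nu>)
  let ?G = "\<lambda>t. (1 - t) * (\<Prod>l = 1..\<nu>. 1 - y l * t)"
  have y: "0 \<le> y (Suc \<nu>)" "y (Suc \<nu>) \<le> 1" using Suc.prems[of "Suc \<nu>"] by auto
  have "\<bar>?G t * (1 - y (Suc \<nu>) * t) - ?G s * (1 - y (Suc \<nu>) * s)\<bar>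
      \<le> \<bar>?G t - ?G s\<bar> + \<bar>(1 - y (Suc \<nu>) * t) - (1 - y (Suc \<nu>) * s)\<bar>"
    using Suc.prems assms(2-5) y by (intro abs_mult_diff_le residual_product_bounds) (auto intro: mult_le_one)
  also have "\<dots> \<le> (\<nu> + 1) * \<bar>t - s\<bar> + 1 * \<bar>t - s\<bar>"
  proof (rule add_mono)
    show "\<bar>?G t - ?G s\<bar> \<le> (\<nu> + 1) * \<bar>t - s\<bar>" using Suc by auto
    have "(1 - y (Suc \<nu>) * t) - (1 - y (Suc \<nu>) * s) = y (Suc \<nu>) * (s - t)" by (simp add: algebra_simps)
    then show "\<bar>(1 - y (Suc \<nu>) * t) - (1 - y (Suc \<nu>) * s)\<bar> \<le> 1 * \<bar>t - s\<bar>"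
      using y by (simp add: abs_mult abs_minus_commute mult_right_mono mult_left_le_one_le)
  qed
  finally show ?case by (simp add: algebra_simps)
qed

text \<open>\<open>a\<close> times the residual at \<open>v / a\<close> is \<open>v s\<close> minus
  \<open>a\<close> times the shorter product, so \<open>a\<close> takes the place of the last factor
  \<open>1 - y t\<close>. The three errors are the residual of the shorter product, the difference
  of \<open>t\<close> and \<open>s\<close>, and the difference of that factor and
  \<open>a\<close>.\<close>

lemma residual_Suc_le:
  fixes y :: "nat \<Rightarrow> real" and \<nu> :: nat and t s a v :: real
  assumes y: "\<And>l. l \<in> {1..Suc \<nu>} \<Longrightarrow> 0 \<le> y l \<and> y l \<le> 1" and t: "0 \<le> t" "t \<le> 1" and s: "0 \<le> s" "s \<le> 1"
    and a: "0 < a" "a \<le> 1" and v: "0 \<le> v"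
  shows "\<bar>residual y (Suc \<nu>) v t\<bar> \<le> \<bar>residual y \<nu> (v / a) s\<bar> + (v + \<nu> + 1) * \<bar>t - s\<bar> + \<bar>(1 - y (Suc \<nu>) * t) - a\<bar>"
proof -
  let ?G = "\<lambda>t. (1 - t) * (\<Prod>l = 1..\<nu>. 1 - y l * t)"
  have y': "\<And>l. l \<in> {1..\<nu>} \<Longrightarrow> 0 \<le> y l \<and> y l \<le> 1" using y by auto
  have "residual y (Suc \<nu>) v t - a * residual y \<nu> (v / a) s = v * (t - s) - (?G t * (1 - y (Suc \<nu>) * t) - ?G s * a)"
    unfolding residual_def using a by (simp add: algebra_simps)
  moreover have "\<bar>?G t * (1 - y (Suc \<nu>) * t) - ?G s * a\<bar> \<le> \<bar>?G t - ?G s\<bar> + \<bar>(1 - y (Suc \<nu>) * t) - a\<bar>"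
    using a by (intro abs_mult_diff_le residual_product_bounds[OF y' t]) auto
  moreover have "\<bar>?G t - ?G s\<bar> \<le> (\<nu> + 1) * \<bar>t - s\<bar>"
    by (rule residual_product_Lipschitz[OF y' t s])
  moreover have "\<bar>v * (t - s)\<bar> = v * \<bar>t - s\<bar>" using v by (simp add: abs_mult)
  moreover have "\<bar>a * residual y \<nu> (v / a) s\<bar> \<le> \<bar>residual y \<nu> (v / a) s\<bar>"
    unfolding abs_mult using a by (simp add: mult_left_le_one_le)
  moreover have "(v + \<nu> + 1) * \<bar>t - s\<bar> = v * \<bar>t - s\<bar> + (\<nu> + 1) * \<bar>t - s\<bar>" by (simp add: algebra_simps)
  ultimately show ?thesis by linarith
qed

lemma borel_measurable_cinner_mvec:
  assumes u: "\<And>i. i < n \<Longrightarrow> (\<lambda>\<omega>. u \<omega> i) \<in> borel_measurable N" and C: "mat_measurable N n C"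
  shows "(\<lambda>\<omega>. cinner n (u \<omega>) (mvec n (C \<omega>) (u \<omega>))) \<in> borel_measurable N"
  unfolding cinner_def mvec_def
  by (intro borel_measurable_sum borel_measurable_times measurable_compose[OF _ cnj_borel_measurable] u
      mat_measurableD[OF C]) auto

text \<open>Rounding up keeps the grid point positive, as \<open>v / a\<close> requires. It is at
  least \<open>1 / N\<close>, which is the origin of the factors \<open>N\<close> in the estimates
  below.\<close>

lemma nearest_grid_point:
  fixes \<alpha> :: real and N :: nat assumes "0 < \<alpha>" "\<alpha> \<le> 1" and N: "0 < N"
  obtains j where "j \<in> {1..N}" "\<bar>real j / N - \<alpha>\<bar> \<le> 1 / N"
proof
  let ?j = "nat \<lceil>\<alpha> * N\<rceil>"
  have 0: "0 < \<alpha> * N" "\<alpha> * N \<le> N" using assms by auto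
  have 1: "real ?j = of_int \<lceil>\<alpha> * N\<rceil>" using 0 by simp
  have 2: "\<alpha> * N \<le> real ?j" "real ?j < \<alpha> * N + 1" unfolding 1 by linarith+
  have "?j \<le> N" using 0 by (simp add: nat_le_iff ceiling_le_iff)
  moreover have "0 < real ?j" using 0(1) 2(1) by (rule less_le_trans)
  then have "1 \<le> ?j" by linarith
  ultimately show "?j \<in> {1..N}" unfolding atLeastAtMost_iff by (rule conjI[rotated])
  have "real ?j / N - \<alpha> = (real ?j - \<alpha> * N) / N" using N by (simp add: field_simps)
  then show "\<bar>real ?j / N - \<alpha>\<bar> \<le> 1 / N"
    using 2 N by (simp add: abs_divide divide_right_mono)
qed

context random_layers
begin

abbreviation lower :: "nat \<Rightarrow> 'a \<Rightarrow> nat \<Rightarrow> nat \<Rightarrow> complex" where "lower \<nu> \<omega> \<equiv> wprod p (sample \<omega>) \<nu>"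

definition "eta \<nu> v k B \<omega> = layer.\<eta> n (p \<nu>) (p (Suc \<nu>)) v (lower \<nu> \<omega>) (lower (Suc \<nu>) \<omega>) k (B (sample \<omega>))"

definition "rho y \<nu> v = (\<integral>\<^sup>+\<omega>. ennreal \<bar>residual y \<nu> v (Tres n v (dmat p (sample \<omega>) \<nu>))\<bar> \<partial>M)"

text \<open>Two copies of \<open>Efrob\<close> come from the quadratic forms, the third from
  exchanging \<open>R\<close> for \<open>R' k\<close> in \<open>layer.\<eta>_le\<close>.\<close>

definition "error_term \<nu> = 3 * Efrob \<nu> + 2 * Edev \<nu> + ennreal (\<tau> + 2 * L)"

lemma layer_axioms:
  assumes "\<nu> < m" "0 < v" shows "layer n (p (Suc \<nu>)) v"
  by standard (use assms n p_ge[of "Suc \<nu>"] in auto)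

lemma restrict_leave_one_out:
  assumes \<nu>: "\<nu> < m" and k: "k < p (Suc \<nu>)"
  defines "J \<equiv> layers p m - layer_column p (Suc \<nu>) k"
  shows "layers p \<nu> \<subseteq> J" "\<And>l. l \<in> {..<p (Suc \<nu>)} - {k} \<Longrightarrow> layer_column p (Suc \<nu>) l \<subseteq> J"
proof -
  show "layers p \<nu> \<subseteq> J" unfolding J_def layers_def layer_column_def using \<nu> by auto
  fix l assume "l \<in> {..<p (Suc \<nu>)} - {k}"
  then show "layer_column p (Suc \<nu>) l \<subseteq> J" unfolding J_def layers_def layer_column_def using \<nu> by auto
qed

lemma eta_measurable:
  assumes \<nu>: "\<nu> < m" and v: "0 < v" and k: "k < p (Suc \<nu>)"
    and B: "mat_measurable M n (\<lambda>\<omega>. B (sample \<omega>))"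
  shows "(\<lambda>\<omega>. eta \<nu> v k B \<omega>) \<in> borel_measurable M"
proof -
  interpret l: layer n "p \<nu>" "p (Suc \<nu>)" v W r for W r by (rule layer_axioms[OF \<nu> v])
  have r: "(\<lambda>\<omega>. lower (Suc \<nu>) \<omega> i l) \<in> borel_measurable M" if "l < p (Suc \<nu>)" for i l
    by (rule borel_measurable_wprod_sample) (use that \<nu> in auto)
  have gr: "mat_measurable M n (\<lambda>\<omega>. resolvent n v (gram K (lower (Suc \<nu>) \<omega>)))" if "K \<subseteq> {..<p (Suc \<nu>)}" for K
    using that by (intro mat_measurable_resolvent mat_measurable_gram r) auto
  show ?thesis
    unfolding eta_def l.\<eta>_def
    by (intro measurable_compose[OF _ borel_measurable_norm] borel_measurable_diff borel_measurable_divide borel_measurable_const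
      borel_measurable_cinner_mvec mat_measurable_mmul B gr borel_measurable_ctrace mat_measurable_dmat r) (use k \<nu> in auto)
qed

text \<open>\<open>B\<close> is a function of the earlier layers alone, so its product with the
  resolvent lacking column \<open>k\<close> does not involve that column. Measurability and
  invariance are assumed for every \<open>J\<close> containing these layers because the index set
  left after removing a column varies with \<open>k\<close>.\<close>

lemma eta_sum_le:
  assumes \<nu>: "\<nu> < m" and v: "0 < v" and \<beta>: "0 \<le> \<beta>" "\<And>x. opbound n \<beta> (B x)"
    and meas: "\<And>J. layers p \<nu> \<subseteq> J \<Longrightarrow> mat_measurable (PiM J (\<lambda>_. borel)) n B"
    and inv: "\<And>J x i j. layers p \<nu> \<subseteq> J \<Longrightarrow> i < n \<Longrightarrow> j < n \<Longrightarrow> B (restrict x J) i j = B x i j"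
    and B: "mat_measurable M n (\<lambda>\<omega>. B (sample \<omega>))"
  shows "(\<integral>\<^sup>+\<omega>. ennreal ((\<Sum>k<p (Suc \<nu>). eta \<nu> v k B \<omega>) / n) \<partial>M) \<le> ennreal (\<beta> / v) * error_term \<nu>"
proof -
  interpret l: layer n "p \<nu>" "p (Suc \<nu>)" v W r for W r by (rule layer_axioms[OF \<nu> v])
  define q where "q = p (Suc \<nu>)"
  have q: "0 < q" unfolding q_def using p_pos \<nu> by auto
  define C where "C k x = mmul n (B x) (resolvent n v (gram ({..<p (Suc \<nu>)} - {k}) (wprod p x (Suc \<nu>))))" for k x
  define e where "e k \<omega> = cmod (cinner n (\<lambda>i. lower (Suc \<nu>) \<omega> i k) (mvec n (C k (sample \<omega>)) (\<lambda>i. lower (Suc \<nu>) \<omega> i k))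
      - ctrace n (mmul n (dmat p (sample \<omega>) \<nu>) (C k (sample \<omega>))) / p (Suc \<nu>)) / n" for k \<omega>
  define f where "f \<omega> = frob n (dmat p (sample \<omega>) \<nu>) / n" for \<omega>
  have opC: "opbound n (\<beta> * (1 / v)) (C k x)" for k x
    unfolding C_def by (intro opbound_mmul \<beta> opbound_resolvent hpsd_gram v)
  have quad: "(\<Sum>k<p (Suc \<nu>). \<integral>\<^sup>+\<omega>. ennreal (e k \<omega>) \<partial>M) \<le> ennreal (\<beta> / v) * (2 * Efrob \<nu> + 2 * Edev \<nu> + ennreal (\<tau> + 2 * L))"
    unfolding e_def
  proof (rule quadratic_forms_sum[OF \<nu>])
    show "0 \<le> \<beta> / v" using \<beta> v by simp
    fix k x assume k: "k < p (Suc \<nu>)"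
    show "opbound n (\<beta> / v) (C k x)" using opC by simp
    let ?J = "layers p m - layer_column p (Suc \<nu>) k"
    note J = restrict_leave_one_out[OF \<nu> k]
    show "mat_measurable (PiM ?J (\<lambda>_. borel)) n (C k)"
      unfolding C_def
      by (intro mat_measurable_mmul meas J mat_measurable_resolvent mat_measurable_gram borel_measurable_wprod_column_PiM)
    fix i j assume ij: "i < n" "j < n"
    have "resolvent n v (gram ({..<p (Suc \<nu>)} - {k}) (wprod p (restrict x ?J) (Suc \<nu>)))
        = resolvent n v (gram ({..<p (Suc \<nu>)} - {k}) (wprod p x (Suc \<nu>)))"
      by (rule resolvent_cong) (simp only: gram_def wprod_restrict_column[OF J] cong: sum.cong)
    then show "C k (restrict x ?J) i j = C k x i j"
      unfolding C_def using ij by (intro mmul_cong) (simp_all add: inv[OF J(1)])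
  qed
  have pw: "eta \<nu> v k B \<omega> / n \<le> e k \<omega> + \<beta> / (q * v) * f \<omega>" if "k < q" for k \<omega>
  proof -
    have "eta \<nu> v k B \<omega> \<le> n * e k \<omega> + \<beta> * frob n (dmat p (sample \<omega>) \<nu>) / (q * v)"
      unfolding eta_def e_def C_def q_def using l.\<eta>_le[OF _ \<beta>(2) \<beta>(1), of k] that n by (simp add: q_def del: wprod.simps)
    then have "eta \<nu> v k B \<omega> / n \<le> (n * e k \<omega> + \<beta> * frob n (dmat p (sample \<omega>) \<nu>) / (q * v)) / n"
      by (rule divide_right_mono) simp
    also have "\<dots> = e k \<omega> + \<beta> / (q * v) * f \<omega>" unfolding f_def using n by (simp add: add_divide_distrib)
    finally show ?thesis .
  qed
  have e0: "0 \<le> e k \<omega>" for k \<omega> unfolding e_def by simp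
  have f0: "0 \<le> f \<omega>" for \<omega> unfolding f_def by simp
  have me: "(\<lambda>\<omega>. ennreal (e k \<omega>)) \<in> borel_measurable M" if "k < q" for k
  proof -
    have r: "(\<lambda>\<omega>. lower (Suc \<nu>) \<omega> i l) \<in> borel_measurable M" if "l < p (Suc \<nu>)" for i l
      by (rule borel_measurable_wprod_sample) (use that \<nu> in auto)
    have "mat_measurable M n (\<lambda>\<omega>. C k (sample \<omega>))"
      unfolding C_def using that by (intro mat_measurable_mmul B mat_measurable_resolvent mat_measurable_gram r) auto
    then show ?thesis
      unfolding e_def
      by (intro measurable_compose[OF _ measurable_ennreal] measurable_compose[OF _ borel_measurable_norm] borel_measurable_diff borel_measurable_divide borel_measurable_const
        borel_measurable_cinner_mvec mat_measurable_mmul borel_measurable_ctrace mat_measurable_dmat r) (use that \<nu> in \<open>auto simp: q_def\<close>)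
  qed
  have mf: "(\<lambda>\<omega>. ennreal (f \<omega>)) \<in> borel_measurable M"
    unfolding f_def by (intro measurable_compose[OF _ measurable_ennreal] borel_measurable_divide borel_measurable_const borel_measurable_frob_dmat) (use \<nu> in auto)
  have "(\<integral>\<^sup>+\<omega>. ennreal ((\<Sum>k<p (Suc \<nu>). eta \<nu> v k B \<omega>) / n) \<partial>M) \<le> (\<integral>\<^sup>+\<omega>. (\<Sum>k<q. ennreal (e k \<omega>)) + ennreal (\<beta> / v) * ennreal (f \<omega>) \<partial>M)"
  proof (rule nn_integral_mono)
    fix \<omega>
    have "(\<Sum>k<q. eta \<nu> v k B \<omega>) / n \<le> (\<Sum>k<q. e k \<omega> + \<beta> / (q * v) * f \<omega>)"
      unfolding sum_divide_distrib by (intro sum_mono pw) simp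
    also have "\<dots> = (\<Sum>k<q. e k \<omega>) + \<beta> / v * f \<omega>" using q by (simp add: sum.distrib)
    finally have *: "(\<Sum>k<q. eta \<nu> v k B \<omega>) / n \<le> (\<Sum>k<q. e k \<omega>) + \<beta> / v * f \<omega>" .
    have "ennreal ((\<Sum>k<q. e k \<omega>) + \<beta> / v * f \<omega>) = ennreal (\<Sum>k<q. e k \<omega>) + ennreal (\<beta> / v * f \<omega>)"
      using e0 f0 \<beta> v by (intro ennreal_plus sum_nonneg mult_nonneg_nonneg divide_nonneg_nonneg) auto
    also have "\<dots> = (\<Sum>k<q. ennreal (e k \<omega>)) + ennreal (\<beta> / v) * ennreal (f \<omega>)"
    proof -
      have "ennreal (\<beta> / v * f \<omega>) = ennreal (\<beta> / v) * ennreal (f \<omega>)"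
        using f0 \<beta> v by (intro ennreal_mult divide_nonneg_nonneg) auto
      moreover have "(\<Sum>k<q. ennreal (e k \<omega>)) = ennreal (\<Sum>k<q. e k \<omega>)"
        by (rule sum_ennreal) (rule e0)
      ultimately show ?thesis by simp
    qed
    finally show "ennreal ((\<Sum>k<p (Suc \<nu>). eta \<nu> v k B \<omega>) / n) \<le> (\<Sum>k<q. ennreal (e k \<omega>)) + ennreal (\<beta> / v) * ennreal (f \<omega>)"
      using ennreal_leI[OF *] unfolding q_def by simp
  qed
  also have "\<dots> = (\<integral>\<^sup>+\<omega>. (\<Sum>k<q. ennreal (e k \<omega>)) \<partial>M) + (\<integral>\<^sup>+\<omega>. ennreal (\<beta> / v) * ennreal (f \<omega>) \<partial>M)"
    using me mf by (intro nn_integral_add borel_measurable_sum borel_measurable_times borel_measurable_const) auto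
  also have "\<dots> = (\<Sum>k<q. \<integral>\<^sup>+\<omega>. ennreal (e k \<omega>) \<partial>M) + ennreal (\<beta> / v) * Efrob \<nu>"
  proof -
    have me': "(\<lambda>\<omega>. ennreal (e k \<omega>)) \<in> borel_measurable M" if "k \<in> {..<q}" for k
      using me that by simp
    have "Efrob \<nu> = (\<integral>\<^sup>+\<omega>. ennreal (f \<omega>) \<partial>M)" unfolding Efrob_def f_def ..
    then show ?thesis by (simp only: nn_integral_sum[OF me'] nn_integral_cmult[OF mf])
  qed
  also have "\<dots> \<le> ennreal (\<beta> / v) * (2 * Efrob \<nu> + 2 * Edev \<nu> + ennreal (\<tau> + 2 * L)) + ennreal (\<beta> / v) * Efrob \<nu>"
    using quad unfolding q_def by (intro add_right_mono)
  also have "\<dots> = ennreal (\<beta> / v) * error_term \<nu>"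
  proof -
    have "(2 * Efrob \<nu> + 2 * Edev \<nu> + ennreal (\<tau> + 2 * L)) + Efrob \<nu> = (2 * Efrob \<nu> + Efrob \<nu>) + 2 * Edev \<nu> + ennreal (\<tau> + 2 * L)"
      by (simp add: ac_simps)
    moreover have "2 * Efrob \<nu> + Efrob \<nu> = 3 * Efrob \<nu>"
    proof -
      have "2 * Efrob \<nu> + Efrob \<nu> = (2 + 1) * Efrob \<nu>" unfolding distrib_right by simp
      then show ?thesis by simp
    qed
    ultimately show ?thesis unfolding error_term_def distrib_left[symmetric] by (simp only:)
  qed
  finally show ?thesis .
qed

lemma borel_measurable_Tres:
  assumes "\<nu> \<le> m" shows "(\<lambda>\<omega>. Tres n v (dmat p (sample \<omega>) \<nu>)) \<in> borel_measurable M"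
  unfolding Tres_def
  by (intro borel_measurable_diff borel_measurable_times borel_measurable_const measurable_compose[OF _ borel_measurable_Re]
    borel_measurable_ctrace mat_measurable_resolvent mat_measurable_dmat assms)

lemma borel_measurable_residual:
  assumes "\<nu> \<le> m" shows "(\<lambda>\<omega>. residual y \<mu> v' (Tres n v (dmat p (sample \<omega>) \<nu>))) \<in> borel_measurable M"
  unfolding residual_def
  by (intro borel_measurable_diff borel_measurable_times borel_measurable_const borel_measurable_prod borel_measurable_Tres assms)

text \<open>The grid argument: which \<open>a j\<close> is nearest to \<open>\<alpha>\<close>
  depends on the outcome, and summing the bounds over all \<open>N\<close> grid points removes this
  dependence. The price is a factor in front of \<open>error_term\<close> that grows with
  \<open>N\<close>, to be weighed against a grid error of order \<open>K / N\<close>.\<close>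

lemma rho_Suc:
  assumes \<nu>: "\<nu> < m" and v: "0 < v" and N: "0 < N"
    and y: "\<And>l. l \<in> {1..Suc \<nu>} \<Longrightarrow> 0 \<le> y l \<and> y l \<le> 1"
  defines "K \<equiv> 1 + (v + \<nu> + 1) / v"
  shows "rho y (Suc \<nu>) v \<le> (\<Sum>j = 1..N. rho y \<nu> (v / (real j / N)))
    + ennreal (N * ((v + \<nu> + 1) * real (1 + 2 * N)) / v + 1 / v) * error_term \<nu>
    + ennreal \<bar>y (Suc \<nu>) - n / p (Suc \<nu>)\<bar> + ennreal (K / N) + ennreal (K / N) * Edev \<nu>"
proof -
  interpret l: layer n "p \<nu>" "p (Suc \<nu>)" v W r for W r by (rule layer_axioms[OF \<nu> v])
  define q where "q = p (Suc \<nu>)"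
  have q: "0 < q" "n \<le> q" unfolding q_def using p_pos p_ge \<nu> by auto
  define a where "a j = real j / N" for j
  have a: "0 < a j" "a j \<le> 1" "1 / a j \<le> N" if "j \<in> {1..N}" for j
    using that N by (auto simp: a_def field_simps)
  define Q where "Q j x = resolvent n v (\<lambda>i i'. of_real (a j) * dmat p x \<nu> i i')" for j x
  define EI where "EI \<omega> = (\<Sum>k<q. eta \<nu> v k (\<lambda>_. idm) \<omega>) / n" for \<omega>
  define EQ where "EQ j \<omega> = (\<Sum>k<q. eta \<nu> v k (Q j) \<omega>) / n" for j \<omega>
  define c where "c = v + real \<nu> + 1"
  have c: "0 < c" unfolding c_def using v by simp
  have K: "0 \<le> K" unfolding K_def using v by simp
  have eta0: "0 \<le> eta \<nu> v k B \<omega>" for k B \<omega> unfolding eta_def by (rule l.\<eta>_nonneg)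
  have EI0: "0 \<le> EI \<omega>" and EQ0: "0 \<le> EQ j \<omega>" for j \<omega>
    unfolding EI_def EQ_def using eta0 by (auto intro!: divide_nonneg_nonneg sum_nonneg)
  have mdm: "mat_measurable M n (\<lambda>\<omega>. Q j (sample \<omega>))" for j
    unfolding Q_def by (intro mat_measurable_resolvent mat_measurable_scale mat_measurable_dmat) (use \<nu> in auto)
  have mEI: "EI \<in> borel_measurable M"
    unfolding EI_def by (intro borel_measurable_divide borel_measurable_sum borel_measurable_const eta_measurable \<nu> v mat_measurable_const) (auto simp: q_def)
  have mEQ: "EQ j \<in> borel_measurable M" for j
    unfolding EQ_def by (intro borel_measurable_divide borel_measurable_sum borel_measurable_const eta_measurable \<nu> v mdm) (auto simp: q_def)
  have IEI: "(\<integral>\<^sup>+\<omega>. ennreal (EI \<omega>) \<partial>M) \<le> ennreal (1 / v) * error_term \<nu>"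
    unfolding EI_def q_def by (rule eta_sum_le[OF \<nu> v]) (auto simp: opbound_idm mat_measurable_const)
  have IEQ: "(\<integral>\<^sup>+\<omega>. ennreal (EQ j \<omega>) \<partial>M) \<le> ennreal (1 / v / v) * error_term \<nu>" if j: "j \<in> {1..N}" for j
    unfolding EQ_def q_def
  proof (rule eta_sum_le[OF \<nu> v])
    show "0 \<le> 1 / v" using v by simp
    show "opbound n (1 / v) (Q j x)" for x
      unfolding Q_def using a[OF j] by (intro opbound_resolvent hpsd_scale hpsd_gram v) auto
    show "mat_measurable (PiM J (\<lambda>_. borel)) n (Q j)" if "layers p \<nu> \<subseteq> J" for J
      unfolding Q_def using that by (intro mat_measurable_resolvent mat_measurable_scale mat_measurable_gram borel_measurable_wprod_PiM) auto
    show "Q j (restrict x J) i i' = Q j x i i'" if "layers p \<nu> \<subseteq> J" for J x i i'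
    proof -
      have "resolvent n v (\<lambda>i i'. of_real (a j) * dmat p (restrict x J) \<nu> i i') = resolvent n v (\<lambda>i i'. of_real (a j) * dmat p x \<nu> i i')"
        by (rule resolvent_cong) (simp add: gram_def wprod_restrict[OF that])
      then show ?thesis unfolding Q_def by simp
    qed
    show "mat_measurable M n (\<lambda>\<omega>. Q j (sample \<omega>))" by (rule mdm)
  qed
  \<comment> \<open>The error if grid point \<open>j\<close> is the one near
    \<open>\<alpha>\<close>; it is nonnegative, so the sum over \<open>j\<close> dominates the
    selected term.\<close>
  define E where "E j \<omega> = \<bar>residual y \<nu> (v / a j) (Tres n (v / a j) (dmat p (sample \<omega>) \<nu>))\<bar> + (c * v * EQ j \<omega> + c * (2 * N) * EI \<omega>)" for j \<omega>
  have E0: "0 \<le> E j \<omega>" for j \<omega>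
    unfolding E_def using EI0 EQ0 c v by (intro add_nonneg_nonneg mult_nonneg_nonneg) auto
  have pw: "\<bar>residual y (Suc \<nu>) v (Tres n v (dmat p (sample \<omega>) (Suc \<nu>)))\<bar>
      \<le> (\<Sum>j = 1..N. E j \<omega>) + EI \<omega> + \<bar>y (Suc \<nu>) - n / q\<bar> + K / N + K / N * dev n p (sample \<omega>) \<nu>" for \<omega>
  proof -
    let ?W = "lower \<nu> \<omega>" and ?r = "lower (Suc \<nu>) \<omega>"
    define T where "T = Tres n v (dmat p (sample \<omega>) (Suc \<nu>))"
    define \<alpha> where "\<alpha> = layer.\<alpha> n (p \<nu>) (p (Suc \<nu>)) v ?W ?r"
    have \<alpha>: "0 < \<alpha>" "\<alpha> \<le> 1" unfolding \<alpha>_def by (rule l.\<alpha>)+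
    obtain j where j: "j \<in> {1..N}" and aj: "\<bar>a j - \<alpha>\<bar> \<le> 1 / N"
      using nearest_grid_point[OF \<alpha> N] unfolding a_def by blast
    define f where "f = Tres n (v / a j) (dmat p (sample \<omega>) \<nu>)"
    have T01: "0 \<le> T" "T \<le> 1" unfolding T_def by (intro Tres_bounds hpsd_gram v)+
    have f01: "0 \<le> f" "f \<le> 1" unfolding f_def using v a[OF j] by (intro Tres_bounds hpsd_gram; simp)+
    have sqn: "layer.sqn n (p \<nu>) ?W / n \<le> 1 + dev n p (sample \<omega>) \<nu>"
    proof -
      have "layer.sqn n (p \<nu>) ?W = (\<Sum>k<p \<nu>. colsq n p (sample \<omega>) \<nu> k)" unfolding l.sqn_def colsq_def ..
      also have "\<dots> \<le> n + n * dev n p (sample \<omega>) \<nu>" using sum_colsq_dev[of \<nu> "sample \<omega>"] \<nu> by linarith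
      finally have "layer.sqn n (p \<nu>) ?W \<le> (1 + dev n p (sample \<omega>) \<nu>) * n" by (simp add: algebra_simps)
      then show ?thesis using n by (simp add: divide_le_eq)
    qed
    have "\<bar>T - f\<bar> \<le> \<bar>a j - \<alpha>\<bar> * (layer.sqn n (p \<nu>) ?W / n) / v + v * EQ j \<omega> + 2 / a j * EI \<omega>"
      using l.Tres_approx[OF a(1,2)[OF j], where W = ?W and r = ?r]
      unfolding T_def f_def \<alpha>_def EQ_def EI_def eta_def Q_def q_def by simp
    also have "\<dots> \<le> 1 / N * (1 + dev n p (sample \<omega>) \<nu>) / v + v * EQ j \<omega> + 2 * N * EI \<omega>"
    proof (intro add_mono divide_right_mono mult_mono order_refl)
      show "0 \<le> layer.sqn n (p \<nu>) ?W / n" unfolding l.sqn_def by (intro divide_nonneg_nonneg sum_nonneg) auto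
      show "2 / a j \<le> 2 * N" using a(3)[OF j] by simp
    qed (use sqn aj v EI0 EQ0 N in auto)
    finally have Tf: "\<bar>T - f\<bar> \<le> 1 / N * (1 + dev n p (sample \<omega>) \<nu>) / v + v * EQ j \<omega> + 2 * N * EI \<omega>" .
    have "(\<Sum>k<q. eta \<nu> v k (\<lambda>_. idm) \<omega>) / q \<le> EI \<omega>"
      unfolding EI_def using eta0 q n by (intro divide_left_mono sum_nonneg) auto
    moreover have "\<bar>\<alpha> - (1 - n / q * T)\<bar> \<le> (\<Sum>k<q. eta \<nu> v k (\<lambda>_. idm) \<omega>) / q"
      using l.\<alpha>_approx[of ?W ?r] unfolding T_def \<alpha>_def eta_def q_def .
    moreover have "\<bar>y (Suc \<nu>) * T - n / q * T\<bar> \<le> \<bar>y (Suc \<nu>) - n / q\<bar>"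
      unfolding left_diff_distrib[symmetric] abs_mult using T01 by (simp add: mult_left_le)
    ultimately have ya: "\<bar>(1 - y (Suc \<nu>) * T) - a j\<bar> \<le> \<bar>y (Suc \<nu>) - n / q\<bar> + EI \<omega> + 1 / N"
    proof -
      have abs: "\<bar>(1 - yt) - x\<bar> \<le> z + e + d" if "s \<le> e" "\<bar>\<alpha> - (1 - w)\<bar> \<le> s" "\<bar>yt - w\<bar> \<le> z" "\<bar>x - \<alpha>\<bar> \<le> d"
        for s e w yt z x d :: real using that by linarith
      show ?thesis
        by (rule abs[OF \<open>(\<Sum>k<q. eta \<nu> v k (\<lambda>_. idm) \<omega>) / q \<le> EI \<omega>\<close>
            \<open>\<bar>\<alpha> - (1 - n / q * T)\<bar> \<le> (\<Sum>k<q. eta \<nu> v k (\<lambda>_. idm) \<omega>) / q\<close>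
            \<open>\<bar>y (Suc \<nu>) * T - n / q * T\<bar> \<le> \<bar>y (Suc \<nu>) - n / q\<bar>\<close> aj])
    qed
    have "\<bar>residual y (Suc \<nu>) v T\<bar> \<le> \<bar>residual y \<nu> (v / a j) f\<bar> + c * \<bar>T - f\<bar> + \<bar>(1 - y (Suc \<nu>) * T) - a j\<bar>"
      unfolding c_def by (rule residual_Suc_le) (use y T01 f01 a[OF j] v in auto)
    moreover have "c * \<bar>T - f\<bar> \<le> c * (1 / N * (1 + dev n p (sample \<omega>) \<nu>) / v + v * EQ j \<omega> + 2 * N * EI \<omega>)"
      using Tf c by (intro mult_left_mono) auto
    ultimately have "\<bar>residual y (Suc \<nu>) v T\<bar> \<le> E j \<omega> + c * (1 / N * (1 + dev n p (sample \<omega>) \<nu>) / v) + \<bar>(1 - y (Suc \<nu>) * T) - a j\<bar>"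
    proof -
      have eq: "c * (1 / N * (1 + dev n p (sample \<omega>) \<nu>) / v + v * EQ j \<omega> + 2 * N * EI \<omega>)
          = c * (1 / N * (1 + dev n p (sample \<omega>) \<nu>) / v) + (c * v * EQ j \<omega> + c * (2 * N) * EI \<omega>)"
        by (simp only: distrib_left mult.assoc add.assoc)
      have lin: "r \<le> (x + w) + u + z" if "r \<le> x + e + z" "e \<le> d" "d = u + w" for r x e z d u w :: real
        using that by linarith
      show ?thesis
        unfolding E_def f_def[symmetric] by (rule lin[OF \<open>\<bar>residual y (Suc \<nu>) v T\<bar> \<le> _\<close> \<open>c * \<bar>T - f\<bar> \<le> _\<close> eq])
    qed
    moreover have "E j \<omega> \<le> (\<Sum>j = 1..N. E j \<omega>)" using j E0 by (intro member_le_sum) auto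
    \<comment> \<open>The grid error occurs twice: through \<open>a - \<alpha>\<close> in the
      comparison of the traces, multiplied by \<open>c / v\<close>, and as the distance of the last
      factor of the product from \<open>a j\<close>. \<open>K\<close> collects both.\<close>
    moreover have "c * (1 / N * (1 + dev n p (sample \<omega>) \<nu>) / v) + 1 / N \<le> K / N + K / N * dev n p (sample \<omega>) \<nu>"
    proof -
      have "K / N + K / N * dev n p (sample \<omega>) \<nu> = c * (1 / N * (1 + dev n p (sample \<omega>) \<nu>) / v) + 1 / N + dev n p (sample \<omega>) \<nu> / N"
        unfolding K_def c_def using v N by (simp add: field_simps)
      moreover have "0 \<le> dev n p (sample \<omega>) \<nu> / N" using dev_nonneg by simp
      ultimately show ?thesis by linarith
    qed
    moreover have lin: "r \<le> s + e + z + k + k'" if "r \<le> x + u + w" "x \<le> s" "u + d \<le> k + k'" "w \<le> z + e + d"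
      for r s e z k k' x u w d :: real using that by linarith
    ultimately show ?thesis using ya unfolding T_def[symmetric] by (intro lin)
  qed
  have IE: "(\<integral>\<^sup>+\<omega>. ennreal (E j \<omega>) \<partial>M) \<le> rho y \<nu> (v / a j) + ennreal (c * v * (1 / v / v) + c * (2 * N) * (1 / v)) * error_term \<nu>"
    if j: "j \<in> {1..N}" for j
  proof -
    have "(\<integral>\<^sup>+\<omega>. ennreal (E j \<omega>) \<partial>M) = (\<integral>\<^sup>+\<omega>. ennreal \<bar>residual y \<nu> (v / a j) (Tres n (v / a j) (dmat p (sample \<omega>) \<nu>))\<bar>
        + (ennreal (c * v) * ennreal (EQ j \<omega>) + ennreal (c * (2 * N)) * ennreal (EI \<omega>)) \<partial>M)"
    proof (rule nn_integral_cong)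
      fix \<omega>
      have *: "ennreal (A + (x * b + y * d)) = ennreal A + (ennreal x * ennreal b + ennreal y * ennreal d)"
        if "0 \<le> A" "0 \<le> x" "0 \<le> b" "0 \<le> y" "0 \<le> d" for A x b y d :: real
        using that by (simp add: ennreal_plus ennreal_mult)
      show "ennreal (E j \<omega>) = ennreal \<bar>residual y \<nu> (v / a j) (Tres n (v / a j) (dmat p (sample \<omega>) \<nu>))\<bar>
        + (ennreal (c * v) * ennreal (EQ j \<omega>) + ennreal (c * (2 * N)) * ennreal (EI \<omega>))"
        unfolding E_def by (rule *) (use EI0 EQ0 c v in auto)
    qed
    also have "\<dots> = rho y \<nu> (v / a j) + (ennreal (c * v) * (\<integral>\<^sup>+\<omega>. ennreal (EQ j \<omega>) \<partial>M) + ennreal (c * (2 * N)) * (\<integral>\<^sup>+\<omega>. ennreal (EI \<omega>) \<partial>M))"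
    proof -
      note [measurable] = mEI mEQ[of j] borel_measurable_residual[OF less_imp_le[OF \<nu>], of y \<nu> "v / a j" "v / a j"]
      show ?thesis unfolding rho_def by (simp add: nn_integral_add nn_integral_cmult)
    qed
    also have "\<dots> \<le> rho y \<nu> (v / a j) + (ennreal (c * v) * (ennreal (1 / v / v) * error_term \<nu>) + ennreal (c * (2 * N)) * (ennreal (1 / v) * error_term \<nu>))"
      by (intro add_left_mono add_mono mult_left_mono IEQ[OF j] IEI) auto
    also have "\<dots> = rho y \<nu> (v / a j) + ennreal (c * v * (1 / v / v) + c * (2 * N) * (1 / v)) * error_term \<nu>"
    proof -
      have "ennreal (c * v) * (ennreal (1 / v / v) * error_term \<nu>) = ennreal (c * v * (1 / v / v)) * error_term \<nu>"
        "ennreal (c * (2 * N)) * (ennreal (1 / v) * error_term \<nu>) = ennreal (c * (2 * N) * (1 / v)) * error_term \<nu>"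
        using c v by (simp_all only: mult.assoc[symmetric] ennreal_mult'[symmetric] mult_nonneg_nonneg less_imp_le of_nat_0_le_iff zero_le_numeral)
      moreover have "ennreal (c * v * (1 / v / v) + c * (2 * N) * (1 / v)) = ennreal (c * v * (1 / v / v)) + ennreal (c * (2 * N) * (1 / v))"
        using c v by (intro ennreal_plus) auto
      ultimately show ?thesis by (simp only: distrib_right)
    qed
    finally show ?thesis .
  qed
  have mE: "(\<lambda>\<omega>. ennreal (E j \<omega>)) \<in> borel_measurable M" for j
    unfolding E_def using mEI mEQ[of j] borel_measurable_residual[of \<nu>] \<nu>
    by (intro measurable_compose[OF _ measurable_ennreal] borel_measurable_add borel_measurable_abs borel_measurable_times borel_measurable_const) auto
  have md: "(\<lambda>\<omega>. ennreal (dev n p (sample \<omega>) \<nu>)) \<in> borel_measurable M"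
    by (rule measurable_compose[OF borel_measurable_dev measurable_ennreal]) (use \<nu> in simp)
  have mI: "(\<lambda>\<omega>. ennreal (EI \<omega>)) \<in> borel_measurable M"
    by (rule measurable_compose[OF mEI measurable_ennreal])
  have "rho y (Suc \<nu>) v \<le> (\<integral>\<^sup>+\<omega>. (\<Sum>j = 1..N. ennreal (E j \<omega>)) + ennreal (EI \<omega>) + ennreal \<bar>y (Suc \<nu>) - n / q\<bar> + ennreal (K / N)
      + ennreal (K / N) * ennreal (dev n p (sample \<omega>) \<nu>) \<partial>M)"
    unfolding rho_def
  proof (rule nn_integral_mono)
    fix \<omega>
    have "ennreal ((\<Sum>j = 1..N. E j \<omega>) + EI \<omega> + \<bar>y (Suc \<nu>) - n / q\<bar> + K / N + K / N * dev n p (sample \<omega>) \<nu>)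
       = (\<Sum>j = 1..N. ennreal (E j \<omega>)) + ennreal (EI \<omega>) + ennreal \<bar>y (Suc \<nu>) - n / q\<bar> + ennreal (K / N)
      + ennreal (K / N) * ennreal (dev n p (sample \<omega>) \<nu>)"
    proof -
      have *: "ennreal (x + b + z + d + e * f) = ennreal x + ennreal b + ennreal z + ennreal d + ennreal e * ennreal f"
        if "0 \<le> x" "0 \<le> b" "0 \<le> z" "0 \<le> d" "0 \<le> e" "0 \<le> f" for x b z d e f :: real
        using that by (simp add: ennreal_plus ennreal_mult)
      have "(\<Sum>j = 1..N. ennreal (E j \<omega>)) = ennreal (\<Sum>j = 1..N. E j \<omega>)"
        by (rule sum_ennreal) (rule E0)
      moreover have "0 \<le> (\<Sum>j = 1..N. E j \<omega>)" by (intro sum_nonneg E0)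
      ultimately show ?thesis using EI0[of \<omega>] K dev_nonneg[of "sample \<omega>" \<nu>] by (simp only:) (rule *, auto)
    qed
    then show "ennreal \<bar>residual y (Suc \<nu>) v (Tres n v (dmat p (sample \<omega>) (Suc \<nu>)))\<bar>
      \<le> (\<Sum>j = 1..N. ennreal (E j \<omega>)) + ennreal (EI \<omega>) + ennreal \<bar>y (Suc \<nu>) - n / q\<bar> + ennreal (K / N)
      + ennreal (K / N) * ennreal (dev n p (sample \<omega>) \<nu>)"
      using ennreal_leI[OF pw[of \<omega>]] by simp
  qed
  also have "\<dots> = (\<Sum>j = 1..N. \<integral>\<^sup>+\<omega>. ennreal (E j \<omega>) \<partial>M) + (\<integral>\<^sup>+\<omega>. ennreal (EI \<omega>) \<partial>M) + ennreal \<bar>y (Suc \<nu>) - n / q\<bar> + ennreal (K / N)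
      + ennreal (K / N) * Edev \<nu>"
  proof -
    note [measurable] = mE mI md
    show ?thesis
      unfolding Edev_def by (simp add: nn_integral_add nn_integral_sum nn_integral_cmult emeasure_space_1)
  qed
  also have "\<dots> \<le> (\<Sum>j = 1..N. rho y \<nu> (v / a j) + ennreal (c * v * (1 / v / v) + c * (2 * N) * (1 / v)) * error_term \<nu>)
      + ennreal (1 / v) * error_term \<nu> + ennreal \<bar>y (Suc \<nu>) - n / q\<bar> + ennreal (K / N) + ennreal (K / N) * Edev \<nu>"
    by (intro add_right_mono add_mono sum_mono IE IEI)
  also have "\<dots> = (\<Sum>j = 1..N. rho y \<nu> (v / a j)) + (of_nat N * ennreal (c * v * (1 / v / v) + c * (2 * N) * (1 / v)) + ennreal (1 / v)) * error_term \<nu>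
      + ennreal \<bar>y (Suc \<nu>) - n / q\<bar> + ennreal (K / N) + ennreal (K / N) * Edev \<nu>"
    by (simp add: sum.distrib distrib_right mult.assoc add.assoc)
  also have "\<dots> = (\<Sum>j = 1..N. rho y \<nu> (v / a j)) + ennreal (N * (c * (1 + 2 * N)) / v + 1 / v) * error_term \<nu>
      + ennreal \<bar>y (Suc \<nu>) - n / q\<bar> + ennreal (K / N) + ennreal (K / N) * Edev \<nu>"
  proof -
    have "c * v * (1 / v / v) + c * (2 * N) * (1 / v) = c * (1 + 2 * N) / v"
      using v by (simp add: field_simps)
    moreover have "of_nat N * ennreal (c * (1 + 2 * N) / v) = ennreal (N * (c * (1 + 2 * N)) / v)"
      using c v by (simp add: ennreal_of_nat_eq_real_of_nat ennreal_mult'[symmetric])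
    ultimately have "of_nat N * ennreal (c * v * (1 / v / v) + c * (2 * N) * (1 / v)) + ennreal (1 / v)
      = ennreal (N * (c * (1 + 2 * N)) / v + 1 / v)"
      using c v by (simp add: ennreal_plus[symmetric] del: ennreal_plus)
    then show ?thesis by (simp only:)
  qed
  finally show ?thesis unfolding a_def c_def q_def .
qed

end

text \<open>The majorant \<open>g\<close> and its limit may depend on \<open>e\<close>; this
  accommodates the parameters \<open>\<tau>\<close> and \<open>N\<close>, which are fixed before
  \<open>n\<close> tends to infinity.\<close>

lemma tendsto_0_ennrealI:
  fixes f :: "nat \<Rightarrow> ennreal"
  assumes "\<And>e. 0 < e \<Longrightarrow> \<exists>g l. (\<forall>n\<ge>1. f n \<le> g n) \<and> g \<longlonglongrightarrow> l \<and> l \<le> ennreal e"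
  shows "f \<longlonglongrightarrow> 0"
proof (rule order_tendstoI)
  fix a :: ennreal assume "0 < a"
  then obtain e where e: "0 < e" "ennreal e < a"
  proof -
    obtain b where b: "0 < b" "b < a" using dense[OF \<open>0 < a\<close>] by blast
    show thesis
    proof (cases b)
      case (real r)
      then show thesis using b that[of r] by auto
    qed (use b in auto)
  qed
  from assms[OF e(1)] obtain g l where g: "\<forall>n\<ge>1. f n \<le> g n" "g \<longlonglongrightarrow> l" "l \<le> ennreal e" by blast
  have "l < a" using g(3) e(2) by simp
  then have "eventually (\<lambda>n. g n < a) sequentially" using order_tendstoD(2)[OF g(2)] by blast
  then show "eventually (\<lambda>n. f n < a) sequentially"
    using eventually_ge_at_top[of 1] by eventually_elim (use g(1) in \<open>auto intro: le_less_trans\<close>)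
qed simp

lemma tendsto_cmult_ennreal:
  fixes f :: "'z \<Rightarrow> ennreal"
  assumes "(f \<longlongrightarrow> l) F" "0 < c" "c < \<top>"
  shows "((\<lambda>x. c * f x) \<longlongrightarrow> c * l) F"
  by (rule tendsto_mult_ennreal[OF tendsto_const assms(1)]) (use assms(2,3) in auto)

text \<open>The subtracted product is nonincreasing in \<open>t\<close> on [0, 1], so the linear
  term \<open>v t\<close> alone bounds the growth from below.\<close>

lemma residual_diff_ge:
  fixes y :: "nat \<Rightarrow> real" and t s v :: real
  assumes y: "\<And>l. l \<in> {1..\<nu>} \<Longrightarrow> 0 \<le> y l \<and> y l \<le> 1" and "0 \<le> t" "t \<le> s" "s \<le> 1"
  shows "v * (s - t) \<le> residual y \<nu> v s - residual y \<nu> v t"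
proof -
  have "(\<Prod>l = 1..\<nu>. 1 - y l * s) \<le> (\<Prod>l = 1..\<nu>. 1 - y l * t)"
    using y assms(2-4) by (intro prod_mono) (auto intro!: mult_left_mono mult_le_one)
  moreover have "0 \<le> (\<Prod>l = 1..\<nu>. 1 - y l * s)"
    using y assms(2-4) by (intro prod_nonneg) (auto intro!: mult_le_one)
  ultimately have "(1 - s) * (\<Prod>l = 1..\<nu>. 1 - y l * s) \<le> (1 - t) * (\<Prod>l = 1..\<nu>. 1 - y l * t)"
    using assms(2-4) by (intro mult_mono) auto
  then show ?thesis unfolding residual_def by (simp add: algebra_simps)
qed

lemma residual_stable:
  fixes y :: "nat \<Rightarrow> real" and t s v :: real
  assumes y: "\<And>l. l \<in> {1..\<nu>} \<Longrightarrow> 0 \<le> y l \<and> y l \<le> 1" and "0 \<le> t" "t \<le> 1" "0 \<le> s" "s \<le> 1"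
    and "residual y \<nu> v s = 0" and "0 < v"
  shows "\<bar>t - s\<bar> \<le> \<bar>residual y \<nu> v t\<bar> / v"
proof -
  have "v * \<bar>t - s\<bar> \<le> \<bar>residual y \<nu> v t\<bar>"
  proof (cases "t \<le> s")
    case True
    have "v * (s - t) \<le> residual y \<nu> v s - residual y \<nu> v t" by (rule residual_diff_ge) (use assms True in auto)
    then show ?thesis using True assms(6) by simp
  next
    case False
    have "v * (t - s) \<le> residual y \<nu> v t - residual y \<nu> v s" by (rule residual_diff_ge) (use assms False in auto)
    then show ?thesis using False assms(6) by simp
  qed
  then show ?thesis using assms(7) by (simp add: field_simps)
qed

text \<open>The residual is -1 at 0 and \<open>v\<close> at 1. The root names the limit of the
  normalised traces before any \<open>G_y\<close> is known to exist.\<close>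

lemma ex_residual_root:
  fixes y :: "nat \<Rightarrow> real" and v :: real
  assumes "0 < v" shows "\<exists>t. 0 \<le> t \<and> t \<le> 1 \<and> residual y \<nu> v t = 0"
proof -
  have "continuous_on {0..1} (residual y \<nu> v)"
    unfolding residual_def by (intro continuous_intros)
  moreover have "residual y \<nu> v 0 \<le> 0" "0 \<le> residual y \<nu> v 1" using assms by (auto simp: residual_def)
  ultimately show ?thesis using IVT'[of "residual y \<nu> v" 0 0 1] by auto
qed

subsection \<open>The limit of the normalised traces\<close>

locale product_model = prob_space M for M :: "'a measure" +
  fixes m :: nat and p :: "nat \<Rightarrow> nat \<Rightarrow> nat" and X :: "nat \<Rightarrow> nat \<Rightarrow> nat \<Rightarrow> nat \<Rightarrow> 'a \<Rightarrow> complex" and y :: "nat \<Rightarrow> real"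
  assumes m: "m \<ge> 1"
    and p0: "\<And>n. n \<ge> 1 \<Longrightarrow> p n 0 = n"
    and pmono: "\<And>n \<nu>. n \<ge> 1 \<Longrightarrow> \<nu> < m \<Longrightarrow> p n \<nu> \<le> p n (Suc \<nu>)"
    and indep: "\<And>n. n \<ge> 1 \<Longrightarrow> indep_vars (\<lambda>_. borel) (\<lambda>(\<nu>, j, k). X n \<nu> j k)
                 {(\<nu>, j, k). \<nu> \<in> {1..m} \<and> j < p n (\<nu> - 1) \<and> k < p n \<nu>}"
    and mean: "\<And>n \<nu> j k. n \<ge> 1 \<Longrightarrow> \<nu> \<in> {1..m} \<Longrightarrow> j < p n (\<nu> - 1) \<Longrightarrow> k < p n \<nu> \<Longrightarrow>
                 integrable M (X n \<nu> j k) \<and> (\<integral>\<omega>. X n \<nu> j k \<omega> \<partial>M) = 0"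
    and var: "\<And>n \<nu> j k. n \<ge> 1 \<Longrightarrow> \<nu> \<in> {1..m} \<Longrightarrow> j < p n (\<nu> - 1) \<Longrightarrow> k < p n \<nu> \<Longrightarrow>
                 integrable M (\<lambda>\<omega>. (cmod (X n \<nu> j k \<omega>))\<^sup>2) \<and>
                 (\<integral>\<omega>. (cmod (X n \<nu> j k \<omega>))\<^sup>2 \<partial>M) = 1"
    and lindeberg: "\<And>\<tau>. \<tau> > 0 \<Longrightarrow> (\<lambda>n. Lind M m p X n \<tau>) \<longlonglongrightarrow> 0"
    and ratio: "\<And>l. l \<in> {1..m} \<Longrightarrow> 0 < y l \<and> y l \<le> 1 \<and>
                 (\<lambda>n. real n / real (p n l)) \<longlonglongrightarrow> y l"
begin

definition XX :: "nat \<Rightarrow> nat \<times> nat \<times> nat \<Rightarrow> 'a \<Rightarrow> complex" where "XX n = (\<lambda>(\<nu>, j, k). X n \<nu> j k)"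

lemma random_layers:
  assumes n: "n \<ge> 1" and \<tau>: "\<tau> > 0"
  shows "random_layers M n m (p n) (XX n) \<tau> (Lind M m p X n \<tau>)"
proof
  show "0 < n" "p n 0 = n" "0 < \<tau>" using n p0 \<tau> by auto
  show "p n \<nu> \<le> p n (Suc \<nu>)" if "\<nu> < m" for \<nu> using pmono n that by auto
  show "indep_vars (\<lambda>_. borel) (XX n) (layers (p n) m)"
    using indep[OF n] unfolding XX_def layers_def .
  fix a assume "a \<in> layers (p n) m"
  then obtain \<nu> j k where a: "a = (\<nu>, j, k)" "\<nu> \<in> {1..m}" "j < p n (\<nu> - 1)" "k < p n \<nu>" unfolding layers_def by auto
  show "integrable M (XX n a)" "expectation (XX n a) = 0"
    using mean[OF n a(2-4)] unfolding a(1) XX_def by auto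
  show "integrable M (\<lambda>\<omega>. (cmod (XX n a \<omega>))\<^sup>2)" "expectation (\<lambda>\<omega>. (cmod (XX n a \<omega>))\<^sup>2) = 1"
    using var[OF n a(2-4)] unfolding a(1) XX_def by auto
next
  fix \<nu> assume \<nu>: "\<nu> \<in> {1..m}"
  have "(\<Sum>j<p n (\<nu> - 1). \<Sum>k<p n \<nu>. lind (\<tau> * sqrt n) (XX n (\<nu>, j, k))) / (real n)\<^sup>2
    = 1 / (real n)\<^sup>2 * (\<Sum>j < p n (\<nu> - 1). \<Sum>k < p n \<nu>.
        (\<integral>\<omega>. (cmod (X n \<nu> j k \<omega>))\<^sup>2 * indicator {\<omega>. cmod (X n \<nu> j k \<omega>) \<ge> \<tau> * sqrt (real n)} \<omega> \<partial>M))"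
    unfolding lind_def XX_def by simp
  also have "\<dots> \<le> Lind M m p X n \<tau>"
    unfolding Lind_def by (rule Max_ge) (use \<nu> in auto)
  finally show "(\<Sum>j<p n (\<nu> - 1). \<Sum>k<p n \<nu>. lind (\<tau> * sqrt n) (XX n (\<nu>, j, k))) / (real n)\<^sup>2 \<le> Lind M m p X n \<tau>" .
qed

definition "Ef n \<nu> = random_layers.Efrob M n (p n) (XX n) \<nu>"
definition "Ed n \<nu> = random_layers.Edev M n (p n) (XX n) \<nu>"
definition "Er n \<nu> v = random_layers.rho M n (p n) (XX n) y \<nu> v"

lemma y_bounds: "l \<in> {1..m} \<Longrightarrow> 0 \<le> y l \<and> y l \<le> 1"
  using ratio[of l] by auto

lemma dmat_0: "n \<ge> 1 \<Longrightarrow> i < n \<Longrightarrow> j < n \<Longrightarrow> dmat (p n) x 0 i j = idm i j"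
proof -
  assume n: "n \<ge> 1" and ij: "i < n" "j < n"
  have "wprod (p n) x 0 = idm" by (intro ext) simp
  moreover have "adj idm = idm" by (intro ext) (simp add: adj_def idm_def)
  ultimately have "dmat (p n) x 0 = mmul n idm idm" by (simp only: gram_eq_mmul p0[OF n])
  then show "dmat (p n) x 0 i j = idm i j" using ij by (simp only: mmul_idm)
qed

lemma Ef_0: assumes "n \<ge> 1" shows "Ef n 0 = ennreal (1 / sqrt n)"
proof -
  interpret random_layers M n m "p n" "XX n" 1 "Lind M m p X n 1" by (rule random_layers) (use assms in auto)
  have "frob n (dmat (p n) x 0) = sqrt n" for x
  proof -
    have "(\<Sum>i<n. \<Sum>j<n. (cmod (dmat (p n) x 0 i j))\<^sup>2) = (\<Sum>i<n. \<Sum>j<n. if i = j then 1 else 0)"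
      using assms by (intro sum.cong refl) (simp add: dmat_0 del: wprod.simps, simp add: idm_def)
    then show ?thesis unfolding frob_def by simp
  qed
  then show ?thesis
    unfolding Ef_def Efrob_def using assms by (simp add: emeasure_space_1 real_div_sqrt field_simps del: wprod.simps)
qed

lemma Ed_0: assumes "n \<ge> 1" shows "Ed n 0 = 0"
proof -
  interpret random_layers M n m "p n" "XX n" 1 "Lind M m p X n 1" by (rule random_layers) (use assms in auto)
  have "colsq n (p n) x 0 k = 1" if "k < n" for x k
  proof -
    have "(\<Sum>i<n. (cmod (wprod (p n) x 0 i k))\<^sup>2) = (\<Sum>i<n. if i = k then 1 else 0)"
      by (intro sum.cong refl) (simp add: idm_def)
    then show ?thesis unfolding colsq_def cnorm_sq using that by simp
  qed
  then have "dev n (p n) x 0 = 0" for x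
    unfolding dev_def using assms by (simp add: p0)
  then show ?thesis unfolding Ed_def Edev_def by simp
qed

text \<open>For the empty product \<open>D\<close> is the identity and
  \<open>t = 1 / (1 + v)\<close>, the exact root of \<open>v t = 1 - t\<close>.\<close>

lemma Er_0: assumes "n \<ge> 1" "0 < v" shows "Er n 0 v = 0"
proof -
  interpret random_layers M n m "p n" "XX n" 1 "Lind M m p X n 1" by (rule random_layers) (use assms in auto)
  have "Tres n v (dmat (p n) x 0) = 1 / (1 + v)" for x
  proof -
    have "idm i j / of_real (1 + v) = resolvent n v (dmat (p n) x 0) i j" if "i < n" "j < n" for i j
    proof (rule resolvent_eqI[OF hpsd_gram assms(2) _ that, where S = "\<lambda>i j. idm i j / of_real (1 + v)"])
      fix i j assume ij: "i < n" "j < n"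
      let ?w = "complex_of_real (1 + v)"
      have w: "?w \<noteq> 0" using assms(2) unfolding of_real_eq_0_iff by linarith
      have *: "z / ?w + of_real v * (z / ?w) = z" for z
      proof -
        have "z / ?w + of_real v * (z / ?w) = ?w * (z / ?w)" by (simp only: of_real_add of_real_1 distrib_right mult_1)
        then show ?thesis using w by simp
      qed
      have "mmul n (dmat (p n) x 0) (\<lambda>i j. idm i j / ?w) i j = mmul n idm (\<lambda>i j. idm i j / ?w) i j"
        using ij assms(1) by (intro mmul_cong) (simp_all add: dmat_0 del: wprod.simps)
      also have "\<dots> = idm i j / ?w" using ij by (simp only: mmul_idm)
      finally show "mmul n (dmat (p n) x 0) (\<lambda>i j. idm i j / ?w) i j + of_real v * (idm i j / ?w) = idm i j"
        by (simp only: *)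
    qed
    then have "ctrace n (resolvent n v (dmat (p n) x 0)) = (\<Sum>i<n. of_real (1 / (1 + v)))"
      unfolding ctrace_def by (intro sum.cong refl) (simp add: idm_def flip: \<open>\<And>i j. i < n \<Longrightarrow> j < n \<Longrightarrow> _ = resolvent n v (dmat (p n) x 0) i j\<close> del: wprod.simps)
    also have "\<dots> = of_real (n * (1 / (1 + v)))" by simp
    finally have "Re (ctrace n (resolvent n v (dmat (p n) x 0))) = n * (1 / (1 + v))" by (simp only: Re_complex_of_real)
    then show ?thesis unfolding Tres_def using assms by (simp add: field_simps)
  qed
  then have "residual y 0 v (Tres n v (dmat (p n) x 0)) = 0" for x
    unfolding residual_def using assms(2) by (simp add: field_simps del: wprod.simps)
  then show ?thesis unfolding Er_def rho_def by (simp del: wprod.simps)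
qed

text \<open>A joint induction in which the order matters: \<open>Ed\<close> at the next layer is
  bounded by both quantities of the present one, and \<open>Ef\<close> at the next layer by the
  \<open>Ed\<close> just obtained. For \<open>Ed\<close> the parameter \<open>\<tau>\<close> is
  \<open>e\<close> itself.\<close>

lemma Ef_Ed_tendsto:
  "\<nu> \<le> m \<Longrightarrow> (\<lambda>n. Ef n \<nu>) \<longlonglongrightarrow> 0 \<and> (\<lambda>n. Ed n \<nu>) \<longlonglongrightarrow> 0"
proof (induction \<nu>)
  case 0
  have "(\<lambda>n. 1 / sqrt (real n)) \<longlonglongrightarrow> 0" by real_asymp
  then have 1: "(\<lambda>n. ennreal (1 / sqrt (real n))) \<longlonglongrightarrow> 0" using tendsto_ennrealI by fastforce
  have "eventually (\<lambda>n. ennreal (1 / sqrt (real n)) = Ef n 0) sequentially"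
    using eventually_ge_at_top[of 1] by eventually_elim (simp add: Ef_0)
  with 1 have "(\<lambda>n. Ef n 0) \<longlonglongrightarrow> 0" by (rule Lim_transform_eventually)
  moreover have "eventually (\<lambda>n. 0 = Ed n 0) sequentially"
    using eventually_ge_at_top[of 1] by eventually_elim (simp add: Ed_0)
  then have "(\<lambda>n. Ed n 0) \<longlonglongrightarrow> 0" by (rule Lim_transform_eventually[OF tendsto_const])
  ultimately show ?case by blast
next
  case (Suc \<nu>)
  then have IH: "(\<lambda>n. Ef n \<nu>) \<longlonglongrightarrow> 0" "(\<lambda>n. Ed n \<nu>) \<longlonglongrightarrow> 0" and \<nu>: "\<nu> < m" by auto
  have Ed: "(\<lambda>n. Ed n (Suc \<nu>)) \<longlonglongrightarrow> 0"
  proof (rule tendsto_0_ennrealI)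
    fix e :: real assume e: "0 < e"
    let ?g = "\<lambda>n. 2 * Ef n \<nu> + 3 * Ed n \<nu> + ennreal (e + 2 * Lind M m p X n e)"
    have "Ed n (Suc \<nu>) \<le> ?g n" if "n \<ge> 1" for n
    proof -
      interpret random_layers M n m "p n" "XX n" e "Lind M m p X n e" by (rule random_layers) (use that e in auto)
      show ?thesis unfolding Ed_def Ef_def by (rule Edev_Suc[OF \<nu>])
    qed
    moreover have "?g \<longlonglongrightarrow> 2 * 0 + 3 * 0 + ennreal (e + 2 * 0)"
      by (intro tendsto_add tendsto_cmult_ennreal IH tendsto_ennrealI tendsto_const tendsto_mult lindeberg e) auto
    ultimately show "\<exists>g l. (\<forall>n\<ge>1. Ed n (Suc \<nu>) \<le> g n) \<and> g \<longlonglongrightarrow> l \<and> l \<le> ennreal e"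
      by (intro exI[of _ ?g] exI[of _ "ennreal e"]) auto
  qed
  have "(\<lambda>n. Ef n (Suc \<nu>)) \<longlonglongrightarrow> 0"
  proof (rule tendsto_0_ennrealI)
    fix e :: real assume e: "0 < e"
    let ?g = "\<lambda>n. Ef n \<nu> + ennreal (1 / sqrt n) + Ed n (Suc \<nu>)"
    have "Ef n (Suc \<nu>) \<le> ?g n" if "n \<ge> 1" for n
    proof -
      interpret random_layers M n m "p n" "XX n" e "Lind M m p X n e" by (rule random_layers) (use that e in auto)
      show ?thesis unfolding Ed_def Ef_def by (rule Efrob_Suc[OF \<nu>])
    qed
    moreover have "(\<lambda>n. 1 / sqrt (real n)) \<longlonglongrightarrow> 0" by real_asymp
    then have "?g \<longlonglongrightarrow> 0 + ennreal 0 + 0"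
      by (intro tendsto_add IH Ed tendsto_ennrealI)
    ultimately show "\<exists>g l. (\<forall>n\<ge>1. Ef n (Suc \<nu>) \<le> g n) \<and> g \<longlonglongrightarrow> l \<and> l \<le> ennreal e"
      by (intro exI[of _ ?g] exI[of _ 0]) auto
  qed
  with Ed show ?case by blast
qed

lemma Er_tendsto:
  "\<nu> \<le> m \<Longrightarrow> 0 < v \<Longrightarrow> (\<lambda>n. Er n \<nu> v) \<longlonglongrightarrow> 0"
proof (induction \<nu> arbitrary: v)
  case 0
  have "eventually (\<lambda>n. 0 = Er n 0 v) sequentially"
    using eventually_ge_at_top[of 1] by eventually_elim (simp add: Er_0 0)
  then show ?case by (rule Lim_transform_eventually[OF tendsto_const])
next
  case (Suc \<nu>)
  then have \<nu>: "\<nu> < m" and v: "0 < v" by auto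
  have EfEd: "(\<lambda>n. Ef n \<nu>) \<longlonglongrightarrow> 0" "(\<lambda>n. Ed n \<nu>) \<longlonglongrightarrow> 0"
    using Ef_Ed_tendsto[of \<nu>] \<nu> by auto
  define K where "K = 1 + (v + \<nu> + 1) / v"
  have K: "0 < K" unfolding K_def using v by (simp add: add_pos_nonneg)
  show ?case
  proof (rule tendsto_0_ennrealI)
    fix e :: real assume e: "0 < e"
    \<comment> \<open>Order of the choices: \<open>N\<close> makes the grid error at most
      \<open>e / 2\<close>, it determines the constant \<open>C\<close>, and \<open>\<tau>\<close>
      is such that \<open>C * \<tau>\<close> is the other half. The induction hypothesis is needed
      at the finitely many points \<open>v / (j / N)\<close>, hence for arbitrary
      \<open>v\<close>.\<close>
    obtain N :: nat where N: "0 < N" "K / N \<le> e / 2"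
    proof -
      obtain N :: nat where "2 * K / e < N" using reals_Archimedean2 by blast
      moreover have "0 < 2 * K / e" using K e by simp
      ultimately have "0 < real N" by linarith
      with \<open>2 * K / e < N\<close> have "K / N \<le> e / 2" using e by (simp add: field_simps)
      with \<open>0 < real N\<close> show ?thesis using that[of N] by simp
    qed
    define C where "C = N * ((v + \<nu> + 1) * real (1 + 2 * N)) / v + 1 / v"
    have C: "0 < C" unfolding C_def using v by (intro add_nonneg_pos) auto
    define \<tau> where "\<tau> = e / 2 / C"
    have \<tau>: "0 < \<tau>" unfolding \<tau>_def using e C by simp
    let ?g = "\<lambda>n. (\<Sum>j = 1..N. Er n \<nu> (v / (real j / N)))
      + ennreal C * (3 * Ef n \<nu> + 2 * Ed n \<nu> + ennreal (\<tau> + 2 * Lind M m p X n \<tau>))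
      + ennreal \<bar>y (Suc \<nu>) - n / p n (Suc \<nu>)\<bar> + ennreal (K / N) + ennreal (K / N) * Ed n \<nu>"
    have a1: "Er n (Suc \<nu>) v \<le> ?g n" if "n \<ge> 1" for n
    proof -
      interpret random_layers M n m "p n" "XX n" \<tau> "Lind M m p X n \<tau>" by (rule random_layers) (use that \<tau> in auto)
      show ?thesis
        using rho_Suc[OF \<nu> v N(1), of y] y_bounds \<nu>
        unfolding Er_def Ed_def Ef_def C_def K_def error_term_def by auto
    qed
    have a2: "?g \<longlonglongrightarrow> (\<Sum>j = 1..N. 0) + ennreal C * (3 * 0 + 2 * 0 + ennreal (\<tau> + 2 * 0))
        + ennreal \<bar>y (Suc \<nu>) - y (Suc \<nu>)\<bar> + ennreal (K / N) + ennreal (K / N) * 0"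
    proof -
      have r: "(\<lambda>n. real n / real (p n (Suc \<nu>))) \<longlonglongrightarrow> y (Suc \<nu>)" using ratio[of "Suc \<nu>"] \<nu> by auto
      show ?thesis
        by (intro tendsto_add tendsto_sum tendsto_cmult_ennreal EfEd tendsto_ennrealI tendsto_const tendsto_mult lindeberg \<tau>
            tendsto_rabs tendsto_diff r Suc.IH) (use \<nu> v N C K in auto)
    qed
    have a3: "(\<Sum>j = 1..N. 0) + ennreal C * (3 * 0 + 2 * 0 + ennreal (\<tau> + 2 * 0))
        + ennreal \<bar>y (Suc \<nu>) - y (Suc \<nu>)\<bar> + ennreal (K / N) + ennreal (K / N) * 0 \<le> ennreal e"
    proof -
      have "ennreal C * ennreal \<tau> + ennreal (K / N) = ennreal (C * \<tau> + K / N)"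
        using C \<tau> K by (simp add: ennreal_plus ennreal_mult)
      also have "\<dots> \<le> ennreal e"
      proof (rule ennreal_leI)
        have "C * \<tau> = e / 2" unfolding \<tau>_def using C by simp
        then show "C * \<tau> + K / N \<le> e" using N(2) by linarith
      qed
      finally show ?thesis by simp
    qed
    show "\<exists>g l. (\<forall>n\<ge>1. Er n (Suc \<nu>) v \<le> g n) \<and> g \<longlonglongrightarrow> l \<and> l \<le> ennreal e"
      by (rule exI, rule exI, rule conjI[OF _ conjI[OF a2 a3]]) (use a1 in blast)
  qed
qed

definition "TT n v \<omega> = Tres n v (dmat (p n) (\<lambda>a. XX n a \<omega>) m)"

lemma TT_bounds: "n \<ge> 1 \<Longrightarrow> 0 < v \<Longrightarrow> 0 \<le> TT n v \<omega>" "n \<ge> 1 \<Longrightarrow> 0 < v \<Longrightarrow> TT n v \<omega> \<le> 1"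
  unfolding TT_def by (rule Tres_bounds[OF hpsd_gram]; simp)+

lemma TT_measurable: assumes "n \<ge> 1" shows "TT n v \<in> borel_measurable M"
proof -
  interpret random_layers M n m "p n" "XX n" 1 "Lind M m p X n 1" by (rule random_layers) (use assms in auto)
  show ?thesis unfolding TT_def[abs_def] by (rule borel_measurable_Tres) simp
qed

text \<open>By stability every realisation of \<open>TT\<close> is within its own residual over
  \<open>v\<close> of the root, so convergence in mean passes from the residual to \<open>TT\<close>
  without any concentration argument.\<close>

lemma expectation_TT_tendsto:
  assumes v: "0 < v" and t: "0 \<le> t" "t \<le> 1" "residual y m v t = 0"
  shows "(\<lambda>n. expectation (TT n v)) \<longlonglongrightarrow> t"
proof -
  have int: "integrable M (TT n v)" if "n \<ge> 1" for n
    by (rule integrable_const_bound[where B = 1]) (use TT_bounds[OF that v] TT_measurable[OF that] in auto)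
  have le: "ennreal \<bar>expectation (TT n v) - t\<bar> \<le> ennreal (1 / v) * Er n m v" if n1: "n \<ge> 1" for n
  proof -
    interpret random_layers M n m "p n" "XX n" 1 "Lind M m p X n 1" by (rule random_layers) (use n1 in auto)
    have [measurable]: "(\<lambda>\<omega>. residual y m v (TT n v \<omega>)) \<in> borel_measurable M"
      unfolding TT_def by (rule borel_measurable_residual) simp
    have "expectation (TT n v) - t = expectation (\<lambda>\<omega>. TT n v \<omega> - t)" using int[OF n1] by (simp add: prob_space)
    then have "\<bar>expectation (TT n v) - t\<bar> \<le> expectation (\<lambda>\<omega>. \<bar>TT n v \<omega> - t\<bar>)"
      using integral_norm_bound[of M "\<lambda>\<omega>. TT n v \<omega> - t"] by simp
    then have "ennreal \<bar>expectation (TT n v) - t\<bar> \<le> ennreal (expectation (\<lambda>\<omega>. \<bar>TT n v \<omega> - t\<bar>))" by (rule ennreal_leI)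
    also have "\<dots> = (\<integral>\<^sup>+\<omega>. ennreal \<bar>TT n v \<omega> - t\<bar> \<partial>M)"
      using int[OF n1] by (intro nn_integral_eq_integral[symmetric]) auto
    also have "\<dots> \<le> (\<integral>\<^sup>+\<omega>. ennreal (1 / v) * ennreal \<bar>residual y m v (TT n v \<omega>)\<bar> \<partial>M)"
    proof (rule nn_integral_mono)
      fix \<omega>
      have "\<bar>TT n v \<omega> - t\<bar> \<le> \<bar>residual y m v (TT n v \<omega>)\<bar> / v"
        by (rule residual_stable[OF y_bounds]) (use TT_bounds[OF n1 v] t v in auto)
      then show "ennreal \<bar>TT n v \<omega> - t\<bar> \<le> ennreal (1 / v) * ennreal \<bar>residual y m v (TT n v \<omega>)\<bar>"
        using v by (simp add: ennreal_mult[symmetric] ennreal_leI)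
    qed
    also have "\<dots> = ennreal (1 / v) * Er n m v"
      unfolding Er_def rho_def TT_def[symmetric] by (rule nn_integral_cmult) measurable
    finally show ?thesis .
  qed
  have "(\<lambda>n. ennreal \<bar>expectation (TT n v) - t\<bar>) \<longlonglongrightarrow> 0"
  proof (rule tendsto_0_ennrealI)
    fix e :: real assume "0 < e"
    have "(\<lambda>n. ennreal (1 / v) * Er n m v) \<longlonglongrightarrow> ennreal (1 / v) * 0"
      by (intro tendsto_cmult_ennreal Er_tendsto v) (use v in auto)
    then show "\<exists>g l. (\<forall>n\<ge>1. ennreal \<bar>expectation (TT n v) - t\<bar> \<le> g n) \<and> g \<longlonglongrightarrow> l \<and> l \<le> ennreal e"
      using le by (intro exI[of _ "\<lambda>n. ennreal (1 / v) * Er n m v"] exI[of _ 0]) auto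
  qed
  then have "(\<lambda>n. enn2real (ennreal \<bar>expectation (TT n v) - t\<bar>)) \<longlonglongrightarrow> enn2real 0"
    by (intro tendsto_enn2real) auto
  then have "(\<lambda>n. \<bar>expectation (TT n v) - t\<bar>) \<longlonglongrightarrow> 0" by simp
  then show ?thesis by (simp only: tendsto_rabs_zero_iff LIM_zero_iff)
qed

text \<open>\<open>n TT\<close> is the trace of \<open>D R\<close>, at most \<open>tr D / v\<close>,
  and \<open>tr D\<close> is at most \<open>n (1 + dev)\<close>. The decay in \<open>v\<close> is
  the same for all \<open>n\<close> with \<open>Ed\<close> bounded, which is what tightness asks
  for.\<close>

lemma expectation_TT_le:
  assumes n1: "n \<ge> 1" and v: "0 < v"
  shows "ennreal (expectation (TT n v)) \<le> ennreal (1 / v) * (1 + Ed n m)"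
proof -
  interpret random_layers M n m "p n" "XX n" 1 "Lind M m p X n 1" by (rule random_layers) (use n1 in auto)
  have le: "TT n v \<omega> \<le> 1 / v * (1 + dev n (p n) (\<lambda>a. XX n a \<omega>) m)" for \<omega>
  proof -
    let ?x = "\<lambda>a. XX n a \<omega>"
    let ?D = "dmat (p n) ?x m"
    let ?R = "resolvent n v ?D"
    have "of_real n - of_real v * ctrace n ?R = ctrace n (mmul n ?D ?R)"
      unfolding ctrace_def sum_distrib_left
      using resolvent_right[OF hpsd_gram v, of _ n _ "{..<p n m}" "wprod (p n) ?x m"] by (simp add: sum_subtractf idm_def)
    also have "\<dots> = (\<Sum>k<p n m. cinner n (\<lambda>i. wprod (p n) ?x m i k) (mvec n ?R (\<lambda>i. wprod (p n) ?x m i k)))"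
      by (rule ctrace_mmul_gram)
    finally have eq: "of_real n - of_real v * ctrace n ?R = (\<Sum>k<p n m. cinner n (\<lambda>i. wprod (p n) ?x m i k) (mvec n ?R (\<lambda>i. wprod (p n) ?x m i k)))" .
    have "n * TT n v \<omega> = Re (of_real n - of_real v * ctrace n ?R)"
      unfolding TT_def Tres_def using n by (simp add: field_simps)
    also have "\<dots> \<le> cmod (of_real n - of_real v * ctrace n ?R)" by (rule complex_Re_le_cmod)
    also have "\<dots> \<le> (\<Sum>k<p n m. 1 / v * colsq n (p n) ?x m k)"
      unfolding eq colsq_def by (intro sum_norm_le cmod_cinner_mvec_le opbound_resolvent hpsd_gram v)
    also have "\<dots> = 1 / v * (\<Sum>k<p n m. colsq n (p n) ?x m k)" by (simp add: sum_distrib_left)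
    also have "\<dots> \<le> 1 / v * (n + n * dev n (p n) ?x m)"
      using sum_colsq_dev[of m ?x] v by (intro mult_left_mono) auto
    also have "\<dots> = n * (1 / v * (1 + dev n (p n) ?x m))" by (simp add: algebra_simps)
    finally show ?thesis using n by (simp only: mult_le_cancel_left_pos of_nat_0_less_iff)
  qed
  have int: "integrable M (TT n v)"
    by (rule integrable_const_bound[where B = 1]) (use TT_bounds[OF n1 v] TT_measurable[OF n1] in auto)
  have [measurable]: "(\<lambda>\<omega>. dev n (p n) (\<lambda>a. XX n a \<omega>) m) \<in> borel_measurable M" by (rule borel_measurable_dev) simp
  have "ennreal (expectation (TT n v)) = (\<integral>\<^sup>+\<omega>. ennreal (TT n v \<omega>) \<partial>M)"
    using int TT_bounds[OF n1 v] by (intro nn_integral_eq_integral[symmetric]) auto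
  also have "\<dots> \<le> (\<integral>\<^sup>+\<omega>. ennreal (1 / v) * (1 + ennreal (dev n (p n) (\<lambda>a. XX n a \<omega>) m)) \<partial>M)"
  proof (rule nn_integral_mono)
    fix \<omega>
    have "ennreal (1 / v * (1 + dev n (p n) (\<lambda>a. XX n a \<omega>) m)) = ennreal (1 / v) * ennreal (1 + dev n (p n) (\<lambda>a. XX n a \<omega>) m)"
      using v dev_nonneg by (intro ennreal_mult) auto
    also have "\<dots> = ennreal (1 / v) * (1 + ennreal (dev n (p n) (\<lambda>a. XX n a \<omega>) m))"
      using dev_nonneg by (simp add: ennreal_plus)
    finally show "ennreal (TT n v \<omega>) \<le> ennreal (1 / v) * (1 + ennreal (dev n (p n) (\<lambda>a. XX n a \<omega>) m))"
      using ennreal_leI[OF le[of \<omega>]] by simp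
  qed
  also have "\<dots> = ennreal (1 / v) * (1 + Ed n m)"
    unfolding Ed_def Edev_def by (simp add: nn_integral_cmult nn_integral_add emeasure_space_1)
  finally show ?thesis .
qed

end

subsection \<open>Spectra and singular values\<close>

lemma order_linear_prod:
  fixes es :: "complex list"
  shows "order e (\<Prod>a\<leftarrow>es. [:- a, 1:]) = count_list es e"
proof (induction es)
  case Nil
  then show ?case by (simp add: order_0I)
next
  case (Cons a es)
  have "(\<Prod>a\<leftarrow>es. [:- a, 1:]) \<noteq> 0" by (auto simp: prod_list_zero_iff)
  then have nz: "[:- a, 1:] * (\<Prod>a\<leftarrow>es. [:- a, 1:]) \<noteq> 0" by (simp only: mult_eq_0_iff) simp
  have "order e [:- a, 1:] = (if a = e then 1 else 0)"
  proof (cases "a = e")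
    case True
    have "order e ([:- e, 1:] ^ 1) = 1" by (rule order_power_n_n)
    with True show ?thesis by simp
  next
    case False
    then show ?thesis by (simp add: order_0I)
  qed
  then show ?case using Cons order_mult[OF nz, of e] by simp
qed

text \<open>From the last row upward: the entries of \<open>S\<close> below the diagonal in later
  rows vanish, so row \<open>i\<close> of \<open>B * S\<close> at a column \<open>j \<le> i\<close>
  reduces to the single product of the diagonal entry of \<open>B\<close> with the entry of
  \<open>S\<close>.\<close>

lemma upper_triangular_inverse_diag:
  fixes B S :: "complex mat"
  assumes B: "B \<in> carrier_mat n n" "upper_triangular B" and S: "S \<in> carrier_mat n n" and BS: "B * S = 1\<^sub>m n"
    and d: "\<And>i. i < n \<Longrightarrow> B $$ (i, i) \<noteq> 0" and i: "i < n"
  shows "S $$ (i, i) = 1 / B $$ (i, i)"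
proof -
  have row: "(\<Sum>l<n. B $$ (i, l) * S $$ (l, j)) = (if i = j then 1 else 0)" if "i < n" "j < n" for i j
  proof -
    have "(B * S) $$ (i, j) = (\<Sum>l<n. B $$ (i, l) * S $$ (l, j))"
      using that B S by (simp add: scalar_prod_def atLeast0LessThan)
    then show ?thesis unfolding BS using that by simp
  qed
  have "\<forall>j<n. (j < i \<longrightarrow> S $$ (i, j) = 0) \<and> (j = i \<longrightarrow> S $$ (i, i) = 1 / B $$ (i, i))" if "i < n" for i
    using that
  proof (induction "n - i" arbitrary: i rule: less_induct)
    case less
    have low: "S $$ (l, j) = 0" if "i < l" "l < n" "j < l" for l j
      using less.hyps[of l] less.prems that by auto
    have eq: "B $$ (i, i) * S $$ (i, j) = (if i = j then 1 else 0)" if j: "j \<le> i" for j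
    proof -
      have "(\<Sum>l<n. B $$ (i, l) * S $$ (l, j)) = (\<Sum>l\<in>{i}. B $$ (i, l) * S $$ (l, j))"
      proof (rule sum.mono_neutral_right)
        show "\<forall>l\<in>{..<n} - {i}. B $$ (i, l) * S $$ (l, j) = 0"
        proof
          fix l assume l: "l \<in> {..<n} - {i}"
          show "B $$ (i, l) * S $$ (l, j) = 0"
          proof (cases "l < i")
            case True
            then show ?thesis using upper_triangularD[OF B(2), of l i] less.prems B(1) by auto
          next
            case False
            then show ?thesis using low[of l j] l j by auto
          qed
        qed
      qed (use less.prems in auto)
      then show ?thesis using row[of i j] less.prems j by simp
    qed
    show ?case
      using eq d[OF less.prems] less.prems by (auto simp: field_simps) (metis eq less_imp_le mult_eq_0_iff nat_neq_iff)
  qed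
  then show ?thesis using i by blast
qed

lemma mat_of_resolvent:
  assumes A: "hpsd n a" and v: "0 < v"
  defines "R \<equiv> Matrix.mat n n (\<lambda>(i, j). resolvent n v a i j)"
  shows "(Matrix.mat n n (\<lambda>(i, j). a i j) + of_real v \<cdot>\<^sub>m 1\<^sub>m n) * R = 1\<^sub>m n"
proof (rule eq_matI)
  fix i j assume "i < dim_row (1\<^sub>m n :: complex mat)" "j < dim_col (1\<^sub>m n :: complex mat)"
  then have ij: "i < n" "j < n" by auto
  let ?M = "Matrix.mat n n (\<lambda>(i, j). a i j) + of_real v \<cdot>\<^sub>m 1\<^sub>m n"
  have "(?M * R) $$ (i, j) = (\<Sum>l<n. (a i l + of_real v * idm i l) * resolvent n v a l j)"
    using ij by (auto simp: R_def scalar_prod_def atLeast0LessThan idm_def intro!: sum.cong)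
  also have "\<dots> = mmul n a (resolvent n v a) i j + of_real v * mmul n idm (resolvent n v a) i j"
    unfolding mmul_def by (simp add: distrib_right sum.distrib sum_distrib_left mult.assoc)
  also have "\<dots> = idm i j"
    using ij by (simp add: mmul_idm resolvent_right[OF A v])
  finally show "(?M * R) $$ (i, j) = 1\<^sub>m n $$ (i, j)" using ij by (simp add: idm_def)
qed (auto simp: R_def)

lemma hpsd_eigenvalue:
  assumes A: "hpsd n a" and e: "eigenvalue (Matrix.mat n n (\<lambda>(i, j). a i j)) e"
  shows "e \<in> \<real>" "0 \<le> Re e"
proof -
  obtain x where x: "x \<in> carrier_vec n" "x \<noteq> 0\<^sub>v n" "Matrix.mat n n (\<lambda>(i, j). a i j) *\<^sub>v x = e \<cdot>\<^sub>v x"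
    using e unfolding eigenvalue_def eigenvector_def by auto
  define u where "u i = x $ i" for i
  have eq: "mvec n a u i = e * u i" if "i < n" for i
  proof -
    have "(Matrix.mat n n (\<lambda>(i, j). a i j) *\<^sub>v x) $ i = mvec n a u i"
      using that x(1) by (simp add: scalar_prod_def atLeast0LessThan mvec_def u_def)
    then show ?thesis unfolding x(3) using that x(1) by (simp add: u_def)
  qed
  have "cinner n u (mvec n a u) = cinner n u (\<lambda>i. e * u i)"
    by (rule cinner_cong) (auto simp: eq)
  also have "\<dots> = e * cinner n u u" unfolding cinner_def by (simp add: sum_distrib_left mult_ac)
  finally have q: "cinner n u (mvec n a u) = e * of_real ((cnorm n u)\<^sup>2)" unfolding cinner_self .
  have pos: "0 < (cnorm n u)\<^sup>2"
  proof -
    obtain i where i: "i < n" "u i \<noteq> 0"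
      using x(1,2) unfolding u_def by (metis carrier_vecD eq_vecI index_zero_vec)
    then have "0 < (cmod (u i))\<^sup>2" by simp
    also have "\<dots> \<le> (\<Sum>i<n. (cmod (u i))\<^sup>2)" using i by (intro member_le_sum) auto
    finally show ?thesis unfolding cnorm_sq .
  qed
  have "cnj (cinner n u (mvec n a u)) = cinner n u (mvec n a u)"
    using A by (simp add: cnj_cinner cinner_mvec_hermitian hpsd_def)
  then have "cnj e * of_real ((cnorm n u)\<^sup>2) = e * of_real ((cnorm n u)\<^sup>2)"
    unfolding q by simp
  moreover have "complex_of_real ((cnorm n u)\<^sup>2) \<noteq> 0" using pos unfolding of_real_eq_0_iff by linarith
  ultimately have "cnj e = e" by (simp only: mult_cancel_right) simp
  then show "e \<in> \<real>" by (simp add: Reals_cnj_iff)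
  have "0 \<le> Re (cinner n u (mvec n a u))" using A by (simp add: hpsd_def)
  then have "0 \<le> Re e * (cnorm n u)\<^sup>2" unfolding q by (simp only: times_complex.sel Re_complex_of_real Im_complex_of_real mult_zero_right diff_zero)
  then show "0 \<le> Re e" using pos by (simp only: zero_le_mult_iff) auto
qed

text \<open>Schur form: the resolvent is similar to the inverse of an upper triangular matrix with
  diagonal \<open>e + v\<close>, and the trace is invariant under similarity. One triangular form
  serves the characteristic polynomial and all \<open>v\<close> at once, so multiplicities agree
  without diagonalisation.\<close>

lemma hpsd_spectrum:
  assumes A: "hpsd n a"
  obtains es :: "real list" where "length es = n" "\<And>e. e \<in> set es \<Longrightarrow> 0 \<le> e"
    "char_poly (Matrix.mat n n (\<lambda>(i, j). a i j)) = (\<Prod>e\<leftarrow>es. [:- of_real e, 1:])"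
    "\<And>v. 0 < v \<Longrightarrow> ctrace n (resolvent n v a) = of_real (\<Sum>e\<leftarrow>es. 1 / (e + v))"
proof -
  define A' where "A' = Matrix.mat n n (\<lambda>(i, j). a i j)"
  have A': "A' \<in> carrier_mat n n" unfolding A'_def by simp
  obtain cs where cs: "char_poly A' = (\<Prod>a\<leftarrow>cs. [:- a, 1:])" "length cs = n"
    using char_poly_factorized[OF A'] by blast
  have ev: "e \<in> \<real>" "0 \<le> Re e" if "e \<in> set cs" for e
  proof -
    have "poly (char_poly A') e = 0" unfolding cs(1) using that by (rule linear_poly_root)
    then have "eigenvalue A' e" unfolding eigenvalue_root_char_poly[OF A'] .
    then show "e \<in> \<real>" "0 \<le> Re e" using hpsd_eigenvalue[OF A] unfolding A'_def by auto
  qed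
  define es where "es = map Re cs"
  have cs_es: "cs = map of_real es"
    unfolding es_def map_map by (rule map_idI[symmetric]) (use ev in auto)
  obtain B P Q where BPQ: "schur_decomposition A' cs = (B, P, Q)" by (cases "schur_decomposition A' cs") auto
  have sim: "similar_mat_wit A' B P Q" and ut: "upper_triangular B" and dg: "diag_mat B = cs"
    using schur_decomposition[OF A' cs(1) BPQ] by auto
  note w = similar_mat_witD2[OF A' sim]
  have Bii: "B $$ (i, i) = cs ! i" if "i < n" for i
    using w(5) that unfolding dg[symmetric] diag_mat_def by simp
  have tr: "ctrace n (resolvent n v a) = of_real (\<Sum>e\<leftarrow>es. 1 / (e + v))" if v: "0 < v" for v
  proof -
    define R where "R = Matrix.mat n n (\<lambda>(i, j). resolvent n v a i j)"
    define S where "S = Q * R * P"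
    let ?I = "1\<^sub>m n :: complex mat"
    let ?v = "of_real v \<cdot>\<^sub>m ?I"
    have R: "R \<in> carrier_mat n n" unfolding R_def by simp
    have S: "S \<in> carrier_mat n n" unfolding S_def using R w by auto
    have AR: "(A' + ?v) * R = ?I" unfolding A'_def R_def by (rule mat_of_resolvent[OF A v])
    have PBQ: "A' + ?v = P * (B + ?v) * Q"
    proof -
      have "P * (B + ?v) * Q = (P * B + P * ?v) * Q" using w by (simp add: mult_add_distrib_mat[of _ n n _ n])
      also have "\<dots> = P * B * Q + P * ?v * Q" using w by (intro add_mult_distrib_mat[of _ n n]) auto
      also have "P * ?v = of_real v \<cdot>\<^sub>m P" using w by (simp add: mult_smult_distrib[of _ n n _ n])
      also have "of_real v \<cdot>\<^sub>m P * Q = ?v" using w by (simp add: mult_smult_assoc_mat[of _ n n _ n])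
      finally show ?thesis using w(3) by simp
    qed
    have BS: "(B + ?v) * S = ?I"
    proof -
      define C where "C = B + ?v"
      have c: "C \<in> carrier_mat n n" unfolding C_def using w by auto
      have "Q * ((A' + ?v) * R) * P = Q * (P * C * Q * R) * P" unfolding PBQ C_def ..
      also have "\<dots> = (Q * P) * (C * (Q * R * P))"
        using w(6,7) R c by (simp add: assoc_mult_mat[of _ n n _ n _ n])
      also have "\<dots> = C * S" unfolding S_def using w(2,6,7) c R by simp
      finally show ?thesis unfolding AR C_def using w(2,6,7) by simp
    qed
    have utv: "upper_triangular (B + ?v)"
    proof (rule upper_triangularI)
      fix i j assume "j < i" "i < dim_row (B + ?v)"
      then show "(B + ?v) $$ (i, j) = 0" using upper_triangularD[OF ut, of j i] w(5) by simp
    qed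
    have dBv: "(B + ?v) $$ (i, i) = of_real (es ! i + v)" if "i < n" for i
      using that w(5) Bii[OF that] cs(2) by (simp add: cs_es)
    have nz: "complex_of_real (es ! i + v) \<noteq> 0" if "i < n" for i
    proof -
      have "0 \<le> es ! i" unfolding es_def using ev(2) cs(2) that by simp
      then show ?thesis using v unfolding of_real_eq_0_iff by linarith
    qed
    have Sii: "S $$ (i, i) = of_real (1 / (es ! i + v))" if "i < n" for i
    proof -
      have "S $$ (i, i) = 1 / (B + ?v) $$ (i, i)"
        by (rule upper_triangular_inverse_diag[OF _ utv S BS _ that]) (use w dBv nz in auto)
      then show ?thesis unfolding dBv[OF that] by simp
    qed
    have RPSQ: "R = P * S * Q"
    proof -
      have "P * S * Q = (P * Q) * R * (P * Q)" unfolding S_def using w(6,7) R by (simp add: assoc_mult_mat[of _ n n _ n _ n])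
      also have "\<dots> = R" unfolding w(1) using R by simp
      finally show ?thesis by simp
    qed
    let ?f = "\<lambda>M :: complex mat. \<lambda>i j. M $$ (i, j)"
    have mm: "(M * N) $$ (i, j) = mmul n (?f M) (?f N) i j"
      if "M \<in> carrier_mat n n" "N \<in> carrier_mat n n" "i < n" "j < n" for M N i j
      using that by (simp add: scalar_prod_def atLeast0LessThan mmul_def)
    have "ctrace n (resolvent n v a) = ctrace n (?f R)"
      by (rule ctrace_cong) (simp add: R_def)
    also have "\<dots> = ctrace n (mmul n (?f (P * S)) (?f Q))"
      by (rule ctrace_cong) (use w S RPSQ mm[of "P * S" Q] in auto)
    also have "\<dots> = ctrace n (mmul n (?f Q) (?f (P * S)))" by (rule ctrace_mmul_comm)
    also have "\<dots> = ctrace n (?f (Q * (P * S)))"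
      by (rule ctrace_cong) (use w S mm[of Q "P * S"] in auto)
    also have "Q * (P * S) = S"
      using w S by (simp add: assoc_mult_mat[of Q n n P n S n, symmetric])
    also have "ctrace n (?f S) = (\<Sum>i<n. of_real (1 / (es ! i + v)))"
      unfolding ctrace_def by (intro sum.cong refl) (simp only: Sii lessThan_iff)
    also have "\<dots> = of_real (\<Sum>i<n. 1 / (es ! i + v))" by (simp only: of_real_sum)
    also have "(\<Sum>i<n. 1 / (es ! i + v)) = (\<Sum>e\<leftarrow>es. 1 / (e + v))"
      using cs(2) by (simp add: es_def sum_list_sum_nth atLeast0LessThan)
    finally show ?thesis .
  qed
  show ?thesis
  proof (rule that)
    show "length es = n" using cs(2) by (simp add: es_def)
    show "0 \<le> e" if "e \<in> set es" for e using that ev(2) by (auto simp: es_def)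
    show "char_poly (Matrix.mat n n (\<lambda>(i, j). a i j)) = (\<Prod>e\<leftarrow>es. [:- of_real e, 1:])"
      using cs(1) unfolding A'_def by (simp add: cs_es comp_def)
  qed (rule tr)
qed

lemma Wprod_carrier: "Wprod p x \<nu> \<in> carrier_mat (p 0) (p \<nu>)"
proof (induction \<nu>)
  case (Suc \<nu>)
  then show ?case by (simp add: Xmat_def)
qed simp

lemma Wprod_index:
  "i < p 0 \<Longrightarrow> j < p \<nu> \<Longrightarrow> Wprod p x \<nu> $$ (i, j) = wprod p (\<lambda>(\<nu>, j, k). x \<nu> j k) \<nu> i j"
proof (induction \<nu> arbitrary: j)
  case 0
  then show ?case by (simp add: idm_def)
next
  case (Suc \<nu>)
  then show ?case
    using Wprod_carrier[of p x \<nu>] by (simp add: Xmat_def scalar_prod_def atLeast0LessThan)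
qed

lemma Wprod_gram:
  "Wprod p x \<nu> * mat_adjoint (Wprod p x \<nu>) = Matrix.mat (p 0) (p 0) (\<lambda>(i, j). dmat p (\<lambda>(\<nu>, j, k). x \<nu> j k) \<nu> i j)"
proof (rule eq_matI)
  let ?W = "Wprod p x \<nu>"
  note W = Wprod_carrier[of p x \<nu>]
  fix i j assume "i < dim_row (Matrix.mat (p 0) (p 0) (\<lambda>(i, j). dmat p (\<lambda>(\<nu>, j, k). x \<nu> j k) \<nu> i j))"
    "j < dim_col (Matrix.mat (p 0) (p 0) (\<lambda>(i, j). dmat p (\<lambda>(\<nu>, j, k). x \<nu> j k) \<nu> i j))"
  then have ij: "i < p 0" "j < p 0" by auto
  have adj: "mat_adjoint ?W $$ (k, j) = cnj (?W $$ (j, k))" if "k < p \<nu>" for k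
    using that ij W unfolding mat_adjoint_def by (simp add: mat_of_rows_index)
  have d: "dim_row (mat_adjoint ?W) = p \<nu>" "dim_col (mat_adjoint ?W) = p 0"
    using W unfolding mat_adjoint_def by auto
  have "(?W * mat_adjoint ?W) $$ (i, j) = (\<Sum>k<p \<nu>. ?W $$ (i, k) * mat_adjoint ?W $$ (k, j))"
    using ij W d by (simp add: scalar_prod_def atLeast0LessThan)
  also have "\<dots> = dmat p (\<lambda>(\<nu>, j, k). x \<nu> j k) \<nu> i j"
    unfolding gram_def using ij by (intro sum.cong refl) (simp add: adj Wprod_index)
  finally show "(?W * mat_adjoint ?W) $$ (i, j) = Matrix.mat (p 0) (p 0) (\<lambda>(i, j). dmat p (\<lambda>(\<nu>, j, k). x \<nu> j k) \<nu> i j) $$ (i, j)"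
    using ij by simp
qed (use Wprod_carrier[of p x \<nu>] in \<open>auto simp: mat_adjoint_def\<close>)

text \<open>All roots are real and listed in \<open>es\<close>, and the order of a root is its
  number of occurrences, so the sum of orders counts list entries.\<close>

lemma sq_sv_count_eq:
  assumes cp: "char_poly (W * mat_adjoint W) = (\<Prod>e\<leftarrow>es. [:- complex_of_real e, 1:])"
  shows "sq_sv_count W t = length (filter (\<lambda>e. e \<le> t) es)"
proof -
  let ?cs = "map complex_of_real es"
  have cp': "char_poly (W * mat_adjoint W) = (\<Prod>a\<leftarrow>?cs. [:- a, 1:])" unfolding cp by (simp add: comp_def)
  have root: "poly (\<Prod>a\<leftarrow>cs. [:- a, 1:]) e = 0 \<longleftrightarrow> e \<in> set cs" for e :: complex and cs
    by (induction cs) auto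
  have "{e. poly (char_poly (W * mat_adjoint W)) e = 0 \<and> e \<in> \<real> \<and> Re e \<le> t} = of_real ` set (filter (\<lambda>e. e \<le> t) es)"
    unfolding cp' root by auto
  then have "sq_sv_count W t = (\<Sum>e\<in>of_real ` set (filter (\<lambda>e. e \<le> t) es). count_list ?cs e)"
    unfolding sq_sv_count_def cp' order_linear_prod by simp
  also have "\<dots> = (\<Sum>e\<in>set (filter (\<lambda>e. e \<le> t) es). count_list ?cs (of_real e))"
    by (rule sum.reindex_cong[where l = of_real]) (auto simp: inj_on_def)
  also have "\<dots> = (\<Sum>e\<in>set (filter (\<lambda>e. e \<le> t) es). count_list (filter (\<lambda>e. e \<le> t) es) e)"
  proof (rule sum.cong[OF refl])
    fix e assume e: "e \<in> set (filter (\<lambda>e. e \<le> t) es)"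
    have "count_list (map complex_of_real xs) (of_real e) = count_list (filter (\<lambda>e. e \<le> t) xs) e" for xs
      using e by (induction xs) auto
    then show "count_list ?cs (of_real e) = count_list (filter (\<lambda>e. e \<le> t) es) e" .
  qed
  also have "\<dots> = length (filter (\<lambda>e. e \<le> t) es)" by (rule sum_count_set) auto
  finally show ?thesis .
qed

subsection \<open>Stieltjes transforms of distributions on the half-line\<close>

text \<open>Stated for an arbitrary property \<open>K\<close> because it serves twice: for the
  equality of integrals against two measures and for the measurability of sums over eigenvalues. The
  variable \<open>u = 1 / (1 + x)\<close> maps the half-line into a compact interval, where
  polynomials approximate continuous functions uniformly.\<close>

lemma indicator_from_Cauchy_kernels:
  fixes K :: "(real \<Rightarrow> real) \<Rightarrow> bool"
  assumes const: "\<And>c. K (\<lambda>_. c)" and kernel: "\<And>v. 0 < v \<Longrightarrow> K (\<lambda>x. 1 / (x + v))"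
    and add: "\<And>f g. K f \<Longrightarrow> K g \<Longrightarrow> K (\<lambda>x. f x + g x)" and cmult: "\<And>f c. K f \<Longrightarrow> K (\<lambda>x. c * f x)"
    and lim: "\<And>(f :: nat \<Rightarrow> real \<Rightarrow> real) g B. (\<And>k. K (f k)) \<Longrightarrow> (\<And>k x. 0 \<le> x \<Longrightarrow> \<bar>f k x\<bar> \<le> B) \<Longrightarrow>
      (\<And>x. 0 \<le> x \<Longrightarrow> (\<lambda>k. f k x) \<longlonglongrightarrow> g x) \<Longrightarrow> K g"
  shows "K (\<lambda>x. if x \<le> t then 1 else 0)"
proof -
  \<comment> \<open>A constant sequence in \<open>lim\<close>: membership of a bounded function does
    not depend on its values at negative \<open>x\<close>.\<close>
  have cong: "K g" if "K f" "\<And>x. 0 \<le> x \<Longrightarrow> \<bar>f x\<bar> \<le> B" "\<And>x. 0 \<le> x \<Longrightarrow> f x = g x" for f g and B :: real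
    by (rule lim[where f = "\<lambda>_. f" and B = B]) (use that in auto)
  define Pr where "Pr S x = (\<Prod>c\<in>S. 1 / (x + c))" for S and x :: real
  have Pr_bound: "\<bar>Pr S x\<bar> \<le> (\<Prod>c\<in>S. 1 / c)" if "S \<subseteq> {0<..}" "0 \<le> x" for S x
  proof -
    have "0 \<le> Pr S x" unfolding Pr_def using that by (intro prod_nonneg) auto
    moreover have "Pr S x \<le> (\<Prod>c\<in>S. 1 / c)"
      unfolding Pr_def using that by (intro prod_mono) (auto intro!: divide_left_mono mult_pos_pos add_nonneg_pos)
    ultimately show ?thesis by simp
  qed
  have Pr: "K (Pr S)" if "finite S" "S \<noteq> {}" "S \<subseteq> {0<..}" for S
    using that
  proof (induction "card S" arbitrary: S rule: less_induct)
    case less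
    obtain a where a: "a \<in> S" using less.prems by blast
    show ?case
    proof (cases "S = {a}")
      case True
      then have "Pr S = (\<lambda>x. 1 / (x + a))" by (auto simp: Pr_def)
      then show ?thesis using kernel[of a] less.prems a by auto
    next
      case False
      then obtain b where b: "b \<in> S" "b \<noteq> a" using a by blast
      have ab: "0 < a" "0 < b" using a b less.prems by auto
      have Ka: "K (Pr (S - {b}))" "K (Pr (S - {a}))"
        using less.prems a b by (auto intro!: less.hyps card_Diff1_less)
      \<comment> \<open>Partial fractions in the two poles \<open>-a\<close> and \<open>-b\<close>
        express the product through two products with one pole fewer.\<close>
      have KK: "K (\<lambda>x. 1 / (b - a) * (Pr (S - {b}) x + (- 1) * Pr (S - {a}) x))"
        by (intro cmult add Ka)
      have eq: "1 / (b - a) * (Pr (S - {b}) x + (- 1) * Pr (S - {a}) x) = Pr S x" if "0 \<le> x" for x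
      proof -
        let ?P = "Pr (S - {a, b}) x"
        have Sa: "Pr (S - {b}) x = 1 / (x + a) * ?P"
          unfolding Pr_def using a b less.prems(1) by (subst prod.remove[of _ a]) (auto simp: Diff_insert2[symmetric] insert_commute)
        have Sb: "Pr (S - {a}) x = 1 / (x + b) * ?P"
          unfolding Pr_def using a b less.prems(1) by (subst prod.remove[of _ b]) (auto simp: Diff_insert2[symmetric] insert_commute)
        have S: "Pr S x = 1 / (x + b) * Pr (S - {b}) x"
          unfolding Pr_def using b less.prems(1) by (subst prod.remove[of _ b]) auto
        have partial_fractions: "1 / A + (- 1) * (1 / B) = (B - A) * (1 / B * (1 / A))" if "A \<noteq> 0" "B \<noteq> 0" for A B :: real
          using that by (simp add: diff_frac_eq)
        have "1 / (x + a) + (- 1) * (1 / (x + b)) = ((x + b) - (x + a)) * (1 / (x + b) * (1 / (x + a)))"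
          by (rule partial_fractions) (use ab that in auto)
        then have *: "1 / (x + a) + (- 1) * (1 / (x + b)) = (b - a) * (1 / (x + b) * (1 / (x + a)))"
          by simp
        have "1 / (x + a) * ?P + (- 1) * (1 / (x + b) * ?P) = (1 / (x + a) + (- 1) * (1 / (x + b))) * ?P"
          by (simp only: distrib_right mult.assoc)
        then have "1 / (b - a) * (1 / (x + a) * ?P + (- 1) * (1 / (x + b) * ?P)) = 1 / (b - a) * ((b - a) * (1 / (x + b) * (1 / (x + a)))) * ?P"
          unfolding * by (simp only: mult.assoc)
        then show ?thesis unfolding S Sa Sb using b(2) by (simp only: mult.assoc[symmetric]) simp
      qed
      show ?thesis
      proof (rule cong[OF KK])
        fix x :: real assume x: "0 \<le> x"
        show "\<bar>1 / (b - a) * (Pr (S - {b}) x + (- 1) * Pr (S - {a}) x)\<bar> \<le> (\<Prod>c\<in>S. 1 / c)"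
          unfolding eq[OF x] by (rule Pr_bound[OF less.prems(3) x])
      qed (rule eq)
    qed
  qed
  \<comment> \<open>A power of \<open>1 / (1 + x)\<close> is a limit of products of kernels with distinct poles, which
    partial fractions split into single kernels.\<close>
  have pow: "K (\<lambda>x. (1 / (1 + x)) ^ n)" for n
  proof (cases n)
    case 0
    then show ?thesis using const[of 1] by simp
  next
    case (Suc n')
    define S where "S k = (\<lambda>j. 1 + real j / real (Suc k)) ` {..<n}" for k
    have inj: "inj_on (\<lambda>j. 1 + real j / real (Suc k)) {..<n}" for k
      by (auto simp: inj_on_def)
    show ?thesis
    proof (rule lim[where f = "\<lambda>k. Pr (S k)" and B = 1])
      show "K (Pr (S k))" for k using Suc by (intro Pr) (auto simp: S_def intro!: add_pos_nonneg)
    next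
      fix k and x :: real assume x: "0 \<le> x"
      have "\<bar>Pr (S k) x\<bar> \<le> (\<Prod>c\<in>S k. 1 / c)" by (rule Pr_bound) (auto simp: S_def x intro!: add_pos_nonneg)
      also have "\<dots> \<le> 1"
      proof (intro prod_le_1 conjI)
        fix c assume "c \<in> S k"
        then have "1 \<le> c" unfolding S_def by auto
        then show "0 \<le> 1 / c" "1 / c \<le> 1" by auto
      qed
      finally show "\<bar>Pr (S k) x\<bar> \<le> 1" .
    next
      fix x :: real assume x: "0 \<le> x"
      have "(\<lambda>k. \<Prod>j<n. 1 / (x + (1 + real j / real (Suc k)))) \<longlonglongrightarrow> (\<Prod>j<n. 1 / (x + (1 + 0)))"
      proof (intro tendsto_intros)
        fix j :: nat show "(\<lambda>k. real j / real (Suc k)) \<longlonglongrightarrow> 0"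
          using LIMSEQ_Suc[OF lim_const_over_n[of "real j"]] by simp
      qed (use x in auto)
      moreover have "Pr (S k) x = (\<Prod>j<n. 1 / (x + (1 + real j / real (Suc k))))" for k
        unfolding Pr_def S_def by (subst prod.reindex[OF inj]) simp
      moreover have "(\<Prod>j<n. 1 / (x + (1 + 0))) = (1 / (1 + x)) ^ n" by (simp add: add.commute)
      ultimately show "(\<lambda>k. Pr (S k) x) \<longlonglongrightarrow> (1 / (1 + x)) ^ n" by simp
    qed
  qed
  have poly: "K (\<lambda>x. P (1 / (1 + x)))" if rP: "real_polynomial_function P" for P :: "real \<Rightarrow> real"
  proof -
    obtain a n where P: "P = (\<lambda>x. \<Sum>i\<le>n. a i * x ^ i)" using rP unfolding real_polynomial_function_iff_sum by blast
    have "K (\<lambda>x. \<Sum>i\<le>N. a i * (1 / (1 + x)) ^ i)" for N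
      proof (induction N)
      case 0
      show ?case using const[of "a 0"] by simp
    next
      case (Suc N)
      show ?case unfolding sum.atMost_Suc by (rule add[OF Suc cmult[OF pow]])
    qed
    then show ?thesis unfolding P .
  qed
  have u: "1 / (1 + x) \<in> {0..1}" if "0 \<le> x" for x :: real using that by (auto simp: divide_le_eq)
  have cont: "K (\<lambda>x. g (1 / (1 + x)))" if g: "continuous_on {0..1} g" for g :: "real \<Rightarrow> real"
  proof -
    have "\<exists>P. real_polynomial_function P \<and> (\<forall>x\<in>{0..1}. \<bar>g x - P x\<bar> < 1 / real (Suc k))" for k
    proof -
      have "0 < 1 / real (Suc k)" by simp
      then show ?thesis
        by (rule Stone_Weierstrass_real_polynomial_function[OF compact_Icc g]) (intro exI conjI ballI)
    qed
    then have "\<exists>P. \<forall>k. real_polynomial_function (P k) \<and> (\<forall>x\<in>{0..1}. \<bar>g x - P k x\<bar> < 1 / real (Suc k))"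
      by (intro choice allI)
    then obtain P where P: "\<And>k. real_polynomial_function (P k)" "\<And>k x. x \<in> {0..1} \<Longrightarrow> \<bar>g x - P k x\<bar> < 1 / real (Suc k)"
      by blast
    have "bounded (g ` {0..1})"
      by (rule compact_imp_bounded[OF compact_continuous_image[OF g compact_Icc]])
    then obtain B where "\<forall>x\<in>g ` {0..1}. norm x \<le> B" unfolding bounded_iff by blast
    then have B: "\<bar>g x\<bar> \<le> B" if "x \<in> {0..1}" for x using imageI[OF that, of g] by (simp only: real_norm_def)
    show ?thesis
    proof (rule lim[where f = "\<lambda>k x. P k (1 / (1 + x))" and B = "B + 1"])
      show "K (\<lambda>x. P k (1 / (1 + x)))" for k by (rule poly[OF P(1)])
    next
      fix k and x :: real assume x: "0 \<le> x"
      have "1 / real (Suc k) \<le> 1" by (simp add: divide_le_eq)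
      then show "\<bar>P k (1 / (1 + x))\<bar> \<le> B + 1" using P(2)[OF u[OF x], of k] B[OF u[OF x]] by linarith
    next
      fix x :: real assume x: "0 \<le> x"
      have "(\<lambda>k. P k (1 / (1 + x)) - g (1 / (1 + x))) \<longlonglongrightarrow> 0"
      proof (rule Lim_null_comparison)
        show "\<forall>\<^sub>F k in sequentially. norm (P k (1 / (1 + x)) - g (1 / (1 + x))) \<le> 1 / real (Suc k)"
          using P(2)[OF u[OF x]] by (intro always_eventually allI) (simp add: abs_minus_commute less_imp_le)
        show "(\<lambda>k. 1 / real (Suc k)) \<longlonglongrightarrow> 0" using LIMSEQ_Suc[OF lim_1_over_n] by simp
      qed
      then show "(\<lambda>k. P k (1 / (1 + x))) \<longlonglongrightarrow> g (1 / (1 + x))" by (simp only: LIM_zero_iff)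
    qed
  qed
  show ?thesis
  proof (cases "0 \<le> t")
    case False
    show ?thesis by (rule cong[OF const[of 0], where B = 0]) (use False in auto)
  next
    case True
    \<comment> \<open>For \<open>u = 1 / (1 + x)\<close>, the condition \<open>x \<le> t\<close>
      means \<open>c \<le> u\<close>. The ramps \<open>g k\<close> are 1 on that side, including
      \<open>u = c\<close>, and for positive \<open>k\<close> fall to 0 within distance
      \<open>1 / k\<close> below it.\<close>
    define c where "c = 1 / (1 + t)"
    define g where "g k u = max 0 (min 1 (1 - real k * (c - u)))" for k u
    show ?thesis
    proof (rule lim[where f = "\<lambda>k x. g k (1 / (1 + x))" and B = 1])
      show "K (\<lambda>x. g k (1 / (1 + x)))" for k
        unfolding g_def by (intro cont continuous_intros)
      show "\<bar>g k (1 / (1 + x))\<bar> \<le> 1" for k x unfolding g_def by auto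
    next
      fix x :: real assume x: "0 \<le> x"
      show "(\<lambda>k. g k (1 / (1 + x))) \<longlonglongrightarrow> (if x \<le> t then 1 else 0)"
      proof (cases "x \<le> t")
        case True
        then have "c \<le> 1 / (1 + x)" unfolding c_def using x by (intro divide_left_mono) auto
        then have "g k (1 / (1 + x)) = 1" for k
          unfolding g_def by (simp add: mult_nonneg_nonpos)
        then show ?thesis using True by simp
      next
        case False
        then have "1 / (1 + x) < c" unfolding c_def using \<open>0 \<le> t\<close> by (intro divide_strict_left_mono) auto
        then have pos: "0 < c - 1 / (1 + x)" by simp
        obtain k0 :: nat where k0: "1 / (c - 1 / (1 + x)) < k0" using reals_Archimedean2 by blast
        have "\<forall>\<^sub>F k in sequentially. g k (1 / (1 + x)) = 0"
          using eventually_ge_at_top[of k0]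
        proof eventually_elim
          case (elim k)
          then have "1 / (c - 1 / (1 + x)) < k" using k0 by (meson less_le_trans of_nat_mono)
          then have "1 < k * (c - 1 / (1 + x))" using pos by (simp only: divide_less_eq if_True)
          then show ?case unfolding g_def by simp
        qed
        then show ?thesis using False by (simp add: tendsto_eventually)
      qed
    qed
  qed
qed

locale nonneg_distribution = real_distribution \<mu> for \<mu> :: "real measure" +
  assumes nonneg: "measure \<mu> {..<0} = 0"
begin

lemma prob_UNIV [simp]: "measure \<mu> UNIV = 1"
  using prob_space by simp

lemma AE_nonneg: "AE x in \<mu>. 0 \<le> x"
proof -
  have "AE x in \<mu>. x \<notin> {..<0}"
    by (rule AE_not_in) (simp add: null_sets_def emeasure_eq_measure nonneg)
  then show ?thesis by eventually_elim auto
qed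

text \<open>The Stieltjes transform at \<open>-v\<close>. The cut-off \<open>max 0 x\<close> changes
  nothing almost everywhere and makes the integrand bounded and continuous on the whole line, as
  weak convergence requires.\<close>

definition "cauchy v = (\<integral>x. 1 / (max 0 x + v) \<partial>\<mu>)"

lemma integrable_bounded:
  fixes f :: "real \<Rightarrow> 'b :: {banach, second_countable_topology}"
  assumes "f \<in> borel_measurable borel" "\<And>x. norm (f x) \<le> B"
  shows "integrable \<mu> f"
  by (rule integrable_const_bound[where B = B]) (use assms in \<open>auto simp: measurable_cong_sets[OF events_eq_borel refl]\<close>)

lemma integrable_cauchy: "0 < v \<Longrightarrow> integrable \<mu> (\<lambda>x. 1 / (max 0 x + v))"
  by (rule integrable_bounded[where B = "1 / v"]) (auto simp: frac_le)

lemma stieltjes_max: "stieltjes \<mu> z = (\<integral>x. 1 / (complex_of_real (max 0 x) - z) \<partial>\<mu>)"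
  unfolding stieltjes_def
proof (rule integral_cong_AE)
  show "AE x in \<mu>. 1 / (complex_of_real x - z) = 1 / (complex_of_real (max 0 x) - z)"
    using AE_nonneg by eventually_elim (simp add: max_def)
qed (auto simp: measurable_cong_sets[OF events_eq_borel refl])

lemma stieltjes_negative: "0 < v \<Longrightarrow> stieltjes \<mu> (- of_real v) = of_real (cauchy v)"
  unfolding stieltjes_max cauchy_def integral_complex_of_real[symmetric]
  by (intro Bochner_Integration.integral_cong refl) simp

lemma cauchy_bounds:
  assumes "0 < v" shows "0 \<le> v * cauchy v" "v * cauchy v \<le> 1"
proof -
  show "0 \<le> v * cauchy v" unfolding cauchy_def using assms by (intro mult_nonneg_nonneg Bochner_Integration.integral_nonneg) auto
  have "cauchy v \<le> (\<integral>x. 1 / v \<partial>\<mu>)"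
    unfolding cauchy_def using assms by (intro integral_mono integrable_cauchy) (auto simp: frac_le)
  then have "cauchy v \<le> 1 / v" by simp
  then show "v * cauchy v \<le> 1" using assms by (simp add: field_simps)
qed

text \<open>The integrand is expanded in a geometric series around \<open>z0\<close>, and the series
  is integrated term by term.\<close>

lemma stieltjes_holomorphic: "stieltjes \<mu> holomorphic_on (- \<real>\<^sub>\<ge>\<^sub>0)"
proof -
  have "\<exists>r>0. stieltjes \<mu> holomorphic_on ball z0 r" if z0: "z0 \<in> - \<real>\<^sub>\<ge>\<^sub>0" for z0
  proof -
    have "open (- \<real>\<^sub>\<ge>\<^sub>0 :: complex set)" using closed_nonneg_Reals_complex by (rule open_Compl)
    then obtain e where e: "0 < e" "ball z0 e \<subseteq> - \<real>\<^sub>\<ge>\<^sub>0" using z0 unfolding open_contains_ball by blast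
    define w where "w x = complex_of_real (max 0 x) - z0" for x
    have w: "e \<le> cmod (w x)" for x
    proof (rule ccontr)
      assume "\<not> e \<le> cmod (w x)"
      then have "complex_of_real (max 0 x) \<in> ball z0 e" by (simp add: w_def dist_norm norm_minus_commute)
      then show False using e(2) by auto
    qed
    have w0: "w x \<noteq> 0" for x using w[of x] e(1) by auto
    \<comment> \<open>Half of \<open>e\<close>, a lower bound for the distance from
      \<open>z0\<close> to the half-line, so that the ratio of the series is below 1/2 uniformly in
      \<open>x\<close>.\<close>
    define r where "r = e / 2"
    have r: "0 < r" unfolding r_def using e by simp
    define a where "a k = (\<integral>x. 1 / w x ^ Suc k \<partial>\<mu>)" for k
    have mw: "(\<lambda>x. 1 / w x ^ Suc k) \<in> borel_measurable borel" for k unfolding w_def by measurable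
    have nb: "cmod (1 / w x ^ Suc k) \<le> (1 / e) ^ Suc k" for x k
    proof -
      have "cmod (1 / w x ^ Suc k) = (1 / cmod (w x)) ^ Suc k" by (simp add: norm_divide norm_power norm_mult power_one_over power_divide)
      also have "\<dots> \<le> (1 / e) ^ Suc k" using w[of x] e(1) by (intro power_mono) (auto simp: frac_le)
      finally show ?thesis .
    qed
    have iw: "integrable \<mu> (\<lambda>x. 1 / w x ^ Suc k)" for k
      by (rule integrable_bounded[OF mw nb])
    have "stieltjes \<mu> holomorphic_on ball z0 r"
    proof (rule power_series_holomorphic)
      fix z assume "z \<in> ball z0 r"
      then have z: "cmod (z - z0) < r" by (simp add: dist_norm norm_minus_commute)
      define f where "f k x = 1 / w x ^ Suc k * (z - z0) ^ k" for k x
      have fb: "cmod (f k x) \<le> (1 / e) * (1 / 2) ^ k" for k x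
      proof -
        have "cmod (f k x) = cmod (1 / w x ^ Suc k) * cmod (z - z0) ^ k" unfolding f_def norm_mult norm_power ..
        also have "\<dots> \<le> (1 / e) ^ Suc k * r ^ k"
          using z e(1) by (intro mult_mono nb power_mono) auto
        also have "\<dots> = (1 / e) * (1 / 2) ^ k" unfolding r_def using e(1) by (simp add: power_divide)
        finally show ?thesis .
      qed
      have geo: "(\<lambda>k. f k x) sums (1 / (complex_of_real (max 0 x) - z))" for x
      proof -
        define q where "q = (z - z0) / w x"
        have "cmod q < 1" unfolding q_def norm_divide using z w[of x] e(1) r_def by (simp add: divide_less_eq)
        then have "(\<lambda>k. 1 / w x * q ^ k) sums (1 / w x * (1 / (1 - q)))" by (intro sums_mult geometric_sums)
        moreover have "1 / w x * q ^ k = f k x" for k unfolding q_def f_def by (simp add: power_divide)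
        moreover have "1 / w x * (1 / (1 - q)) = 1 / (complex_of_real (max 0 x) - z)"
        proof -
          have "w x * (1 - q) = w x - (z - z0)" unfolding q_def using w0[of x] by (simp only: right_diff_distrib[of "w x" 1] mult_1_right times_divide_eq_right nonzero_mult_div_cancel_left not_False_eq_True)
          then have "w x * (1 - q) = complex_of_real (max 0 x) - z" unfolding w_def by simp
          then show ?thesis by (simp only: times_divide_times_eq mult_1)
        qed
        ultimately show ?thesis by simp
      qed
      have sg: "summable (\<lambda>k. (1 / e) * (1 / 2 :: real) ^ k)" by (intro summable_mult summable_geometric) simp
      have if': "integrable \<mu> (f k)" for k
        unfolding f_def by (intro integrable_mult_left iw)
      have "(\<lambda>k. integral\<^sup>L \<mu> (f k)) sums (\<integral>x. (\<Sum>k. f k x) \<partial>\<mu>)"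
      proof (rule sums_integral[OF if'])
        show "AE x in \<mu>. summable (\<lambda>k. norm (f k x))"
          by (intro AE_I2 summable_comparison_test'[OF sg]) (use fb in auto)
        show "summable (\<lambda>k. \<integral>x. norm (f k x) \<partial>\<mu>)"
        proof (rule summable_comparison_test'[OF sg])
          fix k
          have "(\<integral>x. norm (f k x) \<partial>\<mu>) \<le> (\<integral>x. (1 / e) * (1 / 2) ^ k \<partial>\<mu>)"
            using fb by (intro integral_mono integrable_norm if') auto
          then show "norm (\<integral>x. norm (f k x) \<partial>\<mu>) \<le> (1 / e) * (1 / 2) ^ k" by simp
        qed
      qed
      moreover have "(\<integral>x. (\<Sum>k. f k x) \<partial>\<mu>) = stieltjes \<mu> z"
        unfolding stieltjes_max using geo by (intro Bochner_Integration.integral_cong refl) (simp add: sums_unique[symmetric])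
      moreover have "integral\<^sup>L \<mu> (f k) = a k * (z - z0) ^ k" for k
        unfolding f_def a_def by (rule integral_mult_left_zero)
      ultimately show "(\<lambda>k. a k * (z - z0) ^ k) sums stieltjes \<mu> z" by simp
    qed
    with r show ?thesis by blast
  qed
  then have "stieltjes \<mu> field_differentiable (at z)" if "z \<in> - \<real>\<^sub>\<ge>\<^sub>0" for z
    using that holomorphic_on_imp_differentiable_at[OF _ open_ball] centre_in_ball by blast
  then show ?thesis unfolding holomorphic_on_def using field_differentiable_at_within by blast
qed

end

lemma nonneg_distribution_unique:
  assumes \<mu>: "nonneg_distribution \<mu>" and \<nu>: "nonneg_distribution \<nu>"
    and eq: "\<And>v. 0 < v \<Longrightarrow> nonneg_distribution.cauchy \<mu> v = nonneg_distribution.cauchy \<nu> v"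
  shows "cdf \<mu> t = cdf \<nu> t"
proof -
  interpret \<mu>: nonneg_distribution \<mu> by fact
  interpret \<nu>: nonneg_distribution \<nu> by fact
  \<comment> \<open>Measurability and boundedness are part of the class so that integrals are
    additive and limits pass through them by dominated convergence.\<close>
  define K where "K f \<longleftrightarrow> (\<lambda>x. f (max 0 x)) \<in> borel_measurable borel \<and> (\<exists>B. \<forall>x\<ge>0. \<bar>f x\<bar> \<le> B) \<and>
    (\<integral>x. f (max 0 x) \<partial>\<mu>) = (\<integral>x. f (max 0 x) \<partial>\<nu>)" for f :: "real \<Rightarrow> real"
  have int: "integrable \<mu> (\<lambda>x. f (max 0 x))" "integrable \<nu> (\<lambda>x. f (max 0 x))" if Kf: "K f" for f
  proof -
    obtain B where "\<forall>x\<ge>0. \<bar>f x\<bar> \<le> B" using Kf unfolding K_def by blast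
    then have B: "norm (f (max 0 x)) \<le> B" for x by simp
    have mf: "(\<lambda>x. f (max 0 x)) \<in> borel_measurable borel" using Kf unfolding K_def by (rule conjunct1)
    show "integrable \<mu> (\<lambda>x. f (max 0 x))" by (rule \<mu>.integrable_bounded[OF mf B])
    show "integrable \<nu> (\<lambda>x. f (max 0 x))" by (rule \<nu>.integrable_bounded[OF mf B])
  qed
  have "K (\<lambda>x. if x \<le> t then 1 else 0)"
  proof (rule indicator_from_Cauchy_kernels)
    show "K (\<lambda>_. c)" for c unfolding K_def by auto
    show "K (\<lambda>x. 1 / (x + v))" if "0 < v" for v
      unfolding K_def
    proof (intro conjI)
      show "\<exists>B. \<forall>x\<ge>0. \<bar>1 / (x + v)\<bar> \<le> B" using that by (intro exI[of _ "1 / v"]) (auto simp: frac_le)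
      show "(\<integral>x. 1 / (max 0 x + v) \<partial>\<mu>) = (\<integral>x. 1 / (max 0 x + v) \<partial>\<nu>)"
        using eq[OF that] unfolding \<mu>.cauchy_def \<nu>.cauchy_def .
    qed measurable
    show "K (\<lambda>x. f x + g x)" if fg: "K f" "K g" for f g
    proof -
      obtain B C where "\<forall>x\<ge>0. \<bar>f x\<bar> \<le> B" "\<forall>x\<ge>0. \<bar>g x\<bar> \<le> C" using fg unfolding K_def by blast
      then have "\<forall>x\<ge>0. \<bar>f x + g x\<bar> \<le> B + C" by (auto intro!: order_trans[OF abs_triangle_ineq] add_mono)
      then show ?thesis using int[OF fg(1)] int[OF fg(2)] fg unfolding K_def by (auto intro!: borel_measurable_add)
    qed
    show "K (\<lambda>x. c * f x)" if f: "K f" for f c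
    proof -
      obtain B where "\<forall>x\<ge>0. \<bar>f x\<bar> \<le> B" using f unfolding K_def by blast
      then have "\<forall>x\<ge>0. \<bar>c * f x\<bar> \<le> \<bar>c\<bar> * B" by (auto simp: abs_mult intro!: mult_left_mono)
      then show ?thesis using f unfolding K_def by (auto intro!: borel_measurable_times)
    qed
    show "K g" if f: "\<And>k. K (f k)" and B: "\<And>k x. 0 \<le> x \<Longrightarrow> \<bar>f k x\<bar> \<le> B" and l: "\<And>x. 0 \<le> x \<Longrightarrow> (\<lambda>k. f k x) \<longlonglongrightarrow> g x"
      for f :: "nat \<Rightarrow> real \<Rightarrow> real" and g B
    proof -
      have mf: "(\<lambda>x. f k (max 0 x)) \<in> borel_measurable borel" for k using f unfolding K_def by blast
      have mg: "(\<lambda>x. g (max 0 x)) \<in> borel_measurable borel"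
        by (rule borel_measurable_LIMSEQ_real[OF _ mf]) (rule l, simp)
      have gB: "\<forall>x\<ge>0. \<bar>g x\<bar> \<le> B"
      proof (intro allI impI)
        fix x :: real assume x: "0 \<le> x"
        show "\<bar>g x\<bar> \<le> B"
          by (rule tendsto_upperbound[OF tendsto_rabs[OF l[OF x]]]) (use B[OF x] in auto)
      qed
      have "(\<lambda>k. \<integral>x. f k (max 0 x) \<partial>\<mu>) \<longlonglongrightarrow> (\<integral>x. g (max 0 x) \<partial>\<mu>)"
        by (rule integral_dominated_convergence[where w = "\<lambda>_. B"])
          (use mf mg l B in \<open>auto simp: measurable_cong_sets[OF \<mu>.events_eq_borel refl]\<close>)
      moreover have "(\<lambda>k. \<integral>x. f k (max 0 x) \<partial>\<nu>) \<longlonglongrightarrow> (\<integral>x. g (max 0 x) \<partial>\<nu>)"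
        by (rule integral_dominated_convergence[where w = "\<lambda>_. B"])
          (use mf mg l B in \<open>auto simp: measurable_cong_sets[OF \<nu>.events_eq_borel refl]\<close>)
      moreover have "(\<integral>x. f k (max 0 x) \<partial>\<mu>) = (\<integral>x. f k (max 0 x) \<partial>\<nu>)" for k using f unfolding K_def by blast
      ultimately have "(\<integral>x. g (max 0 x) \<partial>\<mu>) = (\<integral>x. g (max 0 x) \<partial>\<nu>)" using LIMSEQ_unique by simp
      then show ?thesis using mg gB unfolding K_def by blast
    qed
  qed
  then have eq: "(\<integral>x. (if max 0 x \<le> t then 1 else 0) \<partial>\<mu>) = (\<integral>x. (if max 0 x \<le> t then 1 else 0 :: real) \<partial>\<nu>)"
    unfolding K_def by blast
  have cdf: "(\<integral>x. (if max 0 x \<le> t then 1 else 0 :: real) \<partial>\<rho>) = cdf \<rho> t" if "nonneg_distribution \<rho>" for \<rho>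
  proof -
    interpret \<rho>: nonneg_distribution \<rho> by fact
    have "(\<integral>x. (if max 0 x \<le> t then 1 else 0 :: real) \<partial>\<rho>) = (\<integral>x. indicator {..t} x \<partial>\<rho>)"
    proof (rule integral_cong_AE)
      show "AE x in \<rho>. (if max 0 x \<le> t then 1 else 0 :: real) = indicator {..t} x"
        using \<rho>.AE_nonneg by eventually_elim (auto simp: indicator_def)
    qed (auto simp: measurable_cong_sets[OF \<rho>.events_eq_borel refl])
    also have "\<dots> = cdf \<rho> t" unfolding cdf_def by simp
    finally show ?thesis .
  qed
  show ?thesis using eq unfolding cdf[OF \<mu>] cdf[OF \<nu>] .
qed

section \<open>The fixed point equation off the half-line and the absence of atoms\<close>

definition fixed_point_gap :: "(nat \<Rightarrow> real) \<Rightarrow> nat \<Rightarrow> complex \<Rightarrow> complex \<Rightarrow> complex" where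
  "fixed_point_gap y m z s = 1 + z * s - s * (\<Prod>l = 1..m. 1 - complex_of_real (y l) - z * complex_of_real (y l) * s)"

text \<open>With \<open>t = 1 - v c\<close> each factor \<open>1 - y - z y s\<close> becomes
  \<open>1 - y t\<close>, and \<open>c = (1 - t) / v\<close> accounts for the division by
  \<open>v\<close>.\<close>

lemma fixed_point_gap_negative:
  assumes "0 < v"
  shows "fixed_point_gap y m (- of_real v) (of_real c) = of_real (residual y m v (1 - v * c) / v)"
proof -
  define P where "P = (\<Prod>l=1..m. 1 - y l * (1 - v * c))"
  have P: "(\<Prod>l = 1..m. 1 - complex_of_real (y l) - (- of_real v) * complex_of_real (y l) * of_real c) = of_real P"
    unfolding P_def of_real_prod by (rule prod.cong) (simp_all add: algebra_simps)
  have "fixed_point_gap y m (- of_real v) (of_real c) = of_real (1 - v * c - c * P)"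
    unfolding fixed_point_gap_def P by simp
  moreover have "residual y m v (1 - v * c) / v = 1 - v * c - c * P"
    unfolding residual_def P_def[symmetric] using assms by (simp add: field_simps)
  ultimately show ?thesis by simp
qed

lemma slit_plane: "open (- \<real>\<^sub>\<ge>\<^sub>0 :: complex set)" "connected (- \<real>\<^sub>\<ge>\<^sub>0 :: complex set)"
proof -
  show "open (- \<real>\<^sub>\<ge>\<^sub>0 :: complex set)" using closed_nonneg_Reals_complex by (rule open_Compl)
  have eq: "(\<real>\<^sub>\<ge>\<^sub>0 :: complex set) = of_real ` {0..}" unfolding nonneg_Reals_def by auto
  show "connected (- \<real>\<^sub>\<ge>\<^sub>0 :: complex set)"
    unfolding eq by (intro starlike_imp_connected starlike_slotted_complex_plane_right)
qed

context nonneg_distribution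
begin

lemma gap_holomorphic: "(\<lambda>z. fixed_point_gap y m z (stieltjes \<mu> z)) holomorphic_on (- \<real>\<^sub>\<ge>\<^sub>0)"
  unfolding fixed_point_gap_def by (intro holomorphic_intros stieltjes_holomorphic)

text \<open>The identity theorem on the slit plane, in both directions. From the upper half-plane,
  an open set, every \<open>-v\<close> is reached; in return it suffices that the negative half-line
  has a limit point in the domain, for which -1 is taken.\<close>

lemma gap_upper_iff:
  "(\<forall>z. 0 < Im z \<longrightarrow> fixed_point_gap y m z (stieltjes \<mu> z) = 0) \<longleftrightarrow>
    (\<forall>v>0. residual y m v (1 - v * cauchy v) = 0)"
proof (intro iffI allI impI)
  fix v :: real assume up: "\<forall>z. 0 < Im z \<longrightarrow> fixed_point_gap y m z (stieltjes \<mu> z) = 0" and v: "0 < v"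
  have "fixed_point_gap y m (- of_real v) (stieltjes \<mu> (- of_real v)) = 0"
  proof (rule analytic_continuation_open[where s = "{z. 0 < Im z}" and g = "\<lambda>_. 0", OF _ slit_plane(1) _ slit_plane(2) _ gap_holomorphic])
    show "{z. 0 < Im z} \<noteq> {}" by (auto intro: exI[of _ \<i>])
    show "{z. 0 < Im z} \<subseteq> - \<real>\<^sub>\<ge>\<^sub>0" by (auto simp: complex_nonneg_Reals_iff)
    show "- complex_of_real v \<in> - \<real>\<^sub>\<ge>\<^sub>0" using v by (auto simp: complex_nonneg_Reals_iff)
  qed (use up in \<open>auto simp: open_halfspace_Im_gt\<close>)
  then show "residual y m v (1 - v * cauchy v) = 0"
    unfolding stieltjes_negative[OF v] fixed_point_gap_negative[OF v] using v by simp
next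
  fix z assume neg: "\<forall>v>0. residual y m v (1 - v * cauchy v) = 0" and z: "0 < Im z"
  define U where "U = (\<lambda>v. - complex_of_real v) ` {0<..}"
  show "fixed_point_gap y m z (stieltjes \<mu> z) = 0"
  proof (rule analytic_continuation[where U = U and \<xi> = "- 1", OF gap_holomorphic slit_plane])
    show "U \<subseteq> - \<real>\<^sub>\<ge>\<^sub>0" unfolding U_def by (auto simp: complex_nonneg_Reals_iff)
    show "- 1 \<in> - (\<real>\<^sub>\<ge>\<^sub>0 :: complex set)" by (auto simp: complex_nonneg_Reals_iff)
    show "(- 1) islimpt U"
      unfolding islimpt_approachable
    proof (intro allI impI)
      fix e :: real assume e: "0 < e"
      show "\<exists>x'\<in>U. x' \<noteq> - 1 \<and> dist x' (- 1) < e"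
      proof (intro bexI conjI)
        have eq: "- complex_of_real (1 + e / 2) - - 1 = of_real (- (e / 2))" by simp
        show "dist (- complex_of_real (1 + e / 2)) (- 1) < e"
          unfolding dist_norm eq norm_of_real using e by simp
        show "- complex_of_real (1 + e / 2) \<noteq> - 1" using e by (simp add: complex_eq_iff)
        show "- complex_of_real (1 + e / 2) \<in> U" unfolding U_def using e by (intro imageI) auto
      qed
    qed
    show "fixed_point_gap y m w (stieltjes \<mu> w) = 0" if "w \<in> U" for w
      using that neg unfolding U_def by (auto simp: stieltjes_negative fixed_point_gap_negative)
    show "z \<in> - \<real>\<^sub>\<ge>\<^sub>0" using z by (auto simp: complex_nonneg_Reals_iff)
  qed
qed

text \<open>As \<open>v\<close> tends to 0, \<open>v * cauchy v\<close> tends to the mass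
  \<open>a\<close> at 0. The residual equation becomes \<open>a\<close> times the product of the
  \<open>1 - y l * (1 - a)\<close> equal to 0, and for \<open>a > 0\<close> every factor is positive
  because \<open>y l \<le> 1\<close>.\<close>

lemma atom_at_zero_eq_0:
  assumes res: "\<And>v. 0 < v \<Longrightarrow> residual y m v (1 - v * cauchy v) = 0"
    and y: "\<And>l. l \<in> {1..m} \<Longrightarrow> 0 < y l \<and> y l \<le> 1"
  shows "measure \<mu> {0} = 0"
proof -
  define a where "a = measure \<mu> {0}"
  define v where "v k = 1 / real (Suc k)" for k
  have v: "0 < v k" for k unfolding v_def by simp
  have v0: "v \<longlonglongrightarrow> 0" unfolding v_def using LIMSEQ_Suc[OF lim_1_over_n] by simp
  have eqa: "(\<integral>x. (if max 0 x = 0 then 1 else 0) \<partial>\<mu>) = a"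
  proof -
    have "(\<integral>x. (if max 0 x = 0 then 1 else 0 :: real) \<partial>\<mu>) = (\<integral>x. indicator {0} x \<partial>\<mu>)"
    proof (rule integral_cong_AE)
      show "AE x in \<mu>. (if max 0 x = 0 then 1 else 0 :: real) = indicator {0} x"
        using AE_nonneg by eventually_elim (auto simp: indicator_def max_def)
    qed (auto simp: measurable_cong_sets[OF events_eq_borel refl])
    then show ?thesis unfolding a_def by simp
  qed
  have "(\<lambda>k. \<integral>x. v k * (1 / (max 0 x + v k)) \<partial>\<mu>) \<longlonglongrightarrow> (\<integral>x. (if max 0 x = 0 then 1 else 0) \<partial>\<mu>)"
  proof (rule integral_dominated_convergence[where w = "\<lambda>_. 1"])
    show "AE x in \<mu>. (\<lambda>k. v k * (1 / (max 0 x + v k))) \<longlonglongrightarrow> (if max 0 x = 0 then 1 else 0)"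
    proof (intro AE_I2)
      fix x :: real
      show "(\<lambda>k. v k * (1 / (max 0 x + v k))) \<longlonglongrightarrow> (if max 0 x = 0 then 1 else 0)"
      proof (cases "max 0 x = 0")
        case True
        have "v k * (1 / (max 0 x + v k)) = 1" for k unfolding True using v[of k] by simp
        then show ?thesis using True by simp
      next
        case False
        have "(\<lambda>k. v k * (1 / (max 0 x + v k))) \<longlonglongrightarrow> 0 * (1 / (max 0 x + 0))"
          by (intro tendsto_intros v0) (use False in simp)
        then show ?thesis using False by simp
      qed
    qed
    show "AE x in \<mu>. norm (v k * (1 / (max 0 x + v k))) \<le> 1" for k
      using v[of k] by (intro AE_I2) (auto simp: divide_le_eq)
  qed (auto simp: measurable_cong_sets[OF events_eq_borel refl])
  then have lim: "(\<lambda>k. v k * cauchy (v k)) \<longlonglongrightarrow> a"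
    unfolding eqa cauchy_def integral_mult_right_zero .
  have "(\<lambda>k. residual y m (v k) (1 - v k * cauchy (v k))) \<longlonglongrightarrow>
      0 * (1 - a) - (1 - (1 - a)) * (\<Prod>l=1..m. 1 - y l * (1 - a))"
    unfolding residual_def by (intro tendsto_intros v0 lim)
  moreover have "residual y m (v k) (1 - v k * cauchy (v k)) = 0" for k using res[OF v] .
  ultimately have "(\<lambda>k :: nat. 0) \<longlonglongrightarrow> 0 * (1 - a) - (1 - (1 - a)) * (\<Prod>l=1..m. 1 - y l * (1 - a))" by simp
  from LIMSEQ_unique[OF tendsto_const this] have "a * (\<Prod>l=1..m. 1 - y l * (1 - a)) = 0" by simp
  then have "a = 0 \<or> (\<exists>l\<in>{1..m}. 1 - y l * (1 - a) = 0)" unfolding mult_eq_0_iff by (simp add: prod_zero_iff del: right_minus_eq)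
  moreover have "0 \<le> a" unfolding a_def by simp
  moreover have "1 - y l * (1 - a) \<noteq> 0" if "0 < a" "l \<in> {1..m}" for l
  proof -
    have "y l * (1 - a) < y l * 1" using y[OF that(2)] that(1) by (intro mult_strict_left_mono) auto
    then show ?thesis using conjunct2[OF y[OF that(2)]] by linarith
  qed
  ultimately show ?thesis unfolding a_def[symmetric] using less_eq_real_def by blast
qed

text \<open>At an atom of mass \<open>a\<close> the transform grows like \<open>a / d\<close> when
  \<open>x0\<close> is approached vertically at distance \<open>d\<close>. The product side of the
  equation has degree \<open>m + 1\<close> in the transform and the other side degree 1, so for
  \<open>m \<ge> 1\<close> the leading term must vanish, and with \<open>x0\<close> and all
  \<open>y l\<close> positive this forces \<open>a = 0\<close>.\<close>

lemma atom_positive_eq_0: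
  assumes gap: "\<And>z. 0 < Im z \<Longrightarrow> fixed_point_gap y m z (stieltjes \<mu> z) = 0" and m: "1 \<le> m"
    and y: "\<And>l. l \<in> {1..m} \<Longrightarrow> 0 < y l" and x0: "0 < x0"
  shows "measure \<mu> {x0} = 0"
proof -
  define a where "a = measure \<mu> {x0}"
  define d where "d k = \<i> * complex_of_real (1 / real (Suc k))" for k
  define z where "z k = of_real x0 + d k" for k
  define s where "s k = d k * stieltjes \<mu> (z k)" for k
  have Imd: "Im (d k) = 1 / real (Suc k)" "Re (d k) = 0" for k unfolding d_def by simp_all
  have d0': "d k \<noteq> 0" for k using Imd(1)[of k] by auto
  have Imz: "0 < Im (z k)" for k unfolding z_def by (simp add: Imd)
  have "(\<lambda>k. \<i> * complex_of_real (1 / real (Suc k))) \<longlonglongrightarrow> \<i> * of_real 0"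
    using LIMSEQ_Suc[OF lim_1_over_n] by (intro tendsto_intros) simp
  then have d0: "d \<longlonglongrightarrow> 0" unfolding d_def by simp
  have z0: "z \<longlonglongrightarrow> of_real x0" unfolding z_def using tendsto_add[OF tendsto_const d0] by simp
  \<comment> \<open>The imaginary part alone keeps the denominator at least as large as
    \<open>d k\<close>; this gives the majorant 1 for dominated convergence.\<close>
  have den: "cmod (d k) \<le> cmod (of_real x - z k)" for x k
  proof -
    have "cmod (d k) = \<bar>Im (of_real x - z k)\<bar>" unfolding z_def d_def by (simp add: norm_mult del: of_real_divide of_real_add of_nat_Suc)
    then show ?thesis by (simp only: abs_Im_le_cmod)
  qed
  have "(\<lambda>k. \<integral>x. d k * (1 / (complex_of_real x - z k)) \<partial>\<mu>) \<longlonglongrightarrow> (\<integral>x. - of_real (indicator {x0} x) \<partial>\<mu>)"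
  proof (rule integral_dominated_convergence[where w = "\<lambda>_. 1"])
    show "AE x in \<mu>. (\<lambda>k. d k * (1 / (complex_of_real x - z k))) \<longlonglongrightarrow> - of_real (indicator {x0} x)"
    proof (intro AE_I2)
      fix x :: real
      show "(\<lambda>k. d k * (1 / (complex_of_real x - z k))) \<longlonglongrightarrow> - of_real (indicator {x0} x)"
      proof (cases "x = x0")
        case True
        have "d k * (1 / (complex_of_real x - z k)) = - 1" for k
          unfolding z_def True using d0'[of k] by simp
        then show ?thesis using True by simp
      next
        case False
        have "(\<lambda>k. d k * (1 / (complex_of_real x - z k))) \<longlonglongrightarrow> 0 * (1 / (complex_of_real x - of_real x0))"
          by (intro tendsto_intros d0 z0) (use False in simp)
        then show ?thesis using False by simp
      qed
    qed
    show "AE x in \<mu>. norm (d k * (1 / (complex_of_real x - z k))) \<le> 1" for k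
      using den[of k] d0'[of k] by (intro AE_I2) (auto simp: norm_mult norm_divide divide_le_eq)
  qed (auto simp: measurable_cong_sets[OF events_eq_borel refl])
  moreover have "(\<integral>x. - complex_of_real (indicator {x0} x) \<partial>\<mu>) = - of_real a"
    unfolding a_def by simp
  ultimately have s: "s \<longlonglongrightarrow> - of_real a"
    unfolding s_def stieltjes_def integral_mult_right_zero by (simp only:)
  \<comment> \<open>Multiplied by \<open>d k ^ (m + 1)\<close>, the equation stays bounded as \<open>d k\<close> tends to \<open>0\<close>.\<close>
  have key: "d k ^ m * (d k + z k * s k) = s k * (\<Prod>l=1..m. d k * (1 - of_real (y l)) - z k * of_real (y l) * s k)" for k
  proof -
    let ?S = "stieltjes \<mu> (z k)"
    have "1 + z k * ?S = ?S * (\<Prod>l=1..m. 1 - of_real (y l) - z k * of_real (y l) * ?S)"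
      using gap[OF Imz[of k]] unfolding fixed_point_gap_def by simp
    then have e: "d k * d k ^ m * (1 + z k * ?S) = d k * d k ^ m * (?S * (\<Prod>l=1..m. 1 - of_real (y l) - z k * of_real (y l) * ?S))"
      by (rule arg_cong[where f = "\<lambda>x. d k * d k ^ m * x"])
    have "A * (1 - b) - w * b * (A * S) = A * (1 - b - w * b * S)" for A b w S :: complex
      by (simp add: algebra_simps)
    then have pr: "(\<Prod>l=1..m. d k * (1 - of_real (y l)) - z k * of_real (y l) * s k) = d k ^ m * (\<Prod>l=1..m. 1 - of_real (y l) - z k * of_real (y l) * ?S)"
      unfolding s_def by (simp add: prod.distrib)
    have "d k ^ m * (d k + z k * s k) = d k * d k ^ m * (1 + z k * ?S)"
      unfolding s_def by (simp only: distrib_left mult_1_right mult_1_left mult.assoc mult.commute mult.left_commute)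
    moreover have "d k * d k ^ m * (?S * P) = s k * (d k ^ m * P)" for P
      unfolding s_def by (simp only: mult.assoc mult.commute mult.left_commute)
    ultimately show ?thesis unfolding e pr by (simp only:)
  qed
  have "(\<lambda>k. d k ^ m * (d k + z k * s k)) \<longlonglongrightarrow> 0 ^ m * (0 + of_real x0 * (- of_real a))"
    by (intro tendsto_intros d0 z0 s)
  moreover have "(\<lambda>k. s k * (\<Prod>l=1..m. d k * (1 - of_real (y l)) - z k * of_real (y l) * s k)) \<longlonglongrightarrow>
      - of_real a * (\<Prod>l=1..m. 0 * (1 - of_real (y l)) - of_real x0 * of_real (y l) * (- of_real a))"
    by (intro tendsto_intros d0 z0 s)
  ultimately have "0 ^ m * (0 + complex_of_real x0 * (- of_real a)) =
      - of_real a * (\<Prod>l=1..m. 0 * (1 - of_real (y l)) - of_real x0 * of_real (y l) * (- of_real a))"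
    unfolding key by (rule LIMSEQ_unique)
  moreover have "(0 :: complex) ^ m = 0" using m by simp
  ultimately have "complex_of_real (a * (\<Prod>l=1..m. x0 * y l * a)) = 0" by (simp add: of_real_prod)
  then have "a * (\<Prod>l=1..m. x0 * y l * a) = 0" by (simp only: of_real_eq_0_iff)
  then have "a = 0 \<or> (\<exists>l\<in>{1..m}. x0 * y l * a = 0)" unfolding mult_eq_0_iff[of a] by (simp only: prod_zero_iff finite_atLeastAtMost)
  then show ?thesis unfolding a_def[symmetric] using x0 y by fastforce
qed

end

text \<open>The definition speaks of the upper half-plane, the estimates of the negative half-line.
  After this equivalence the half-plane is consulted only to exclude atoms at positive
  points.\<close>

lemma is_Gy_iff:
  "is_Gy m y \<mu> \<longleftrightarrow> nonneg_distribution \<mu> \<and>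
    (\<forall>v>0. residual y m v (1 - v * nonneg_distribution.cauchy \<mu> v) = 0)"
proof -
  have "is_Gy m y \<mu> \<longleftrightarrow> nonneg_distribution \<mu> \<and> (\<forall>z. 0 < Im z \<longrightarrow> fixed_point_gap y m z (stieltjes \<mu> z) = 0)"
    unfolding is_Gy_def fixed_point_gap_def nonneg_distribution_def nonneg_distribution_axioms_def by (simp only: conj_assoc)
  then show ?thesis using nonneg_distribution.gap_upper_iff by blast
qed

lemma is_Gy_isCont_cdf:
  assumes G: "is_Gy m y \<mu>" and m: "1 \<le> m" and y: "\<And>l. l \<in> {1..m} \<Longrightarrow> 0 < y l \<and> y l \<le> 1"
  shows "isCont (cdf \<mu>) x"
proof -
  interpret nonneg_distribution \<mu> using G unfolding is_Gy_iff by blast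
  have res: "\<And>v. 0 < v \<Longrightarrow> residual y m v (1 - v * cauchy v) = 0" using G unfolding is_Gy_iff by blast
  have gap: "\<And>z. 0 < Im z \<Longrightarrow> fixed_point_gap y m z (stieltjes \<mu> z) = 0"
    using gap_upper_iff[of y m] res by blast
  consider "x < 0" | "x = 0" | "0 < x" by linarith
  then have "measure \<mu> {x} = 0"
  proof cases
    case 1
    then have "measure \<mu> {x} \<le> measure \<mu> {..<0}" by (intro finite_measure_mono) auto
    then show ?thesis using nonneg measure_nonneg[of \<mu> "{x}"] by linarith
  next
    case 2
    then show ?thesis using atom_at_zero_eq_0[OF res y] by simp
  next
    case 3
    then show ?thesis using atom_positive_eq_0[OF gap m _ 3] y by blast
  qed
  then show ?thesis unfolding isCont_cdf .
qed

text \<open>By continuity \<open>F\<close> attains the levels \<open>j / N\<close>; convergence at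
  these finitely many points and monotonicity confine the error at every other point to
  \<open>2 / N\<close>.\<close>

lemma Polya_uniform_convergence:
  fixes f :: "nat \<Rightarrow> real \<Rightarrow> real" and F :: "real \<Rightarrow> real"
  assumes f_mono: "\<And>n. mono (f n)" and f_bounds: "\<And>n x. 0 \<le> f n x" "\<And>n x. f n x \<le> 1"
    and F_mono: "mono F" and F_cont: "\<And>x. isCont F x"
    and F_bot: "(F \<longlongrightarrow> 0) at_bot" and F_top: "(F \<longlongrightarrow> 1) at_top"
    and F_bounds: "\<And>x. 0 \<le> F x" "\<And>x. F x \<le> 1"
    and lim: "\<And>x. (\<lambda>n. f n x) \<longlonglongrightarrow> F x"
  shows "(\<lambda>n. SUP x. \<bar>f n x - F x\<bar>) \<longlonglongrightarrow> 0"
proof (rule LIMSEQ_I)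
  fix e :: real assume e: "0 < e"
  obtain N :: nat where N: "2 / e < N" using reals_Archimedean2 by blast
  have "0 < 2 / e" using e by simp
  then have N0: "0 < real N" using N by linarith
  have Ne: "2 / N < e" using N e N0 by (simp add: field_simps)
  have "\<exists>x. F x = j / N" if j: "j \<in> {0<..<N}" for j :: nat
  proof -
    have "0 < j / N" "j / N < 1" using j N0 by auto
    then have "\<forall>\<^sub>F x in at_bot. F x < j / N" "\<forall>\<^sub>F x in at_top. j / N < F x"
      using order_tendstoD(2)[OF F_bot] order_tendstoD(1)[OF F_top] by blast+
    then obtain a b where ab: "F a < j / N" "j / N < F b"
      unfolding eventually_at_bot_linorder eventually_at_top_linorder by blast
    have "a \<le> b" using ab monoD[OF F_mono, of b a] by linarith
    then show ?thesis using IVT[of F a "j / N" b] ab F_cont by (auto simp: less_imp_le)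
  qed
  then obtain g where g: "\<And>j. j \<in> {0<..<N} \<Longrightarrow> F (g j) = j / N" by metis
  have "\<forall>\<^sub>F n in sequentially. \<forall>j\<in>{0<..<N}. \<bar>f n (g j) - j / N\<bar> < 1 / N"
  proof (rule eventually_ball_finite)
    show "\<forall>j\<in>{0<..<N}. \<forall>\<^sub>F n in sequentially. \<bar>f n (g j) - j / N\<bar> < 1 / N"
    proof
      fix j assume j: "j \<in> {0<..<N}"
      have "\<forall>\<^sub>F n in sequentially. dist (f n (g j)) (F (g j)) < 1 / N"
        by (rule tendstoD[OF lim]) (use N0 in simp)
      then show "\<forall>\<^sub>F n in sequentially. \<bar>f n (g j) - j / N\<bar> < 1 / N" unfolding dist_real_def g[OF j] .
    qed
  qed simp
  then obtain n0 where n0: "\<And>n j. n0 \<le> n \<Longrightarrow> j \<in> {0<..<N} \<Longrightarrow> \<bar>f n (g j) - j / N\<bar> < 1 / N"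
    unfolding eventually_sequentially by blast
  have "norm ((SUP x. \<bar>f n x - F x\<bar>) - 0) < e" if n: "n0 \<le> n" for n
  proof -
    have bound: "\<bar>f n x - F x\<bar> \<le> 2 / N" for x
    proof -
      define j where "j = nat \<lfloor>N * F x\<rfloor>"
      have nn: "0 \<le> N * F x" using F_bounds(1)[of x] by simp
      have j: "real j \<le> N * F x" "N * F x < real j + 1"
        unfolding j_def using nn by simp_all
      have j': "F x < (j + 1) / N" "j / N \<le> F x" using j N0 by (simp_all add: field_simps)
      have upper: "f n x \<le> F x + 2 / N"
      proof (cases "Suc j < N")
        case True
        then have Sj: "Suc j \<in> {0<..<N}" by simp
        have "x \<le> g (Suc j)"
        proof (rule ccontr)
          assume "\<not> x \<le> g (Suc j)"
          then have "F (g (Suc j)) \<le> F x" by (intro monoD[OF F_mono]) simp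
          then show False using j' g[OF Sj] by simp
        qed
        then have "f n x \<le> f n (g (Suc j))" by (intro monoD[OF f_mono])
        also have "\<dots> \<le> Suc j / N + 1 / N" using n0[OF n Sj] by linarith
        also have "\<dots> = j / N + 2 / N" by (simp add: add_divide_distrib)
        finally show ?thesis using j' by linarith
      next
        case False
        then have "1 \<le> (j + 1) / N" using N0 by simp
        then have "1 \<le> j / N + 1 / N" by (simp add: add_divide_distrib)
        moreover have "1 / N \<le> 2 / N" using N0 by (simp add: divide_right_mono)
        ultimately show ?thesis using f_bounds(2)[of n x] j' by linarith
      qed
      \<comment> \<open>Ceiling minus one rather than the floor: \<open>i / N\<close> has to lie
        strictly below \<open>F x\<close>, because \<open>F\<close> need not be strictly increasing
        and \<open>g i \<le> x\<close> is inferred from \<open>F (g i) < F x\<close>.\<close>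
      define i where "i = nat (\<lceil>N * F x\<rceil> - 1)"
      have i1: "N * F x \<le> real i + 1" unfolding i_def using nn by linarith
      have i2: "i = 0 \<or> real i < N * F x" unfolding i_def using nn by linarith
      have i': "F x \<le> i / N + 1 / N" using i1 N0 by (simp add: field_simps)
      have lower: "F x - 2 / N \<le> f n x"
      proof (cases "i = 0")
        case True
        moreover have "1 / N \<le> 2 / N" using N0 by (simp add: divide_right_mono)
        ultimately show ?thesis using i' f_bounds(1)[of n x] by simp
      next
        case False
        then have iN: "real i < N * F x" using i2 by simp
        also have "real N * F x \<le> real N * 1" using F_bounds(2)[of x] by (intro mult_left_mono) auto
        finally have I: "i \<in> {0<..<N}" using False by simp
        have "i / N < F x" using iN N0 by (simp add: field_simps)
        have "g i \<le> x"
        proof (rule ccontr)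
          assume "\<not> g i \<le> x"
          then have "F x \<le> F (g i)" by (intro monoD[OF F_mono]) simp
          then show False using \<open>i / N < F x\<close> g[OF I] by simp
        qed
        then have "f n (g i) \<le> f n x" by (intro monoD[OF f_mono])
        moreover have "i / N - 1 / N \<le> f n (g i)" using n0[OF n I] by linarith
        ultimately show ?thesis using i' by (simp add: add_divide_distrib)
      qed
      show ?thesis using upper lower by linarith
    qed
    have "(SUP x. \<bar>f n x - F x\<bar>) \<le> 2 / N" by (intro cSUP_least) (use bound in auto)
    moreover have "0 \<le> (SUP x. \<bar>f n x - F x\<bar>)"
      by (rule cSUP_upper2[where x = 0]) (use bound in \<open>auto intro!: bdd_aboveI[of _ "2 / N"]\<close>)
    ultimately show ?thesis using Ne by simp
  qed
  then show "\<exists>n0. \<forall>n\<ge>n0. norm ((SUP x. \<bar>f n x - F x\<bar>) - 0) < e" by blast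
qed

subsection \<open>Convergence of the empirical distributions\<close>

text \<open>Expresses an order statistic by counts, so that measurability passes from the counts to
  the sorted eigenvalues.\<close>

lemma sorted_nth_le_iff:
  assumes "sorted xs" "i < length xs"
  shows "xs ! i \<le> t \<longleftrightarrow> i < length (filter (\<lambda>e. e \<le> t) xs)"
  using assms
proof (induction xs arbitrary: i)
  case (Cons a xs)
  show ?case
  proof (cases "a \<le> t")
    case True
    then show ?thesis using Cons by (cases i) auto
  next
    case False
    then have "\<forall>e\<in>set (a # xs). \<not> e \<le> t" using Cons.prems(1) by auto
    then have "filter (\<lambda>e. e \<le> t) (a # xs) = []" "\<not> (a # xs) ! i \<le> t"
      using nth_mem[OF Cons.prems(2)] by (auto simp: filter_empty_conv)
    then show ?thesis by simp
  qed
qed simp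

context prob_space
begin

text \<open>The lists \<open>es \<omega>\<close> are chosen outcome by outcome, so nothing is known
  about the measurability of single entries; only the symmetric sums given by resolvent traces are
  measurable. Closing the kernels under linear combinations and bounded limits yields the
  counts.\<close>

lemma sum_list_measurable_from_kernels:
  fixes es :: "'a \<Rightarrow> real list"
  assumes len: "\<And>\<omega>. length (es \<omega>) = n" and nonneg: "\<And>\<omega> e. e \<in> set (es \<omega>) \<Longrightarrow> 0 \<le> e"
    and meas: "\<And>v. 0 < v \<Longrightarrow> (\<lambda>\<omega>. \<Sum>e\<leftarrow>es \<omega>. 1 / (e + v)) \<in> borel_measurable M"
  shows "(\<lambda>\<omega>. \<Sum>e\<leftarrow>es \<omega>. if e \<le> t then 1 else 0 :: real) \<in> borel_measurable M"
proof -
  define K where "K f \<longleftrightarrow> (\<lambda>\<omega>. \<Sum>e\<leftarrow>es \<omega>. f e) \<in> borel_measurable M" for f :: "real \<Rightarrow> real"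
  have "K (\<lambda>e. if e \<le> t then 1 else 0)"
  proof (rule indicator_from_Cauchy_kernels)
    show "K (\<lambda>_. c)" for c unfolding K_def by (simp add: sum_list_triv len)
    show "K (\<lambda>x. 1 / (x + v))" if "0 < v" for v unfolding K_def by (rule meas[OF that])
    show "K (\<lambda>x. f x + g x)" if "K f" "K g" for f g
      using that unfolding K_def by (simp add: sum_list_addf)
    show "K (\<lambda>x. c * f x)" if "K f" for f c
      using that unfolding K_def by (simp add: sum_list_const_mult)
    show "K g" if f: "\<And>k. K (f k)" and B: "\<And>k x. 0 \<le> x \<Longrightarrow> \<bar>f k x\<bar> \<le> B" and l: "\<And>x. 0 \<le> x \<Longrightarrow> (\<lambda>k. f k x) \<longlonglongrightarrow> g x"
      for f :: "nat \<Rightarrow> real \<Rightarrow> real" and g B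
      unfolding K_def
    proof (rule borel_measurable_LIMSEQ_real)
      show "(\<lambda>\<omega>. \<Sum>e\<leftarrow>es \<omega>. f k e) \<in> borel_measurable M" for k using f unfolding K_def .
      have "(\<lambda>k. \<Sum>e\<leftarrow>xs. f k e) \<longlonglongrightarrow> (\<Sum>e\<leftarrow>xs. g e)" if "\<And>e. e \<in> set xs \<Longrightarrow> 0 \<le> e" for xs
        using that
      proof (induction xs)
        case (Cons a xs)
        then show ?case by (auto intro!: tendsto_add l)
      qed simp
      then show "(\<lambda>k. \<Sum>e\<leftarrow>es \<omega>. f k e) \<longlonglongrightarrow> (\<Sum>e\<leftarrow>es \<omega>. g e)" for \<omega>
        using nonneg by blast
    qed
  qed
  then show ?thesis unfolding K_def .
qed

text \<open>The measure is the law of an eigenvalue picked uniformly among the \<open>n\<close>, on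
  the product of the uniform index space with \<open>M\<close>. Being a law it is a probability
  measure on the Borel sets, and by Fubini its integrals are expected means over the
  eigenvalues.\<close>

lemma mean_empirical_distribution:
  fixes es :: "'a \<Rightarrow> real list"
  assumes n: "1 \<le> n" and len: "\<And>\<omega>. length (es \<omega>) = n" and nonneg: "\<And>\<omega> e. e \<in> set (es \<omega>) \<Longrightarrow> 0 \<le> e"
    and meas: "\<And>v. 0 < v \<Longrightarrow> (\<lambda>\<omega>. \<Sum>e\<leftarrow>es \<omega>. 1 / (e + v)) \<in> borel_measurable M"
  shows "\<exists>\<mu>. nonneg_distribution \<mu> \<and>
    (\<forall>t. cdf \<mu> t = expectation (\<lambda>\<omega>. real (length (filter (\<lambda>e. e \<le> t) (es \<omega>))) / real n)) \<and>
    (\<forall>v>0. nonneg_distribution.cauchy \<mu> v = expectation (\<lambda>\<omega>. (\<Sum>e\<leftarrow>es \<omega>. 1 / (e + v)) / real n))"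
proof -
  \<comment> \<open>Sorting selects a measurable version of the \<open>i\<close>-th eigenvalue, and
    sums over the list do not notice the reordering.\<close>
  define ev where "ev i \<omega> = sort (es \<omega>) ! i" for i \<omega>
  have count: "(\<Sum>e\<leftarrow>xs. if e \<le> t then 1 else 0 :: real) = real (length (filter (\<lambda>e. e \<le> t) xs))" for xs and t :: real
    by (induction xs) auto
  have count_meas: "(\<lambda>\<omega>. \<Sum>e\<leftarrow>es \<omega>. if e \<le> t then 1 else 0 :: real) \<in> borel_measurable M" for t
    by (rule sum_list_measurable_from_kernels) (fact len nonneg meas)+
  have ev_meas: "ev i \<in> borel_measurable M" if i: "i < n" for i
  proof (rule borel_measurableI_le)
    fix t :: real
    have "ev i \<omega> \<le> t \<longleftrightarrow> real i < (\<Sum>e\<leftarrow>es \<omega>. if e \<le> t then 1 else 0)" for \<omega>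
      unfolding ev_def count using sorted_nth_le_iff[of "sort (es \<omega>)" i t] i len by (simp add: filter_sort)
    moreover have "{\<omega> \<in> space M. real i < (\<Sum>e\<leftarrow>es \<omega>. if e \<le> t then 1 else 0)} \<in> sets M"
      by (rule borel_measurable_less[OF borel_measurable_const count_meas])
    ultimately show "{\<omega> \<in> space M. ev i \<omega> \<le> t} \<in> sets M" by simp
  qed
  have sum_ev: "(\<Sum>i<n. f (ev i \<omega>)) = (\<Sum>e\<leftarrow>es \<omega>. f e)" for f :: "real \<Rightarrow> real" and \<omega>
  proof -
    have "(\<Sum>e\<leftarrow>es \<omega>. f e) = (\<Sum>e\<leftarrow>sort (es \<omega>). f e)"
      unfolding sum_mset_sum_list[symmetric] mset_map mset_sort ..
    also have "\<dots> = (\<Sum>i<n. f (ev i \<omega>))"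
      unfolding ev_def by (simp add: sum_list_sum_nth len atLeast0LessThan)
    finally show ?thesis by simp
  qed
  define U where "U = uniform_count_measure {..<n}"
  interpret U: prob_space U unfolding U_def by (rule prob_space_uniform_count_measure) (use n in \<open>auto simp: lessThan_empty_iff\<close>)
  interpret P: pair_prob_space U M ..
  define g where "g = (\<lambda>(i, \<omega>). ev i \<omega>)"
  have "g \<in> borel_measurable (count_space {..<n} \<Otimes>\<^sub>M M)"
    by (rule measurable_pair_measure_countable1) (auto simp: g_def ev_meas)
  moreover have sets: "sets (U \<Otimes>\<^sub>M M) = sets (count_space {..<n} \<Otimes>\<^sub>M M)"
    by (rule sets_pair_measure_cong) (simp_all add: U_def sets_uniform_count_measure_count_space)
  ultimately have g_meas: "g \<in> borel_measurable (U \<Otimes>\<^sub>M M)"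
    by (simp only: measurable_cong_sets[OF sets refl])
  define \<mu> where "\<mu> = distr (U \<Otimes>\<^sub>M M) borel g"
  interpret \<mu>: real_distribution \<mu> unfolding \<mu>_def by (rule P.real_distribution_distr[OF g_meas])
  have int: "(\<integral>x. f x \<partial>\<mu>) = expectation (\<lambda>\<omega>. (\<Sum>e\<leftarrow>es \<omega>. f e) / real n)"
    if f: "f \<in> borel_measurable borel" "\<And>x. \<bar>f x\<bar> \<le> B" for f and B :: real
  proof -
    have i: "integrable (U \<Otimes>\<^sub>M M) (\<lambda>(i, \<omega>). f (g (i, \<omega>)))"
      unfolding case_prod_unfold prod.collapse by (rule P.integrable_const_bound[where B = B]) (use f g_meas in auto)
    have "(\<integral>x. f x \<partial>\<mu>) = (\<integral>z. f (g z) \<partial>(U \<Otimes>\<^sub>M M))"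
      unfolding \<mu>_def by (rule integral_distr[OF g_meas f(1)])
    also have "\<dots> = (\<integral>\<omega>. (\<integral>i. f (g (i, \<omega>)) \<partial>U) \<partial>M)"
      using P.integral_snd[OF i] unfolding case_prod_unfold prod.collapse by simp
    also have "\<dots> = (\<integral>\<omega>. (\<Sum>i<n. f (ev i \<omega>)) / real n \<partial>M)"
      unfolding U_def g_def by (simp add: integral_uniform_count_measure)
    finally show ?thesis unfolding sum_ev .
  qed
  have nn: "nonneg_distribution \<mu>"
  proof
    have "measure \<mu> {..<0} = (\<integral>x. indicator {..<0} x \<partial>\<mu>)" by simp
    also have "\<dots> = expectation (\<lambda>\<omega>. (\<Sum>e\<leftarrow>es \<omega>. indicator {..<0} e) / real n)"
      by (rule int[of _ 1]) auto
    also have "\<dots> = expectation (\<lambda>\<omega>. 0)"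
    proof (intro Bochner_Integration.integral_cong refl)
      fix \<omega>
      have "map (indicator {..<0}) (es \<omega>) = map (\<lambda>_. 0 :: real) (es \<omega>)"
        by (rule map_cong[OF refl]) (use nonneg[of _ \<omega>] in \<open>force simp: indicator_def\<close>)
      then show "(\<Sum>e\<leftarrow>es \<omega>. indicator {..<0} e) / real n = 0" by (simp only: sum_list_0 div_0)
    qed
    finally show "measure \<mu> {..<0} = 0" by simp
  qed
  interpret \<mu>: nonneg_distribution \<mu> by fact
  show ?thesis
  proof (rule exI[of _ \<mu>], intro conjI allI impI)
    show "nonneg_distribution \<mu>" by (rule nn)
  next
    fix t
    have "cdf \<mu> t = (\<integral>x. (if x \<le> t then 1 else 0) \<partial>\<mu>)"
    proof -
      have "(\<lambda>x. if x \<le> t then 1 else 0 :: real) = indicator {..t}" by (auto simp: indicator_def)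
      then show ?thesis unfolding cdf_def by simp
    qed
    also have "\<dots> = expectation (\<lambda>\<omega>. (\<Sum>e\<leftarrow>es \<omega>. if e \<le> t then 1 else 0) / real n)"
      by (rule int[of _ 1]) auto
    finally show "cdf \<mu> t = expectation (\<lambda>\<omega>. real (length (filter (\<lambda>e. e \<le> t) (es \<omega>))) / real n)"
      unfolding count .
  next
    fix v :: real assume v: "0 < v"
    have "\<mu>.cauchy v = expectation (\<lambda>\<omega>. (\<Sum>e\<leftarrow>es \<omega>. 1 / (max 0 e + v)) / real n)"
      unfolding \<mu>.cauchy_def
    proof (rule int)
      show "\<bar>1 / (max 0 x + v)\<bar> \<le> 1 / v" for x using v by (auto simp: frac_le)
    qed measurable
    also have "\<dots> = expectation (\<lambda>\<omega>. (\<Sum>e\<leftarrow>es \<omega>. 1 / (e + v)) / real n)"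
    proof (intro Bochner_Integration.integral_cong refl)
      fix \<omega>
      have "map (\<lambda>e. 1 / (max 0 e + v)) (es \<omega>) = map (\<lambda>e. 1 / (e + v)) (es \<omega>)"
        by (rule map_cong[OF refl]) (use nonneg[of _ \<omega>] in \<open>simp add: max_def\<close>)
      then show "(\<Sum>e\<leftarrow>es \<omega>. 1 / (max 0 e + v)) / real n = (\<Sum>e\<leftarrow>es \<omega>. 1 / (e + v)) / real n" by (simp only:)
    qed
    finally show "\<mu>.cauchy v = expectation (\<lambda>\<omega>. (\<Sum>e\<leftarrow>es \<omega>. 1 / (e + v)) / real n)" .
  qed
qed

end

lemma nonneg_distribution_weak_limit:
  assumes \<rho>: "\<And>k. nonneg_distribution (\<rho> k)" and \<nu>: "real_distribution \<nu>" and w: "weak_conv_m \<rho> \<nu>"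
  shows "nonneg_distribution \<nu>"
    and "0 < v \<Longrightarrow> (\<lambda>k. nonneg_distribution.cauchy (\<rho> k) v) \<longlonglongrightarrow> nonneg_distribution.cauchy \<nu> v"
proof -
  interpret \<nu>: real_distribution \<nu> by fact
  have rd: "real_distribution (\<rho> k)" for k using \<rho> by (simp add: nonneg_distribution_def)
  have conv: "(\<lambda>k. integral\<^sup>L (\<rho> k) f) \<longlonglongrightarrow> integral\<^sup>L \<nu> f"
    if "\<And>x. isCont f x" "\<And>x. norm (f x) \<le> B" for f :: "real \<Rightarrow> real" and B :: real
    by (rule weak_conv_imp_integral_bdd_continuous_conv[OF rd \<nu> w that])
  \<comment> \<open>A bounded continuous function that vanishes exactly on the closed half-line: a
    zero integral excludes negative mass in the limit.\<close>
  define h where "h x = min 1 (max 0 (- x))" for x :: real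
  have "(\<lambda>k. integral\<^sup>L (\<rho> k) h) \<longlonglongrightarrow> integral\<^sup>L \<nu> h"
  proof (rule conv[of _ 1])
    show "isCont h x" for x unfolding h_def[abs_def] by (intro continuous_intros)
    show "norm (h x) \<le> 1" for x by (simp add: h_def)
  qed
  moreover have "integral\<^sup>L (\<rho> k) h = 0" for k
  proof -
    interpret r: nonneg_distribution "\<rho> k" by (rule \<rho>)
    show ?thesis
      by (rule integral_eq_zero_AE) (use r.AE_nonneg in \<open>eventually_elim, auto simp: h_def\<close>)
  qed
  ultimately have "integral\<^sup>L \<nu> h = 0" by (simp add: LIMSEQ_const_iff)
  moreover have "integrable \<nu> h"
    unfolding h_def[abs_def] by (rule \<nu>.integrable_const_bound[where B = 1]) auto
  moreover have "AE x in \<nu>. 0 \<le> h x" by (simp add: h_def)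
  ultimately have "AE x in \<nu>. h x = 0" using integral_nonneg_eq_0_iff_AE by blast
  then have "AE x in \<nu>. x \<notin> {..<0}" by eventually_elim (auto simp: h_def)
  then have "measure \<nu> {..<0} = 0"
    by (subst \<nu>.prob_eq_0) auto
  then show nn: "nonneg_distribution \<nu>" using \<nu> by (simp add: nonneg_distribution_def nonneg_distribution_axioms_def)
  assume v: "0 < v"
  have "(\<lambda>k. \<integral>x. 1 / (max 0 x + v) \<partial>\<rho> k) \<longlonglongrightarrow> (\<integral>x. 1 / (max 0 x + v) \<partial>\<nu>)"
  proof (rule conv)
    show "norm (1 / (max 0 x + v)) \<le> 1 / v" for x using v by (auto simp: frac_le)
    show "isCont (\<lambda>x. 1 / (max 0 x + v)) x" for x
      by (intro continuous_intros) (use v in \<open>auto simp: max_def\<close>)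
  qed
  then show "(\<lambda>k. nonneg_distribution.cauchy (\<rho> k) v) \<longlonglongrightarrow> nonneg_distribution.cauchy \<nu> v"
    unfolding nonneg_distribution.cauchy_def[OF \<rho>] nonneg_distribution.cauchy_def[OF nn] .
qed

text \<open>A Markov inequality with the Cauchy kernel as test function. The interval is open on the
  left, the form required by tightness, so it starts at -1 in order to contain a possible mass at
  0.\<close>

lemma (in nonneg_distribution) tail_le_cauchy:
  assumes K: "0 < K" shows "1 - 2 * (1 - K * cauchy K) \<le> measure \<mu> {-1<..K}"
proof -
  \<comment> \<open>For \<open>x \<ge> 0\<close> the left-hand side is at most 1, it is 0 at
    \<open>x = K\<close> and negative beyond; the factor 2 is chosen for this.\<close>
  have le: "2 * K * (1 / (max 0 x + K)) - 1 \<le> indicator {..K} x" for x :: real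
    using K by (auto simp: indicator_def field_simps max_def)
  have i: "integrable \<mu> (\<lambda>x. 2 * K * (1 / (max 0 x + K)))"
    by (rule integrable_mult_right[OF integrable_cauchy[OF K]])
  have "1 - 2 * (1 - K * cauchy K) = 2 * K * cauchy K - 1" by simp
  also have "\<dots> = (\<integral>x. 2 * K * (1 / (max 0 x + K)) - 1 \<partial>\<mu>)"
    unfolding cauchy_def Bochner_Integration.integral_diff[OF i integrable_const] integral_mult_right_zero by simp
  also have "\<dots> \<le> (\<integral>x. indicator {..K} x \<partial>\<mu>)"
    by (intro integral_mono Bochner_Integration.integrable_diff i le integrable_bounded[where B = 1]) auto
  also have "\<dots> = cdf \<mu> K" unfolding cdf_def by simp
  also have "\<dots> = measure \<mu> {-1<..K}"
  proof -
    have "cdf \<mu> (- 1) \<le> measure \<mu> {..<0}" unfolding cdf_def by (rule finite_measure_mono) auto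
    then have "cdf \<mu> (- 1) = 0" using nonneg cdf_nonneg[of "- 1"] by simp
    then show ?thesis using cdf_diff_eq[of "- 1" K] K by simp
  qed
  finally show ?thesis .
qed

text \<open>Stability with both residuals zero makes the root in [0, 1] unique, so the two
  transforms agree on the whole negative half-line.\<close>

lemma is_Gy_cdf_unique:
  assumes \<mu>: "is_Gy m y \<mu>" and \<nu>: "is_Gy m y \<nu>" and y: "\<And>l. l \<in> {1..m} \<Longrightarrow> 0 \<le> y l \<and> y l \<le> 1"
  shows "cdf \<mu> = cdf \<nu>"
proof
  fix x
  have nn: "nonneg_distribution \<mu>" "nonneg_distribution \<nu>" using \<mu> \<nu> by (simp_all add: is_Gy_iff)
  have res: "residual y m v (1 - v * nonneg_distribution.cauchy \<mu> v) = 0" "residual y m v (1 - v * nonneg_distribution.cauchy \<nu> v) = 0"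
    if "0 < v" for v using \<mu> \<nu> that by (simp_all add: is_Gy_iff)
  show "cdf \<mu> x = cdf \<nu> x"
  proof (rule nonneg_distribution_unique[OF nn])
    fix v :: real assume v: "0 < v"
    let ?t = "1 - v * nonneg_distribution.cauchy \<mu> v" and ?s = "1 - v * nonneg_distribution.cauchy \<nu> v"
    have "\<bar>?t - ?s\<bar> \<le> \<bar>residual y m v ?t\<bar> / v"
      by (rule residual_stable[OF y]) (use nonneg_distribution.cauchy_bounds[OF nn(1) v] nonneg_distribution.cauchy_bounds[OF nn(2) v] v res[OF v] in auto)
    then have "v * nonneg_distribution.cauchy \<mu> v = v * nonneg_distribution.cauchy \<nu> v" unfolding res[OF v] by (simp only: abs_zero div_0 abs_le_zero_iff)
    then show "nonneg_distribution.cauchy \<mu> v = nonneg_distribution.cauchy \<nu> v" using v by simp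
  qed
qed

context product_model
begin

text \<open>Joins the two descriptions of the spectrum: the eigenvalue list from
  \<open>hpsd_spectrum\<close> gives the singular value count through the characteristic polynomial
  and \<open>TT\<close> through the resolvent trace. Measurability of the kernel sums is read off
  from \<open>TT\<close>.\<close>

lemma empirical_measure:
  assumes n: "1 \<le> n"
  shows "\<exists>\<mu>. nonneg_distribution \<mu> \<and> (\<forall>t. cdf \<mu> t = Fn M m p X n t) \<and>
    (\<forall>v>0. v * nonneg_distribution.cauchy \<mu> v = 1 - expectation (TT n v))"
proof -
  define D where "D \<omega> = dmat (p n) (\<lambda>a. XX n a \<omega>) m" for \<omega>
  have hD: "hpsd n (D \<omega>)" for \<omega> unfolding D_def by (rule hpsd_gram)
  have "\<exists>es :: real list. length es = n \<and> (\<forall>e\<in>set es. 0 \<le> e) \<and>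
      char_poly (Matrix.mat n n (\<lambda>(i, j). D \<omega> i j)) = (\<Prod>e\<leftarrow>es. [:- of_real e, 1:]) \<and>
      (\<forall>v>0. ctrace n (resolvent n v (D \<omega>)) = of_real (\<Sum>e\<leftarrow>es. 1 / (e + v)))" for \<omega>
    by (rule hpsd_spectrum[OF hD]) blast
  then have "\<exists>es. \<forall>\<omega>. length (es \<omega> :: real list) = n \<and> (\<forall>e\<in>set (es \<omega>). 0 \<le> e) \<and>
      char_poly (Matrix.mat n n (\<lambda>(i, j). D \<omega> i j)) = (\<Prod>e\<leftarrow>es \<omega>. [:- of_real e, 1:]) \<and>
      (\<forall>v>0. ctrace n (resolvent n v (D \<omega>)) = of_real (\<Sum>e\<leftarrow>es \<omega>. 1 / (e + v)))"
    by (intro choice allI)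
  then obtain es :: "'a \<Rightarrow> real list" where len: "\<And>\<omega>. length (es \<omega>) = n" and nonneg: "\<And>\<omega> e. e \<in> set (es \<omega>) \<Longrightarrow> 0 \<le> e"
    and cp: "\<And>\<omega>. char_poly (Matrix.mat n n (\<lambda>(i, j). D \<omega> i j)) = (\<Prod>e\<leftarrow>es \<omega>. [:- of_real e, 1:])"
    and tr: "\<And>\<omega> v. 0 < v \<Longrightarrow> ctrace n (resolvent n v (D \<omega>)) = of_real (\<Sum>e\<leftarrow>es \<omega>. 1 / (e + v))"
    by blast
  have TT: "TT n v \<omega> = 1 - v * ((\<Sum>e\<leftarrow>es \<omega>. 1 / (e + v)) / real n)" if "0 < v" for v \<omega>
    unfolding TT_def Tres_def D_def[symmetric] tr[OF that] by simp
  have meas: "(\<lambda>\<omega>. \<Sum>e\<leftarrow>es \<omega>. 1 / (e + v)) \<in> borel_measurable M" if v: "0 < v" for v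
  proof -
    have "(\<Sum>e\<leftarrow>es \<omega>. 1 / (e + v)) = real n / v * (1 - TT n v \<omega>)" for \<omega>
      unfolding TT[OF v] using v n by simp
    then show ?thesis using TT_measurable[OF n, of v] by simp
  qed
  obtain \<mu> where \<mu>: "nonneg_distribution \<mu>"
    "\<And>t. cdf \<mu> t = expectation (\<lambda>\<omega>. real (length (filter (\<lambda>e. e \<le> t) (es \<omega>))) / real n)"
    "\<And>v. 0 < v \<Longrightarrow> nonneg_distribution.cauchy \<mu> v = expectation (\<lambda>\<omega>. (\<Sum>e\<leftarrow>es \<omega>. 1 / (e + v)) / real n)"
  proof -
    have "\<exists>\<mu>. nonneg_distribution \<mu> \<and>
      (\<forall>t. cdf \<mu> t = expectation (\<lambda>\<omega>. real (length (filter (\<lambda>e. e \<le> t) (es \<omega>))) / real n)) \<and>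
      (\<forall>v>0. nonneg_distribution.cauchy \<mu> v = expectation (\<lambda>\<omega>. (\<Sum>e\<leftarrow>es \<omega>. 1 / (e + v)) / real n))"
      by (rule mean_empirical_distribution[OF n]) (fact len nonneg meas)+
    then show ?thesis using that by blast
  qed
  have "sq_sv_count (Wprod (p n) (\<lambda>\<nu> j k. X n \<nu> j k \<omega>) m) t = length (filter (\<lambda>e. e \<le> t) (es \<omega>))" for \<omega> t
  proof (rule sq_sv_count_eq)
    have "(\<lambda>(\<nu>, j, k). X n \<nu> j k \<omega>) = (\<lambda>a. XX n a \<omega>)" unfolding XX_def by auto
    then show "char_poly (Wprod (p n) (\<lambda>\<nu> j k. X n \<nu> j k \<omega>) m * mat_adjoint (Wprod (p n) (\<lambda>\<nu> j k. X n \<nu> j k \<omega>) m)) =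
        (\<Prod>e\<leftarrow>es \<omega>. [:- of_real e, 1:])"
      unfolding Wprod_gram p0[OF n] using cp[of \<omega>] unfolding D_def by simp
  qed
  then have "cdf \<mu> t = Fn M m p X n t" for t unfolding \<mu>(2) Fn_def by simp
  moreover have "v * nonneg_distribution.cauchy \<mu> v = 1 - expectation (TT n v)" if v: "0 < v" for v
  proof -
    have i: "integrable M (TT n v)"
      by (rule integrable_const_bound[where B = 1]) (use TT_bounds[OF n v] TT_measurable[OF n] in auto)
    have "v * nonneg_distribution.cauchy \<mu> v = expectation (\<lambda>\<omega>. v * ((\<Sum>e\<leftarrow>es \<omega>. 1 / (e + v)) / real n))"
      unfolding \<mu>(3)[OF v] by (rule integral_mult_right_zero[symmetric])
    also have "\<dots> = expectation (\<lambda>\<omega>. 1 - TT n v \<omega>)" unfolding TT[OF v] by simp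
    also have "\<dots> = 1 - expectation (TT n v)" using i by (simp add: prob_space)
    finally show ?thesis .
  qed
  ultimately show ?thesis using \<mu>(1) by blast
qed

lemma convergence:
  "(\<exists>\<mu>. is_Gy m y \<mu>) \<and>
    (\<forall>\<mu>. is_Gy m y \<mu> \<longrightarrow> (\<lambda>n. SUP x. \<bar>Fn M m p X n x - cdf \<mu> x\<bar>) \<longlonglongrightarrow> 0)"
proof -
  have "\<forall>\<^sub>F n in sequentially. Ed n m < 1"
    using order_tendstoD(2)[OF conjunct2[OF Ef_Ed_tendsto[OF order_refl]], of 1] by simp
  then obtain n1 where n1: "\<And>n. n1 \<le> n \<Longrightarrow> Ed n m < 1" unfolding eventually_sequentially by blast
  \<comment> \<open>The sequence starts where \<open>Ed n m < 1\<close>, so that the tail bound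
    holds for every index, as \<open>tight\<close> demands; the \<open>Suc\<close> also keeps all
    indices at least 1.\<close>
  define N where "N = Suc n1"
  have "\<exists>\<rho>. \<forall>k. nonneg_distribution (\<rho> k) \<and> (\<forall>t. cdf (\<rho> k) t = Fn M m p X (k + N) t) \<and>
    (\<forall>v>0. v * nonneg_distribution.cauchy (\<rho> k) v = 1 - expectation (TT (k + N) v))"
    by (intro choice allI empirical_measure) (simp add: N_def)
  then obtain \<rho> where nn: "\<And>k. nonneg_distribution (\<rho> k)" and cdf: "\<And>k t. cdf (\<rho> k) t = Fn M m p X (k + N) t"
    and cau: "\<And>k v. 0 < v \<Longrightarrow> v * nonneg_distribution.cauchy (\<rho> k) v = 1 - expectation (TT (k + N) v)"
    by blast
  have rd: "real_distribution (\<rho> k)" for k using nn by (simp add: nonneg_distribution_def)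
  have tight: "tight \<rho>"
    unfolding tight_def
  proof (intro conjI allI impI rd)
    fix \<epsilon> :: real assume \<epsilon>: "0 < \<epsilon>"
    \<comment> \<open>With \<open>Ed n m < 1\<close> the mean of \<open>TT\<close> at
      \<open>K\<close> is at most \<open>2 / K\<close>, and the tail bound doubles it:
      \<open>4 / K\<close> is four fifths of \<open>\<epsilon>\<close>.\<close>
    define K where "K = 5 / \<epsilon>"
    have K: "0 < K" unfolding K_def using \<epsilon> by simp
    have "1 - \<epsilon> < measure (\<rho> k) {-1<..K}" for k
    proof -
      interpret r: nonneg_distribution "\<rho> k" by (rule nn)
      have kN: "1 \<le> k + N" "n1 \<le> k + N" unfolding N_def by auto
      have "ennreal (expectation (TT (k + N) K)) \<le> ennreal (1 / K) * (1 + 1)"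
        by (rule order_trans[OF expectation_TT_le[OF kN(1) K]]) (intro mult_left_mono add_left_mono less_imp_le[OF n1[OF kN(2)]] zero_le)
      also have "\<dots> = ennreal (2 / K)" using K by (simp flip: ennreal_numeral ennreal_mult'')
      finally have "expectation (TT (k + N) K) \<le> 2 / K" using K by (simp add: ennreal_le_iff)
      also have "2 * (2 / K) < \<epsilon>" unfolding K_def using \<epsilon> by simp
      then have "2 / K < \<epsilon> / 2" by simp
      finally have "expectation (TT (k + N) K) < \<epsilon> / 2" .
      then show ?thesis using r.tail_le_cauchy[OF K] cau[OF K, of k] by simp
    qed
    then show "\<exists>a b. a < b \<and> (\<forall>k. 1 - \<epsilon> < measure (\<rho> k) {a<..b})"
      using K by (intro exI[of _ "-1"] exI[of _ K]) auto
  qed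
  \<comment> \<open>Used twice: one convergent subsequence gives the existence of a solution, and
    all of them together give convergence to any given one.\<close>
  have limit: "is_Gy m y \<nu>" if s: "strict_mono s" and \<nu>: "real_distribution \<nu>" and w: "weak_conv_m (\<rho> \<circ> s) \<nu>" for s \<nu>
  proof -
    note lim = nonneg_distribution_weak_limit[of "\<rho> \<circ> s", OF _ \<nu> w, unfolded comp_def, OF nn]
    have "residual y m v (1 - v * nonneg_distribution.cauchy \<nu> v) = 0" if v: "0 < v" for v
    proof -
      obtain t where t: "0 \<le> t" "t \<le> 1" "residual y m v t = 0" using ex_residual_root[OF v] by blast
      have "(\<lambda>k. expectation (TT (k + N) v)) \<longlonglongrightarrow> t"
        by (rule LIMSEQ_ignore_initial_segment[OF expectation_TT_tendsto[OF v t]])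
      then have "(\<lambda>k. expectation (TT (s k + N) v)) \<longlonglongrightarrow> t"
        using LIMSEQ_subseq_LIMSEQ[OF _ s] by (fastforce simp: comp_def)
      then have "(\<lambda>k. 1 - expectation (TT (s k + N) v)) \<longlonglongrightarrow> 1 - t" by (intro tendsto_intros)
      moreover have "(\<lambda>k. v * nonneg_distribution.cauchy (\<rho> (s k)) v) \<longlonglongrightarrow> v * nonneg_distribution.cauchy \<nu> v"
        by (intro tendsto_intros lim(2) v)
      ultimately have "v * nonneg_distribution.cauchy \<nu> v = 1 - t"
        unfolding cau[OF v] using LIMSEQ_unique by blast
      then show ?thesis using t(3) by simp
    qed
    then show ?thesis unfolding is_Gy_iff using lim(1) by blast
  qed
  have "\<exists>\<mu>. is_Gy m y \<mu>"
  proof -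
    obtain r \<nu> where "strict_mono r" "real_distribution \<nu>" "weak_conv_m (\<rho> \<circ> id \<circ> r) \<nu>"
      using tight_imp_convergent_subsubsequence[OF tight strict_mono_id] by blast
    then show ?thesis using limit[of r \<nu>] by (auto simp: comp_def)
  qed
  moreover have "(\<lambda>n. SUP x. \<bar>Fn M m p X n x - cdf \<mu> x\<bar>) \<longlonglongrightarrow> 0" if G: "is_Gy m y \<mu>" for \<mu>
  proof -
    have n\<mu>: "nonneg_distribution \<mu>" using G unfolding is_Gy_iff by (rule conjunct1)
    interpret \<mu>: nonneg_distribution \<mu> by (rule n\<mu>)
    have cont: "isCont (cdf \<mu>) x" for x using is_Gy_isCont_cdf[OF G m] ratio by blast
    \<comment> \<open>Weak convergence involves a limit only through its distribution function,
      which is common to all solutions; so every subsequential limit may be exchanged for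
      \<open>\<mu>\<close>, and by tightness the whole sequence converges.\<close>
    have "weak_conv_m \<rho> \<mu>"
    proof (rule tight_subseq_weak_converge[OF rd \<mu>.real_distribution_axioms tight])
      fix s \<nu> assume s: "strict_mono s" and \<nu>: "real_distribution \<nu>" and w: "weak_conv_m (\<rho> \<circ> s) \<nu>"
      have G': "is_Gy m y \<nu>" by (rule limit[OF s \<nu> w])
      have "cdf \<nu> = cdf \<mu>" by (rule is_Gy_cdf_unique[OF G' G y_bounds])
      then show "weak_conv_m (\<rho> \<circ> s) \<mu>" using w unfolding weak_conv_m_def by simp
    qed
    then have "(\<lambda>k. cdf (\<rho> k) x) \<longlonglongrightarrow> cdf \<mu> x" for x
      using cont unfolding weak_conv_m_def weak_conv_def by blast
    then have "(\<lambda>k. SUP x. \<bar>cdf (\<rho> k) x - cdf \<mu> x\<bar>) \<longlonglongrightarrow> 0"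
    proof (intro Polya_uniform_convergence)
      fix k
      interpret r: nonneg_distribution "\<rho> k" by (rule nn)
      show "mono (cdf (\<rho> k))" by (intro monoI r.cdf_nondecreasing)
      show "0 \<le> cdf (\<rho> k) x" "cdf (\<rho> k) x \<le> 1" for x by (rule r.cdf_nonneg, rule r.cdf_bounded_prob)
    next
      show "mono (cdf \<mu>)" by (intro monoI \<mu>.cdf_nondecreasing)
    qed (rule cont \<mu>.cdf_lim_at_bot \<mu>.cdf_lim_at_top_prob \<mu>.cdf_nonneg \<mu>.cdf_bounded_prob | assumption)+
    then show ?thesis unfolding cdf by (rule LIMSEQ_offset)
  qed
  ultimately show ?thesis by blast
qed

end

text \<open>The existence clause keeps the second clause from being vacuous; as all solutions share
  one distribution function, quantifying over all of them speaks of a single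
  \<open>G_y\<close>.\<close>

theorem theorem1p1:
  fixes m :: nat and p :: "nat \<Rightarrow> nat \<Rightarrow> nat" and M :: "'a measure"
    and X :: "nat \<Rightarrow> nat \<Rightarrow> nat \<Rightarrow> nat \<Rightarrow> 'a \<Rightarrow> complex" and y :: "nat \<Rightarrow> real"
  assumes m: "m \<ge> 1"
    and p0: "\<And>n. n \<ge> 1 \<Longrightarrow> p n 0 = n"
    and pmono: "\<And>n \<nu>. n \<ge> 1 \<Longrightarrow> \<nu> < m \<Longrightarrow> p n \<nu> \<le> p n (Suc \<nu>)"
    and P: "prob_space M"
    and meas: "\<And>n \<nu> j k. n \<ge> 1 \<Longrightarrow> \<nu> \<in> {1..m} \<Longrightarrow> j < p n (\<nu> - 1) \<Longrightarrow> k < p n \<nu> \<Longrightarrow>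
                 X n \<nu> j k \<in> borel_measurable M"
    and indep: "\<And>n. n \<ge> 1 \<Longrightarrow> prob_space.indep_vars M (\<lambda>_. borel) (\<lambda>(\<nu>, j, k). X n \<nu> j k)
                 {(\<nu>, j, k). \<nu> \<in> {1..m} \<and> j < p n (\<nu> - 1) \<and> k < p n \<nu>}"
    and mean: "\<And>n \<nu> j k. n \<ge> 1 \<Longrightarrow> \<nu> \<in> {1..m} \<Longrightarrow> j < p n (\<nu> - 1) \<Longrightarrow> k < p n \<nu> \<Longrightarrow>
                 integrable M (X n \<nu> j k) \<and> (\<integral>\<omega>. X n \<nu> j k \<omega> \<partial>M) = 0"
    and var: "\<And>n \<nu> j k. n \<ge> 1 \<Longrightarrow> \<nu> \<in> {1..m} \<Longrightarrow> j < p n (\<nu> - 1) \<Longrightarrow> k < p n \<nu> \<Longrightarrow>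
                 integrable M (\<lambda>\<omega>. (cmod (X n \<nu> j k \<omega>))\<^sup>2) \<and>
                 (\<integral>\<omega>. (cmod (X n \<nu> j k \<omega>))\<^sup>2 \<partial>M) = 1"
    and lindeberg: "\<And>\<tau>. \<tau> > 0 \<Longrightarrow> (\<lambda>n. Lind M m p X n \<tau>) \<longlonglongrightarrow> 0"
    and ratio: "\<And>l. l \<in> {1..m} \<Longrightarrow> 0 < y l \<and> y l \<le> 1 \<and>
                 (\<lambda>n. real n / real (p n l)) \<longlonglongrightarrow> y l"
  shows "(\<exists>\<mu>. is_Gy m y \<mu>) \<and>
         (\<forall>\<mu>. is_Gy m y \<mu> \<longrightarrow>
            (\<lambda>n. SUP x. \<bar>Fn M m p X n x - cdf \<mu> x\<bar>) \<longlonglongrightarrow> 0)"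
proof -
  interpret prob_space M by (rule P)
  interpret product_model M m p X y
    by unfold_locales (fact m p0 pmono indep mean var lindeberg ratio)+
  show ?thesis by (rule convergence)
qed

end
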